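(* Let $(M,F)$ be a balanced complex Finsler manifold. Then $F$ is a Kähler-Finsler metric if and only if $$\left\langle\partial_{\mathcal H}\bar\partial_{\mathcal H}\omega_{\mathcal H},\,\omega_{\mathcal H}^2\right\rangle_{\mathbb P\tilde M}=0$$ (as a function on $\mathbb P\tilde M$).
   Context: Basic notation. $M$ is a complex manifold with $n=\dim_{\mathbb C}M\ge 2$. Local holomorphic coordinates $z^1,\dots,z^n$ on $M$ induce coordinates $(z,v)$ on the holomorphic tangent bundle $T^{1,0}M$ via $v=v^\alpha\partial/\partial z^\alpha$; $\tilde M=T^{1,0}M\setminus\{0\}$ is the complement of the zero section. Greek indices run from $1$ to $n$, repeated indices are summed, and barred indices refer to conjugate variables/objects. A complex Finsler metric is a continuous $F:T^{1,0}M\to[0,\infty)$ with $G=F^2$ smooth on $\tilde M$, $F>0$ on $\tilde M$, and $F(z,\zeta v)=|\zeta|F(z,v)$ for $\zeta\in\mathbb C$. Put $G_{\alpha\bar\beta}=\partial^2G/\partial v^\alpha\partial\bar v^\beta$. $F$ is strongly pseudoconvex if $(G_{\alpha\bar\beta})$ is positive definite on $\tilde M$; $(G^{\bar\beta\alpha})$ is the inverse matrix. Put $\dot\partial_\alpha=\partial/\partial v^\alpha$, $\Gamma^\alpha_{;\mu}=G^{\bar\lambda\alpha}\,\partial^2G/\partial\bar v^\lambda\partial z^\mu$, $\delta_\mu=\partial/\partial z^\mu-\Gamma^\alpha_{;\mu}\dot\partial_\alpha$, $\delta_{\bar\mu}=\overline{\delta_\mu}$, $\delta v^\alpha=dv^\alpha+\Gamma^\alpha_{;\beta}dz^\beta$,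 $\Gamma^\alpha_{\beta;\mu}=G^{\bar\lambda\alpha}\delta_\mu(G_{\beta\bar\lambda})$. $F$ is Kähler-Finsler if $(\Gamma^\alpha_{\beta;\mu}-\Gamma^\alpha_{\mu;\beta})v^\beta=0$; by a known theorem of Chen and Shen this is equivalent to $\Gamma^\alpha_{\beta;\mu}=\Gamma^\alpha_{\mu;\beta}$. Horizontal forms and balanced metrics. $\mathbb P\tilde M=\tilde M/(\mathbb C\setminus\{0\})$ is the projectivized tangent bundle. Put $\omega_{\mathcal V}=\sqrt{-1}\,(\log G)_{\alpha\bar\beta}\,\delta v^\alpha\wedge\delta\bar v^\beta$ (subscripts denote $v$-derivatives), $\omega_{\mathcal H}=\sqrt{-1}\,G_{\alpha\bar\beta}\,dz^\alpha\wedge d\bar z^\beta$, $\omega_{\mathcal H}^2=\omega_{\mathcal H}\wedge\omega_{\mathcal H}$, and $d\mu_{\mathbb P\tilde M}=\frac{\omega_{\mathcal V}^{n-1}}{(n-1)!}\wedge\frac{\omega_{\mathcal H}^n}{n!}$. $\mathcal A^{p,q}$ is the space of smooth horizontal $(p,q)$-forms on $\mathbb P\tilde M$: $\varphi=\frac1{p!q!}\varphi_{\alpha_1\cdots\alpha_p\bar\beta_1\cdots\bar\beta_q}dz^{\alpha_1}\wedge\cdots\wedge dz^{\alpha_p}\wedge d\bar z^{\beta_1}\wedge\cdots\wedge d\bar z^{\beta_q}$ (coefficients skew-symmetric, invariant under $v\mapsto\zeta v$). The operators $\partial_{\mathcal H}:\mathcal A^{p,q}\to\mathcal A^{p+1,q}$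 and $\bar\partial_{\mathcal H}:\mathcal A^{p,q}\to\mathcal A^{p,q+1}$ are given by the usual coordinate formulas for $\partial,\bar\partial$ with $\partial/\partial z^\mu,\partial/\partial\bar z^\nu$ replaced by $\delta_\mu,\delta_{\bar\nu}$, i.e. $f\,dz^A\wedge d\bar z^B\mapsto\delta_\mu(f)\,dz^\mu\wedge dz^A\wedge d\bar z^B$ and $f\,dz^A\wedge d\bar z^B\mapsto\delta_{\bar\nu}(f)\,d\bar z^\nu\wedge dz^A\wedge d\bar z^B$. The pointwise inner product is $\langle\varphi,\psi\rangle_{\mathbb P\tilde M}=\frac1{p!q!}\varphi_{\alpha_1\cdots\alpha_p\bar\beta_1\cdots\bar\beta_q}G^{\bar\gamma_1\alpha_1}\cdots G^{\bar\gamma_p\alpha_p}G^{\bar\beta_1\kappa_1}\cdots G^{\bar\beta_q\kappa_q}\overline{\psi_{\gamma_1\cdots\gamma_p\bar\kappa_1\cdots\bar\kappa_q}}$. For $M$ compact, $(\varphi,\psi)_{\mathbb P\tilde M}=\int_{\mathbb P\tilde M}\langle\varphi,\psi\rangle_{\mathbb P\tilde M}\,d\mu_{\mathbb P\tilde M}$, and $\partial_{\mathcal H}^*,\bar\partial_{\mathcal H}^*$ are the formal adjoints of $\partial_{\mathcal H},\bar\partial_{\mathcal H}$. A balanced complex Finsler manifold is a compact strongly pseudoconvex complex Finsler manifold $(M,F)$ with $(\partial_{\mathcal H}^*+\bar\partial_{\mathcal H}^* )\omega_{\mathcal H}=0$. *)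

theory Defs
  imports "HOL-Analysis.Analysis" "HOL-Combinatorics.Permutations"
begin

section \<open>Smooth functions and Wirtinger derivatives\<close>

text \<open>Only used on open sets.\<close>

fun Ck_on :: "nat \<Rightarrow> 'a::real_normed_vector set \<Rightarrow> ('a \<Rightarrow> 'b::real_normed_vector) \<Rightarrow> bool" where
  "Ck_on 0 S f \<longleftrightarrow> continuous_on S f"
| "Ck_on (Suc k) S f \<longleftrightarrow>
     f differentiable_on S \<and> (\<forall>h. Ck_on k S (\<lambda>x. frechet_derivative f (at x) h))"

definition smooth_on :: "'a::real_normed_vector set \<Rightarrow> ('a \<Rightarrow> 'b::real_normed_vector) \<Rightarrow> bool" where
  "smooth_on S f \<longleftrightarrow> (\<forall>k. Ck_on k S f)"

definition holo_map_on :: "(complex^('n::finite)) set \<Rightarrow> (complex^'n \<Rightarrow> complex^'n) \<Rightarrow> bool" where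
  "holo_map_on S f \<longleftrightarrow>
     (\<forall>z\<in>S. \<exists>A::complex^'n^'n. (f has_derivative (\<lambda>h. A *v h)) (at z))"

text \<open>A pair \<open>(z, v)\<close> consists of base and fibre coordinates of a tangent vector.\<close>

type_synonym 'n cpair = "(complex^'n) \<times> (complex^'n)"

definition D_z :: "'n \<Rightarrow> ('n::finite cpair \<Rightarrow> complex) \<Rightarrow> 'n cpair \<Rightarrow> complex" where
  "D_z \<mu> f p = (frechet_derivative f (at p) (axis \<mu> 1, 0)
              - \<i> * frechet_derivative f (at p) (axis \<mu> \<i>, 0)) / 2"

definition D_zbar :: "'n \<Rightarrow> ('n::finite cpair \<Rightarrow> complex) \<Rightarrow> 'n cpair \<Rightarrow> complex" where
  "D_zbar \<mu> f p = (frechet_derivative f (at p) (axis \<mu> 1, 0)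
                 + \<i> * frechet_derivative f (at p) (axis \<mu> \<i>, 0)) / 2"

definition D_v :: "'n \<Rightarrow> ('n::finite cpair \<Rightarrow> complex) \<Rightarrow> 'n cpair \<Rightarrow> complex" where
  "D_v \<alpha> f p = (frechet_derivative f (at p) (0, axis \<alpha> 1)
              - \<i> * frechet_derivative f (at p) (0, axis \<alpha> \<i>)) / 2"

definition D_vbar :: "'n \<Rightarrow> ('n::finite cpair \<Rightarrow> complex) \<Rightarrow> 'n cpair \<Rightarrow> complex" where
  "D_vbar \<alpha> f p = (frechet_derivative f (at p) (0, axis \<alpha> 1)
                 + \<i> * frechet_derivative f (at p) (0, axis \<alpha> \<i>)) / 2"


section \<open>Complex manifolds and the holomorphic tangent bundle\<close>

text \<open>The manifold is the type \<open>'m\<close>; its dimension is \<open>CARD('n)\<close>. A chart is a domain together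
  with a coordinate map, of which only the values on the domain matter.\<close>

type_synonym ('m, 'n) chart = "'m set \<times> ('m \<Rightarrow> complex^'n)"

definition cdom :: "('m, 'n::finite) chart \<Rightarrow> 'm set" where
  "cdom c = fst c"

definition cmap :: "('m, 'n::finite) chart \<Rightarrow> 'm \<Rightarrow> complex^'n" where
  "cmap c = snd c"

definition cinv :: "('m, 'n::finite) chart \<Rightarrow> complex^'n \<Rightarrow> 'm" where
  "cinv c = inv_into (cdom c) (cmap c)"

definition transition :: "('m, 'n::finite) chart \<Rightarrow> ('m, 'n) chart \<Rightarrow> complex^'n \<Rightarrow> complex^'n" where
  "transition c d = cmap d \<circ> cinv c"

definition complex_manifold ::
    "('m::{t2_space, second_countable_topology}, 'n::finite) chart set \<Rightarrow> bool" where
  "complex_manifold A \<longleftrightarrow>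
     (\<Union>c\<in>A. cdom c) = UNIV \<and>
     (\<forall>c\<in>A. open (cdom c) \<and> open (cmap c ` cdom c) \<and>
        homeomorphism (cdom c) (cmap c ` cdom c) (cmap c) (cinv c)) \<and>
     (\<forall>c\<in>A. \<forall>d\<in>A. holo_map_on (cmap c ` (cdom c \<inter> cdom d)) (transition c d))"

text \<open>The complex Jacobian matrix \<open>\<partial>z'\<^sup>\<alpha>/\<partial>z\<^sup>\<beta>\<close> (row \<open>\<alpha>\<close>, column \<open>\<beta>\<close>) of the change from the
  coordinates \<open>z\<close> of \<open>c\<close> to the coordinates \<open>z'\<close> of \<open>d\<close>.\<close>

definition jac :: "('m, 'n::finite) chart \<Rightarrow> ('m, 'n) chart \<Rightarrow> complex^'n \<Rightarrow> complex^'n^'n" where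
  "jac c d z = matrix (frechet_derivative (transition c d) (at z))"

text \<open>A holomorphic tangent vector at \<open>x\<close> is the family of its components in all charts around \<open>x\<close>;
  at all other arguments the family is set to \<open>0\<close>.\<close>

type_synonym ('m, 'n) tvec = "'m \<times> (('m, 'n) chart \<Rightarrow> complex^'n)"

definition TM :: "('m, 'n::finite) chart set \<Rightarrow> ('m, 'n) tvec set" where
  "TM A = {(x, X).
     (\<forall>c. c \<notin> A \<or> x \<notin> cdom c \<longrightarrow> X c = 0) \<and>
     (\<forall>c\<in>A. \<forall>d\<in>A. x \<in> cdom c \<inter> cdom d \<longrightarrow> X d = jac c d (cmap c x) *v X c)}"

definition TM0 :: "('m, 'n::finite) chart set \<Rightarrow> ('m, 'n) tvec set" where
  "TM0 A = {u \<in> TM A. snd u \<noteq> (\<lambda>c. 0)}"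

definition tscale :: "complex \<Rightarrow> ('m, 'n::finite) tvec \<Rightarrow> ('m, 'n) tvec" where
  "tscale \<zeta> u = (fst u, \<lambda>c. \<zeta> *s snd u c)"

definition tcoord :: "('m, 'n::finite) chart \<Rightarrow> ('m, 'n) tvec \<Rightarrow> 'n cpair" where
  "tcoord c u = (cmap c (fst u), snd u c)"

definition tpoint :: "('m, 'n::finite) chart set \<Rightarrow> ('m, 'n) chart \<Rightarrow> 'n cpair \<Rightarrow> ('m, 'n) tvec" where
  "tpoint A c = inv_into {u \<in> TM A. fst u \<in> cdom c} (tcoord c)"

definition tdom :: "('m, 'n::finite) chart \<Rightarrow> 'n cpair set" where
  "tdom c = (cmap c ` cdom c) \<times> UNIV"

definition tdom0 :: "('m, 'n::finite) chart \<Rightarrow> 'n cpair set" where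
  "tdom0 c = (cmap c ` cdom c) \<times> (UNIV - {0})"


section \<open>Complex Finsler metrics\<close>

definition complex_finsler :: "('m, 'n::finite) chart set \<Rightarrow> (('m, 'n) tvec \<Rightarrow> real) \<Rightarrow> bool" where
  "complex_finsler A F \<longleftrightarrow>
     (\<forall>u\<in>TM A. F u \<ge> 0) \<and>
     (\<forall>c\<in>A. continuous_on (tdom c) (F \<circ> tpoint A c)) \<and>
     (\<forall>c\<in>A. smooth_on (tdom0 c) (\<lambda>p. (F (tpoint A c p))\<^sup>2)) \<and>
     (\<forall>u\<in>TM0 A. F u > 0) \<and>
     (\<forall>u\<in>TM A. \<forall>\<zeta>. F (tscale \<zeta> u) = cmod \<zeta> * F u)"

definition Gloc :: "('m, 'n::finite) chart set \<Rightarrow> (('m, 'n) tvec \<Rightarrow> real) \<Rightarrow> ('m, 'n) chart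
    \<Rightarrow> 'n cpair \<Rightarrow> real" where
  "Gloc A F c p = (F (tpoint A c p))\<^sup>2"

text \<open>The following objects are computed from the expression \<open>g\<close> of \<open>G\<close> in one chart.
  In \<open>G_mat g p\<close> the row index is \<open>\<alpha>\<close> and the column index \<open>\<beta>\<close> of \<open>G\<^sub>\<alpha>\<^sub>\<beta>\<close> (with \<open>\<beta>\<close> barred).
  Hence in \<open>G_inv g p\<close> the row index is the barred and the column index the unbarred one.\<close>

definition G_mat :: "('n::finite cpair \<Rightarrow> real) \<Rightarrow> 'n cpair \<Rightarrow> complex^'n^'n" where
  "G_mat g p = (\<chi> \<alpha> \<beta>. D_v \<alpha> (D_vbar \<beta> (\<lambda>q. complex_of_real (g q))) p)"

definition G_inv :: "('n::finite cpair \<Rightarrow> real) \<Rightarrow> 'n cpair \<Rightarrow> complex^'n^'n" where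
  "G_inv g p = matrix_inv (G_mat g p)"

definition logG_mat :: "('n::finite cpair \<Rightarrow> real) \<Rightarrow> 'n cpair \<Rightarrow> complex^'n^'n" where
  "logG_mat g p = (\<chi> \<alpha> \<beta>. D_v \<alpha> (D_vbar \<beta> (\<lambda>q. complex_of_real (ln (g q)))) p)"

text \<open>\<open>Gam1 g \<alpha> \<mu>\<close> is \<open>\<Gamma>\<^sup>\<alpha>\<^sub>;\<^sub>\<mu>\<close> and \<open>Gam2 g \<alpha> \<beta> \<mu>\<close> is \<open>\<Gamma>\<^sup>\<alpha>\<^sub>\<beta>\<^sub>;\<^sub>\<mu>\<close>.\<close>

definition Gam1 :: "('n::finite cpair \<Rightarrow> real) \<Rightarrow> 'n \<Rightarrow> 'n \<Rightarrow> 'n cpair \<Rightarrow> complex" where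
  "Gam1 g \<alpha> \<mu> p =
     (\<Sum>l\<in>UNIV. G_inv g p $ l $ \<alpha> * D_vbar l (D_z \<mu> (\<lambda>q. complex_of_real (g q))) p)"

definition del :: "('n::finite cpair \<Rightarrow> real) \<Rightarrow> 'n \<Rightarrow> ('n cpair \<Rightarrow> complex) \<Rightarrow> 'n cpair \<Rightarrow> complex" where
  "del g \<mu> f p = D_z \<mu> f p - (\<Sum>\<alpha>\<in>UNIV. Gam1 g \<alpha> \<mu> p * D_v \<alpha> f p)"

definition delbar :: "('n::finite cpair \<Rightarrow> real) \<Rightarrow> 'n \<Rightarrow> ('n cpair \<Rightarrow> complex) \<Rightarrow> 'n cpair \<Rightarrow> complex" where
  "delbar g \<mu> f p = D_zbar \<mu> f p - (\<Sum>\<alpha>\<in>UNIV. cnj (Gam1 g \<alpha> \<mu> p) * D_vbar \<alpha> f p)"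

definition Gam2 :: "('n::finite cpair \<Rightarrow> real) \<Rightarrow> 'n \<Rightarrow> 'n \<Rightarrow> 'n \<Rightarrow> 'n cpair \<Rightarrow> complex" where
  "Gam2 g \<alpha> \<beta> \<mu> p =
     (\<Sum>l\<in>UNIV. G_inv g p $ l $ \<alpha> * del g \<mu> (\<lambda>q. G_mat g q $ \<beta> $ l) p)"

definition pos_def :: "complex^('n::finite)^'n \<Rightarrow> bool" where
  "pos_def H \<longleftrightarrow>
     (\<forall>\<xi>::complex^'n. \<xi> \<noteq> 0 \<longrightarrow>
        (let s = (\<Sum>\<alpha>\<in>UNIV. \<Sum>\<beta>\<in>UNIV. H $ \<alpha> $ \<beta> * \<xi> $ \<alpha> * cnj (\<xi> $ \<beta>)) in Im s = 0 \<and> Re s > 0))"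

definition strongly_pseudoconvex :: "('m, 'n::finite) chart set \<Rightarrow> (('m, 'n) tvec \<Rightarrow> real) \<Rightarrow> bool" where
  "strongly_pseudoconvex A F \<longleftrightarrow> (\<forall>c\<in>A. \<forall>p\<in>tdom0 c. pos_def (G_mat (Gloc A F c) p))"

definition kahler_finsler :: "('m, 'n::finite) chart set \<Rightarrow> (('m, 'n) tvec \<Rightarrow> real) \<Rightarrow> bool" where
  "kahler_finsler A F \<longleftrightarrow>
     (\<forall>c\<in>A. \<forall>p\<in>tdom0 c. \<forall>\<alpha> \<mu>.
        (\<Sum>\<beta>\<in>UNIV. (Gam2 (Gloc A F c) \<alpha> \<beta> \<mu> p - Gam2 (Gloc A F c) \<alpha> \<mu> \<beta> p) * snd p $ \<beta>) = 0)"


section \<open>Exterior algebra\<close>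

text \<open>For a complex coframe \<open>(e\<^sup>i)\<close> indexed by \<open>'i\<close>, the coefficient array \<open>\<phi>\<close>, skew in each of its
  two index lists, represents the (possibly inhomogeneous) form
  \<open>\<Sum>\<^sub>p\<^sub>,\<^sub>q 1/(p!q!) \<Sum> \<phi> I J e\<^sup>I \<and> cnj e\<^sup>J\<close>, the inner sum being over lists of lengths \<open>p\<close> and \<open>q\<close>.\<close>

type_synonym 'i cform = "'i list \<Rightarrow> 'i list \<Rightarrow> complex"

definition skew_pq :: "nat \<Rightarrow> nat \<Rightarrow> 'i cform \<Rightarrow> bool" where
  "skew_pq p q \<phi> \<longleftrightarrow>
     (\<forall>I J. length I \<noteq> p \<or> length J \<noteq> q \<longrightarrow> \<phi> I J = 0) \<and>
     (\<forall>I J \<sigma> \<tau>. length I = p \<and> length J = q \<and> \<sigma> permutes {..<p} \<and> \<tau> permutes {..<q} \<longrightarrow>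
        \<phi> (permute_list \<sigma> I) (permute_list \<tau> J) = of_int (sign \<sigma>) * of_int (sign \<tau>) * \<phi> I J)"

text \<open>The sign \<open>(-1)\<^bsup>q (|I| - p)\<^esup>\<close> arises from moving the \<open>q\<close> conjugate covectors of the first factor
  past the \<open>|I| - p\<close> unbarred covectors of the second one.\<close>

definition wedge :: "'i cform \<Rightarrow> 'i cform \<Rightarrow> 'i cform" where
  "wedge \<phi> \<psi> I J =
     (\<Sum>p\<le>length I. \<Sum>q\<le>length J.
        (-1) ^ (q * (length I - p)) /
          (fact p * fact (length I - p) * fact q * fact (length J - q)) *
        (\<Sum>\<sigma> | \<sigma> permutes {..<length I}. \<Sum>\<tau> | \<tau> permutes {..<length J}.
           of_int (sign \<sigma>) * of_int (sign \<tau>) *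
           \<phi> (take p (permute_list \<sigma> I)) (take q (permute_list \<tau> J)) *
           \<psi> (drop p (permute_list \<sigma> I)) (drop q (permute_list \<tau> J))))"

fun wedge_pow :: "'i cform \<Rightarrow> nat \<Rightarrow> 'i cform" where
  "wedge_pow \<phi> 0 = (\<lambda>I J. if I = [] \<and> J = [] then 1 else 0)"
| "wedge_pow \<phi> (Suc k) = wedge \<phi> (wedge_pow \<phi> k)"

text \<open>The form \<open>\<surd>-1 h\<^sub>\<alpha>\<^sub>\<beta> \<theta>\<^sup>\<alpha> \<and> cnj \<theta>\<^sup>\<beta>\<close>, where \<open>\<theta> \<alpha> i\<close> is the \<open>i\<close>-th component of the covector \<open>\<theta>\<^sup>\<alpha>\<close>.\<close>

definition form11 :: "complex^('n::finite)^'n \<Rightarrow> ('n \<Rightarrow> 'i \<Rightarrow> complex) \<Rightarrow> 'i cform" where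
  "form11 h \<theta> I J =
     (if length I = 1 \<and> length J = 1
      then \<i> * (\<Sum>\<alpha>\<in>UNIV. \<Sum>\<beta>\<in>UNIV. h $ \<alpha> $ \<beta> * \<theta> \<alpha> (I ! 0) * cnj (\<theta> \<beta> (J ! 0)))
      else 0)"


section \<open>Horizontal forms\<close>

text \<open>A horizontal form is given by its coefficients with respect to \<open>dz\<^sup>\<alpha>\<close> in every chart; only the
  coefficients at points of \<open>tdom0\<close> are meaningful. The last clause is the tensorial transformation
  law; the third one makes the coefficients functions on the projectivized bundle.\<close>

type_synonym ('m, 'n) hform = "('m, 'n) chart \<Rightarrow> 'n cpair \<Rightarrow> 'n cform"

definition hforms :: "('m, 'n::finite) chart set \<Rightarrow> nat \<Rightarrow> nat \<Rightarrow> ('m, 'n) hform set" where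
  "hforms A p q = {\<phi>.
     (\<forall>c\<in>A. \<forall>x\<in>tdom0 c. skew_pq p q (\<phi> c x)) \<and>
     (\<forall>c\<in>A. \<forall>I J. smooth_on (tdom0 c) (\<lambda>x. \<phi> c x I J)) \<and>
     (\<forall>c\<in>A. \<forall>(z, v)\<in>tdom0 c. \<forall>\<zeta>. \<zeta> \<noteq> 0 \<longrightarrow> \<phi> c (z, \<zeta> *s v) = \<phi> c (z, v)) \<and>
     (\<forall>c\<in>A. \<forall>d\<in>A. \<forall>u\<in>TM0 A. fst u \<in> cdom c \<inter> cdom d \<longrightarrow>
        (\<forall>I J. length I = p \<and> length J = q \<longrightarrow>
          \<phi> c (tcoord c u) I J =
            (\<Sum>K | length K = p. \<Sum>L | length L = q.
               (\<Prod>k<p. jac c d (cmap c (fst u)) $ (K ! k) $ (I ! k)) *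
               (\<Prod>k<q. cnj (jac c d (cmap c (fst u)) $ (L ! k) $ (J ! k))) *
               \<phi> d (tcoord d u) K L)))}"

definition omega_H :: "('m, 'n::finite) chart set \<Rightarrow> (('m, 'n) tvec \<Rightarrow> real) \<Rightarrow> ('m, 'n) hform" where
  "omega_H A F c x = form11 (G_mat (Gloc A F c) x) (\<lambda>\<alpha> i. of_bool (i = \<alpha>))"

definition hwedge :: "('m, 'n::finite) hform \<Rightarrow> ('m, 'n) hform \<Rightarrow> ('m, 'n) hform" where
  "hwedge \<phi> \<psi> c x = wedge (\<phi> c x) (\<psi> c x)"

definition hplus :: "('m, 'n::finite) hform \<Rightarrow> ('m, 'n) hform \<Rightarrow> ('m, 'n) hform" where
  "hplus \<phi> \<psi> c x I J = \<phi> c x I J + \<psi> c x I J"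

definition hzero :: "('m, 'n::finite) chart set \<Rightarrow> ('m, 'n) hform \<Rightarrow> bool" where
  "hzero A \<phi> \<longleftrightarrow> (\<forall>c\<in>A. \<forall>x\<in>tdom0 c. \<forall>I J. \<phi> c x I J = 0)"

definition omit :: "nat \<Rightarrow> 'i list \<Rightarrow> 'i list" where
  "omit k I = take k I @ drop (Suc k) I"

text \<open>Skew coefficients of \<open>\<delta>\<^sub>\<mu>(f) dz\<^sup>\<mu> \<and> dz\<^sup>A \<and> d\<zbar>\<^sup>B\<close> and of \<open>\<delta>\<^sub>\<nu>(f) d\<zbar>\<^sup>\<nu> \<and> dz\<^sup>A \<and> d\<zbar>\<^sup>B\<close> (with \<open>\<nu>\<close> barred),
  where \<open>d\<zbar>\<close> is the conjugate of \<open>dz\<close>; in the latter, moving \<open>d\<zbar>\<^sup>\<nu>\<close> past \<open>dz\<^sup>A\<close> gives \<open>(-1)\<^bsup>|A|\<^esup>\<close>.\<close>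

definition d_H :: "('m, 'n::finite) chart set \<Rightarrow> (('m, 'n) tvec \<Rightarrow> real) \<Rightarrow> ('m, 'n) hform \<Rightarrow> ('m, 'n) hform" where
  "d_H A F \<phi> c x I J =
     (\<Sum>k<length I. (-1) ^ k * del (Gloc A F c) (I ! k) (\<lambda>y. \<phi> c y (omit k I) J) x)"

definition dbar_H :: "('m, 'n::finite) chart set \<Rightarrow> (('m, 'n) tvec \<Rightarrow> real) \<Rightarrow> ('m, 'n) hform \<Rightarrow> ('m, 'n) hform" where
  "dbar_H A F \<phi> c x I J =
     (-1) ^ length I *
     (\<Sum>k<length J. (-1) ^ k * delbar (Gloc A F c) (J ! k) (\<lambda>y. \<phi> c y I (omit k J)) x)"

text \<open>The pointwise inner product of \<open>(p,q)\<close>-forms, as an expression in each chart.\<close>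

definition h_inner :: "('m, 'n::finite) chart set \<Rightarrow> (('m, 'n) tvec \<Rightarrow> real) \<Rightarrow> nat \<Rightarrow> nat
    \<Rightarrow> ('m, 'n) hform \<Rightarrow> ('m, 'n) hform \<Rightarrow> ('m, 'n) chart \<Rightarrow> 'n cpair \<Rightarrow> complex" where
  "h_inner A F p q \<phi> \<psi> c x =
     1 / (fact p * fact q) *
     (\<Sum>I | length I = p. \<Sum>J | length J = q. \<Sum>K | length K = p. \<Sum>L | length L = q.
        \<phi> c x I J *
        (\<Prod>k<p. G_inv (Gloc A F c) x $ (K ! k) $ (I ! k)) *
        (\<Prod>k<q. G_inv (Gloc A F c) x $ (J ! k) $ (L ! k)) *
        cnj (\<psi> c x K L))"


section \<open>The projectivized tangent bundle and its volume\<close>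

definition proj_rel :: "('m, 'n::finite) chart set \<Rightarrow> (('m, 'n) tvec \<times> ('m, 'n) tvec) set" where
  "proj_rel A = {(u, w). u \<in> TM0 A \<and> w \<in> TM0 A \<and> (\<exists>\<zeta>. \<zeta> \<noteq> 0 \<and> w = tscale \<zeta> u)}"

definition PTM :: "('m, 'n::finite) chart set \<Rightarrow> ('m, 'n) tvec set set" where
  "PTM A = TM0 A // proj_rel A"

text \<open>A \<open>\<complex>\<^sup>*\<close>-invariant function on \<open>TM0 A\<close>, given in charts, as a function on \<open>PTM A\<close>.\<close>

definition on_PTM :: "('m, 'n::finite) chart set \<Rightarrow> (('m, 'n) chart \<Rightarrow> 'n cpair \<Rightarrow> complex)
    \<Rightarrow> ('m, 'n) tvec set \<Rightarrow> complex" where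
  "on_PTM A h l = (THE y. \<forall>c\<in>A. \<forall>u\<in>l. fst u \<in> cdom c \<longrightarrow> h c (tcoord c u) = y)"

text \<open>Holomorphic coordinates on \<open>PTM A\<close>: for a chart \<open>c\<close> and an index \<open>a\<close>, the coordinates \<open>z\<close> and
  the inhomogeneous fibre coordinates \<open>(w\<^sup>i)\<close>, \<open>i \<noteq> a\<close>, on the set where \<open>v\<^sup>a \<noteq> 0\<close>. Functions in
  \<open>Pi\<^sub>E (UNIV - {a}) (\<lambda>_. UNIV)\<close> represent the points \<open>w\<close> of complex (n-1)-space.\<close>

definition slice :: "'n::finite \<Rightarrow> (complex^'n) \<times> ('n \<Rightarrow> complex) \<Rightarrow> 'n cpair" where
  "slice a y = (fst y, \<chi> i. if i = a then 1 else snd y i)"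

definition pdom :: "('m, 'n::finite) chart \<Rightarrow> 'n \<Rightarrow> ((complex^'n) \<times> ('n \<Rightarrow> complex)) set" where
  "pdom c a = (cmap c ` cdom c) \<times> (\<Pi>\<^sub>E i\<in>UNIV - {a}. UNIV)"

definition ppoint :: "('m, 'n::finite) chart set \<Rightarrow> ('m, 'n) chart \<Rightarrow> 'n
    \<Rightarrow> (complex^'n) \<times> ('n \<Rightarrow> complex) \<Rightarrow> ('m, 'n) tvec set" where
  "ppoint A c a y = proj_rel A `` {tpoint A c (slice a y)}"

definition leb_slice :: "'n::finite \<Rightarrow> ((complex^'n) \<times> ('n \<Rightarrow> complex)) measure" where
  "leb_slice a = lborel \<Otimes>\<^sub>M (\<Pi>\<^sub>M i\<in>UNIV - {a}. lborel)"

text \<open>On the tangent bundle the coframe is \<open>dz\<^sup>\<alpha>\<close> (index \<open>Inl \<alpha>\<close>) and \<open>dv\<^sup>\<alpha>\<close> (index \<open>Inr \<alpha>\<close>);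
  \<open>dv_cov g x \<alpha>\<close> is the covector \<open>\<delta>v\<^sup>\<alpha> = dv\<^sup>\<alpha> + \<Gamma>\<^sup>\<alpha>\<^sub>;\<^sub>\<beta> dz\<^sup>\<beta>\<close>.\<close>

definition dv_cov :: "('n::finite cpair \<Rightarrow> real) \<Rightarrow> 'n cpair \<Rightarrow> 'n \<Rightarrow> 'n + 'n \<Rightarrow> complex" where
  "dv_cov g x \<alpha> i = (case i of Inl \<beta> \<Rightarrow> Gam1 g \<alpha> \<beta> x | Inr \<beta> \<Rightarrow> of_bool (\<beta> = \<alpha>))"

definition omega_V_full :: "('n::finite cpair \<Rightarrow> real) \<Rightarrow> 'n cpair \<Rightarrow> ('n + 'n) cform" where
  "omega_V_full g x = form11 (logG_mat g x) (dv_cov g x)"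

definition omega_H_full :: "('n::finite cpair \<Rightarrow> real) \<Rightarrow> 'n cpair \<Rightarrow> ('n + 'n) cform" where
  "omega_H_full g x = form11 (G_mat g x) (\<lambda>\<alpha> i. of_bool (i = Inl \<alpha>))"

definition vol_form :: "('n::finite cpair \<Rightarrow> real) \<Rightarrow> 'n cpair \<Rightarrow> ('n + 'n) cform" where
  "vol_form g x I J =
     wedge (wedge_pow (omega_V_full g x) (CARD('n) - 1)) (wedge_pow (omega_H_full g x) CARD('n)) I J
       / (fact (CARD('n) - 1) * fact CARD('n))"

text \<open>The pullback of \<open>vol_form\<close> to the slice \<open>v\<^sup>a = 1\<close> only involves the indices other than \<open>Inr a\<close>.
  With \<open>N = 2n - 1\<close> coordinates \<open>\<zeta>\<^sup>k = x\<^sup>k + \<i> y\<^sup>k\<close> on the slice, listed in \<open>I\<close>, it equals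
  \<open>c d\<zeta>\<^sup>1 \<and> \<dots> \<and> d\<zeta>\<^sup>N \<and> cnj d\<zeta>\<^sup>1 \<and> \<dots> \<and> cnj d\<zeta>\<^sup>N\<close> with \<open>c = vol_form g x I I\<close> (independent of the
  ordering of \<open>I\<close>), that is \<open>c (-1)\<^bsup>N(N-1)/2\<^esup> (-2\<i>)\<^bsup>N\<^esup> dx\<^sup>1 \<and> dy\<^sup>1 \<and> \<dots> \<and> dx\<^sup>N \<and> dy\<^sup>N\<close>.\<close>

definition slice_indices :: "'n::finite \<Rightarrow> ('n + 'n) list" where
  "slice_indices a = (SOME I. distinct I \<and> set I = UNIV - {Inr a})"

definition vol_density :: "('n::finite cpair \<Rightarrow> real) \<Rightarrow> 'n \<Rightarrow> (complex^'n) \<times> ('n \<Rightarrow> complex) \<Rightarrow> real" where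
  "vol_density g a y =
     (let N = 2 * CARD('n) - 1; I = slice_indices a in
      Re (vol_form g (slice a y) I I * (-1) ^ (N * (N - 1) div 2) * (- 2 * \<i>) ^ N))"

text \<open>The measure on \<open>PTM A\<close> defined by the volume form: the Borel measure (Borel sets being detected
  in coordinates) which in each coordinate domain has the above density.\<close>

definition volume_measure :: "('m, 'n::finite) chart set \<Rightarrow> (('m, 'n) tvec \<Rightarrow> real)
    \<Rightarrow> ('m, 'n) tvec set measure \<Rightarrow> bool" where
  "volume_measure A F \<nu> \<longleftrightarrow>
     space \<nu> = PTM A \<and>
     sets \<nu> = {S. S \<subseteq> PTM A \<and> (\<forall>c\<in>A. \<forall>a. {y \<in> pdom c a. ppoint A c a y \<in> S} \<in> sets (leb_slice a))} \<and>
     (\<forall>c\<in>A. \<forall>a. \<forall>S\<in>sets \<nu>. S \<subseteq> ppoint A c a ` pdom c a \<longrightarrow>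
        emeasure \<nu> S =
          (\<integral>\<^sup>+ y. ennreal (vol_density (Gloc A F c) a y) *
                 indicator {y \<in> pdom c a. ppoint A c a y \<in> S} y \<partial>leb_slice a))"

definition L2_inner :: "('m, 'n::finite) chart set \<Rightarrow> (('m, 'n) tvec \<Rightarrow> real)
    \<Rightarrow> ('m, 'n) tvec set measure \<Rightarrow> nat \<Rightarrow> nat \<Rightarrow> ('m, 'n) hform \<Rightarrow> ('m, 'n) hform \<Rightarrow> complex" where
  "L2_inner A F \<nu> p q \<phi> \<psi> = (\<integral>l. on_PTM A (h_inner A F p q \<phi> \<psi>) l \<partial>\<nu>)"


section \<open>Formal adjoints and balanced metrics\<close>

text \<open>\<open>T'\<close> is a formal adjoint of the operator \<open>T\<close> of bidegree \<open>(r,s)\<close>. It is uniquely determined on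
  forms, since the \<open>L\<^sup>2\<close> inner product is definite.\<close>

definition formal_adjoint :: "('m, 'n::finite) chart set \<Rightarrow> (('m, 'n) tvec \<Rightarrow> real)
    \<Rightarrow> ('m, 'n) tvec set measure \<Rightarrow> nat \<Rightarrow> nat
    \<Rightarrow> (('m, 'n) hform \<Rightarrow> ('m, 'n) hform) \<Rightarrow> (('m, 'n) hform \<Rightarrow> ('m, 'n) hform) \<Rightarrow> bool" where
  "formal_adjoint A F \<nu> r s T T' \<longleftrightarrow>
     (\<forall>p q. \<forall>\<psi>\<in>hforms A (p + r) (q + s).
        T' \<psi> \<in> hforms A p q \<and>
        (\<forall>\<phi>\<in>hforms A p q. L2_inner A F \<nu> (p + r) (q + s) (T \<phi>) \<psi> = L2_inner A F \<nu> p q \<phi> (T' \<psi>)))"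

definition balanced_finsler ::
    "('m::{t2_space, second_countable_topology}, 'n::finite) chart set \<Rightarrow> (('m, 'n) tvec \<Rightarrow> real) \<Rightarrow> bool" where
  "balanced_finsler A F \<longleftrightarrow>
     complex_manifold A \<and> compact (UNIV :: 'm set) \<and>
     complex_finsler A F \<and> strongly_pseudoconvex A F \<and>
     (\<exists>\<nu> d_adj dbar_adj.
        volume_measure A F \<nu> \<and>
        formal_adjoint A F \<nu> 1 0 (d_H A F) d_adj \<and>
        formal_adjoint A F \<nu> 0 1 (dbar_H A F) dbar_adj \<and>
        hzero A (hplus (d_adj (omega_H A F)) (dbar_adj (omega_H A F))))"

end

theory Submission
  imports Defs "HOL-Complex_Analysis.Cauchy_Integral_Formula"
begin

text \<open>
  Let \<open>T\<^sub>\<mu>\<^sub>\<sigma>\<^sub>\<lambda> = \<delta>\<^sub>\<mu>G\<^sub>\<sigma>\<^sub>\<lambda> - \<delta>\<^sub>\<sigma>G\<^sub>\<mu>\<^sub>\<lambda>\<close> (with \<open>\<lambda>\<close> barred) be the torsion of the horizontal connection and \<open>\<tau>\<^sub>\<sigma>\<close> its trace.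
  The theorem follows from three facts.

  First, by the theorem of Chen and Shen, the Kaehler condition is equivalent to \<open>T = 0\<close>. The coefficients
  \<open>\<Gamma>\<^sup>\<alpha>\<^sub>\<beta>\<^sub>;\<^sub>\<mu>\<close> are the vertical derivatives of \<open>\<Gamma>\<^sup>\<alpha>\<^sub>;\<^sub>\<mu>\<close>; differentiating the Kaehler condition along the fibre
  therefore yields a term symmetric in the two lower indices, and the skew-symmetric part must vanish
  (\<open>kaehler_strong\<close>).

  Second, a balanced metric has \<open>\<tau> = 0\<close>. The two adjoints of \<open>\<omega>\<^sub>H\<close> have different bidegrees, so
  both are zero, and the \<open>L\<^sup>2\<close> product of \<open>\<partial>\<^sub>H\<phi>\<close> with \<open>\<omega>\<^sub>H\<close> vanishes for every horizontal (0,1)-form \<open>\<phi>\<close>. Take for \<open>\<phi>\<close> a bump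
  function times a conjugate coordinate differential, supported near one direction (locale \<open>test_form\<close>).
  In the slice \<open>v\<^sup>a = 1\<close> the volume form is a constant times \<open>(det G\<^sub>\<alpha>\<^sub>\<beta>)\<^sup>2 / G\<^sup>n\<close> times Lebesgue measure
  (\<open>vol_density_eq\<close>), and the divergence of \<open>G\<^sup>\<beta>\<^sup>\<mu> \<delta>\<^sub>\<mu>\<close> with respect to this density is the density times
  \<open>G\<^sup>\<beta>\<^sup>\<sigma> \<tau>\<^sub>\<sigma>\<close> (\<open>divergence_flux\<close>). Integration by parts shows that the integral of \<open>G\<^sup>\<beta>\<^sup>\<sigma> \<tau>\<^sub>\<sigma>\<close> against every
  such bump function is zero, hence \<open>\<tau> = 0\<close> (\<open>torsion_trace_zero\<close>).

  Third, if \<open>\<tau> = 0\<close>, then the function in the theorem is \<open>-\<i>\<close> times the squared norm of \<open>T\<close>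
  (\<open>h_inner_ddbar_omega\<close>). It is a double trace of the derivative \<open>\<delta>\<^sub>\<mu>\<close> of the conjugate torsion. As the simple trace of
  the conjugate torsion vanishes identically, the product rule moves the derivative to the inverse metric, and
  the skew-symmetry of the torsion turns the derivative of the metric into the torsion itself
  (\<open>trace_del_torsion_bar\<close>). Consequently the function vanishes exactly where \<open>T\<close> does.

  The global objects are handled in charts. Changes of coordinates and multiplication by scalars in the fibres
  are instances of holomorphic bundle maps, under which the metric, its inverse and \<open>\<delta>\<^sub>\<mu>\<close> are covariant
  (locale \<open>finsler_bundle_map\<close>). Since the charts are only assumed to be differentiable with complex linear
  derivatives, smoothness of the transition functions is derived from Cauchy's formula.
\<close>

section \<open>Calculus of smooth functions\<close>

lemma Ck_on_cong:
  assumes "open S" "\<And>x. x \<in> S \<Longrightarrow> f x = g x"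
  shows "Ck_on k S f \<longleftrightarrow> Ck_on k S g"
  using assms
proof (induction k arbitrary: f g)
  case 0
  then show ?case by (simp cong: continuous_on_cong)
next
  case (Suc k)
  have *: "Ck_on (Suc k) S g'" if ck: "Ck_on (Suc k) S f'" and eq: "\<And>x. x \<in> S \<Longrightarrow> f' x = g' x" for f' g' :: "'a \<Rightarrow> 'b"
  proof -
    have df: "f' differentiable at x" if "x \<in> S" for x
      using ck that Suc.prems(1) by (simp add: differentiable_on_eq_differentiable_at)
    have fd: "frechet_derivative f' (at x) = frechet_derivative g' (at x)" if "x \<in> S" for x
      by (rule frechet_derivative_transform_within_open[OF df[OF that] Suc.prems(1) that eq])
    have dg: "g' differentiable_on S"
    proof -
      have "g' differentiable (at x)" if "x \<in> S" for x
      proof -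
        obtain D where "(f' has_derivative D) (at x)"
          using df[OF \<open>x \<in> S\<close>] unfolding differentiable_def by blast
        then have "(g' has_derivative D) (at x)"
          by (rule has_derivative_transform_within_open[OF _ Suc.prems(1) \<open>x \<in> S\<close>]) (rule eq)
        then show ?thesis unfolding differentiable_def by blast
      qed
      then show ?thesis using Suc.prems(1) by (simp add: differentiable_on_eq_differentiable_at)
    qed
    have "Ck_on k S (\<lambda>x. frechet_derivative g' (at x) h)" for h
      using ck Suc.IH[OF Suc.prems(1), of "\<lambda>x. frechet_derivative f' (at x) h" "\<lambda>x. frechet_derivative g' (at x) h"]
        fd by simp
    with dg show ?thesis by simp
  qed
  show ?case using *[of f g] *[of g f] Suc.prems(2) by fastforce
qed

lemma Ck_on_SucI:
  assumes "open S" "\<And>x. x \<in> S \<Longrightarrow> (f has_derivative f' x) (at x)"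
    and "\<And>h. Ck_on k S (\<lambda>x. f' x h)"
  shows "Ck_on (Suc k) S f"
proof -
  have "f differentiable_on S"
    using assms(1,2) by (auto simp: differentiable_on_eq_differentiable_at differentiable_def)
  moreover have "Ck_on k S (\<lambda>x. frechet_derivative f (at x) h)" for h
    using assms(3)[of h] Ck_on_cong[OF assms(1), of "\<lambda>x. frechet_derivative f (at x) h" "\<lambda>x. f' x h"]
      frechet_derivative_at[OF assms(2)] by (metis (no_types, lifting))
  ultimately show ?thesis by simp
qed

lemma Ck_on_SucD: "Ck_on (Suc k) S f \<Longrightarrow> Ck_on k S f"
  by (induction k arbitrary: f) (auto intro: differentiable_imp_continuous_on)

lemma Ck_on_subset: "Ck_on k S f \<Longrightarrow> T \<subseteq> S \<Longrightarrow> Ck_on k T f"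
  by (induction k arbitrary: f) (auto intro: continuous_on_subset differentiable_on_subset)

lemma Ck_on_locally:
  assumes "open S" "\<And>x. x \<in> S \<Longrightarrow> \<exists>T. open T \<and> x \<in> T \<and> Ck_on k T f"
  shows "Ck_on k S f"
  using assms
proof (induction k arbitrary: f)
  case 0
  then show ?case
    by (metis Ck_on.simps(1) continuous_on_eq_continuous_at continuous_at_imp_continuous_on)
next
  case (Suc k)
  have "f differentiable_on S"
    using Suc.prems by (metis Ck_on.simps(2) differentiable_on_eq_differentiable_at)
  moreover have "Ck_on k S (\<lambda>x. frechet_derivative f (at x) h)" for h
    using Suc.prems by (intro Suc.IH) fastforce+
  ultimately show ?case by simp
qed

lemma Ck_on_const: "Ck_on k S (\<lambda>x. c)"
  by (induction k arbitrary: c) auto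

lemma Ck_on_bounded_linear_comp:
  assumes "bounded_linear L" "open S" "Ck_on k S f"
  shows "Ck_on k S (\<lambda>x. L (f x))"
  using assms(3)
proof (induction k arbitrary: f)
  case 0
  then show ?case using assms(1)
    by (simp add: bounded_linear.continuous_on)
next
  case (Suc k)
  show ?case
  proof (rule Ck_on_SucI[OF assms(2)])
    fix x assume "x \<in> S"
    then have "(f has_derivative frechet_derivative f (at x)) (at x)"
      using Suc.prems assms(2) by (simp add: differentiable_on_eq_differentiable_at frechet_derivative_works)
    then show "((\<lambda>x. L (f x)) has_derivative (\<lambda>h. L (frechet_derivative f (at x) h))) (at x)"
      by (rule bounded_linear.has_derivative[OF assms(1)])
  next
    fix h show "Ck_on k S (\<lambda>x. L (frechet_derivative f (at x) h))"
      using Suc by simp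
  qed
qed

lemma Ck_on_bounded_linear:
  assumes "bounded_linear L" "open S" shows "Ck_on k S L"
proof (cases k)
  case 0 then show ?thesis using assms by (simp add: linear_continuous_on)
next
  case (Suc j)
  have "Ck_on (Suc j) S L"
    by (rule Ck_on_SucI[OF assms(2) bounded_linear_imp_has_derivative[OF assms(1)]]) (rule Ck_on_const)
  then show ?thesis by (simp add: Suc)
qed

lemma Ck_on_add:
  assumes "open S" "Ck_on k S f" "Ck_on k S g"
  shows "Ck_on k S (\<lambda>x. f x + g x)"
  using assms(2,3)
proof (induction k arbitrary: f g)
  case 0
  then show ?case by (auto intro: continuous_intros)
next
  case (Suc k)
  show ?case
  proof (rule Ck_on_SucI[OF assms(1)])
    fix x assume "x \<in> S"
    then show "((\<lambda>x. f x + g x) has_derivative (\<lambda>h. frechet_derivative f (at x) h + frechet_derivative g (at x) h)) (at x)"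
      using Suc.prems assms(1)
      by (intro has_derivative_add) (simp_all add: differentiable_on_eq_differentiable_at frechet_derivative_works)
  qed (use Suc in simp)
qed

lemma Ck_on_bilinear:
  assumes "bounded_bilinear B" "open S" "Ck_on k S f" "Ck_on k S g"
  shows "Ck_on k S (\<lambda>x. B (f x) (g x))"
  using assms(3,4)
proof (induction k arbitrary: f g)
  case 0
  then show ?case using bounded_bilinear.continuous_on[OF assms(1)] by simp
next
  case (Suc k)
  show ?case
  proof (rule Ck_on_SucI[OF assms(2)])
    fix x assume "x \<in> S"
    then show "((\<lambda>x. B (f x) (g x)) has_derivative
        (\<lambda>h. B (f x) (frechet_derivative g (at x) h) + B (frechet_derivative f (at x) h) (g x))) (at x)"
      using Suc.prems assms(2)
      by (intro bounded_bilinear.FDERIV[OF assms(1)])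
        (simp_all add: differentiable_on_eq_differentiable_at frechet_derivative_works)
  next
    fix h
    show "Ck_on k S (\<lambda>x. B (f x) (frechet_derivative g (at x) h) + B (frechet_derivative f (at x) h) (g x))"
      using Suc.prems Ck_on_SucD[OF Suc.prems(1)] Ck_on_SucD[OF Suc.prems(2)]
      by (intro Ck_on_add[OF assms(2)] Suc.IH) auto
  qed
qed

text \<open>The chain rule \<open>D(f \<circ> g)(x) h = D f(g x) (D g(x) h)\<close> becomes a finite sum of products of
  functions of class \<open>C\<^sup>k\<close> once \<open>D g(x) h\<close> is expanded in a basis; this drives the induction.\<close>

lemma Ck_on_compose:
  fixes g :: "'a::real_normed_vector \<Rightarrow> 'b::euclidean_space" and f :: "'b \<Rightarrow> 'c::real_normed_vector"
  assumes "open S" "open T" "Ck_on k S g" "Ck_on k T f" "g ` S \<subseteq> T"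
  shows "Ck_on k S (\<lambda>x. f (g x))"
  using assms(3,4)
proof (induction k arbitrary: f)
  case 0
  then show ?case using assms(5) by (auto intro: continuous_on_compose2)
next
  case (Suc k)
  have dg: "(g has_derivative frechet_derivative g (at x)) (at x)" if "x \<in> S" for x
    using Suc.prems assms(1) that by (simp add: differentiable_on_eq_differentiable_at frechet_derivative_works)
  have df: "(f has_derivative frechet_derivative f (at x)) (at x)" if "x \<in> T" for x
    using Suc.prems assms(2) that by (simp add: differentiable_on_eq_differentiable_at frechet_derivative_works)
  show ?case
  proof (rule Ck_on_SucI[OF assms(1)])
    fix x assume x: "x \<in> S"
    then have gx: "g x \<in> T" using assms(5) by auto
    have "((\<lambda>x. f (g x)) has_derivative (\<lambda>h. frechet_derivative f (at (g x)) (frechet_derivative g (at x) h))) (at x)"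
      by (rule has_derivative_compose[OF dg[OF x]]) (rule df[OF gx])
    moreover have "frechet_derivative f (at (g x)) (frechet_derivative g (at x) h) =
       (\<Sum>b\<in>Basis. (frechet_derivative g (at x) h \<bullet> b) *\<^sub>R frechet_derivative f (at (g x)) b)" for h
    proof -
      have lin: "linear (frechet_derivative f (at (g x)))"
        using df[OF gx] has_derivative_linear by blast
      have "frechet_derivative f (at (g x)) (frechet_derivative g (at x) h)
         = frechet_derivative f (at (g x)) (\<Sum>b\<in>Basis. (frechet_derivative g (at x) h \<bullet> b) *\<^sub>R b)"
        by (simp add: euclidean_representation)
      also have "\<dots> = (\<Sum>b\<in>Basis. (frechet_derivative g (at x) h \<bullet> b) *\<^sub>R frechet_derivative f (at (g x)) b)"
        by (simp add: linear_sum[OF lin] linear_cmul[OF lin])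
      finally show ?thesis .
    qed
    then have "(\<lambda>h. frechet_derivative f (at (g x)) (frechet_derivative g (at x) h)) =
       (\<lambda>h. \<Sum>b\<in>Basis. (frechet_derivative g (at x) h \<bullet> b) *\<^sub>R frechet_derivative f (at (g x)) b)"
      by (rule ext)
    ultimately show "((\<lambda>x. f (g x)) has_derivative (\<lambda>h. \<Sum>b\<in>Basis. (frechet_derivative g (at x) h \<bullet> b) *\<^sub>R frechet_derivative f (at (g x)) b)) (at x)"
      by simp
  next
    fix h
    have sm: "Ck_on k S (\<lambda>x. \<Sum>b\<in>B. (frechet_derivative g (at x) h \<bullet> b) *\<^sub>R frechet_derivative f (at (g x)) b)" 
      if "finite B" for B
      using that
    proof induction
      case empty then show ?case by (simp add: Ck_on_const)
    next
      case (insert b B)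
      have "Ck_on k S (\<lambda>x. frechet_derivative g (at x) h \<bullet> b)"
        by (rule Ck_on_bounded_linear_comp[OF bounded_linear_inner_left assms(1)]) (use Suc.prems in simp)
      moreover have "Ck_on k S (\<lambda>x. frechet_derivative f (at (g x)) b)"
        using Suc.IH[of "\<lambda>y. frechet_derivative f (at y) b"] Suc.prems Ck_on_SucD by auto
      ultimately have "Ck_on k S (\<lambda>x. (frechet_derivative g (at x) h \<bullet> b) *\<^sub>R frechet_derivative f (at (g x)) b)"
        by (rule Ck_on_bilinear[OF bounded_bilinear_scaleR assms(1)])
      then show ?case using insert Ck_on_add[OF assms(1)] by simp
    qed
    show "Ck_on k S (\<lambda>x. \<Sum>b\<in>Basis. (frechet_derivative g (at x) h \<bullet> b) *\<^sub>R frechet_derivative f (at (g x)) b)"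
      by (rule sm) simp
  qed
qed

lemma smooth_on_cong:
  assumes "open S" "\<And>x. x \<in> S \<Longrightarrow> f x = g x" "smooth_on S f"
  shows "smooth_on S g"
  using assms(3) Ck_on_cong[of S f g] assms(1,2) by (auto simp: smooth_on_def)

lemma smooth_on_Ck_on: "smooth_on S f \<Longrightarrow> Ck_on k S f"
  by (simp add: smooth_on_def)

lemma smooth_on_subset: "smooth_on S f \<Longrightarrow> T \<subseteq> S \<Longrightarrow> smooth_on T f"
  by (auto simp: smooth_on_def intro: Ck_on_subset)

lemma smooth_on_locally:
  assumes "open S" "\<And>x. x \<in> S \<Longrightarrow> \<exists>T. open T \<and> x \<in> T \<and> smooth_on T f"
  shows "smooth_on S f"
  unfolding smooth_on_def
  by (intro allI Ck_on_locally assms(1)) (use assms(2) smooth_on_def in blast)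

lemma smooth_on_const [simp]: "smooth_on S (\<lambda>x. c)"
  by (simp add: smooth_on_def Ck_on_const)

lemma smooth_on_bounded_linear_comp:
  "bounded_linear L \<Longrightarrow> open S \<Longrightarrow> smooth_on S f \<Longrightarrow> smooth_on S (\<lambda>x. L (f x))"
  by (simp add: smooth_on_def Ck_on_bounded_linear_comp)

lemma smooth_on_bounded_linear: "bounded_linear L \<Longrightarrow> open S \<Longrightarrow> smooth_on S L"
  by (simp add: smooth_on_def Ck_on_bounded_linear)

lemma smooth_on_add: "open S \<Longrightarrow> smooth_on S f \<Longrightarrow> smooth_on S g \<Longrightarrow> smooth_on S (\<lambda>x. f x + g x)"
  by (simp add: smooth_on_def Ck_on_add)

lemma smooth_on_bilinear:
  "bounded_bilinear B \<Longrightarrow> open S \<Longrightarrow> smooth_on S f \<Longrightarrow> smooth_on S g \<Longrightarrow> smooth_on S (\<lambda>x. B (f x) (g x))"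
  by (simp add: smooth_on_def Ck_on_bilinear)

lemma smooth_on_compose:
  fixes g :: "'a::real_normed_vector \<Rightarrow> 'b::euclidean_space"
  assumes "open S" "open T" "smooth_on S g" "smooth_on T f" "g ` S \<subseteq> T"
  shows "smooth_on S (\<lambda>x. f (g x))"
  using assms by (simp add: smooth_on_def Ck_on_compose)

lemma smooth_on_mult:
  fixes f g :: "_ \<Rightarrow> 'b::real_normed_algebra"
  shows "open S \<Longrightarrow> smooth_on S f \<Longrightarrow> smooth_on S g \<Longrightarrow> smooth_on S (\<lambda>x. f x * g x)"
  by (rule smooth_on_bilinear[OF bounded_bilinear_mult])

lemma smooth_on_minus: "open S \<Longrightarrow> smooth_on S f \<Longrightarrow> smooth_on S (\<lambda>x. - f x)"
  by (rule smooth_on_bounded_linear_comp[OF bounded_linear_minus[OF bounded_linear_ident]])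

lemma smooth_on_diff: "open S \<Longrightarrow> smooth_on S f \<Longrightarrow> smooth_on S g \<Longrightarrow> smooth_on S (\<lambda>x. f x - g x)"
  using smooth_on_add[of S f "\<lambda>x. - g x"] smooth_on_minus[of S g] by simp

lemma smooth_on_sum:
  "open S \<Longrightarrow> (\<And>i. i \<in> I \<Longrightarrow> smooth_on S (f i)) \<Longrightarrow> smooth_on S (\<lambda>x. \<Sum>i\<in>I. f i x)"
  by (induction I rule: infinite_finite_induct) (auto intro!: smooth_on_add)

lemma smooth_on_prod:
  fixes f :: "_ \<Rightarrow> _ \<Rightarrow> 'b::{real_normed_algebra, comm_ring_1}"
  shows "open S \<Longrightarrow> (\<And>i. i \<in> I \<Longrightarrow> smooth_on S (f i)) \<Longrightarrow> smooth_on S (\<lambda>x. \<Prod>i\<in>I. f i x)"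
  by (induction I rule: infinite_finite_induct) (auto intro!: smooth_on_mult)

lemma smooth_on_cnj: "open S \<Longrightarrow> smooth_on S f \<Longrightarrow> smooth_on S (\<lambda>x. cnj (f x))"
  by (rule smooth_on_bounded_linear_comp[OF bounded_linear_cnj])

lemma smooth_on_inverse:
  fixes f :: "_ \<Rightarrow> 'b::{euclidean_space, real_normed_field}"
  assumes "open S" "smooth_on S f" "\<And>x. x \<in> S \<Longrightarrow> f x \<noteq> 0"
  shows "smooth_on S (\<lambda>x. inverse (f x))"
proof (rule smooth_on_compose[OF assms(1) _ assms(2)])
  show op: "open (- {0::'b})" by auto
  show "f ` S \<subseteq> - {0}" using assms(3) by auto
  have "Ck_on k (- {0::'b}) inverse" for k
  proof (induction k)
    case 0 then show ?case by (auto intro: continuous_intros)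
  next
    case (Suc k)
    show ?case
    proof (rule Ck_on_SucI[OF op])
      fix x :: 'b assume "x \<in> - {0}"
      then show "(inverse has_derivative (\<lambda>h. - (inverse x * h * inverse x))) (at x)"
        by (intro has_derivative_inverse') auto
    next
      fix h :: 'b
      have "Ck_on k (- {0}) (\<lambda>x::'b. inverse x * h * inverse x)"
        by (intro Ck_on_bilinear[OF bounded_bilinear_mult op] Suc Ck_on_const)
      then show "Ck_on k (- {0}) (\<lambda>x::'b. - (inverse x * h * inverse x))"
        by (rule Ck_on_bounded_linear_comp[OF bounded_linear_minus[OF bounded_linear_ident] op])
    qed
  qed
  then show "smooth_on (- {0::'b}) inverse" by (simp add: smooth_on_def)
qed

lemma smooth_on_differentiable:
  "open S \<Longrightarrow> smooth_on S f \<Longrightarrow> x \<in> S \<Longrightarrow> f differentiable (at x)"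
  using smooth_on_Ck_on[of S f 1] by (simp add: differentiable_on_eq_differentiable_at)

lemma smooth_on_has_derivative:
  "open S \<Longrightarrow> smooth_on S f \<Longrightarrow> x \<in> S \<Longrightarrow> (f has_derivative frechet_derivative f (at x)) (at x)"
  using smooth_on_differentiable frechet_derivative_works by blast

lemma smooth_on_continuous: "smooth_on S f \<Longrightarrow> continuous_on S f"
  using smooth_on_Ck_on[of S f 0] by simp

lemma smooth_on_frechet_derivative:
  "smooth_on S f \<Longrightarrow> smooth_on S (\<lambda>x. frechet_derivative f (at x) h)"
  unfolding smooth_on_def by (metis Ck_on.simps(2))


section \<open>Symmetry of second derivatives\<close>

text \<open>The mean value theorem is applied to the second difference in the direction \<open>a\<close>, then in the direction
  \<open>b\<close>. The second difference is symmetric in \<open>a\<close> and \<open>b\<close>, which is the source of Schwarz's theorem.\<close>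

lemma second_difference_mean_value:
  fixes f :: "'a::real_normed_vector \<Rightarrow> real"
  assumes S: "open S" and f: "Ck_on 2 S f" and p: "ball p d \<subseteq> S"
    and t: "0 < t" "t * (norm a + norm b) < d"
  shows "\<exists>x\<in>ball p d. f (p + t *\<^sub>R a + t *\<^sub>R b) - f (p + t *\<^sub>R a) - f (p + t *\<^sub>R b) + f p
      = t^2 * frechet_derivative (\<lambda>x. frechet_derivative f (at x) a) (at x) b"
proof -
  define D where "D = (\<lambda>x. frechet_derivative f (at x) a)"
  have f2: "Ck_on (Suc (Suc 0)) S f" using f by (simp add: numeral_2_eq_2)
  have df: "(f has_derivative frechet_derivative f (at x)) (at x)" if "x \<in> S" for x
    using f2 that S by (simp add: differentiable_on_eq_differentiable_at frechet_derivative_works)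
  have dD: "(D has_derivative frechet_derivative D (at x)) (at x)" if "x \<in> S" for x
    using f2 that S by (simp add: D_def differentiable_on_eq_differentiable_at frechet_derivative_works)
  have inb: "p + x *\<^sub>R a + y *\<^sub>R b \<in> ball p d" if "0 \<le> x" "x \<le> t" "0 \<le> y" "y \<le> t" for x y
  proof -
    have "norm (x *\<^sub>R a + y *\<^sub>R b) \<le> x * norm a + y * norm b"
      using norm_triangle_ineq[of "x *\<^sub>R a" "y *\<^sub>R b"] that by simp
    also have "\<dots> \<le> t * norm a + t * norm b"
      using that by (intro add_mono mult_right_mono) auto
    finally show ?thesis using t by (simp add: dist_norm norm_minus_commute algebra_simps)
  qed
  define u where "u = (\<lambda>s. f (p + s *\<^sub>R a + t *\<^sub>R b) - f (p + s *\<^sub>R a))"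
  have du: "(u has_real_derivative D (p + s *\<^sub>R a + t *\<^sub>R b) - D (p + s *\<^sub>R a)) (at s)" if "0 \<le> s" "s \<le> t" for s
  proof -
    have 1: "p + s *\<^sub>R a + t *\<^sub>R b \<in> S" "p + s *\<^sub>R a \<in> S"
      using inb[of s t] inb[of s 0] that t p by auto
    have "((\<lambda>s. f (p + s *\<^sub>R a + t *\<^sub>R b)) has_derivative
      (\<lambda>h. frechet_derivative f (at (p + s *\<^sub>R a + t *\<^sub>R b)) (h *\<^sub>R a))) (at s)"
      by (rule has_derivative_compose[where f="\<lambda>s. p + s *\<^sub>R a + t *\<^sub>R b", OF _ df[OF 1(1)]]) (auto intro!: derivative_eq_intros)
    moreover have "((\<lambda>s. f (p + s *\<^sub>R a)) has_derivative
      (\<lambda>h. frechet_derivative f (at (p + s *\<^sub>R a)) (h *\<^sub>R a))) (at s)"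
      by (rule has_derivative_compose[where f="\<lambda>s. p + s *\<^sub>R a", OF _ df[OF 1(2)]]) (auto intro!: derivative_eq_intros)
    ultimately have "(u has_derivative (\<lambda>h. frechet_derivative f (at (p + s *\<^sub>R a + t *\<^sub>R b)) (h *\<^sub>R a) -
       frechet_derivative f (at (p + s *\<^sub>R a)) (h *\<^sub>R a))) (at s)"
      unfolding u_def by (rule has_derivative_diff)
    moreover have "(\<lambda>h. frechet_derivative f (at (p + s *\<^sub>R a + t *\<^sub>R b)) (h *\<^sub>R a) -
       frechet_derivative f (at (p + s *\<^sub>R a)) (h *\<^sub>R a)) = (*) (D (p + s *\<^sub>R a + t *\<^sub>R b) - D (p + s *\<^sub>R a))"
      using linear_cmul[OF has_derivative_linear[OF df[OF 1(1)]]] linear_cmul[OF has_derivative_linear[OF df[OF 1(2)]]]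
      by (auto simp: D_def algebra_simps)
    ultimately show ?thesis by (simp add: has_field_derivative_def)
  qed
  obtain \<xi> where \<xi>: "0 < \<xi>" "\<xi> < t" "u t - u 0 = (t - 0) * (D (p + \<xi> *\<^sub>R a + t *\<^sub>R b) - D (p + \<xi> *\<^sub>R a))"
    using MVT2[OF t(1), of u "\<lambda>s. D (p + s *\<^sub>R a + t *\<^sub>R b) - D (p + s *\<^sub>R a)"] du by blast
  define w where "w = (\<lambda>s. D (p + \<xi> *\<^sub>R a + s *\<^sub>R b))"
  have dw: "(w has_real_derivative frechet_derivative D (at (p + \<xi> *\<^sub>R a + s *\<^sub>R b)) b) (at s)" if "0 \<le> s" "s \<le> t" for s
  proof -
    have 1: "p + \<xi> *\<^sub>R a + s *\<^sub>R b \<in> S" using inb[of \<xi> s] that \<xi> p by auto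
    have "(w has_derivative
      (\<lambda>h. frechet_derivative D (at (p + \<xi> *\<^sub>R a + s *\<^sub>R b)) (h *\<^sub>R b))) (at s)"
      unfolding w_def by (rule has_derivative_compose[where f="\<lambda>s. p + \<xi> *\<^sub>R a + s *\<^sub>R b", OF _ dD[OF 1(1)]]) (auto intro!: derivative_eq_intros)
    moreover have "(\<lambda>h. frechet_derivative D (at (p + \<xi> *\<^sub>R a + s *\<^sub>R b)) (h *\<^sub>R b)) = (*) (frechet_derivative D (at (p + \<xi> *\<^sub>R a + s *\<^sub>R b)) b)"
      using linear_cmul[OF has_derivative_linear[OF dD[OF 1]]] by (auto simp: algebra_simps)
    ultimately show ?thesis by (simp add: has_field_derivative_def)
  qed
  obtain \<eta> where \<eta>: "0 < \<eta>" "\<eta> < t" "w t - w 0 = (t - 0) * frechet_derivative D (at (p + \<xi> *\<^sub>R a + \<eta> *\<^sub>R b)) b"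
    using MVT2[OF t(1), of w "\<lambda>s. frechet_derivative D (at (p + \<xi> *\<^sub>R a + s *\<^sub>R b)) b"] dw by blast
  have "f (p + t *\<^sub>R a + t *\<^sub>R b) - f (p + t *\<^sub>R a) - f (p + t *\<^sub>R b) + f p = u t - u 0"
    by (simp add: u_def)
  also have "\<dots> = t * (w t - w 0)" using \<xi>(3) by (simp add: w_def)
  also have "\<dots> = t^2 * frechet_derivative D (at (p + \<xi> *\<^sub>R a + \<eta> *\<^sub>R b)) b"
    using \<eta>(3) by (simp add: power2_eq_square)
  finally show ?thesis using inb[of \<xi> \<eta>] \<xi> \<eta> unfolding D_def by auto
qed

lemma second_derivative_symmetric_real:
  fixes f :: "'a::real_normed_vector \<Rightarrow> real"
  assumes S: "open S" and f: "Ck_on 2 S f" and p: "p \<in> S"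
  shows "frechet_derivative (\<lambda>x. frechet_derivative f (at x) a) (at p) b
       = frechet_derivative (\<lambda>x. frechet_derivative f (at x) b) (at p) a"
proof -
  define A where "A = (\<lambda>a b x. frechet_derivative (\<lambda>x. frechet_derivative f (at x) a) (at x) b)"
  have cont: "continuous_on S (A a b)" for a b
    using f unfolding A_def by (simp add: numeral_2_eq_2)
  have "\<bar>A a b p - A b a p\<bar> \<le> 0"
  proof (rule field_le_epsilon)
    fix e :: real assume "0 < e"
    have "\<exists>d>0. \<forall>x\<in>S. dist x p < d \<longrightarrow> dist (A a b x) (A a b p) < e/2" for a b
      using cont[of a b] p \<open>0 < e\<close> unfolding continuous_on_iff by (meson half_gt_zero)
    then obtain d1 d2 where d: "0 < d1" "\<And>x. x \<in> S \<Longrightarrow> dist x p < d1 \<Longrightarrow> dist (A a b x) (A a b p) < e/2"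
       "0 < d2" "\<And>x. x \<in> S \<Longrightarrow> dist x p < d2 \<Longrightarrow> dist (A b a x) (A b a p) < e/2" by metis
    obtain r where r: "0 < r" "ball p r \<subseteq> S" using S p openE by blast
    define \<delta> where "\<delta> = min r (min d1 d2)"
    have \<delta>: "0 < \<delta>" "ball p \<delta> \<subseteq> S" using d r by (auto simp: \<delta>_def)
    define t where "t = \<delta> / (2 * (norm a + norm b + 1))"
    have pos: "0 < norm a + norm b + 1" by (simp add: add_nonneg_pos)
    have t: "0 < t" using \<delta> pos by (simp add: t_def)
    have "t * (norm a + norm b) \<le> t * (norm a + norm b + 1)" using t by simp
    also have "\<dots> = \<delta> / 2" using pos unfolding t_def by (simp add: field_simps)
    also have "\<dots> < \<delta>" using \<delta> by simp
    finally have t2: "t * (norm a + norm b) < \<delta>" "t * (norm b + norm a) < \<delta>" by (simp_all add: add.commute)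
    obtain x where x: "x \<in> ball p \<delta>" "f (p + t *\<^sub>R a + t *\<^sub>R b) - f (p + t *\<^sub>R a) - f (p + t *\<^sub>R b) + f p = t^2 * A a b x"
      using second_difference_mean_value[OF S f \<delta>(2) t t2(1)] unfolding A_def by blast
    obtain y where y: "y \<in> ball p \<delta>" "f (p + t *\<^sub>R b + t *\<^sub>R a) - f (p + t *\<^sub>R b) - f (p + t *\<^sub>R a) + f p = t^2 * A b a y"
      using second_difference_mean_value[OF S f \<delta>(2) t t2(2)] unfolding A_def by blast
    have "t^2 * A a b x = t^2 * A b a y"
      using x(2) y(2) by (simp add: algebra_simps)
    then have "A a b x = A b a y" using t by simp
    moreover have "dist (A a b x) (A a b p) < e/2" "dist (A b a y) (A b a p) < e/2"
      using d(2)[of x] d(4)[of y] x(1) y(1) \<delta>(2) by (auto simp: \<delta>_def dist_commute)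
    ultimately show "\<bar>A a b p - A b a p\<bar> \<le> 0 + e" by (simp add: dist_real_def abs_if split: if_splits)
  qed
  then show ?thesis by (simp add: A_def)
qed

lemma frechet_derivative_bounded_linear_comp:
  assumes "bounded_linear L" "f differentiable (at x)"
  shows "frechet_derivative (\<lambda>x. L (f x)) (at x) = (\<lambda>h. L (frechet_derivative f (at x) h))"
  using frechet_derivative_at[OF bounded_linear.has_derivative[OF assms(1) frechet_derivative_works[THEN iffD1, OF assms(2)]]]
  by simp

lemma second_derivative_symmetric:
  fixes f :: "'a::real_normed_vector \<Rightarrow> complex"
  assumes S: "open S" and f: "smooth_on S f" and p: "p \<in> S"
  shows "frechet_derivative (\<lambda>x. frechet_derivative f (at x) a) (at p) b
       = frechet_derivative (\<lambda>x. frechet_derivative f (at x) b) (at p) a"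
proof -
  have comp: "L (frechet_derivative (\<lambda>x. frechet_derivative f (at x) a) (at p) b)
       = L (frechet_derivative (\<lambda>x. frechet_derivative f (at x) b) (at p) a)"
    if L: "bounded_linear L" for L :: "complex \<Rightarrow> real"
  proof -
    have 1: "L (frechet_derivative (\<lambda>x. frechet_derivative f (at x) a) (at p) b) =
      frechet_derivative (\<lambda>x. frechet_derivative (\<lambda>x. L (f x)) (at x) a) (at p) b" for a b
    proof -
      have "L (frechet_derivative (\<lambda>x. frechet_derivative f (at x) a) (at p) b) =
         frechet_derivative (\<lambda>x. L (frechet_derivative f (at x) a)) (at p) b"
        using frechet_derivative_bounded_linear_comp[OF L smooth_on_differentiable[OF S smooth_on_frechet_derivative[OF f] p]]
        by simp
      also have "frechet_derivative (\<lambda>x. L (frechet_derivative f (at x) a)) (at p) =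
          frechet_derivative (\<lambda>x. frechet_derivative (\<lambda>x. L (f x)) (at x) a) (at p)"
      proof (rule frechet_derivative_transform_within_open[OF _ S p])
        show "(\<lambda>x. L (frechet_derivative f (at x) a)) differentiable at p"
          by (rule smooth_on_differentiable[OF S smooth_on_bounded_linear_comp[OF L S smooth_on_frechet_derivative[OF f]] p])
        show "L (frechet_derivative f (at x) a) = frechet_derivative (\<lambda>x. L (f x)) (at x) a" if "x \<in> S" for x
          using frechet_derivative_bounded_linear_comp[OF L smooth_on_differentiable[OF S f that]] by simp
      qed
      finally show ?thesis .
    qed
    show ?thesis unfolding 1
      by (rule second_derivative_symmetric_real[OF S smooth_on_Ck_on[OF smooth_on_bounded_linear_comp[OF L S f]] p])
  qed
  show ?thesis using comp[OF bounded_linear_Re] comp[OF bounded_linear_Im] complex_eqI by blast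
qed


section \<open>Complex derivations\<close>

text \<open>All first order operators below (the Wirtinger derivatives and their horizontal combinations)
  are, at a point, derivations on germs of complex functions. The rules for sums, products, inverse matrices
  and determinants are derived from this alone.\<close>

definition derivation_at :: "'a::real_normed_vector \<Rightarrow> (('a \<Rightarrow> complex) \<Rightarrow> complex) \<Rightarrow> bool" where
  "derivation_at p X \<longleftrightarrow>
     (\<forall>c. X (\<lambda>x. c) = 0) \<and>
     (\<forall>f g. f differentiable (at p) \<and> g differentiable (at p) \<longrightarrow>
        X (\<lambda>x. f x + g x) = X f + X g \<and> X (\<lambda>x. f x * g x) = X f * g p + f p * X g) \<and>
     (\<forall>f g S. f differentiable (at p) \<and> open S \<and> p \<in> S \<and> (\<forall>x\<in>S. f x = g x) \<longrightarrow> X f = X g)"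

lemma derivation_const: "derivation_at p X \<Longrightarrow> X (\<lambda>x. c) = 0"
  by (simp add: derivation_at_def)

lemma derivation_add:
  "derivation_at p X \<Longrightarrow> f differentiable (at p) \<Longrightarrow> g differentiable (at p) \<Longrightarrow>
    X (\<lambda>x. f x + g x) = X f + X g"
  by (simp add: derivation_at_def)

lemma derivation_mult:
  "derivation_at p X \<Longrightarrow> f differentiable (at p) \<Longrightarrow> g differentiable (at p) \<Longrightarrow>
    X (\<lambda>x. f x * g x) = X f * g p + f p * X g"
  by (simp add: derivation_at_def)

lemma derivation_cong:
  "derivation_at p X \<Longrightarrow> open S \<Longrightarrow> p \<in> S \<Longrightarrow> f differentiable (at p) \<Longrightarrow> (\<And>x. x \<in> S \<Longrightarrow> f x = g x) \<Longrightarrow> X f = X g"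
  unfolding derivation_at_def by blast

lemma derivation_cmult:
  "derivation_at p X \<Longrightarrow> f differentiable (at p) \<Longrightarrow> X (\<lambda>x. c * f x) = c * X f"
  using derivation_mult[of p X "\<lambda>x. c" f] derivation_const[of p X c] by simp

lemma derivation_minus:
  "derivation_at p X \<Longrightarrow> f differentiable (at p) \<Longrightarrow> X (\<lambda>x. - f x) = - X f"
  using derivation_cmult[of p X f "-1"] by simp

lemma derivation_diff:
  "derivation_at p X \<Longrightarrow> f differentiable (at p) \<Longrightarrow> g differentiable (at p) \<Longrightarrow>
    X (\<lambda>x. f x - g x) = X f - X g"
  using derivation_add[of p X f "\<lambda>x. - g x"] derivation_minus[of p X g] by (simp add: differentiable_minus)

lemma derivation_sum:
  "derivation_at p X \<Longrightarrow> finite I \<Longrightarrow> (\<And>i. i \<in> I \<Longrightarrow> f i differentiable (at p)) \<Longrightarrow>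
    X (\<lambda>x. \<Sum>i\<in>I. f i x) = (\<Sum>i\<in>I. X (f i))"
proof (induction I rule: infinite_finite_induct)
  case (insert i I)
  have "(\<lambda>x. \<Sum>i\<in>I. f i x) differentiable (at p)"
    using insert by (intro differentiable_sum) auto
  with insert show ?case using derivation_add[of p X "f i" "\<lambda>x. \<Sum>i\<in>I. f i x"] by simp
qed (simp_all add: derivation_const)

lemma differentiable_prod:
  fixes f :: "_ \<Rightarrow> _ \<Rightarrow> complex"
  shows "(\<And>i. i \<in> I \<Longrightarrow> f i differentiable (at p)) \<Longrightarrow> (\<lambda>x. \<Prod>i\<in>I. f i x) differentiable (at p)"
  by (induction I rule: infinite_finite_induct) (auto intro: differentiable_mult)

lemma derivation_prod:
  fixes f :: "_ \<Rightarrow> _ \<Rightarrow> complex"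
  shows "derivation_at p X \<Longrightarrow> finite I \<Longrightarrow> (\<And>i. i \<in> I \<Longrightarrow> f i differentiable (at p)) \<Longrightarrow>
    X (\<lambda>x. \<Prod>i\<in>I. f i x) = (\<Sum>j\<in>I. X (f j) * (\<Prod>i\<in>I-{j}. f i p))"
proof (induction I rule: infinite_finite_induct)
  case (insert i I)
  have d: "(\<lambda>x. \<Prod>i\<in>I. f i x) differentiable (at p)"
    using insert by (intro differentiable_prod) auto
  have "X (\<lambda>x. \<Prod>i\<in>insert i I. f i x) = X (f i) * (\<Prod>i\<in>I. f i p) + f i p * (\<Sum>j\<in>I. X (f j) * (\<Prod>i\<in>I-{j}. f i p))"
    using insert d derivation_mult[of p X "f i" "\<lambda>x. \<Prod>i\<in>I. f i x"] by simp
  also have "f i p * (\<Sum>j\<in>I. X (f j) * (\<Prod>i\<in>I-{j}. f i p)) = (\<Sum>j\<in>I. X (f j) * (\<Prod>i\<in>insert i I-{j}. f i p))"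
    unfolding sum_distrib_left
  proof (rule sum.cong[OF refl])
    fix j assume "j \<in> I"
    then have "insert i I - {j} = insert i (I - {j})" using insert by auto
    then show "f i p * (X (f j) * (\<Prod>i\<in>I-{j}. f i p)) = X (f j) * (\<Prod>i\<in>insert i I-{j}. f i p)"
      using insert by simp
  qed
  also have "(\<Prod>i\<in>I. f i p) = (\<Prod>i\<in>insert i I - {i}. f i p)" using insert by simp
  finally show ?case using insert by simp
qed (simp_all add: derivation_const)

lemma derivation_at_lincomb:
  fixes X :: "('a::real_normed_vector \<Rightarrow> complex) \<Rightarrow> complex"
  assumes "derivation_at p X" "\<And>a. derivation_at p (Y a)"
  shows "derivation_at p (\<lambda>f. X f - (\<Sum>a\<in>A. c a * Y a f))"
  unfolding derivation_at_def
proof (intro conjI allI impI; (elim conjE)?)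
  fix f g :: "'a \<Rightarrow> complex" assume d: "f differentiable (at p)" "g differentiable (at p)"
  show "X (\<lambda>x. f x + g x) - (\<Sum>a\<in>A. c a * Y a (\<lambda>x. f x + g x)) =
      (X f - (\<Sum>a\<in>A. c a * Y a f)) + (X g - (\<Sum>a\<in>A. c a * Y a g))"
    by (simp add: derivation_add[OF assms(1) d] derivation_add[OF assms(2) d] algebra_simps sum.distrib)
  show "X (\<lambda>x. f x * g x) - (\<Sum>a\<in>A. c a * Y a (\<lambda>x. f x * g x)) =
      (X f - (\<Sum>a\<in>A. c a * Y a f)) * g p + f p * (X g - (\<Sum>a\<in>A. c a * Y a g))"
    by (simp add: derivation_mult[OF assms(1) d] derivation_mult[OF assms(2) d] algebra_simps sum.distrib
        sum_distrib_left sum_distrib_right)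
next
  fix f g :: "'a \<Rightarrow> complex" and S assume "f differentiable (at p)" "open S" "p \<in> S" "\<forall>x\<in>S. f x = g x"
  then have "X f = X g" "\<And>a. Y a f = Y a g"
    using derivation_cong[OF assms(1), of S f g] derivation_cong[OF assms(2), of S f g] by auto
  then show "X f - (\<Sum>a\<in>A. c a * Y a f) = X g - (\<Sum>a\<in>A. c a * Y a g)" by simp
qed (simp add: derivation_const[OF assms(1)] derivation_const[OF assms(2)])


section \<open>Wirtinger derivatives\<close>

definition wirtinger :: "complex \<Rightarrow> 'a \<Rightarrow> 'a \<Rightarrow> ('a::real_normed_vector \<Rightarrow> complex) \<Rightarrow> 'a \<Rightarrow> complex" where
  "wirtinger s a b f p = (frechet_derivative f (at p) a + s * frechet_derivative f (at p) b) / 2"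

lemma derivation_at_wirtinger: "derivation_at p (\<lambda>f. wirtinger s a b f p)"
  unfolding derivation_at_def
proof (intro conjI allI impI; (elim conjE)?)
  fix f g :: "'a \<Rightarrow> complex" assume "f differentiable (at p)" "g differentiable (at p)"
  then have d: "(f has_derivative frechet_derivative f (at p)) (at p)" "(g has_derivative frechet_derivative g (at p)) (at p)"
    by (simp_all add: frechet_derivative_works)
  show "wirtinger s a b (\<lambda>x. f x + g x) p = wirtinger s a b f p + wirtinger s a b g p"
    unfolding wirtinger_def
    using frechet_derivative_at[OF has_derivative_add[OF d], symmetric]
    by (simp add: algebra_simps add_divide_distrib)
  show "wirtinger s a b (\<lambda>x. f x * g x) p = wirtinger s a b f p * g p + f p * wirtinger s a b g p"
    unfolding wirtinger_def
    using frechet_derivative_at[OF has_derivative_mult[OF d], symmetric]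
    by (simp add: algebra_simps add_divide_distrib)
next
  fix f g :: "'a \<Rightarrow> complex" and S assume "f differentiable (at p)" "open S" "p \<in> S" "\<forall>x\<in>S. f x = g x"
  then show "wirtinger s a b f p = wirtinger s a b g p"
    unfolding wirtinger_def
    using frechet_derivative_transform_within_open[of f p S g] by auto
qed (simp add: wirtinger_def)

lemma smooth_on_wirtinger:
  assumes "open S" "smooth_on S f" shows "smooth_on S (wirtinger s a b f)"
proof -
  have "smooth_on S (\<lambda>x. (1/2) * (frechet_derivative f (at x) a + s * frechet_derivative f (at x) b))"
    using assms by (intro smooth_on_mult smooth_on_add smooth_on_const smooth_on_frechet_derivative) auto
  then show ?thesis by (simp add: wirtinger_def[abs_def])
qed

lemma wirtinger_cnj:
  assumes "f differentiable (at p)"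
  shows "wirtinger s a b (\<lambda>x. cnj (f x)) p = cnj (wirtinger (cnj s) a b f p)"
  unfolding wirtinger_def
  using frechet_derivative_bounded_linear_comp[OF bounded_linear_cnj assms] by simp

lemma wirtinger_commute:
  assumes S: "open S" and f: "smooth_on S f" and p: "p \<in> S"
  shows "wirtinger s a b (wirtinger s' a' b' f) p = wirtinger s' a' b' (wirtinger s a b f) p"
proof -
  have fd: "frechet_derivative (wirtinger s a b f) (at p) h =
     (frechet_derivative (\<lambda>x. frechet_derivative f (at x) a) (at p) h
       + s * frechet_derivative (\<lambda>x. frechet_derivative f (at x) b) (at p) h) / 2" for s a b h
  proof -
    have d: "((\<lambda>x. frechet_derivative f (at x) k) has_derivative frechet_derivative (\<lambda>x. frechet_derivative f (at x) k) (at p)) (at p)" for k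
      by (rule smooth_on_has_derivative[OF S smooth_on_frechet_derivative[OF f] p])
    have "((\<lambda>x. (1/2) * (frechet_derivative f (at x) a + s * frechet_derivative f (at x) b)) has_derivative
       (\<lambda>h. (1/2) * (frechet_derivative (\<lambda>x. frechet_derivative f (at x) a) (at p) h
       + s * frechet_derivative (\<lambda>x. frechet_derivative f (at x) b) (at p) h))) (at p)"
      by (intro has_derivative_mult_right has_derivative_add d)
    from frechet_derivative_at[OF this] show ?thesis
      by (simp add: wirtinger_def[abs_def] fun_eq_iff)
  qed
  note sym = second_derivative_symmetric[OF S f p]
  show ?thesis
    unfolding wirtinger_def[of s a b "wirtinger s' a' b' f"] wirtinger_def[of s' a' b' "wirtinger s a b f"] fd
    using sym[of a a'] sym[of a b'] sym[of b a'] sym[of b b'] by (simp add: field_simps)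
qed

text \<open>A common type for \<open>\<partial>/\<partial>z\<close>, \<open>\<partial>/\<partial>v\<close> and their conjugates, whose regularity and commutation rules are the
  same.\<close>

definition wirtinger_op :: "(('a::real_normed_vector \<Rightarrow> complex) \<Rightarrow> 'a \<Rightarrow> complex) \<Rightarrow> bool" where
  "wirtinger_op P \<longleftrightarrow> (\<exists>s a b. P = wirtinger s a b)"

lemma D_z_wirtinger: "D_z \<mu> = wirtinger (- \<i>) (axis \<mu> 1, 0) (axis \<mu> \<i>, 0)"
  and D_zbar_wirtinger: "D_zbar \<mu> = wirtinger \<i> (axis \<mu> 1, 0) (axis \<mu> \<i>, 0)"
  and D_v_wirtinger: "D_v \<mu> = wirtinger (- \<i>) (0, axis \<mu> 1) (0, axis \<mu> \<i>)"
  and D_vbar_wirtinger: "D_vbar \<mu> = wirtinger \<i> (0, axis \<mu> 1) (0, axis \<mu> \<i>)"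
  by (simp_all add: fun_eq_iff D_z_def D_zbar_def D_v_def D_vbar_def wirtinger_def)

lemma wirtinger_op_D [simp]:
  "wirtinger_op (D_z \<mu>)" "wirtinger_op (D_zbar \<mu>)" "wirtinger_op (D_v \<mu>)" "wirtinger_op (D_vbar \<mu>)"
  unfolding wirtinger_op_def D_z_wirtinger D_zbar_wirtinger D_v_wirtinger D_vbar_wirtinger by blast+

lemma wirtinger_op_derivation: "wirtinger_op P \<Longrightarrow> derivation_at p (\<lambda>f. P f p)"
  by (auto simp: wirtinger_op_def derivation_at_wirtinger)

lemma derivation_D [simp]:
  "derivation_at p (\<lambda>f. D_z \<mu> f p)" "derivation_at p (\<lambda>f. D_zbar \<mu> f p)"
  "derivation_at p (\<lambda>f. D_v \<mu> f p)" "derivation_at p (\<lambda>f. D_vbar \<mu> f p)"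
  by (simp_all add: wirtinger_op_derivation)

lemma wirtinger_op_smooth_on: "wirtinger_op P \<Longrightarrow> open S \<Longrightarrow> smooth_on S f \<Longrightarrow> smooth_on S (P f)"
  by (auto simp: wirtinger_op_def smooth_on_wirtinger)

lemma wirtinger_op_commute:
  "wirtinger_op P \<Longrightarrow> wirtinger_op Q \<Longrightarrow> open S \<Longrightarrow> smooth_on S f \<Longrightarrow> p \<in> S \<Longrightarrow> P (Q f) p = Q (P f) p"
  unfolding wirtinger_op_def using wirtinger_commute by blast

lemma D_cnj:
  assumes "f differentiable (at p)"
  shows "D_z \<mu> (\<lambda>x. cnj (f x)) p = cnj (D_zbar \<mu> f p)"
    and "D_zbar \<mu> (\<lambda>x. cnj (f x)) p = cnj (D_z \<mu> f p)"
    and "D_v \<mu> (\<lambda>x. cnj (f x)) p = cnj (D_vbar \<mu> f p)"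
    and "D_vbar \<mu> (\<lambda>x. cnj (f x)) p = cnj (D_v \<mu> f p)"
  unfolding D_z_wirtinger D_zbar_wirtinger D_v_wirtinger D_vbar_wirtinger wirtinger_cnj[OF assms] by simp_all

lemma complex_vec_axis_expansion:
  fixes \<xi> :: "complex^'n::finite"
  shows "\<xi> = (\<Sum>k\<in>UNIV. Re (\<xi>$k) *\<^sub>R axis k 1 + Im (\<xi>$k) *\<^sub>R axis k \<i>)"
proof -
  have "(\<Sum>k\<in>UNIV. Re (\<xi>$k) *\<^sub>R axis k 1 + Im (\<xi>$k) *\<^sub>R axis k \<i>) $ j =
     (\<Sum>k\<in>UNIV. if k = j then Re (\<xi>$j) *\<^sub>R 1 + Im (\<xi>$j) *\<^sub>R \<i> else 0)" for j
    unfolding sum_component by (rule sum.cong) (auto simp: axis_def)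
  then show ?thesis by (simp add: vec_eq_iff complex_eq_iff)
qed

lemma frechet_derivative_wirtinger_expansion:
  fixes f :: "'n::finite cpair \<Rightarrow> complex"
  assumes "f differentiable (at p)"
  shows "frechet_derivative f (at p) (\<xi>, \<eta>) =
     (\<Sum>k\<in>UNIV. D_z k f p * \<xi>$k + D_zbar k f p * cnj (\<xi>$k)) +
     (\<Sum>k\<in>UNIV. D_v k f p * \<eta>$k + D_vbar k f p * cnj (\<eta>$k))"
proof -
  define L where "L = frechet_derivative f (at p)"
  have lin: "linear L" using assms unfolding L_def by (rule linear_frechet_derivative)
  have split: "Re x *\<^sub>R A + Im x *\<^sub>R B = (A - \<i> * B) / 2 * x + (A + \<i> * B) / 2 * cnj x" for A B x
    by (simp add: complex_eq_iff field_simps)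
  have "(\<xi>, \<eta>) = (\<Sum>k\<in>UNIV. Re (\<xi>$k) *\<^sub>R (axis k 1, 0) + Im (\<xi>$k) *\<^sub>R (axis k \<i>, 0))
     + (\<Sum>k\<in>UNIV. Re (\<eta>$k) *\<^sub>R (0, axis k 1) + Im (\<eta>$k) *\<^sub>R (0, axis k \<i>))"
  proof (rule prod_eqI)
    show "fst (\<xi>, \<eta>) = fst ((\<Sum>k\<in>UNIV. Re (\<xi>$k) *\<^sub>R (axis k 1, 0) + Im (\<xi>$k) *\<^sub>R (axis k \<i>, 0))
     + (\<Sum>k\<in>UNIV. Re (\<eta>$k) *\<^sub>R (0::complex^'n, axis k 1) + Im (\<eta>$k) *\<^sub>R (0, axis k \<i>)))"
      using complex_vec_axis_expansion[of \<xi>] by (simp add: fst_sum)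
    show "snd (\<xi>, \<eta>) = snd ((\<Sum>k\<in>UNIV. Re (\<xi>$k) *\<^sub>R (axis k 1, 0) + Im (\<xi>$k) *\<^sub>R (axis k \<i>, 0::complex^'n))
     + (\<Sum>k\<in>UNIV. Re (\<eta>$k) *\<^sub>R (0, axis k 1) + Im (\<eta>$k) *\<^sub>R (0, axis k \<i>)))"
      using complex_vec_axis_expansion[of \<eta>] by (simp add: snd_sum)
  qed
  then have "L (\<xi>, \<eta>) = (\<Sum>k\<in>UNIV. Re (\<xi>$k) *\<^sub>R L (axis k 1, 0) + Im (\<xi>$k) *\<^sub>R L (axis k \<i>, 0))
     + (\<Sum>k\<in>UNIV. Re (\<eta>$k) *\<^sub>R L (0, axis k 1) + Im (\<eta>$k) *\<^sub>R L (0, axis k \<i>))"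
    by (simp only: linear_add[OF lin] linear_sum[OF lin] linear_cmul[OF lin])
  then show ?thesis
    unfolding D_z_def D_zbar_def D_v_def D_vbar_def L_def[symmetric] split by simp
qed

text \<open>The hypothesis on \<open>L\<close> says that \<open>\<Phi>\<close> is holomorphic along the complex line spanned by \<open>a\<close>, with \<open>b\<close> in
  the role of \<open>\<i> a\<close>; this eliminates the mixed terms of the complex chain rule.\<close>

lemma wirtinger_chain:
  fixes f :: "'n::finite cpair \<Rightarrow> complex"
  assumes "f differentiable (at (\<Phi> p))" "(\<Phi> has_derivative L) (at p)"
    and "L a = (\<xi>, \<eta>)" "L b = (\<i> *s \<xi>, \<i> *s \<eta>)"
  shows "wirtinger (- \<i>) a b (\<lambda>x. f (\<Phi> x)) p = (\<Sum>k\<in>UNIV. D_z k f (\<Phi> p) * \<xi>$k) + (\<Sum>k\<in>UNIV. D_v k f (\<Phi> p) * \<eta>$k)"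
    and "wirtinger \<i> a b (\<lambda>x. f (\<Phi> x)) p = (\<Sum>k\<in>UNIV. D_zbar k f (\<Phi> p) * cnj (\<xi>$k)) + (\<Sum>k\<in>UNIV. D_vbar k f (\<Phi> p) * cnj (\<eta>$k))"
proof -
  have "((\<lambda>x. f (\<Phi> x)) has_derivative (\<lambda>h. frechet_derivative f (at (\<Phi> p)) (L h))) (at p)"
    by (rule has_derivative_compose[OF assms(2)]) (use assms(1) frechet_derivative_works in blast)
  then have fd: "frechet_derivative (\<lambda>x. f (\<Phi> x)) (at p) = (\<lambda>h. frechet_derivative f (at (\<Phi> p)) (L h))"
    by (rule frechet_derivative_at[symmetric])
  note ex = frechet_derivative_wirtinger_expansion[OF assms(1)]
  have 1: "(\<Sum>k\<in>UNIV. D_z k f (\<Phi> p) * (\<i> * \<xi>$k) + D_zbar k f (\<Phi> p) * cnj (\<i> * \<xi>$k)) =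
      \<i> * (\<Sum>k\<in>UNIV. D_z k f (\<Phi> p) * \<xi>$k) - \<i> * (\<Sum>k\<in>UNIV. D_zbar k f (\<Phi> p) * cnj (\<xi>$k))"
    by (simp add: sum_distrib_left sum.distrib sum_subtractf algebra_simps)
  have 2: "(\<Sum>k\<in>UNIV. D_v k f (\<Phi> p) * (\<i> * \<eta>$k) + D_vbar k f (\<Phi> p) * cnj (\<i> * \<eta>$k)) =
      \<i> * (\<Sum>k\<in>UNIV. D_v k f (\<Phi> p) * \<eta>$k) - \<i> * (\<Sum>k\<in>UNIV. D_vbar k f (\<Phi> p) * cnj (\<eta>$k))"
    by (simp add: sum_distrib_left sum.distrib sum_subtractf algebra_simps)
  have A: "frechet_derivative (\<lambda>x. f (\<Phi> x)) (at p) a =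
     (\<Sum>k\<in>UNIV. D_z k f (\<Phi> p) * \<xi>$k) + (\<Sum>k\<in>UNIV. D_zbar k f (\<Phi> p) * cnj (\<xi>$k))
    + ((\<Sum>k\<in>UNIV. D_v k f (\<Phi> p) * \<eta>$k) + (\<Sum>k\<in>UNIV. D_vbar k f (\<Phi> p) * cnj (\<eta>$k)))"
    unfolding fd assms(3) ex by (simp add: sum.distrib)
  have B: "frechet_derivative (\<lambda>x. f (\<Phi> x)) (at p) b =
     \<i> * (\<Sum>k\<in>UNIV. D_z k f (\<Phi> p) * \<xi>$k) - \<i> * (\<Sum>k\<in>UNIV. D_zbar k f (\<Phi> p) * cnj (\<xi>$k))
    + (\<i> * (\<Sum>k\<in>UNIV. D_v k f (\<Phi> p) * \<eta>$k) - \<i> * (\<Sum>k\<in>UNIV. D_vbar k f (\<Phi> p) * cnj (\<eta>$k)))"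
    unfolding fd assms(4) ex vector_smult_component 1 2 ..
  show "wirtinger (- \<i>) a b (\<lambda>x. f (\<Phi> x)) p = (\<Sum>k\<in>UNIV. D_z k f (\<Phi> p) * \<xi>$k) + (\<Sum>k\<in>UNIV. D_v k f (\<Phi> p) * \<eta>$k)"
    unfolding wirtinger_def A B by (simp add: algebra_simps add_divide_distrib diff_divide_distrib)
  show "wirtinger \<i> a b (\<lambda>x. f (\<Phi> x)) p = (\<Sum>k\<in>UNIV. D_zbar k f (\<Phi> p) * cnj (\<xi>$k)) + (\<Sum>k\<in>UNIV. D_vbar k f (\<Phi> p) * cnj (\<eta>$k))"
    unfolding wirtinger_def A B by (simp add: algebra_simps add_divide_distrib diff_divide_distrib)
qed


section \<open>Matrices\<close>

text \<open>Expanding the new row in terms of the rows of \<open>A\<close> leaves only the coefficient of the replaced row.\<close>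

lemma det_replace_row:
  fixes A N :: "complex^'n::finite^'n"
  assumes "N ** A = mat 1"
  shows "det (\<chi> i. if i = j then y else A $ i) = det A * (\<Sum>l\<in>UNIV. y $ l * N $ l $ j)"
proof -
  define c where "c = (\<chi> i. \<Sum>l\<in>UNIV. y $ l * N $ l $ i)"
  have NA: "(\<Sum>i\<in>UNIV. N $ l $ i * A $ i $ k) = of_bool (l = k)" for l k
    using arg_cong[OF assms, of "\<lambda>B. B $ l $ k"] by (simp add: matrix_matrix_mult_def mat_def)
  have "(\<Sum>i\<in>UNIV. c $ i *s row i A) $ k = y $ k" for k
  proof -
    have "(\<Sum>i\<in>UNIV. c $ i *s row i A) $ k = (\<Sum>i\<in>UNIV. \<Sum>l\<in>UNIV. y $ l * (N $ l $ i * A $ i $ k))"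
      by (simp add: c_def row_def sum_distrib_right mult.assoc)
    also have "\<dots> = (\<Sum>l\<in>UNIV. y $ l * (\<Sum>i\<in>UNIV. N $ l $ i * A $ i $ k))"
      unfolding sum_distrib_left by (rule sum.swap)
    finally show ?thesis by (simp add: NA if_distrib of_bool_def cong: if_cong)
  qed
  then have y: "y = (\<Sum>i\<in>UNIV. c $ i *s row i A)" by (simp add: vec_eq_iff)
  have "det (\<chi> i. if i = j then y else A $ i) = det (\<chi> i. if i = j then (\<Sum>i\<in>UNIV. c $ i *s row i A) else row i A)"
  proof -
    have "row i A = A $ i" for i by (simp add: row_def vec_eq_iff)
    then show ?thesis unfolding y by (simp cong: if_cong)
  qed
  then show ?thesis
    by (simp add: cramer_lemma_transpose c_def mult.commute)
qed

text \<open>Jacobi's formula: by the product rule, the derivative of a determinant is the sum of the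
  determinants in which one row is differentiated.\<close>

lemma derivation_det:
  fixes M :: "'a::real_normed_vector \<Rightarrow> complex^'n::finite^'n"
  assumes X: "derivation_at p X" and d: "\<And>i j. (\<lambda>x. M x $ i $ j) differentiable (at p)"
    and N: "N ** M p = mat 1"
  shows "X (\<lambda>x. det (M x)) = det (M p) * (\<Sum>i\<in>UNIV. \<Sum>j\<in>UNIV. N $ j $ i * X (\<lambda>x. M x $ i $ j))"
proof -
  let ?P = "{q. q permutes (UNIV::'n set)}"
  have dp: "(\<lambda>x. \<Prod>i\<in>UNIV. M x $ i $ q i) differentiable (at p)" for q
    by (intro differentiable_prod d)
  have "X (\<lambda>x. det (M x)) = (\<Sum>q\<in>?P. of_int (sign q) * X (\<lambda>x. \<Prod>i\<in>UNIV. M x $ i $ q i))"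
    unfolding det_def using dp
    by (subst derivation_sum[OF X]) (auto intro!: differentiable_mult sum.cong derivation_cmult[OF X])
  also have "\<dots> = (\<Sum>q\<in>?P. \<Sum>j\<in>UNIV. of_int (sign q) * (X (\<lambda>x. M x $ j $ q j) * (\<Prod>i\<in>UNIV-{j}. M p $ i $ q i)))"
    by (simp add: derivation_prod[OF X] d sum_distrib_left)
  also have "\<dots> = (\<Sum>j\<in>UNIV. \<Sum>q\<in>?P. of_int (sign q) * (X (\<lambda>x. M x $ j $ q j) * (\<Prod>i\<in>UNIV-{j}. M p $ i $ q i)))"
    by (rule sum.swap)
  also have "\<dots> = (\<Sum>j\<in>UNIV. det (\<chi> i. if i = j then (\<chi> k. X (\<lambda>x. M x $ j $ k)) else M p $ i))"
  proof (rule sum.cong[OF refl], unfold det_def, rule sum.cong[OF refl])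
    fix j q
    have "(\<Prod>i\<in>UNIV. (\<chi> i. if i = j then (\<chi> k. X (\<lambda>x. M x $ j $ k)) else M p $ i) $ i $ q i)
       = X (\<lambda>x. M x $ j $ q j) * (\<Prod>i\<in>UNIV-{j}. M p $ i $ q i)"
      by (subst prod.remove[of UNIV j]) (auto intro!: prod.cong)
    then show "of_int (sign q) * (X (\<lambda>x. M x $ j $ q j) * (\<Prod>i\<in>UNIV-{j}. M p $ i $ q i)) =
      of_int (sign q) * (\<Prod>i\<in>UNIV. (\<chi> i. if i = j then (\<chi> k. X (\<lambda>x. M x $ j $ k)) else M p $ i) $ i $ q i)"
      by simp
  qed
  also have "\<dots> = det (M p) * (\<Sum>i\<in>UNIV. \<Sum>j\<in>UNIV. N $ j $ i * X (\<lambda>x. M x $ i $ j))"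
    by (simp add: det_replace_row[OF N] sum_distrib_left mult_ac)
  finally show ?thesis .
qed

lemma matrix_inv_mult:
  fixes A :: "complex^'n::finite^'n"
  assumes "invertible A"
  shows "A ** matrix_inv A = mat 1" "matrix_inv A ** A = mat 1"
  using assms someI_ex[of "\<lambda>A'. A ** A' = mat 1 \<and> A' ** A = mat 1"] unfolding invertible_def matrix_inv_def by auto

lemma matrix_inv_eqI:
  fixes A :: "complex^'n::finite^'n"
  assumes "B ** A = mat 1" shows "matrix_inv A = B"
proof -
  have "invertible A" using assms matrix_left_right_inverse invertible_def by blast
  then have "B ** (A ** matrix_inv A) = B" by (simp add: matrix_inv_mult)
  then show ?thesis by (simp add: matrix_mul_assoc assms)
qed

text \<open>Cramer's rule expresses the inverse through determinants, hence through polynomials in the entries; this is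
  how smoothness passes to the inverse matrix.\<close>

lemma matrix_inv_cofactor:
  fixes A :: "complex^'n::finite^'n"
  assumes "invertible A"
  shows "matrix_inv A $ k $ l = det (\<chi> i j. if j = k then (if i = l then 1 else 0) else A $ i $ j) / det A"
proof -
  have "A *v (matrix_inv A *v axis l 1) = axis l 1"
    using matrix_inv_mult[OF assms] by (simp add: matrix_vector_mul_assoc)
  then have "matrix_inv A *v axis l 1 = (\<chi> k. det(\<chi> i j. if j=k then axis l 1 $ i else A$i$j) / det A)"
    using cramer[of A] assms invertible_det_nz by blast
  moreover have "(matrix_inv A *v axis l 1) $ k = matrix_inv A $ k $ l"
    by (simp add: matrix_vector_mult_def axis_def if_distrib cong: if_cong)
  ultimately have "matrix_inv A $ k $ l = det(\<chi> i j. if j=k then axis l 1 $ i else A$i$j) / det A" by simp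
  moreover have "axis l (1::complex) $ i = (if i = l then 1 else 0)" for i by (simp add: axis_def)
  ultimately show ?thesis by (simp only:)
qed

lemma smooth_on_det:
  fixes M :: "'a::real_normed_vector \<Rightarrow> complex^'n::finite^'n"
  assumes "open S" "\<And>i j. smooth_on S (\<lambda>x. M x $ i $ j)"
  shows "smooth_on S (\<lambda>x. det (M x))"
  unfolding det_def using assms
  by (intro smooth_on_sum smooth_on_mult smooth_on_const smooth_on_prod) auto

lemma smooth_on_matrix_inv:
  fixes M :: "'a::real_normed_vector \<Rightarrow> complex^'n::finite^'n"
  assumes S: "open S" and M: "\<And>i j. smooth_on S (\<lambda>x. M x $ i $ j)" and inv: "\<And>x. x \<in> S \<Longrightarrow> invertible (M x)"
  shows "smooth_on S (\<lambda>x. matrix_inv (M x) $ k $ l)"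
proof (rule smooth_on_cong[OF S])
  show "det (\<chi> i j. if j = k then (if i = l then 1 else 0) else M x $ i $ j) * inverse (det (M x)) = matrix_inv (M x) $ k $ l"
    if "x \<in> S" for x
    by (simp add: matrix_inv_cofactor inv that divide_inverse)
  have "smooth_on S (\<lambda>x. (\<chi> i j. if j = k then (if i = l then 1 else 0) else M x $ i $ j) $ i $ j)" for i j
    using M by (cases "j = k") simp_all
  then show "smooth_on S (\<lambda>x. det (\<chi> i j. if j = k then (if i = l then 1 else 0) else M x $ i $ j) * inverse (det (M x)))"
    using S inv invertible_det_nz by (intro smooth_on_mult smooth_on_inverse smooth_on_det M) auto
qed

lemma pos_def_invertible:
  fixes H :: "complex^'n::finite^'n"
  assumes "pos_def H" shows "invertible H"
proof -
  have "x = 0" if x: "transpose H *v x = 0" for x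
  proof (rule ccontr)
    assume "x \<noteq> 0"
    have "(\<Sum>\<alpha>\<in>UNIV. \<Sum>\<beta>\<in>UNIV. H $ \<alpha> $ \<beta> * x $ \<alpha> * cnj (x $ \<beta>))
       = (\<Sum>\<beta>\<in>UNIV. (\<Sum>\<alpha>\<in>UNIV. H $ \<alpha> $ \<beta> * x $ \<alpha>) * cnj (x $ \<beta>))"
      unfolding sum_distrib_right by (rule sum.swap)
    also have "\<dots> = (\<Sum>\<beta>\<in>UNIV. (transpose H *v x) $ \<beta> * cnj (x $ \<beta>))"
      by (simp add: matrix_vector_mult_def transpose_def)
    finally have "(\<Sum>\<alpha>\<in>UNIV. \<Sum>\<beta>\<in>UNIV. H $ \<alpha> $ \<beta> * x $ \<alpha> * cnj (x $ \<beta>)) = 0"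
      by (simp only: x zero_index mult_zero_left sum.neutral_const)
    moreover have "0 < Re (\<Sum>\<alpha>\<in>UNIV. \<Sum>\<beta>\<in>UNIV. H $ \<alpha> $ \<beta> * x $ \<alpha> * cnj (x $ \<beta>))"
      using assms \<open>x \<noteq> 0\<close> unfolding pos_def_def Let_def by blast
    ultimately show False by simp
  qed
  then have "invertible (transpose H)"
    using matrix_left_invertible_ker matrix_left_right_inverse invertible_def by metis
  then show ?thesis using invertible_det_nz det_transpose by metis
qed

text \<open>Cholesky factorization of a positive definite Hermitian kernel, by induction on the index set:
  splitting off one index replaces the kernel by its Schur complement.\<close>

lemma cholesky_factorization:
  fixes K :: "'i \<Rightarrow> 'i \<Rightarrow> complex"
  assumes "finite S" "\<And>i j. i \<in> S \<Longrightarrow> j \<in> S \<Longrightarrow> K j i = cnj (K i j)"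
    and "\<And>\<xi>. (\<exists>i\<in>S. \<xi> i \<noteq> 0) \<Longrightarrow> 0 < Re (\<Sum>i\<in>S. \<Sum>j\<in>S. K i j * \<xi> i * cnj (\<xi> j))"
  shows "\<exists>c::'i \<Rightarrow> 'i \<Rightarrow> complex. \<forall>i\<in>S. \<forall>j\<in>S. K i j = (\<Sum>s\<in>S. c s i * cnj (c s j))"
  using assms
proof (induction S arbitrary: K rule: finite_induct)
  case empty then show ?case by simp
next
  case (insert s S)
  define d where "d = Re (K s s)"
  have herm: "K j i = cnj (K i j)" if "i \<in> insert s S" "j \<in> insert s S" for i j
    using insert.prems(1) that by blast
  have Kss: "K s s = complex_of_real d"
    using herm[of s s] by (simp add: d_def complex_eq_iff)
  have dpos: "0 < d"
  proof -
    have "0 < Re (\<Sum>i\<in>insert s S. \<Sum>j\<in>insert s S. K i j * of_bool (i = s) * cnj (of_bool (j = s)))"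
      by (rule insert.prems(2)) auto
    also have "(\<Sum>i\<in>insert s S. \<Sum>j\<in>insert s S. K i j * of_bool (i = s) * cnj (of_bool (j = s)))
       = (\<Sum>i\<in>insert s S. if i = s then K s s else 0)"
    proof (rule sum.cong[OF refl])
      fix i
      have "(\<Sum>j\<in>insert s S. K i j * of_bool (i = s) * cnj (of_bool (j = s)))
         = (\<Sum>j\<in>insert s S. if j = s then K i s * of_bool (i = s) else 0)"
        by (intro sum.cong) auto
      also have "\<dots> = (if i = s then K s s else 0)"
        using insert.hyps by (subst sum.delta) auto
      finally show "(\<Sum>j\<in>insert s S. K i j * of_bool (i = s) * cnj (of_bool (j = s))) = (if i = s then K s s else 0)" .
    qed
    also have "\<dots> = K s s" using insert.hyps by (subst sum.delta) auto
    finally show ?thesis by (simp add: d_def)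
  qed
  define K' where "K' i j = K i j - K i s * K s j / complex_of_real d" for i j
  have "\<exists>c::'i \<Rightarrow> 'i \<Rightarrow> complex. \<forall>i\<in>S. \<forall>j\<in>S. K' i j = (\<Sum>s\<in>S. c s i * cnj (c s j))"
  proof (rule insert.IH)
    fix i j assume "i \<in> S" "j \<in> S"
    then have "K j i = cnj (K i j)" "K s i = cnj (K i s)" "K s j = cnj (K j s)" by (auto intro: herm)
    then show "K' j i = cnj (K' i j)" by (simp add: K'_def mult.commute)
  next
    fix \<xi> :: "'i \<Rightarrow> complex" assume ne: "\<exists>i\<in>S. \<xi> i \<noteq> 0"
    define a where "a = (\<Sum>i\<in>S. K i s * \<xi> i)"
    have ca: "(\<Sum>j\<in>S. K s j * cnj (\<xi> j)) = cnj a"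
      unfolding a_def cnj_sum
    proof (rule sum.cong[OF refl])
      fix j assume "j \<in> S"
      then have "K s j = cnj (K j s)" by (intro herm) auto
      then show "K s j * cnj (\<xi> j) = cnj (K j s * \<xi> j)" by simp
    qed
    define \<eta> where "\<eta> = \<xi>(s := - a / complex_of_real d)"
    have \<eta>: "\<eta> i = \<xi> i" if "i \<in> S" for i using that insert.hyps by (auto simp: \<eta>_def)
    have \<eta>s: "\<eta> s = - a / complex_of_real d" by (simp add: \<eta>_def)
    have "(\<Sum>i\<in>insert s S. \<Sum>j\<in>insert s S. K i j * \<eta> i * cnj (\<eta> j)) =
       K s s * \<eta> s * cnj (\<eta> s) + \<eta> s * (\<Sum>j\<in>S. K s j * cnj (\<xi> j)) + a * cnj (\<eta> s)
        + (\<Sum>i\<in>S. \<Sum>j\<in>S. K i j * \<xi> i * cnj (\<xi> j))"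
      using insert.hyps by (simp add: \<eta> sum.distrib a_def sum_distrib_left sum_distrib_right mult_ac)
    also have "\<dots> = (\<Sum>i\<in>S. \<Sum>j\<in>S. K i j * \<xi> i * cnj (\<xi> j)) - a * cnj a / complex_of_real d"
      using dpos by (simp add: ca Kss \<eta>s)
    also have "a * cnj a / complex_of_real d = (\<Sum>i\<in>S. \<Sum>j\<in>S. (K i s * K s j / complex_of_real d) * \<xi> i * cnj (\<xi> j))"
      unfolding ca[symmetric] unfolding a_def sum_product by (simp add: sum_divide_distrib mult_ac)
    also have "(\<Sum>i\<in>S. \<Sum>j\<in>S. K i j * \<xi> i * cnj (\<xi> j)) - \<dots> = (\<Sum>i\<in>S. \<Sum>j\<in>S. K' i j * \<xi> i * cnj (\<xi> j))"
      unfolding sum_subtractf[symmetric] K'_def by (simp add: left_diff_distrib)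
    finally have eq: "(\<Sum>i\<in>insert s S. \<Sum>j\<in>insert s S. K i j * \<eta> i * cnj (\<eta> j)) = (\<Sum>i\<in>S. \<Sum>j\<in>S. K' i j * \<xi> i * cnj (\<xi> j))" .
    have "0 < Re (\<Sum>i\<in>insert s S. \<Sum>j\<in>insert s S. K i j * \<eta> i * cnj (\<eta> j))"
      by (rule insert.prems(2)) (use ne \<eta> in auto)
    then show "0 < Re (\<Sum>i\<in>S. \<Sum>j\<in>S. K' i j * \<xi> i * cnj (\<xi> j))" by (simp only: eq)
  qed
  then obtain c :: "'i \<Rightarrow> 'i \<Rightarrow> complex" where c: "\<And>i j. i \<in> S \<Longrightarrow> j \<in> S \<Longrightarrow> K' i j = (\<Sum>s\<in>S. c s i * cnj (c s j))" by blast
  define c' where "c' t i = (if t = s then K i s / complex_of_real (sqrt d) else if i = s then 0 else c t i)" for t i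
  have sq: "complex_of_real (sqrt d) * complex_of_real (sqrt d) = complex_of_real d"
    using dpos by (simp flip: of_real_mult)
  have 1: "(\<Sum>t\<in>insert s S. c' t i * cnj (c' t j)) = K i s * cnj (K j s) / complex_of_real d
      + (\<Sum>t\<in>S. (if i = s then 0 else c t i) * cnj (if j = s then 0 else c t j))" for i j
  proof -
    have "(\<Sum>t\<in>S. c' t i * cnj (c' t j)) = (\<Sum>t\<in>S. (if i = s then 0 else c t i) * cnj (if j = s then 0 else c t j))"
      using insert.hyps by (intro sum.cong) (auto simp: c'_def)
    moreover have "c' s i * cnj (c' s j) = K i s * cnj (K j s) / complex_of_real d"
      by (simp add: c'_def sq)
    ultimately show ?thesis using insert.hyps by simp
  qed
  have "K i j = (\<Sum>t\<in>insert s S. c' t i * cnj (c' t j))" if ij: "i \<in> insert s S" "j \<in> insert s S" for i j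
  proof -
    have hj: "cnj (K j s) = K s j" using herm[of j s] ij by simp
    show ?thesis
    proof (cases "i = s \<or> j = s")
      case True
      then show ?thesis unfolding 1 hj using dpos Kss by auto
    next
      case False
      then have "K i j = K' i j + K i s * K s j / complex_of_real d" "i \<in> S" "j \<in> S" using ij by (auto simp: K'_def)
      then show ?thesis unfolding 1 hj using False c[of i j] by simp
    qed
  qed
  then show ?case by blast
qed


lemma sum_of_bool_eq [simp]:
  fixes f :: "'n::finite \<Rightarrow> complex"
  shows "(\<Sum>k\<in>UNIV. of_bool (k = a) * f k) = f a" "(\<Sum>k\<in>UNIV. of_bool (a = k) * f k) = f a"
    "(\<Sum>k\<in>UNIV. f k * of_bool (k = a)) = f a" "(\<Sum>k\<in>UNIV. f k * of_bool (a = k)) = f a"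
proof -
  show 1: "(\<Sum>k\<in>UNIV. of_bool (k = a) * f k) = f a"
    by (subst sum.remove[of UNIV a]) auto
  show 2: "(\<Sum>k\<in>UNIV. of_bool (a = k) * f k) = f a"
    using 1 by (simp add: eq_commute[of a])
  show "(\<Sum>k\<in>UNIV. f k * of_bool (k = a)) = f a" "(\<Sum>k\<in>UNIV. f k * of_bool (a = k)) = f a"
    using 1 2 by (simp_all add: mult.commute)
qed

lemma derivation_matrix_inv:
  fixes M N :: "'a::real_normed_vector \<Rightarrow> complex^'n::finite^'n"
  assumes X: "derivation_at p X" and S: "open S" "p \<in> S"
    and dM: "\<And>i j. (\<lambda>x. M x $ i $ j) differentiable (at p)"
    and dN: "\<And>i j. (\<lambda>x. N x $ i $ j) differentiable (at p)"
    and MN: "\<And>x. x \<in> S \<Longrightarrow> M x ** N x = mat 1"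
  shows "X (\<lambda>x. N x $ i $ j) = - (\<Sum>k\<in>UNIV. \<Sum>l\<in>UNIV. N p $ i $ k * X (\<lambda>x. M x $ k $ l) * N p $ l $ j)"
proof -
  have NM: "N p ** M p = mat 1" using MN[OF S(2)] matrix_left_right_inverse[of "M p"] by simp
  have zero: "(\<Sum>l\<in>UNIV. X (\<lambda>x. M x $ k $ l) * N p $ l $ j) + (\<Sum>l\<in>UNIV. M p $ k $ l * X (\<lambda>x. N x $ l $ j)) = 0" for k
  proof -
    have "0 = X (\<lambda>x. of_bool (k = j))" using derivation_const[OF X] by simp
    also have "\<dots> = X (\<lambda>x. \<Sum>l\<in>UNIV. M x $ k $ l * N x $ l $ j)"
    proof (rule derivation_cong[OF X S])
      show "of_bool (k = j) = (\<Sum>l\<in>UNIV. M x $ k $ l * N x $ l $ j)" if "x \<in> S" for x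
        using arg_cong[OF MN[OF that], of "\<lambda>B. B $ k $ j"] by (simp add: matrix_matrix_mult_def mat_def)
    qed simp
    also have "\<dots> = (\<Sum>l\<in>UNIV. X (\<lambda>x. M x $ k $ l) * N p $ l $ j + M p $ k $ l * X (\<lambda>x. N x $ l $ j))"
      using dM dN by (subst derivation_sum[OF X]) (auto intro!: differentiable_mult sum.cong derivation_mult[OF X])
    finally show ?thesis by (simp add: sum.distrib)
  qed
  have NM': "(\<Sum>k\<in>UNIV. N p $ i $ k * M p $ k $ l) = of_bool (i = l)" for l
    using arg_cong[OF NM, of "\<lambda>B. B $ i $ l"] by (simp add: matrix_matrix_mult_def mat_def)
  have "X (\<lambda>x. N x $ i $ j) = (\<Sum>l\<in>UNIV. (\<Sum>k\<in>UNIV. N p $ i $ k * M p $ k $ l) * X (\<lambda>x. N x $ l $ j))"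
    unfolding NM' by (simp add: of_bool_def if_distrib if_distribR cong: if_cong)
  also have "\<dots> = (\<Sum>k\<in>UNIV. N p $ i $ k * (\<Sum>l\<in>UNIV. M p $ k $ l * X (\<lambda>x. N x $ l $ j)))"
    unfolding sum_distrib_left sum_distrib_right by (subst sum.swap) (simp add: mult.assoc)
  also have "\<dots> = (\<Sum>k\<in>UNIV. N p $ i $ k * - (\<Sum>l\<in>UNIV. X (\<lambda>x. M x $ k $ l) * N p $ l $ j))"
  proof (intro sum.cong refl)
    fix k
    have "(\<Sum>l\<in>UNIV. M p $ k $ l * X (\<lambda>x. N x $ l $ j)) = - (\<Sum>l\<in>UNIV. X (\<lambda>x. M x $ k $ l) * N p $ l $ j)"
      unfolding eq_neg_iff_add_eq_0 using zero[of k] by (simp add: add.commute)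
    then show "N p $ i $ k * (\<Sum>l\<in>UNIV. M p $ k $ l * X (\<lambda>x. N x $ l $ j)) =
      N p $ i $ k * - (\<Sum>l\<in>UNIV. X (\<lambda>x. M x $ k $ l) * N p $ l $ j)" by (simp only:)
  qed
  finally show ?thesis by (simp add: sum_distrib_left sum_negf mult.assoc)
qed

lemma D_v_coordinate: "D_v \<alpha> (\<lambda>p::'n::finite cpair. snd p $ a) p = of_bool (\<alpha> = a)"
  and D_vbar_coordinate: "D_vbar \<alpha> (\<lambda>p::'n cpair. snd p $ a) p = 0"
  and D_z_v_coordinate: "D_z \<alpha> (\<lambda>p::'n cpair. snd p $ a) p = 0"
  and D_zbar_v_coordinate: "D_zbar \<alpha> (\<lambda>p::'n cpair. snd p $ a) p = 0"
proof -
  have "bounded_linear (\<lambda>p::'n cpair. snd p $ a)"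
    by (intro bounded_linear_compose[OF bounded_linear_vec_nth] bounded_linear_snd)
  then have "((\<lambda>p::'n cpair. snd p $ a) has_derivative (\<lambda>p. snd p $ a)) (at p)"
    by (rule bounded_linear_imp_has_derivative)
  from frechet_derivative_at[OF this, symmetric]
  have fd: "frechet_derivative (\<lambda>p::'n cpair. snd p $ a) (at p) = (\<lambda>p. snd p $ a)" .
  show "D_v \<alpha> (\<lambda>p::'n cpair. snd p $ a) p = of_bool (\<alpha> = a)" "D_vbar \<alpha> (\<lambda>p::'n cpair. snd p $ a) p = 0"
    "D_z \<alpha> (\<lambda>p::'n cpair. snd p $ a) p = 0" "D_zbar \<alpha> (\<lambda>p::'n cpair. snd p $ a) p = 0"
    unfolding D_v_def D_vbar_def D_z_def D_zbar_def fd by (auto simp: axis_def)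
qed

lemma smooth_on_v_coordinate: "open S \<Longrightarrow> smooth_on S (\<lambda>p::'n::finite cpair. snd p $ a)"
  by (intro smooth_on_bounded_linear bounded_linear_compose[OF bounded_linear_vec_nth] bounded_linear_snd)


section \<open>A Finsler metric in one chart\<close>

text \<open>The expression \<open>g\<close> of \<open>G = F\<^sup>2\<close> in a chart, on an open set \<open>S\<close> of pairs \<open>(z, v)\<close> with \<open>v \<noteq> 0\<close> that is
  stable under multiplication of \<open>v\<close> by nonzero scalars. Below, \<open>M \<alpha> \<beta>\<close> is \<open>G\<^sub>\<alpha>\<^sub>\<beta>\<close> with \<open>\<beta>\<close> barred, and \<open>N \<beta> \<alpha>\<close> is
  its inverse.\<close>

locale finsler_chart =
  fixes S :: "'n::finite cpair set" and g :: "'n cpair \<Rightarrow> real"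
  assumes open_S: "open S"
    and smooth_g: "smooth_on S g"
    and g_pos: "p \<in> S \<Longrightarrow> 0 < g p"
    and cone: "(z, v) \<in> S \<Longrightarrow> \<zeta> \<noteq> 0 \<Longrightarrow> (z, \<zeta> *s v) \<in> S"
    and g_homogeneous: "(z, v) \<in> S \<Longrightarrow> \<zeta> \<noteq> 0 \<Longrightarrow> g (z, \<zeta> *s v) = (cmod \<zeta>)\<^sup>2 * g (z, v)"
    and pseudoconvex: "p \<in> S \<Longrightarrow> pos_def (G_mat g p)"
begin

abbreviation G where "G \<equiv> (\<lambda>q. complex_of_real (g q))"
abbreviation M where "M \<equiv> (\<lambda>\<alpha> \<beta> p. G_mat g p $ \<alpha> $ \<beta>)"
abbreviation N where "N \<equiv> (\<lambda>\<beta> \<alpha> p. G_inv g p $ \<beta> $ \<alpha>)"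

lemma smooth_G: "smooth_on S G"
  by (rule smooth_on_bounded_linear_comp[OF bounded_linear_of_real open_S smooth_g])

lemma G_nonzero: "p \<in> S \<Longrightarrow> G p \<noteq> 0"
  using g_pos by fastforce

lemmas smooth_D =
  wirtinger_op_smooth_on[OF wirtinger_op_D(1) open_S] wirtinger_op_smooth_on[OF wirtinger_op_D(2) open_S]
  wirtinger_op_smooth_on[OF wirtinger_op_D(3) open_S] wirtinger_op_smooth_on[OF wirtinger_op_D(4) open_S]
lemmas D_commute = wirtinger_op_commute[OF _ _ open_S]
lemmas diffble = smooth_on_differentiable[OF open_S]

lemma M_eq: "M \<alpha> \<beta> = D_v \<alpha> (D_vbar \<beta> G)"
  by (simp add: G_mat_def fun_eq_iff)

lemma M_at: "M \<alpha> \<beta> p = D_v \<alpha> (D_vbar \<beta> G) p"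
  by (simp add: G_mat_def)

lemma smooth_M: "smooth_on S (M \<alpha> \<beta>)"
  unfolding M_eq by (intro smooth_D smooth_G)

lemma invertible_M: "p \<in> S \<Longrightarrow> invertible (G_mat g p)"
  by (rule pos_def_invertible[OF pseudoconvex])

lemma smooth_N: "smooth_on S (N \<beta> \<alpha>)"
  unfolding G_inv_def by (rule smooth_on_matrix_inv[OF open_S smooth_M invertible_M])

lemma smooth_Gam1: "smooth_on S (Gam1 g \<alpha> \<mu>)"
  unfolding Gam1_def[abs_def]
  by (intro smooth_on_sum smooth_on_mult smooth_N open_S smooth_D smooth_G)

lemma smooth_del: "smooth_on S f \<Longrightarrow> smooth_on S (del g \<mu> f)"
  unfolding del_def[abs_def]
  by (intro smooth_on_diff smooth_on_sum smooth_on_mult smooth_Gam1 open_S smooth_D)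

lemma smooth_delbar: "smooth_on S f \<Longrightarrow> smooth_on S (delbar g \<mu> f)"
  unfolding delbar_def[abs_def]
  by (intro smooth_on_diff smooth_on_sum smooth_on_mult smooth_on_cnj smooth_Gam1 open_S smooth_D)

lemma smooth_Gam2: "smooth_on S (Gam2 g \<alpha> \<beta> \<mu>)"
  unfolding Gam2_def[abs_def]
  by (intro smooth_on_sum smooth_on_mult smooth_N open_S smooth_del smooth_M)

lemma derivation_del: "derivation_at p (\<lambda>f. del g \<mu> f p)"
  unfolding del_def by (intro derivation_at_lincomb) simp_all

lemma derivation_delbar: "derivation_at p (\<lambda>f. delbar g \<mu> f p)"
  unfolding delbar_def by (intro derivation_at_lincomb) simp_all

lemma delbar_cnj: "f differentiable (at p) \<Longrightarrow> delbar g \<mu> (\<lambda>x. cnj (f x)) p = cnj (del g \<mu> f p)"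
  by (simp add: del_def delbar_def D_cnj)

lemma MN: "p \<in> S \<Longrightarrow> G_mat g p ** G_inv g p = mat 1" and NM: "p \<in> S \<Longrightarrow> G_inv g p ** G_mat g p = mat 1"
  unfolding G_inv_def by (rule matrix_inv_mult[OF invertible_M]; simp)+

lemma MN_sum: "p \<in> S \<Longrightarrow> (\<Sum>l\<in>UNIV. M \<alpha> l p * N l \<beta> p) = of_bool (\<alpha> = \<beta>)"
  using arg_cong[OF MN, of p "\<lambda>B. B $ \<alpha> $ \<beta>"] by (simp add: matrix_matrix_mult_def mat_def)

lemma NM_sum: "p \<in> S \<Longrightarrow> (\<Sum>k\<in>UNIV. N \<beta> k p * M k l p) = of_bool (\<beta> = l)"
  using arg_cong[OF NM, of p "\<lambda>B. B $ \<beta> $ l"] by (simp add: matrix_matrix_mult_def mat_def)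

lemma M_hermitian: "p \<in> S \<Longrightarrow> M \<beta> \<alpha> p = cnj (M \<alpha> \<beta> p)"
proof -
  assume p: "p \<in> S"
  have "cnj (M \<alpha> \<beta> p) = D_vbar \<alpha> (\<lambda>x. cnj (D_vbar \<beta> G x)) p"
    unfolding M_at by (rule D_cnj(4)[symmetric]) (intro diffble[OF _ p] smooth_D smooth_G)
  also have "\<dots> = D_vbar \<alpha> (D_v \<beta> G) p"
  proof (rule derivation_cong[OF derivation_D(4) open_S p])
    show "(\<lambda>x. cnj (D_vbar \<beta> G x)) differentiable at p"
      by (intro diffble[OF _ p] smooth_on_cnj open_S smooth_D smooth_G)
    show "cnj (D_vbar \<beta> G x) = D_v \<beta> G x" if "x \<in> S" for x
      using D_cnj(3)[OF diffble[OF smooth_G that], of \<beta>] by simp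
  qed
  also have "\<dots> = M \<beta> \<alpha> p"
    unfolding M_at by (rule D_commute) (simp_all add: smooth_G p)
  finally show ?thesis by simp
qed

lemma N_hermitian: "p \<in> S \<Longrightarrow> N \<beta> \<alpha> p = cnj (N \<alpha> \<beta> p)"
proof -
  assume p: "p \<in> S"
  define B where "B = (\<chi> i j. cnj (N j i p))"
  have "(B ** G_mat g p) $ i $ j = mat 1 $ i $ j" for i j
  proof -
    have "(B ** G_mat g p) $ i $ j = (\<Sum>k\<in>UNIV. cnj (M j k p * N k i p))"
      unfolding matrix_matrix_mult_def using M_hermitian[OF p, of _ j] by (simp add: B_def mult.commute)
    also have "\<dots> = cnj (\<Sum>k\<in>UNIV. M j k p * N k i p)" by simp
    finally show ?thesis by (simp add: MN_sum[OF p] mat_def)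
  qed
  then have "B ** G_mat g p = mat 1" by (simp add: vec_eq_iff)
  then have "G_inv g p = B" unfolding G_inv_def by (rule matrix_inv_eqI)
  then have "G_inv g p $ \<beta> $ \<alpha> = B $ \<beta> $ \<alpha>" by simp
  then show ?thesis by (simp only: B_def vec_lambda_beta)
qed

lemma derivation_N:
  assumes "derivation_at p X" "p \<in> S"
  shows "X (N i j) = - (\<Sum>k\<in>UNIV. \<Sum>l\<in>UNIV. N i k p * X (M k l) * N l j p)"
  by (rule derivation_matrix_inv[OF assms(1) open_S assms(2) _ _ MN]) (intro diffble[OF _ assms(2)] smooth_M smooth_N)+


subsection \<open>Euler relations\<close>

definition euler :: "('n cpair \<Rightarrow> complex) \<Rightarrow> 'n cpair \<Rightarrow> complex" where
  "euler f p = (\<Sum>\<alpha>\<in>UNIV. snd p $ \<alpha> * D_v \<alpha> f p)"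

lemma derivation_euler: "derivation_at p (\<lambda>f. euler f p)"
  using derivation_at_lincomb[of p "\<lambda>f. 0" "\<lambda>\<alpha> f. D_v \<alpha> f p" "\<lambda>\<alpha>. - snd p $ \<alpha>" UNIV]
  by (simp add: euler_def sum_negf) (simp add: derivation_at_def)

lemma smooth_euler: "smooth_on S f \<Longrightarrow> smooth_on S (euler f)"
  unfolding euler_def[abs_def]
  by (intro smooth_on_sum smooth_on_mult smooth_on_v_coordinate open_S smooth_D)

text \<open>The chain rule for \<open>\<zeta> \<mapsto> f (z, \<zeta> v)\<close> at \<open>\<zeta> = 1\<close>; only the holomorphic degree \<open>k\<close> is seen by \<open>\<partial>/\<partial>\<zeta>\<close>.\<close>

lemma euler_homogeneous:
  assumes f: "f differentiable (at p)" and p: "p \<in> S"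
    and hom: "\<And>\<zeta>. \<zeta> \<noteq> 0 \<Longrightarrow> f (fst p, \<zeta> *s snd p) = \<zeta> ^ k * cnj \<zeta> ^ l * f p"
  shows "euler f p = of_nat k * f p"
proof -
  obtain z v where pz: "p = (z, v)" by force
  have L: "((\<lambda>\<zeta>. (z, \<zeta> *s v)) has_derivative (\<lambda>h. (0, h *s v))) (at 1)"
    by (intro has_derivative_Pair bounded_linear_imp_has_derivative has_derivative_const
      linear_conv_bounded_linear[THEN iffD1] linearI) (auto simp: vec_eq_iff algebra_simps)
  have "((\<lambda>\<zeta>. f (z, \<zeta> *s v)) has_derivative (\<lambda>h. frechet_derivative f (at p) (0, h *s v))) (at 1)"
    by (rule has_derivative_compose[OF L]) (use f pz frechet_derivative_works in auto)
  moreover have "((\<lambda>\<zeta>. \<zeta> ^ k * cnj \<zeta> ^ l * f p) has_derivative (\<lambda>h. (of_nat k * h + of_nat l * cnj h) * f p)) (at 1)"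
    by (auto intro!: derivative_eq_intros bounded_linear.has_derivative[OF bounded_linear_cnj] simp: fun_eq_iff algebra_simps)
  then have "((\<lambda>\<zeta>. f (z, \<zeta> *s v)) has_derivative (\<lambda>h. (of_nat k * h + of_nat l * cnj h) * f p)) (at 1)"
    by (rule has_derivative_transform_within_open[of _ _ _ _ "- {0}"]) (use hom pz in auto)
  ultimately have eq: "(\<lambda>h. frechet_derivative f (at p) (0, h *s v)) = (\<lambda>h. (of_nat k * h + of_nat l * cnj h) * f p)"
    by (rule has_derivative_unique)
  have ex: "frechet_derivative f (at p) (0, h *s v) = h * euler f p + cnj h * (\<Sum>\<alpha>\<in>UNIV. D_vbar \<alpha> f p * cnj (v $ \<alpha>))" for h
    unfolding frechet_derivative_wirtinger_expansion[OF f] euler_def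
    by (simp add: pz sum.distrib sum_distrib_left algebra_simps)
  have "euler f p + (\<Sum>\<alpha>\<in>UNIV. D_vbar \<alpha> f p * cnj (v $ \<alpha>)) = (of_nat k + of_nat l) * f p"
    using fun_cong[OF eq, of 1] unfolding ex by simp
  moreover have "\<i> * euler f p - \<i> * (\<Sum>\<alpha>\<in>UNIV. D_vbar \<alpha> f p * cnj (v $ \<alpha>)) = \<i> * (of_nat k - of_nat l) * f p"
    using fun_cong[OF eq, of \<i>] unfolding ex by (simp add: algebra_simps)
  then have "\<i> * (euler f p - (\<Sum>\<alpha>\<in>UNIV. D_vbar \<alpha> f p * cnj (v $ \<alpha>))) = \<i> * ((of_nat k - of_nat l) * f p)"
    by (simp add: algebra_simps)
  then have "euler f p - (\<Sum>\<alpha>\<in>UNIV. D_vbar \<alpha> f p * cnj (v $ \<alpha>)) = (of_nat k - of_nat l) * f p"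
    by simp
  ultimately have "2 * euler f p = 2 * (of_nat k * f p)" by algebra
  then show ?thesis by simp
qed

lemma euler_D_commute:
  assumes f: "smooth_on S f" and p: "p \<in> S" and P: "wirtinger_op P"
  shows "P (euler f) p = euler (P f) p + (\<Sum>\<alpha>\<in>UNIV. P (\<lambda>p. snd p $ \<alpha>) p * D_v \<alpha> f p)"
proof -
  have "P (euler f) p = (\<Sum>\<alpha>\<in>UNIV. P (\<lambda>x. snd x $ \<alpha> * D_v \<alpha> f x) p)"
    unfolding euler_def[abs_def]
    by (rule derivation_sum[OF wirtinger_op_derivation[OF P]])
      (auto intro!: diffble[OF _ p] smooth_on_mult smooth_D f open_S smooth_on_v_coordinate)
  also have "\<dots> = (\<Sum>\<alpha>\<in>UNIV. P (\<lambda>x. snd x $ \<alpha>) p * D_v \<alpha> f p + snd p $ \<alpha> * P (D_v \<alpha> f) p)"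
    by (intro sum.cong refl derivation_mult[OF wirtinger_op_derivation[OF P]] diffble[OF _ p] smooth_D f smooth_on_v_coordinate open_S)
  finally show ?thesis using D_commute[OF P _ f p, of "D_v _"] by (simp add: euler_def sum.distrib)
qed

lemma euler_eigen_D:
  assumes f: "smooth_on S f" and p: "p \<in> S" and eig: "\<And>x. x \<in> S \<Longrightarrow> euler f x = c * f x"
  shows "euler (D_vbar \<beta> f) p = c * D_vbar \<beta> f p" "euler (D_z \<beta> f) p = c * D_z \<beta> f p"
    "euler (D_v \<beta> f) p = (c - 1) * D_v \<beta> f p"
proof -
  have *: "P (euler f) p = c * P f p" if P: "wirtinger_op P" for P
    using derivation_cong[OF wirtinger_op_derivation[OF P] open_S p _ eig, of "\<lambda>x. x"] 
      derivation_cmult[OF wirtinger_op_derivation[OF P] diffble[OF f p], of c]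
      diffble[OF smooth_euler[OF f] p] by simp
  show "euler (D_vbar \<beta> f) p = c * D_vbar \<beta> f p" "euler (D_z \<beta> f) p = c * D_z \<beta> f p"
    using *[of "D_vbar \<beta>"] *[of "D_z \<beta>"] euler_D_commute[OF f p, of "D_vbar \<beta>"] euler_D_commute[OF f p, of "D_z \<beta>"]
    by (simp_all add: D_vbar_coordinate D_z_v_coordinate)
  have "c * D_v \<beta> f p = euler (D_v \<beta> f) p + (\<Sum>\<alpha>\<in>UNIV. of_bool (\<beta> = \<alpha>) * D_v \<alpha> f p)"
    using *[of "D_v \<beta>"] euler_D_commute[OF f p, of "D_v \<beta>"] by (simp add: D_v_coordinate)
  also have "(\<Sum>\<alpha>\<in>UNIV. of_bool (\<beta> = \<alpha>) * D_v \<alpha> f p) = D_v \<beta> f p"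
    by (rule sum_of_bool_eq)
  finally show "euler (D_v \<beta> f) p = (c - 1) * D_v \<beta> f p"
    by (simp add: algebra_simps)
qed

lemma euler_G: "p \<in> S \<Longrightarrow> euler G p = G p"
proof -
  assume p: "p \<in> S"
  have "euler G p = of_nat 1 * G p"
  proof (rule euler_homogeneous[OF diffble[OF smooth_G p] p, of 1 1])
    fix \<zeta> :: complex assume "\<zeta> \<noteq> 0"
    then show "G (fst p, \<zeta> *s snd p) = \<zeta> ^ 1 * cnj \<zeta> ^ 1 * G p"
      using g_homogeneous[of "fst p" "snd p" \<zeta>] p complex_norm_square[of \<zeta>] by simp
  qed
  then show ?thesis by simp
qed

lemma euler_D_vbar_G: "p \<in> S \<Longrightarrow> euler (D_vbar \<beta> G) p = D_vbar \<beta> G p"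
  using euler_eigen_D(1)[OF smooth_G, of p 1 \<beta>] euler_G by simp

lemma euler_D_vbar_D_z_G: "p \<in> S \<Longrightarrow> euler (D_vbar \<beta> (D_z \<mu> G)) p = D_vbar \<beta> (D_z \<mu> G) p"
  using euler_eigen_D(1)[of "D_z \<mu> G" p 1 \<beta>] euler_eigen_D(2)[OF smooth_G, of _ 1 \<mu>] euler_G smooth_D(1)[of G \<mu>]
  by (simp add: smooth_G)

lemma euler_M: "p \<in> S \<Longrightarrow> euler (M \<alpha> \<beta>) p = 0"
  using euler_eigen_D(3)[of "D_vbar \<beta> G" p 1 \<alpha>] euler_D_vbar_G smooth_D(4)[of G \<beta>]
  by (simp add: M_eq smooth_G)

lemma euler_N: "p \<in> S \<Longrightarrow> euler (N \<beta> \<alpha>) p = 0"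
  using derivation_N[OF derivation_euler] by (simp add: euler_M)

lemma euler_Gam1: "p \<in> S \<Longrightarrow> euler (Gam1 g \<alpha> \<mu>) p = Gam1 g \<alpha> \<mu> p"
proof -
  assume p: "p \<in> S"
  have "euler (Gam1 g \<alpha> \<mu>) p = (\<Sum>l\<in>UNIV. euler (\<lambda>p. N l \<alpha> p * D_vbar l (D_z \<mu> G) p) p)"
    unfolding Gam1_def[abs_def]
    by (rule derivation_sum[OF derivation_euler])
      (auto intro!: diffble[OF _ p] smooth_on_mult smooth_N smooth_D smooth_G open_S)
  also have "\<dots> = (\<Sum>l\<in>UNIV. N l \<alpha> p * D_vbar l (D_z \<mu> G) p)"
  proof (rule sum.cong[OF refl])
    fix l
    have "euler (\<lambda>p. N l \<alpha> p * D_vbar l (D_z \<mu> G) p) p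
       = euler (N l \<alpha>) p * D_vbar l (D_z \<mu> G) p + N l \<alpha> p * euler (D_vbar l (D_z \<mu> G)) p"
      by (rule derivation_mult[OF derivation_euler]) (auto intro!: diffble[OF _ p] smooth_N smooth_D smooth_G)
    then show "euler (\<lambda>p. N l \<alpha> p * D_vbar l (D_z \<mu> G) p) p = N l \<alpha> p * D_vbar l (D_z \<mu> G) p"
      by (simp add: euler_N[OF p] euler_D_vbar_D_z_G[OF p])
  qed
  finally show ?thesis by (simp add: Gam1_def)
qed

lemma M_v: "p \<in> S \<Longrightarrow> (\<Sum>\<alpha>\<in>UNIV. snd p $ \<alpha> * M \<alpha> \<beta> p) = D_vbar \<beta> G p"
  using euler_D_vbar_G[of p \<beta>] by (simp add: euler_def M_at)

lemma D_v_G_cnj: "p \<in> S \<Longrightarrow> D_vbar \<beta> G p = cnj (D_v \<beta> G p)"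
  using D_cnj(4)[OF diffble[OF smooth_G], of p \<beta>] by simp

lemma M_vbar: "p \<in> S \<Longrightarrow> (\<Sum>\<beta>\<in>UNIV. M \<alpha> \<beta> p * cnj (snd p $ \<beta>)) = D_v \<alpha> G p"
proof -
  assume p: "p \<in> S"
  have "(\<Sum>\<beta>\<in>UNIV. M \<alpha> \<beta> p * cnj (snd p $ \<beta>)) = cnj (\<Sum>\<beta>\<in>UNIV. snd p $ \<beta> * M \<beta> \<alpha> p)"
    unfolding cnj_sum by (intro sum.cong refl) (simp add: M_hermitian[OF p, symmetric] mult.commute)
  then show ?thesis by (simp add: M_v[OF p] D_v_G_cnj[OF p])
qed

end


lemma sum_swap3:
  fixes f :: "_ \<Rightarrow> _ \<Rightarrow> _ \<Rightarrow> 'b::comm_monoid_add"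
  shows "(\<Sum>l\<in>A. \<Sum>k\<in>B. \<Sum>j\<in>C. f l k j) = (\<Sum>j\<in>C. \<Sum>k\<in>B. \<Sum>l\<in>A. f l k j)"
proof -
  have "(\<Sum>l\<in>A. \<Sum>k\<in>B. \<Sum>j\<in>C. f l k j) = (\<Sum>l\<in>A. \<Sum>j\<in>C. \<Sum>k\<in>B. f l k j)"
    by (intro sum.cong refl sum.swap)
  also have "\<dots> = (\<Sum>j\<in>C. \<Sum>l\<in>A. \<Sum>k\<in>B. f l k j)" by (rule sum.swap)
  also have "\<dots> = (\<Sum>j\<in>C. \<Sum>k\<in>B. \<Sum>l\<in>A. f l k j)" by (intro sum.cong refl sum.swap)
  finally show ?thesis .
qed

lemma sum_swap4:
  fixes f :: "_ \<Rightarrow> _ \<Rightarrow> _ \<Rightarrow> _ \<Rightarrow> 'b::comm_monoid_add"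
  shows "(\<Sum>a\<in>A. \<Sum>b\<in>B. \<Sum>c\<in>C. \<Sum>d\<in>D. f a b c d) = (\<Sum>c\<in>C. \<Sum>d\<in>D. \<Sum>a\<in>A. \<Sum>b\<in>B. f a b c d)"
proof -
  have "(\<Sum>a\<in>A. \<Sum>b\<in>B. \<Sum>c\<in>C. \<Sum>d\<in>D. f a b c d) = (\<Sum>a\<in>A. \<Sum>c\<in>C. \<Sum>d\<in>D. \<Sum>b\<in>B. f a b c d)"
    by (intro sum.cong refl) (subst sum.swap, intro sum.cong refl sum.swap)
  also have "\<dots> = (\<Sum>c\<in>C. \<Sum>d\<in>D. \<Sum>a\<in>A. \<Sum>b\<in>B. f a b c d)"
    by (subst sum.swap, intro sum.cong refl sum.swap)
  finally show ?thesis .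
qed

lemma contract_factorization_right:
  fixes n :: "'n::finite \<Rightarrow> 'n \<Rightarrow> complex" and f h :: "'z \<Rightarrow> 'n \<Rightarrow> complex"
  assumes c: "\<And>i j. n i j = (\<Sum>s\<in>UNIV. c s i * cnj (c s j))"
  shows "(\<Sum>\<nu>\<in>UNIV. \<Sum>\<mu>\<in>UNIV. n \<nu> \<mu> * (\<Sum>i\<in>I. f i \<mu> * cnj (h i \<nu>)))
     = (\<Sum>i\<in>I. \<Sum>s\<in>UNIV. (\<Sum>\<mu>\<in>UNIV. cnj (c s \<mu>) * f i \<mu>) * cnj (\<Sum>\<nu>\<in>UNIV. cnj (c s \<nu>) * h i \<nu>))"
proof -
  have "(\<Sum>\<nu>\<in>UNIV. \<Sum>\<mu>\<in>UNIV. n \<nu> \<mu> * (\<Sum>i\<in>I. f i \<mu> * cnj (h i \<nu>)))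
    = (\<Sum>\<nu>\<in>UNIV. \<Sum>\<mu>\<in>UNIV. \<Sum>i\<in>I. \<Sum>s\<in>UNIV. (cnj (c s \<mu>) * f i \<mu>) * cnj (cnj (c s \<nu>) * h i \<nu>))"
    unfolding c sum_product by (subst sum.swap[of _ I]) (simp add: mult_ac)
  also have "\<dots> = (\<Sum>i\<in>I. \<Sum>s\<in>UNIV. \<Sum>\<nu>\<in>UNIV. \<Sum>\<mu>\<in>UNIV. (cnj (c s \<mu>) * f i \<mu>) * cnj (cnj (c s \<nu>) * h i \<nu>))"
    by (rule sum_swap4)
  also have "\<dots> = (\<Sum>i\<in>I. \<Sum>s\<in>UNIV. (\<Sum>\<mu>\<in>UNIV. cnj (c s \<mu>) * f i \<mu>) * cnj (\<Sum>\<nu>\<in>UNIV. cnj (c s \<nu>) * h i \<nu>))"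
    unfolding cnj_sum sum_product by (intro sum.cong refl sum.swap)
  finally show ?thesis .
qed

lemma contract_factorization_left:
  fixes n :: "'n::finite \<Rightarrow> 'n \<Rightarrow> complex" and f h :: "'n \<Rightarrow> complex"
  assumes c: "\<And>i j. n i j = (\<Sum>s\<in>UNIV. c s i * cnj (c s j))"
  shows "(\<Sum>l\<in>UNIV. \<Sum>\<alpha>\<in>UNIV. n l \<alpha> * (f l * cnj (h \<alpha>)))
     = (\<Sum>u\<in>UNIV. (\<Sum>l\<in>UNIV. c u l * f l) * cnj (\<Sum>\<alpha>\<in>UNIV. c u \<alpha> * h \<alpha>))"
proof -
  have "(\<Sum>l\<in>UNIV. \<Sum>\<alpha>\<in>UNIV. n l \<alpha> * (f l * cnj (h \<alpha>)))
     = (\<Sum>l\<in>UNIV. \<Sum>\<alpha>\<in>UNIV. \<Sum>u\<in>UNIV. (c u l * f l) * cnj (c u \<alpha> * h \<alpha>))"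
    unfolding c sum_distrib_right by (simp add: mult_ac)
  also have "\<dots> = (\<Sum>u\<in>UNIV. \<Sum>\<alpha>\<in>UNIV. \<Sum>l\<in>UNIV. (c u l * f l) * cnj (c u \<alpha> * h \<alpha>))"
    by (rule sum_swap3)
  also have "\<dots> = (\<Sum>u\<in>UNIV. (\<Sum>l\<in>UNIV. c u l * f l) * cnj (\<Sum>\<alpha>\<in>UNIV. c u \<alpha> * h \<alpha>))"
    unfolding cnj_sum sum_product by (intro sum.cong refl sum.swap)
  finally show ?thesis .
qed

text \<open>The logarithmic derivative turns an eigenvalue of \<open>f\<close> into one of its powers.\<close>

lemma derivation_inverse_power:
  fixes f :: "'a::real_normed_vector \<Rightarrow> complex"
  assumes X: "derivation_at p X" and S: "open S" "p \<in> S" and f: "smooth_on S f"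
    and nz: "\<And>x. x \<in> S \<Longrightarrow> f x \<noteq> 0" and eig: "X f = c * f p"
  shows "X (\<lambda>x. inverse (f x ^ n)) = - of_nat n * c * inverse (f p ^ n)"
proof -
  have smp: "smooth_on S (\<lambda>x. f x ^ n)" for n
    by (induction n) (auto intro: smooth_on_mult S f)
  have smi: "smooth_on S (\<lambda>x. inverse (f x ^ n))"
    by (rule smooth_on_inverse[OF S(1) smp]) (use nz in auto)
  have pow: "X (\<lambda>x. f x ^ n) = of_nat n * c * f p ^ n" for n
  proof (induction n)
    case (Suc n)
    have "X (\<lambda>x. f x * f x ^ n) = X f * f p ^ n + f p * X (\<lambda>x. f x ^ n)"
      by (rule derivation_mult[OF X]) (auto intro: smooth_on_differentiable S f smp)
    then show ?case using Suc eig by (simp add: algebra_simps)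
  qed (simp add: derivation_const[OF X])
  have "0 = X (\<lambda>x. 1)" using derivation_const[OF X] by simp
  also have "\<dots> = X (\<lambda>x. f x ^ n * inverse (f x ^ n))"
    by (rule derivation_cong[OF X S]) (use nz in auto)
  also have "\<dots> = of_nat n * c * f p ^ n * inverse (f p ^ n) + f p ^ n * X (\<lambda>x. inverse (f x ^ n))"
    by (subst derivation_mult[OF X]) (auto intro: smooth_on_differentiable S smp smi simp: pow)
  finally have "f p ^ n * X (\<lambda>x. inverse (f x ^ n)) = - (of_nat n * c)" 
    using nz[OF S(2)] by (simp add: add_eq_0_iff)
  then show ?thesis using nz[OF S(2)] by (simp add: field_simps)
qed

context finsler_chart
begin

subsection \<open>The Chern--Finsler connection\<close>

lemma D_v_M_symmetric: "p \<in> S \<Longrightarrow> D_v \<beta> (M \<alpha> \<gamma>) p = D_v \<alpha> (M \<beta> \<gamma>) p"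
  unfolding M_eq by (rule D_commute) (auto intro!: smooth_D smooth_G)

text \<open>Differentiating the inverse metric in \<open>\<Gamma>\<^sup>\<alpha>\<^sub>;\<^sub>\<mu>\<close> yields a term \<open>- \<Gamma>\<^sup>\<sigma>\<^sub>;\<^sub>\<mu> \<partial>\<^sub>\<beta>G\<^sub>\<sigma>\<^sub>\<lambda>\<close> (with \<open>\<lambda>\<close>
  barred). Here \<open>\<beta>\<close> and \<open>\<sigma>\<close> may be exchanged, which makes it the vertical part of \<open>\<delta>\<^sub>\<mu>G\<^sub>\<beta>\<^sub>\<lambda>\<close>.\<close>

lemma D_v_Gam1: assumes p: "p \<in> S" shows "D_v \<beta> (Gam1 g \<alpha> \<mu>) p = Gam2 g \<alpha> \<beta> \<mu> p"
proof -
  define H where "H = (\<lambda>l. D_vbar l (D_z \<mu> G))"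
  have sH: "smooth_on S (H l)" for l unfolding H_def by (intro smooth_D smooth_G)
  have HH: "D_vbar l (D_z \<mu> G) = H l" for l by (simp add: H_def)
  have DH: "D_v \<beta> (H l) p = D_z \<mu> (M \<beta> l) p" for l
  proof -
    have "D_v \<beta> (H l) p = D_v \<beta> (D_z \<mu> (D_vbar l G)) p"
      by (rule derivation_cong[OF derivation_D(3) open_S p])
        (auto intro!: diffble[OF _ p] sH D_commute smooth_D smooth_G simp: H_def)
    also have "\<dots> = D_z \<mu> (D_v \<beta> (D_vbar l G)) p"
      by (rule D_commute) (auto intro!: smooth_D smooth_G p)
    finally show ?thesis by (simp add: M_eq)
  qed
  have "D_v \<beta> (Gam1 g \<alpha> \<mu>) p = (\<Sum>l\<in>UNIV. D_v \<beta> (\<lambda>x. N l \<alpha> x * H l x) p)"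
    unfolding Gam1_def[abs_def] HH
    by (rule derivation_sum[OF derivation_D(3)]) (auto intro!: diffble[OF _ p] smooth_on_mult smooth_N sH open_S)
  also have "\<dots> = (\<Sum>l\<in>UNIV. D_v \<beta> (N l \<alpha>) p * H l p + N l \<alpha> p * D_v \<beta> (H l) p)"
    by (intro sum.cong refl derivation_mult[OF derivation_D(3)] diffble[OF _ p] smooth_N sH)
  also have "\<dots> = (\<Sum>l\<in>UNIV. - (\<Sum>k\<in>UNIV. \<Sum>j\<in>UNIV. N l k p * D_v k (M \<beta> j) p * N j \<alpha> p) * H l p)
      + (\<Sum>l\<in>UNIV. N l \<alpha> p * D_z \<mu> (M \<beta> l) p)"
    unfolding sum.distrib derivation_N[OF derivation_D(3) p] DH D_v_M_symmetric[OF p, of \<beta>] ..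
  also have "(\<Sum>l\<in>UNIV. - (\<Sum>k\<in>UNIV. \<Sum>j\<in>UNIV. N l k p * D_v k (M \<beta> j) p * N j \<alpha> p) * H l p)
     = - (\<Sum>l\<in>UNIV. \<Sum>k\<in>UNIV. \<Sum>j\<in>UNIV. N j \<alpha> p * (N l k p * H l p * D_v k (M \<beta> j) p))"
    by (simp add: sum_negf sum_distrib_left sum_distrib_right mult_ac)
  also have "\<dots> = - (\<Sum>j\<in>UNIV. N j \<alpha> p * (\<Sum>k\<in>UNIV. Gam1 g k \<mu> p * D_v k (M \<beta> j) p))"
    by (subst sum_swap3) (simp add: Gam1_def H_def sum_distrib_left sum_distrib_right)
  finally show ?thesis
    by (simp add: Gam2_def del_def right_diff_distrib sum_subtractf)
qed

text \<open>Chen and Shen: differentiating \<open>\<Gamma>\<^sup>\<alpha>\<^sub>;\<^sub>\<mu> = v\<^sup>\<beta> \<partial>\<^sub>\<mu>\<Gamma>\<^sup>\<alpha>\<^sub>;\<^sub>\<beta>\<close>, which is the Kaehler condition together with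
  homogeneity, in the direction of the fibre expresses the skew-symmetric torsion through symmetric second
  derivatives.\<close>

lemma kaehler_strong:
  assumes K: "\<And>p \<alpha> \<mu>. p \<in> S \<Longrightarrow> (\<Sum>\<beta>\<in>UNIV. (Gam2 g \<alpha> \<beta> \<mu> p - Gam2 g \<alpha> \<mu> \<beta> p) * snd p $ \<beta>) = 0"
    and p: "p \<in> S"
  shows "Gam2 g \<alpha> \<nu> \<mu> p = Gam2 g \<alpha> \<mu> \<nu> p"
proof -
  have eq: "Gam1 g \<alpha> \<mu> x = (\<Sum>\<beta>\<in>UNIV. snd x $ \<beta> * D_v \<mu> (Gam1 g \<alpha> \<beta>) x)" if x: "x \<in> S" for x \<mu>
  proof -
    have "Gam1 g \<alpha> \<mu> x = (\<Sum>\<beta>\<in>UNIV. Gam2 g \<alpha> \<beta> \<mu> x * snd x $ \<beta>)"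
      using euler_Gam1[OF x, of \<alpha> \<mu>] by (simp add: euler_def D_v_Gam1[OF x] mult.commute)
    also have "\<dots> = (\<Sum>\<beta>\<in>UNIV. Gam2 g \<alpha> \<mu> \<beta> x * snd x $ \<beta>)"
      using K[OF x, of \<alpha> \<mu>] by (simp add: left_diff_distrib sum_subtractf)
    finally show ?thesis by (simp add: D_v_Gam1[OF x] mult.commute)
  qed
  define W where "W = (\<lambda>\<nu> \<mu>. \<Sum>\<beta>\<in>UNIV. snd p $ \<beta> * D_v \<nu> (D_v \<mu> (Gam1 g \<alpha> \<beta>)) p)"
  have D: "Gam2 g \<alpha> \<nu> \<mu> p = Gam2 g \<alpha> \<mu> \<nu> p + W \<nu> \<mu>" for \<nu> \<mu>
  proof -
    have "Gam2 g \<alpha> \<nu> \<mu> p = D_v \<nu> (Gam1 g \<alpha> \<mu>) p" by (simp add: D_v_Gam1[OF p])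
    also have "\<dots> = D_v \<nu> (\<lambda>x. \<Sum>\<beta>\<in>UNIV. snd x $ \<beta> * D_v \<mu> (Gam1 g \<alpha> \<beta>) x) p"
      by (rule derivation_cong[OF derivation_D(3) open_S p diffble[OF smooth_Gam1 p] eq])
    also have "\<dots> = (\<Sum>\<beta>\<in>UNIV. D_v \<nu> (\<lambda>x. snd x $ \<beta> * D_v \<mu> (Gam1 g \<alpha> \<beta>) x) p)"
      by (rule derivation_sum[OF derivation_D(3)])
        (auto intro!: diffble[OF _ p] smooth_on_mult smooth_on_v_coordinate smooth_D smooth_Gam1 open_S)
    also have "\<dots> = (\<Sum>\<beta>\<in>UNIV. D_v \<nu> (\<lambda>x. snd x $ \<beta>) p * D_v \<mu> (Gam1 g \<alpha> \<beta>) p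
         + snd p $ \<beta> * D_v \<nu> (D_v \<mu> (Gam1 g \<alpha> \<beta>)) p)"
      by (intro sum.cong refl derivation_mult[OF derivation_D(3)] diffble[OF _ p] smooth_on_v_coordinate open_S
          smooth_D smooth_Gam1)
    also have "\<dots> = Gam2 g \<alpha> \<mu> \<nu> p + W \<nu> \<mu>"
      by (simp add: W_def sum.distrib D_v_coordinate D_v_Gam1[OF p])
    finally show ?thesis .
  qed
  have sym: "W \<nu> \<mu> = W \<mu> \<nu>"
    unfolding W_def by (intro sum.cong refl arg_cong2[where f = "(*)"] D_commute smooth_Gam1 p) simp_all
  have "2 * W \<nu> \<mu> = 0" using D[of \<nu> \<mu>] D[of \<mu> \<nu>] sym by algebra
  then show ?thesis using D[of \<nu> \<mu>] by simp
qed


subsection \<open>Torsion\<close>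

definition torsion :: "'n \<Rightarrow> 'n \<Rightarrow> 'n \<Rightarrow> 'n cpair \<Rightarrow> complex" where
  "torsion \<mu> \<sigma> l p = del g \<mu> (M \<sigma> l) p - del g \<sigma> (M \<mu> l) p"

definition torsion_trace :: "'n \<Rightarrow> 'n cpair \<Rightarrow> complex" where
  "torsion_trace \<sigma> p = (\<Sum>\<gamma>\<in>UNIV. Gam2 g \<gamma> \<gamma> \<sigma> p - Gam2 g \<gamma> \<sigma> \<gamma> p)"

lemma smooth_torsion_trace: "smooth_on S (torsion_trace \<sigma>)"
  unfolding torsion_trace_def[abs_def] by (intro smooth_on_sum smooth_on_diff smooth_Gam2 open_S)

lemma Gam2_diff: "Gam2 g \<alpha> \<sigma> \<mu> p - Gam2 g \<alpha> \<mu> \<sigma> p = (\<Sum>l\<in>UNIV. N l \<alpha> p * torsion \<mu> \<sigma> l p)"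
  by (simp add: Gam2_def torsion_def right_diff_distrib sum_subtractf)

lemma torsion_trace_eq: "torsion_trace \<sigma> p = (\<Sum>\<gamma>\<in>UNIV. \<Sum>l\<in>UNIV. N l \<gamma> p * torsion \<sigma> \<gamma> l p)"
  by (simp add: torsion_trace_def Gam2_diff)

lemma N_injective:
  assumes p: "p \<in> S" and z: "\<And>\<alpha>. (\<Sum>l\<in>UNIV. N l \<alpha> p * f l) = 0" shows "f m = 0"
proof -
  have "0 = (\<Sum>\<alpha>\<in>UNIV. (\<Sum>l\<in>UNIV. N l \<alpha> p * f l) * M \<alpha> m p)" by (simp add: z)
  also have "\<dots> = (\<Sum>\<alpha>\<in>UNIV. \<Sum>l\<in>UNIV. N l \<alpha> p * M \<alpha> m p * f l)"
    unfolding sum_distrib_right by (simp add: mult_ac)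
  also have "\<dots> = (\<Sum>l\<in>UNIV. (\<Sum>\<alpha>\<in>UNIV. N l \<alpha> p * M \<alpha> m p) * f l)"
    unfolding sum_distrib_right by (rule sum.swap)
  finally show ?thesis by (simp add: NM_sum[OF p])
qed

lemma N_injective':
  assumes p: "p \<in> S" and z: "\<And>\<beta>. (\<Sum>k\<in>UNIV. N \<beta> k p * f k) = 0" shows "f m = 0"
proof -
  have "(\<Sum>l\<in>UNIV. N l \<alpha> p * cnj (f l)) = cnj (\<Sum>l\<in>UNIV. N \<alpha> l p * f l)" for \<alpha>
    by (simp add: N_hermitian[OF p, symmetric])
  then have "(\<Sum>l\<in>UNIV. N l \<alpha> p * cnj (f l)) = 0" for \<alpha> by (simp only: z complex_cnj_zero)
  then have "cnj (f m) = 0" by (rule N_injective[OF p, of "\<lambda>l. cnj (f l)"])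
  then show ?thesis by simp
qed

lemma torsion_zero_iff:
  assumes p: "p \<in> S"
  shows "(\<forall>\<alpha> \<sigma> \<mu>. Gam2 g \<alpha> \<sigma> \<mu> p = Gam2 g \<alpha> \<mu> \<sigma> p) \<longleftrightarrow> (\<forall>\<mu> \<sigma> l. torsion \<mu> \<sigma> l p = 0)"
proof
  assume "\<forall>\<alpha> \<sigma> \<mu>. Gam2 g \<alpha> \<sigma> \<mu> p = Gam2 g \<alpha> \<mu> \<sigma> p"
  then have "(\<Sum>l\<in>UNIV. N l \<alpha> p * torsion \<mu> \<sigma> l p) = 0" for \<alpha> \<mu> \<sigma>
    unfolding Gam2_diff[symmetric] by simp
  then show "\<forall>\<mu> \<sigma> l. torsion \<mu> \<sigma> l p = 0"
    using N_injective[OF p, of "\<lambda>l. torsion _ _ l p"] by blast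
next
  assume "\<forall>\<mu> \<sigma> l. torsion \<mu> \<sigma> l p = 0"
  then have "Gam2 g \<alpha> \<sigma> \<mu> p - Gam2 g \<alpha> \<mu> \<sigma> p = 0" for \<alpha> \<sigma> \<mu> unfolding Gam2_diff by simp
  then show "\<forall>\<alpha> \<sigma> \<mu>. Gam2 g \<alpha> \<sigma> \<mu> p = Gam2 g \<alpha> \<mu> \<sigma> p" by simp
qed

text \<open>The squared pointwise norm of the torsion as a tensor with three indices.\<close>

definition torsion_norm :: "'n cpair \<Rightarrow> complex" where
  "torsion_norm p = (\<Sum>\<nu>\<in>UNIV. \<Sum>\<mu>\<in>UNIV. \<Sum>\<beta>\<in>UNIV. \<Sum>\<sigma>\<in>UNIV. \<Sum>l\<in>UNIV. \<Sum>\<alpha>\<in>UNIV.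
     N \<nu> \<mu> p * N \<beta> \<sigma> p * N l \<alpha> p * torsion \<mu> \<sigma> l p * cnj (torsion \<nu> \<beta> \<alpha> p))"

text \<open>The inverse of the metric is positive definite, because \<open>N(\<xi>, \<xi>) = M(\<eta>, \<eta>)\<close> for \<open>\<eta> = N \<xi>\<close>.\<close>

lemma N_factorization:
  assumes p: "p \<in> S"
  obtains c :: "'n \<Rightarrow> 'n \<Rightarrow> complex" where "\<And>i j. N i j p = (\<Sum>s\<in>UNIV. c s i * cnj (c s j))"
proof -
  have "\<exists>c::'n \<Rightarrow> 'n \<Rightarrow> complex. \<forall>i\<in>UNIV. \<forall>j\<in>UNIV. N i j p = (\<Sum>s\<in>UNIV. c s i * cnj (c s j))"
  proof (rule cholesky_factorization)
    show "N j i p = cnj (N i j p)" for i j by (rule N_hermitian[OF p])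
    fix \<xi> :: "'n \<Rightarrow> complex" assume ne: "\<exists>i\<in>UNIV. \<xi> i \<noteq> 0"
    define \<eta> where "\<eta> = (\<chi> \<alpha>. \<Sum>i\<in>UNIV. N i \<alpha> p * \<xi> i)"
    have "\<eta> \<noteq> 0"
    proof
      assume "\<eta> = 0"
      then have "(\<Sum>i\<in>UNIV. N i \<alpha> p * \<xi> i) = 0" for \<alpha>
        by (simp add: \<eta>_def vec_eq_iff)
      then show False using N_injective[OF p] ne by blast
    qed
    then have pos: "0 < Re (\<Sum>\<alpha>\<in>UNIV. \<Sum>\<beta>\<in>UNIV. M \<alpha> \<beta> p * \<eta> $ \<alpha> * cnj (\<eta> $ \<beta>))"
      using pseudoconvex[OF p] unfolding pos_def_def Let_def by blast
    have c\<eta>: "cnj (\<eta> $ \<beta>) = (\<Sum>j\<in>UNIV. N \<beta> j p * cnj (\<xi> j))" for \<beta>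
      by (simp add: \<eta>_def N_hermitian[OF p, symmetric])
    have "(\<Sum>\<beta>\<in>UNIV. M \<alpha> \<beta> p * cnj (\<eta> $ \<beta>)) = cnj (\<xi> \<alpha>)" for \<alpha>
    proof -
      have "(\<Sum>\<beta>\<in>UNIV. M \<alpha> \<beta> p * cnj (\<eta> $ \<beta>)) = (\<Sum>\<beta>\<in>UNIV. \<Sum>j\<in>UNIV. M \<alpha> \<beta> p * N \<beta> j p * cnj (\<xi> j))"
        unfolding c\<eta> sum_distrib_left by (simp add: mult.assoc)
      also have "\<dots> = (\<Sum>j\<in>UNIV. (\<Sum>\<beta>\<in>UNIV. M \<alpha> \<beta> p * N \<beta> j p) * cnj (\<xi> j))"
        unfolding sum_distrib_right by (rule sum.swap)
      finally show ?thesis by (simp add: MN_sum[OF p])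
    qed
    then have "(\<Sum>\<alpha>\<in>UNIV. \<Sum>\<beta>\<in>UNIV. M \<alpha> \<beta> p * \<eta> $ \<alpha> * cnj (\<eta> $ \<beta>)) = (\<Sum>\<alpha>\<in>UNIV. \<eta> $ \<alpha> * cnj (\<xi> \<alpha>))"
      by (simp add: mult.assoc mult.left_commute flip: sum_distrib_left)
    also have "\<dots> = (\<Sum>i\<in>UNIV. \<Sum>j\<in>UNIV. N i j p * \<xi> i * cnj (\<xi> j))"
      by (simp add: \<eta>_def sum_distrib_right) (rule sum.swap)
    finally show "0 < Re (\<Sum>i\<in>UNIV. \<Sum>j\<in>UNIV. N i j p * \<xi> i * cnj (\<xi> j))" using pos by (simp only:)
  qed simp
  then show ?thesis using that by blast
qed

text \<open>Factorizing each of the three inverse metrics turns the norm into a sum of squares of the components of the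
  torsion in a unitary frame. The frame is invertible, so the components vanish only with the torsion.\<close>

lemma torsion_norm_zero:
  assumes p: "p \<in> S" and z: "torsion_norm p = 0"
  shows "torsion \<mu> \<sigma> l p = 0"
proof -
  obtain c :: "'n \<Rightarrow> 'n \<Rightarrow> complex" where c: "\<And>i j. N i j p = (\<Sum>s\<in>UNIV. c s i * cnj (c s j))"
    using N_factorization[OF p] by blast
  have contract2: "(\<Sum>l\<in>UNIV. \<Sum>\<alpha>\<in>UNIV. N l \<alpha> p * (f l * cnj (h \<alpha>)))
     = (\<Sum>u\<in>UNIV. (\<Sum>l\<in>UNIV. c u l * f l) * cnj (\<Sum>\<alpha>\<in>UNIV. c u \<alpha> * h \<alpha>))" for f h
    by (rule contract_factorization_left[of "\<lambda>i j. N i j p" c, OF c])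
  note contract1 = contract_factorization_right[of "\<lambda>i j. N i j p" c, OF c]
  define A where "A u \<mu> \<sigma> = (\<Sum>l\<in>UNIV. c u l * torsion \<mu> \<sigma> l p)" for u \<mu> \<sigma>
  define B where "B i \<mu> = (\<Sum>\<sigma>\<in>UNIV. cnj (c (snd i) \<sigma>) * A (fst i) \<mu> \<sigma>)" for i \<mu>
  define C where "C i s = (\<Sum>\<mu>\<in>UNIV. cnj (c s \<mu>) * B i \<mu>)" for i s
  have "torsion_norm p = (\<Sum>\<nu>\<in>UNIV. \<Sum>\<mu>\<in>UNIV. N \<nu> \<mu> p * (\<Sum>\<beta>\<in>UNIV. \<Sum>\<sigma>\<in>UNIV. N \<beta> \<sigma> p *
     (\<Sum>l\<in>UNIV. \<Sum>\<alpha>\<in>UNIV. N l \<alpha> p * (torsion \<mu> \<sigma> l p * cnj (torsion \<nu> \<beta> \<alpha> p)))))"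
    by (simp add: torsion_norm_def sum_distrib_left mult.assoc)
  also have "\<dots> = (\<Sum>\<nu>\<in>UNIV. \<Sum>\<mu>\<in>UNIV. N \<nu> \<mu> p * (\<Sum>\<beta>\<in>UNIV. \<Sum>\<sigma>\<in>UNIV. N \<beta> \<sigma> p *
     (\<Sum>u\<in>UNIV. A u \<mu> \<sigma> * cnj (A u \<nu> \<beta>))))"
    unfolding contract2 A_def ..
  also have "\<dots> = (\<Sum>\<nu>\<in>UNIV. \<Sum>\<mu>\<in>UNIV. N \<nu> \<mu> p * (\<Sum>i\<in>UNIV\<times>UNIV. B i \<mu> * cnj (B i \<nu>)))"
  proof (intro sum.cong refl arg_cong2[where f = "(*)"])
    fix \<nu> \<mu>
    have "(\<Sum>\<beta>\<in>UNIV. \<Sum>\<sigma>\<in>UNIV. N \<beta> \<sigma> p * (\<Sum>u\<in>UNIV. A u \<mu> \<sigma> * cnj (A u \<nu> \<beta>)))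
       = (\<Sum>u\<in>UNIV. \<Sum>s\<in>UNIV. B (u, s) \<mu> * cnj (B (u, s) \<nu>))"
      unfolding contract1 by (simp add: B_def)
    then show "(\<Sum>\<beta>\<in>UNIV. \<Sum>\<sigma>\<in>UNIV. N \<beta> \<sigma> p * (\<Sum>u\<in>UNIV. A u \<mu> \<sigma> * cnj (A u \<nu> \<beta>)))
       = (\<Sum>i\<in>UNIV \<times> UNIV. B i \<mu> * cnj (B i \<nu>))"
      by (simp add: sum.cartesian_product split_beta)
  qed
  also have "\<dots> = (\<Sum>i\<in>UNIV\<times>UNIV. \<Sum>s\<in>UNIV. C i s * cnj (C i s))"
    unfolding contract1 C_def ..
  also have "\<dots> = complex_of_real (\<Sum>i\<in>UNIV\<times>UNIV. \<Sum>s\<in>UNIV. (cmod (C i s))\<^sup>2)"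
    by (simp only: complex_norm_square of_real_sum)
  finally have "(\<Sum>i\<in>UNIV\<times>UNIV. \<Sum>s\<in>UNIV. (cmod (C i s))\<^sup>2) = 0" using z by (metis of_real_eq_0_iff)
  then have "\<forall>i\<in>UNIV\<times>UNIV. (\<Sum>s\<in>UNIV. (cmod (C i s))\<^sup>2) = 0"
    by (subst (asm) sum_nonneg_eq_0_iff) (auto intro: sum_nonneg)
  then have C0: "C i s = 0" for i s
    by (cases i) (auto simp: sum_nonneg_eq_0_iff)
  have inj1: "f m = 0" if "\<And>s. (\<Sum>\<mu>\<in>UNIV. cnj (c s \<mu>) * f \<mu>) = 0" for f m
  proof (rule N_injective'[OF p, of f])
    fix \<beta>
    have "(\<Sum>k\<in>UNIV. N \<beta> k p * f k) = (\<Sum>s\<in>UNIV. c s \<beta> * (\<Sum>k\<in>UNIV. cnj (c s k) * f k))"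
      unfolding c sum_distrib_left sum_distrib_right by (subst sum.swap) (simp add: mult_ac)
    then show "(\<Sum>k\<in>UNIV. N \<beta> k p * f k) = 0" using that by simp
  qed
  have inj2: "f m = 0" if "\<And>u. (\<Sum>l\<in>UNIV. c u l * f l) = 0" for f m
  proof (rule N_injective[OF p, of f])
    fix \<alpha>
    have "(\<Sum>l\<in>UNIV. N l \<alpha> p * f l) = (\<Sum>s\<in>UNIV. cnj (c s \<alpha>) * (\<Sum>k\<in>UNIV. c s k * f k))"
      unfolding c sum_distrib_left sum_distrib_right by (subst sum.swap) (simp add: mult_ac)
    then show "(\<Sum>l\<in>UNIV. N l \<alpha> p * f l) = 0" using that by simp
  qed
  have "B i \<mu> = 0" for i \<mu> by (rule inj1[of "B i"]) (use C0 C_def in simp)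
  then have "A u \<mu> \<sigma> = 0" for u \<mu> \<sigma>
    using inj1[of "A u \<mu>"] B_def[of "(u, _)"] by simp
  then show ?thesis using inj2[of "\<lambda>l. torsion \<mu> \<sigma> l p"] A_def by simp
qed

lemma delbar_M: assumes p: "p \<in> S" shows "delbar g \<nu> (M \<alpha> \<beta>) p = cnj (del g \<nu> (M \<beta> \<alpha>) p)"
proof -
  have "delbar g \<nu> (M \<alpha> \<beta>) p = delbar g \<nu> (\<lambda>x. cnj (M \<beta> \<alpha> x)) p"
    by (rule derivation_cong[OF derivation_delbar open_S p diffble[OF smooth_M p] M_hermitian])
  then show ?thesis by (simp add: delbar_cnj[OF diffble[OF smooth_M p]])
qed

text \<open>The coefficients of \<open>\<partial>\<close>-bar of \<open>\<omega>\<^sub>H\<close>; by the Hermitian symmetry of the metric they are conjugate to the torsion.\<close>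

definition torsion_bar :: "'n \<Rightarrow> 'n \<Rightarrow> 'n \<Rightarrow> 'n cpair \<Rightarrow> complex" where
  "torsion_bar \<alpha> \<nu> \<beta> p = delbar g \<nu> (M \<alpha> \<beta>) p - delbar g \<beta> (M \<alpha> \<nu>) p"

lemma torsion_bar_cnj: "p \<in> S \<Longrightarrow> torsion_bar \<alpha> \<nu> \<beta> p = cnj (torsion \<nu> \<beta> \<alpha> p)"
  by (simp add: torsion_bar_def torsion_def delbar_M)

lemma smooth_torsion_bar: "smooth_on S (torsion_bar \<alpha> \<nu> \<beta>)"
  unfolding torsion_bar_def[abs_def] by (intro smooth_on_diff smooth_delbar smooth_M open_S)

text \<open>If the torsion is trace free, then a derivative of the torsion can be traded for a derivative of the
  metric. What remains is quadratic in the torsion.\<close>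

lemma trace_del_torsion_bar:
  assumes tr: "\<And>x \<sigma>. x \<in> S \<Longrightarrow> torsion_trace \<sigma> x = 0" and p: "p \<in> S"
  shows "(\<Sum>\<nu>\<in>UNIV. \<Sum>\<mu>\<in>UNIV. N \<nu> \<mu> p * (\<Sum>\<beta>\<in>UNIV. \<Sum>\<alpha>\<in>UNIV. N \<beta> \<alpha> p * del g \<mu> (torsion_bar \<alpha> \<nu> \<beta>) p))
     = torsion_norm p / 2"
proof -
  have tz: "(\<Sum>\<beta>\<in>UNIV. \<Sum>\<alpha>\<in>UNIV. N \<beta> \<alpha> x * torsion_bar \<alpha> \<nu> \<beta> x) = 0" if x: "x \<in> S" for x \<nu>
  proof -
    have "(\<Sum>\<beta>\<in>UNIV. \<Sum>\<alpha>\<in>UNIV. N \<beta> \<alpha> x * torsion_bar \<alpha> \<nu> \<beta> x) = cnj (torsion_trace \<nu> x)"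
      unfolding torsion_trace_eq cnj_sum by (simp add: torsion_bar_cnj[OF x] N_hermitian[OF x, symmetric])
    then show ?thesis by (simp add: tr[OF x])
  qed
  have step: "(\<Sum>\<beta>\<in>UNIV. \<Sum>\<alpha>\<in>UNIV. N \<beta> \<alpha> p * del g \<mu> (torsion_bar \<alpha> \<nu> \<beta>) p)
     = (\<Sum>\<beta>\<in>UNIV. \<Sum>\<sigma>\<in>UNIV. \<Sum>l\<in>UNIV. \<Sum>\<alpha>\<in>UNIV. N \<beta> \<sigma> p * N l \<alpha> p * del g \<mu> (M \<sigma> l) p * torsion_bar \<alpha> \<nu> \<beta> p)" for \<mu> \<nu>
  proof -
    have "0 = del g \<mu> (\<lambda>x. 0) p" using derivation_const[OF derivation_del[of p \<mu>]] by simp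
    also have "\<dots> = del g \<mu> (\<lambda>x. \<Sum>\<beta>\<in>UNIV. \<Sum>\<alpha>\<in>UNIV. N \<beta> \<alpha> x * torsion_bar \<alpha> \<nu> \<beta> x) p"
      by (rule derivation_cong[OF derivation_del open_S p]) (simp_all add: tz)
    also have "\<dots> = (\<Sum>\<beta>\<in>UNIV. \<Sum>\<alpha>\<in>UNIV. del g \<mu> (\<lambda>x. N \<beta> \<alpha> x * torsion_bar \<alpha> \<nu> \<beta> x) p)"
      by (subst derivation_sum[OF derivation_del] |
          auto intro!: diffble[OF _ p] smooth_on_sum smooth_on_mult smooth_N smooth_torsion_bar open_S sum.cong)+
    also have "\<dots> = (\<Sum>\<beta>\<in>UNIV. \<Sum>\<alpha>\<in>UNIV. del g \<mu> (N \<beta> \<alpha>) p * torsion_bar \<alpha> \<nu> \<beta> p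
        + N \<beta> \<alpha> p * del g \<mu> (torsion_bar \<alpha> \<nu> \<beta>) p)"
      by (intro sum.cong refl derivation_mult[OF derivation_del] diffble[OF _ p] smooth_N smooth_torsion_bar)
    finally have "(\<Sum>\<beta>\<in>UNIV. \<Sum>\<alpha>\<in>UNIV. N \<beta> \<alpha> p * del g \<mu> (torsion_bar \<alpha> \<nu> \<beta>) p)
       = (\<Sum>\<beta>\<in>UNIV. \<Sum>\<alpha>\<in>UNIV. - del g \<mu> (N \<beta> \<alpha>) p * torsion_bar \<alpha> \<nu> \<beta> p)"
      by (simp add: sum.distrib sum_negf eq_neg_iff_add_eq_0 add.commute)
    also have "\<dots> = (\<Sum>\<beta>\<in>UNIV. \<Sum>\<alpha>\<in>UNIV. \<Sum>\<sigma>\<in>UNIV. \<Sum>l\<in>UNIV. N \<beta> \<sigma> p * N l \<alpha> p * del g \<mu> (M \<sigma> l) p * torsion_bar \<alpha> \<nu> \<beta> p)"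
      unfolding derivation_N[OF derivation_del p] by (simp add: sum_distrib_left sum_distrib_right mult_ac)
    also have "\<dots> = (\<Sum>\<beta>\<in>UNIV. \<Sum>\<sigma>\<in>UNIV. \<Sum>l\<in>UNIV. \<Sum>\<alpha>\<in>UNIV. N \<beta> \<sigma> p * N l \<alpha> p * del g \<mu> (M \<sigma> l) p * torsion_bar \<alpha> \<nu> \<beta> p)"
    proof (rule sum.cong[OF refl])
      fix \<beta>
      show "(\<Sum>\<alpha>\<in>UNIV. \<Sum>\<sigma>\<in>UNIV. \<Sum>l\<in>UNIV. N \<beta> \<sigma> p * N l \<alpha> p * del g \<mu> (M \<sigma> l) p * torsion_bar \<alpha> \<nu> \<beta> p)
         = (\<Sum>\<sigma>\<in>UNIV. \<Sum>l\<in>UNIV. \<Sum>\<alpha>\<in>UNIV. N \<beta> \<sigma> p * N l \<alpha> p * del g \<mu> (M \<sigma> l) p * torsion_bar \<alpha> \<nu> \<beta> p)"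
        by (subst sum.swap, rule sum.cong[OF refl], rule sum.swap)
    qed
    finally show ?thesis .
  qed
  define f where "f \<nu> \<mu> \<beta> \<sigma> = (\<Sum>l\<in>UNIV. \<Sum>\<alpha>\<in>UNIV. N \<nu> \<mu> p * N \<beta> \<sigma> p * N l \<alpha> p * del g \<mu> (M \<sigma> l) p * torsion_bar \<alpha> \<nu> \<beta> p)" for \<nu> \<mu> \<beta> \<sigma>
  define Q where "Q = (\<Sum>\<nu>\<in>UNIV. \<Sum>\<mu>\<in>UNIV. \<Sum>\<beta>\<in>UNIV. \<Sum>\<sigma>\<in>UNIV. f \<nu> \<mu> \<beta> \<sigma>)"
  have LQ: "(\<Sum>\<nu>\<in>UNIV. \<Sum>\<mu>\<in>UNIV. N \<nu> \<mu> p * (\<Sum>\<beta>\<in>UNIV. \<Sum>\<alpha>\<in>UNIV. N \<beta> \<alpha> p * del g \<mu> (torsion_bar \<alpha> \<nu> \<beta>) p)) = Q"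
    unfolding step Q_def f_def sum_distrib_left by (simp add: mult_ac)
  \<comment> \<open>exchanging \<open>(\<nu>, \<mu>)\<close> with \<open>(\<beta>, \<sigma>)\<close> changes the sign of the conjugate torsion and skew-symmetrizes the other factor\<close>
  have "Q = (\<Sum>\<nu>\<in>UNIV. \<Sum>\<mu>\<in>UNIV. \<Sum>\<beta>\<in>UNIV. \<Sum>\<sigma>\<in>UNIV. f \<beta> \<sigma> \<nu> \<mu>)"
    unfolding Q_def by (rule sum_swap4)
  then have "2 * Q = (\<Sum>\<nu>\<in>UNIV. \<Sum>\<mu>\<in>UNIV. \<Sum>\<beta>\<in>UNIV. \<Sum>\<sigma>\<in>UNIV. f \<nu> \<mu> \<beta> \<sigma> + f \<beta> \<sigma> \<nu> \<mu>)"
    unfolding sum.distrib by (simp add: Q_def)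
  also have "\<dots> = torsion_norm p"
    unfolding torsion_norm_def
  proof (intro sum.cong refl)
    fix \<nu> \<mu> \<beta> \<sigma>
    have anti: "torsion_bar \<alpha> \<beta> \<nu> p = - torsion_bar \<alpha> \<nu> \<beta> p" for \<alpha> by (simp add: torsion_bar_def)
    show "f \<nu> \<mu> \<beta> \<sigma> + f \<beta> \<sigma> \<nu> \<mu> = (\<Sum>l\<in>UNIV. \<Sum>\<alpha>\<in>UNIV.
     N \<nu> \<mu> p * N \<beta> \<sigma> p * N l \<alpha> p * torsion \<mu> \<sigma> l p * cnj (torsion \<nu> \<beta> \<alpha> p))"
      unfolding f_def sum.distrib[symmetric] anti torsion_bar_cnj[OF p, symmetric] torsion_def[of \<mu> \<sigma>]
      by (intro sum.cong refl) (simp add: algebra_simps)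
  qed
  finally show ?thesis unfolding LQ by (simp add: field_simps)
qed

end


section \<open>The volume density and the horizontal divergence\<close>

definition replace_column :: "'n::finite \<Rightarrow> complex^'n \<Rightarrow> complex^'n^'n" where
  "replace_column a w = (\<chi> i j. if j = a then w $ i else of_bool (i = j))"

definition replace_row :: "'n::finite \<Rightarrow> complex^'n \<Rightarrow> complex^'n^'n" where
  "replace_row a w = (\<chi> i j. if i = a then w $ j else of_bool (i = j))"

lemma det_replace_column: "det (replace_column a w) = w $ a"
proof -
  have "replace_column a w = (\<chi> i j. if j = a then (mat 1 *v w) $ i else mat 1 $ i $ j)"
    unfolding matrix_vector_mul_lid by (simp add: replace_column_def mat_def vec_eq_iff)
  then show ?thesis by (simp only: cramer_lemma det_I mult_1_right)
qed

lemma det_replace_row': "det (replace_row a w) = w $ a"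
proof -
  have "replace_row a w = transpose (replace_column a w)"
    by (auto simp: replace_column_def replace_row_def transpose_def vec_eq_iff)
  then show ?thesis by (simp add: det_replace_column)
qed

lemma replace_row_mult: "(replace_row a w ** A) $ i $ j = (if i = a then \<Sum>k\<in>UNIV. w $ k * A $ k $ j else A $ i $ j)"
  by (simp add: replace_row_def matrix_matrix_mult_def)

lemma mult_replace_column: "(A ** replace_column a w) $ i $ j = (if j = a then \<Sum>k\<in>UNIV. A $ i $ k * w $ k else A $ i $ j)"
  by (simp add: replace_column_def matrix_matrix_mult_def)

lemma replace_column_mult:
  "(replace_column a w ** A) $ i $ j = w $ i * A $ a $ j + (if i = a then 0 else A $ i $ j)"
proof -
  have "(replace_column a w ** A) $ i $ j = (\<Sum>k\<in>UNIV. (if k = a then w $ i else of_bool (i = k)) * A $ k $ j)"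
    by (simp add: replace_column_def matrix_matrix_mult_def)
  also have "\<dots> = w $ i * A $ a $ j + (\<Sum>k\<in>UNIV-{a}. of_bool (i = k) * A $ k $ j)"
    by (subst sum.remove[of UNIV a]) (auto intro!: sum.cong)
  also have "(\<Sum>k\<in>UNIV-{a}. of_bool (i = k) * A $ k $ j) = (if i = a then 0 else A $ i $ j)"
    by (cases "i = a") (auto simp: sum.remove[of "UNIV - {a}" i] intro!: sum.neutral)
  finally show ?thesis .
qed

lemma mult_replace_row:
  "(A ** replace_row a w) $ i $ j = A $ i $ a * w $ j + (if j = a then 0 else A $ i $ j)"
proof -
  have "(A ** replace_row a w) $ i $ j = (\<Sum>k\<in>UNIV. A $ i $ k * (if k = a then w $ j else of_bool (k = j)))"
    by (simp add: replace_row_def matrix_matrix_mult_def)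
  also have "\<dots> = A $ i $ a * w $ j + (\<Sum>k\<in>UNIV-{a}. A $ i $ k * of_bool (k = j))"
    by (subst sum.remove[of UNIV a]) (auto intro!: sum.cong)
  also have "(\<Sum>k\<in>UNIV-{a}. A $ i $ k * of_bool (k = j)) = (if j = a then 0 else A $ i $ j)"
    by (cases "j = a") (auto simp: sum.remove[of "UNIV - {a}" j] intro!: sum.neutral)
  finally show ?thesis .
qed

text \<open>The Levi form of \<open>log G\<close> degenerates along the fibre direction \<open>v\<close>. In a basis in which \<open>v\<close>
  replaces the \<open>a\<close>-th vector, its determinant on the complement is a Schur complement.\<close>

lemma det_log_minor:
  fixes A :: "complex^'n::finite^'n"
  assumes va: "v $ a = 1" and b: "\<And>\<alpha>. b \<alpha> = (\<Sum>\<beta>\<in>UNIV. A $ \<alpha> $ \<beta> * cnj (v $ \<beta>))"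
    and c: "\<And>\<beta>. c \<beta> = (\<Sum>\<alpha>\<in>UNIV. v $ \<alpha> * A $ \<alpha> $ \<beta>)"
    and G: "G = (\<Sum>\<alpha>\<in>UNIV. v $ \<alpha> * b \<alpha>)" "G \<noteq> 0"
  shows "det (\<chi> \<alpha> \<beta>. if \<alpha> = a \<or> \<beta> = a then of_bool (\<alpha> = \<beta>) else A $ \<alpha> $ \<beta> / G - b \<alpha> * c \<beta> / G^2)
      = det A / G ^ CARD('n)"
proof -
  define vb where "vb = (\<chi> i. cnj (v $ i))"
  define w where "w = (\<chi> \<alpha>. if \<alpha> = a then 1 else - b \<alpha> / G)"
  define u where "u = (\<chi> \<beta>. if \<beta> = a then 1 else - c \<beta> / G)"
  define L where "L = (\<chi> \<alpha> \<beta>. if \<alpha> = a \<or> \<beta> = a then of_bool (\<alpha> = \<beta>) else A $ \<alpha> $ \<beta> / G - b \<alpha> * c \<beta> / G^2)"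
  define B where "B = replace_row a v ** A ** replace_column a vb"
  have B: "B $ \<alpha> $ \<beta> = (if \<beta> = a then (if \<alpha> = a then G else b \<alpha>) else (if \<alpha> = a then c \<beta> else A $ \<alpha> $ \<beta>))" for \<alpha> \<beta>
  proof -
    have "(\<Sum>k\<in>UNIV. (\<Sum>i\<in>UNIV. v $ i * A $ i $ k) * cnj (v $ k)) = G"
      unfolding G b sum_distrib_left sum_distrib_right by (subst sum.swap) (simp add: mult_ac)
    then show ?thesis
      by (simp add: B_def mult_replace_column replace_row_mult vb_def b c)
  qed
  have "replace_column a w ** B ** replace_row a u = (\<chi> i. G *s L $ i)"
    by (simp add: vec_eq_iff mult_replace_row replace_column_mult B L_def w_def u_def G(2) field_simps power2_eq_square)
  then have "det (replace_column a w) * det B * det (replace_row a u) = det (\<chi> i. G *s L $ i)"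
    by (metis det_mul)
  also have "det (\<chi> i. G *s L $ i) = G ^ CARD('n) * det L"
    using det_rows_mul[of "\<lambda>_. G" "\<lambda>i. L $ i"] by (simp add: vec_lambda_eta)
  also have "det B = det A"
    by (simp add: B_def det_mul det_replace_column det_replace_row' va vb_def)
  finally have "det A = G ^ CARD('n) * det L"
    by (simp add: det_replace_column det_replace_row' w_def u_def)
  then show ?thesis using G(2) by (simp add: L_def)
qed

context finsler_chart
begin

lemma euler_D_zbar_G: "p \<in> S \<Longrightarrow> euler (D_zbar \<mu> G) p = D_zbar \<mu> G p"
proof -
  assume p: "p \<in> S"
  have "D_zbar \<mu> (euler G) p = D_zbar \<mu> G p"
    by (rule derivation_cong[OF derivation_D(2) open_S p diffble[OF smooth_euler[OF smooth_G] p] euler_G])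
  then show ?thesis
    using euler_D_commute[OF smooth_G p, of "D_zbar \<mu>"] by (simp add: D_zbar_v_coordinate)
qed

text \<open>By homogeneity \<open>\<partial>G/\<partial>v\<^sup>\<alpha>\<close> is \<open>G\<^sub>\<alpha>\<^sub>\<beta>\<close> contracted with the conjugate of \<open>v\<close>, so that contracting it with
  \<open>\<Gamma>\<^sup>\<alpha>\<^sub>;\<^sub>\<mu>\<close> undoes the inverse metric and leaves an Euler derivative of \<open>\<partial>G/\<partial>z\<^sup>\<mu>\<close>.\<close>

lemma del_G: assumes p: "p \<in> S" shows "del g \<mu> G p = 0"
proof -
  define H where "H l = D_vbar l (D_z \<mu> G) p" for l
  have H: "H l = cnj (D_v l (D_zbar \<mu> G) p)" for l
  proof -
    have "H l = D_vbar l (\<lambda>x. cnj (D_zbar \<mu> G x)) p"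
      unfolding H_def
    proof (rule derivation_cong[OF derivation_D(4) open_S p])
      show "D_z \<mu> G x = cnj (D_zbar \<mu> G x)" if "x \<in> S" for x
        using D_cnj(1)[OF diffble[OF smooth_G that], of \<mu>] by simp
    qed (intro diffble[OF _ p] smooth_D smooth_G)
    then show ?thesis using D_cnj(4)[OF diffble[OF smooth_D(2)[OF smooth_G] p]] by simp
  qed
  have "(\<Sum>\<alpha>\<in>UNIV. Gam1 g \<alpha> \<mu> p * D_v \<alpha> G p) = (\<Sum>\<alpha>\<in>UNIV. \<Sum>l\<in>UNIV. \<Sum>\<beta>\<in>UNIV. H l * cnj (snd p $ \<beta>) * (N l \<alpha> p * M \<alpha> \<beta> p))"
    by (simp add: Gam1_def M_vbar[OF p, symmetric] H_def[symmetric] sum_product mult_ac)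
  also have "\<dots> = (\<Sum>\<beta>\<in>UNIV. \<Sum>l\<in>UNIV. \<Sum>\<alpha>\<in>UNIV. H l * cnj (snd p $ \<beta>) * (N l \<alpha> p * M \<alpha> \<beta> p))"
    by (rule sum_swap3)
  also have "\<dots> = (\<Sum>\<beta>\<in>UNIV. \<Sum>l\<in>UNIV. H l * cnj (snd p $ \<beta>) * of_bool (l = \<beta>))"
    by (simp only: sum_distrib_left[symmetric] NM_sum[OF p])
  also have "\<dots> = (\<Sum>\<beta>\<in>UNIV. cnj (snd p $ \<beta> * D_v \<beta> (D_zbar \<mu> G) p))"
    by (simp add: H mult.commute)
  also have "\<dots> = cnj (euler (D_zbar \<mu> G) p)" by (simp add: euler_def)
  also have "\<dots> = cnj (D_zbar \<mu> G p)" by (simp add: euler_D_zbar_G[OF p])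
  also have "\<dots> = D_z \<mu> G p" using D_cnj(1)[OF diffble[OF smooth_G p], of \<mu>] by simp
  finally show ?thesis by (simp add: del_def)
qed

text \<open>In the coordinates of a slice, the volume form is a constant multiple of this density.\<close>

definition density :: "'n cpair \<Rightarrow> complex" where
  "density p = (det (G_mat g p))\<^sup>2 * inverse (G p ^ CARD('n))"

lemma smooth_det: "smooth_on S (\<lambda>p. det (G_mat g p))"
  by (rule smooth_on_det[OF open_S smooth_M])

lemma smooth_G_power: "smooth_on S (\<lambda>x. inverse (G x ^ n))"
proof (rule smooth_on_inverse[OF open_S])
  show "smooth_on S (\<lambda>x. G x ^ n)"
    by (induction n) (auto intro: smooth_on_mult open_S smooth_G)
qed (use G_nonzero in auto)

lemma smooth_density: "smooth_on S density"
  unfolding density_def[abs_def] power2_eq_square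
  by (intro smooth_on_mult smooth_det smooth_G_power open_S)

text \<open>The logarithmic derivative of the density. Its horizontal part is twice the trace of the connection, the
  factor \<open>G\<^sup>-\<^sup>n\<close> being horizontally constant.\<close>

lemma derivation_density:
  assumes X: "derivation_at p X" and p: "p \<in> S" and eig: "X G = c * G p"
  shows "X density = density p * (2 * (\<Sum>i\<in>UNIV. \<Sum>j\<in>UNIV. N j i p * X (M i j)) - of_nat CARD('n) * c)"
proof -
  have det: "X (\<lambda>p. det (G_mat g p)) = det (G_mat g p) * (\<Sum>i\<in>UNIV. \<Sum>j\<in>UNIV. N j i p * X (M i j))"
    by (rule derivation_det[OF X diffble[OF smooth_M p] NM[OF p]])
  have inv: "X (\<lambda>x. inverse (G x ^ CARD('n))) = - of_nat CARD('n) * c * inverse (G p ^ CARD('n))"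
    by (rule derivation_inverse_power[OF X open_S p smooth_G G_nonzero eig])
  have sq: "X (\<lambda>p. det (G_mat g p) * det (G_mat g p)) = 2 * (det (G_mat g p) * X (\<lambda>p. det (G_mat g p)))"
    by (subst derivation_mult[OF X]) (auto intro!: diffble[OF _ p] smooth_det)
  have "X density = X (\<lambda>p. (det (G_mat g p) * det (G_mat g p)) * inverse (G p ^ CARD('n)))"
    by (simp add: density_def[abs_def] power2_eq_square)
  also have "\<dots> = X (\<lambda>p. det (G_mat g p) * det (G_mat g p)) * inverse (G p ^ CARD('n))
     + (det (G_mat g p) * det (G_mat g p)) * X (\<lambda>x. inverse (G x ^ CARD('n)))"
    by (rule derivation_mult[OF X]) (intro diffble[OF _ p] smooth_on_mult smooth_det smooth_G_power open_S)+
  finally show ?thesis unfolding sq det inv density_def by (simp add: algebra_simps power2_eq_square)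
qed

lemma del_density: "p \<in> S \<Longrightarrow> del g \<mu> density p = 2 * density p * (\<Sum>\<gamma>\<in>UNIV. Gam2 g \<gamma> \<gamma> \<mu> p)"
  using derivation_density[OF derivation_del, of p \<mu> 0] by (simp add: del_G Gam2_def)

lemma euler_density: "p \<in> S \<Longrightarrow> euler density p = - of_nat CARD('n) * density p"
  using derivation_density[OF derivation_euler, of p 1] by (simp add: euler_G euler_M)

text \<open>The components, in slice coordinates, of the vector field of type \<open>(1,0)\<close> on the projectivized bundle
  that represents the horizontal field \<open>G\<^sup>\<beta>\<^sup>\<mu> \<delta>\<^sub>\<mu>\<close>, multiplied by the density. The
  correction by a multiple of the Euler field makes the field tangent to the slice \<open>v\<^sup>a = 1\<close>.\<close>

definition flux_z :: "'n \<Rightarrow> 'n \<Rightarrow> 'n cpair \<Rightarrow> complex" where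
  "flux_z \<beta> \<mu> p = density p * N \<beta> \<mu> p"

definition flux_v :: "'n \<Rightarrow> 'n \<Rightarrow> 'n \<Rightarrow> 'n cpair \<Rightarrow> complex" where
  "flux_v a \<beta> \<alpha> p = - (\<Sum>\<mu>\<in>UNIV. flux_z \<beta> \<mu> p *
     (Gam1 g \<alpha> \<mu> p - snd p $ \<alpha> * (Gam1 g a \<mu> p * inverse (snd p $ a))))"

definition S_slice where "S_slice a = {p \<in> S. snd p $ a \<noteq> 0}"

lemma open_S_slice: "open (S_slice a)"
proof -
  have "S_slice a = S \<inter> (\<lambda>p. snd p $ a) -` (- {0})" by (auto simp: S_slice_def)
  then show ?thesis
    by (simp only:) (intro open_Int open_S open_vimage continuous_intros; auto)
qed

lemma smooth_flux_z: "smooth_on S (flux_z \<beta> \<mu>)"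
  unfolding flux_z_def[abs_def] by (intro smooth_on_mult smooth_density smooth_N open_S)

lemma smooth_inverse_v: "smooth_on (S_slice a) (\<lambda>p. inverse (snd p $ a))"
  by (intro smooth_on_inverse smooth_on_v_coordinate open_S_slice) (auto simp: S_slice_def)

lemma S_slice_subset: "S_slice a \<subseteq> S" by (auto simp: S_slice_def)

lemmas smooth_slice = smooth_on_subset[OF _ S_slice_subset]

lemma smooth_flux_v: "smooth_on (S_slice a) (flux_v a \<beta> \<alpha>)"
  unfolding flux_v_def[abs_def]
  by (intro smooth_on_minus smooth_on_sum smooth_on_mult smooth_on_diff open_S_slice smooth_slice[OF smooth_flux_z]
     smooth_slice[OF smooth_Gam1] smooth_inverse_v smooth_on_v_coordinate)

lemma flux_v_a: "p \<in> S_slice a \<Longrightarrow> flux_v a \<beta> a p = 0"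
  unfolding flux_v_def S_slice_def by (intro iffD2[OF neg_equal_0_iff_equal] sum.neutral ballI) (simp add: field_simps)

text \<open>The divergence of the flux is the trace of the torsion: \<open>\<delta>\<^sub>\<mu>\<close> of the density contributes
  \<open>2\<Gamma>\<^sup>\<gamma>\<^sub>\<gamma>\<^sub>;\<^sub>\<mu>\<close>, the vertical divergence of \<open>\<Gamma>\<^sup>\<alpha>\<^sub>;\<^sub>\<mu>\<close> removes one of the two traces, and
  the derivative of the inverse metric contributes the other contraction. The Euler correction has divergence
  zero, being homogeneous of degree \<open>- n\<close> apart from the factor \<open>v\<close>.\<close>

lemma divergence_flux:
  assumes p: "p \<in> S_slice a"
  shows "(\<Sum>\<mu>\<in>UNIV. D_z \<mu> (flux_z \<beta> \<mu>) p) + (\<Sum>\<alpha>\<in>UNIV. D_v \<alpha> (flux_v a \<beta> \<alpha>) p)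
     = density p * (\<Sum>\<sigma>\<in>UNIV. N \<beta> \<sigma> p * torsion_trace \<sigma> p)"
proof -
  have pS: "p \<in> S" and va: "snd p $ a \<noteq> 0" using p by (auto simp: S_slice_def)
  note dsl = smooth_on_differentiable[OF open_S_slice _ p]
  define K where "K \<mu> = (\<lambda>x. flux_z \<beta> \<mu> x * (Gam1 g a \<mu> x * inverse (snd x $ a)))" for \<mu>
  have sK: "smooth_on (S_slice a) (K \<mu>)" for \<mu>
    unfolding K_def by (intro smooth_on_mult open_S_slice smooth_slice[OF smooth_flux_z] smooth_slice[OF smooth_Gam1] smooth_inverse_v)
  have eulerY: "euler (flux_z \<beta> \<mu>) p = - of_nat CARD('n) * flux_z \<beta> \<mu> p" for \<mu>
  proof -
    have "euler (flux_z \<beta> \<mu>) p = euler density p * N \<beta> \<mu> p + density p * euler (N \<beta> \<mu>) p"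
      unfolding flux_z_def[abs_def]
      by (rule derivation_mult[OF derivation_euler]) (intro diffble[OF _ pS] smooth_density smooth_N)+
    then show ?thesis by (simp add: euler_density[OF pS] euler_N[OF pS] flux_z_def)
  qed
  have eulerK: "euler (K \<mu>) p = - of_nat CARD('n) * K \<mu> p" for \<mu>
  proof -
    have ev: "euler (\<lambda>x. snd x $ a) p = 1 * snd p $ a"
      by (simp add: euler_def D_v_coordinate)
    have ei: "euler (\<lambda>x. inverse (snd x $ a)) p = - inverse (snd p $ a)"
      using derivation_inverse_power[OF derivation_euler open_S_slice p smooth_on_v_coordinate[OF open_S_slice] _ ev, of 1]
      by (simp add: S_slice_def)
    have "euler (\<lambda>x. Gam1 g a \<mu> x * inverse (snd x $ a)) p = 0"
      by (subst derivation_mult[OF derivation_euler])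
        (auto intro!: dsl smooth_slice[OF smooth_Gam1] smooth_inverse_v simp: ei euler_Gam1[OF pS])
    moreover have "euler (K \<mu>) p = euler (flux_z \<beta> \<mu>) p * (Gam1 g a \<mu> p * inverse (snd p $ a))
        + flux_z \<beta> \<mu> p * euler (\<lambda>x. Gam1 g a \<mu> x * inverse (snd x $ a)) p"
      unfolding K_def by (rule derivation_mult[OF derivation_euler])
        (intro dsl smooth_on_mult open_S_slice smooth_slice[OF smooth_flux_z] smooth_slice[OF smooth_Gam1] smooth_inverse_v)+
    ultimately show ?thesis by (simp add: eulerY K_def)
  qed
  have Dv: "D_v \<alpha> (flux_v a \<beta> \<alpha>) p = - (\<Sum>\<mu>\<in>UNIV. D_v \<alpha> (flux_z \<beta> \<mu>) p * Gam1 g \<alpha> \<mu> p + flux_z \<beta> \<mu> p * Gam2 g \<alpha> \<alpha> \<mu> p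
       - (K \<mu> p + snd p $ \<alpha> * D_v \<alpha> (K \<mu>) p))" for \<alpha>
  proof -
    have 1: "D_v \<alpha> (\<lambda>x. flux_z \<beta> \<mu> x * Gam1 g \<alpha> \<mu> x) p = D_v \<alpha> (flux_z \<beta> \<mu>) p * Gam1 g \<alpha> \<mu> p + flux_z \<beta> \<mu> p * Gam2 g \<alpha> \<alpha> \<mu> p" for \<mu>
      unfolding D_v_Gam1[OF pS, symmetric]
      by (rule derivation_mult[OF derivation_D(3)]) (intro diffble[OF _ pS] smooth_flux_z smooth_Gam1)+
    have 2: "D_v \<alpha> (\<lambda>x. snd x $ \<alpha> * K \<mu> x) p = K \<mu> p + snd p $ \<alpha> * D_v \<alpha> (K \<mu>) p" for \<mu>
      by (subst derivation_mult[OF derivation_D(3)])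
        (auto intro!: dsl sK smooth_on_v_coordinate open_S_slice simp: D_v_coordinate)
    have "flux_v a \<beta> \<alpha> = (\<lambda>x. - (\<Sum>\<mu>\<in>UNIV. flux_z \<beta> \<mu> x * Gam1 g \<alpha> \<mu> x - snd x $ \<alpha> * K \<mu> x))"
      by (simp add: fun_eq_iff flux_v_def K_def algebra_simps)
    then have "D_v \<alpha> (flux_v a \<beta> \<alpha>) p = D_v \<alpha> (\<lambda>x. - (\<Sum>\<mu>\<in>UNIV. flux_z \<beta> \<mu> x * Gam1 g \<alpha> \<mu> x - snd x $ \<alpha> * K \<mu> x)) p"
      by simp
    also have "\<dots> = - D_v \<alpha> (\<lambda>x. \<Sum>\<mu>\<in>UNIV. flux_z \<beta> \<mu> x * Gam1 g \<alpha> \<mu> x - snd x $ \<alpha> * K \<mu> x) p"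
      by (rule derivation_minus[OF derivation_D(3)])
        (intro dsl smooth_on_sum smooth_on_diff smooth_on_mult open_S_slice smooth_slice[OF smooth_flux_z] smooth_slice[OF smooth_Gam1] sK smooth_on_v_coordinate)
    also have "D_v \<alpha> (\<lambda>x. \<Sum>\<mu>\<in>UNIV. flux_z \<beta> \<mu> x * Gam1 g \<alpha> \<mu> x - snd x $ \<alpha> * K \<mu> x) p
       = (\<Sum>\<mu>\<in>UNIV. D_v \<alpha> (\<lambda>x. flux_z \<beta> \<mu> x * Gam1 g \<alpha> \<mu> x - snd x $ \<alpha> * K \<mu> x) p)"
      by (rule derivation_sum[OF derivation_D(3)])
        (simp, intro dsl smooth_on_diff smooth_on_mult open_S_slice smooth_slice[OF smooth_flux_z] smooth_slice[OF smooth_Gam1] sK smooth_on_v_coordinate)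
    also have "\<dots> = (\<Sum>\<mu>\<in>UNIV. D_v \<alpha> (\<lambda>x. flux_z \<beta> \<mu> x * Gam1 g \<alpha> \<mu> x) p - D_v \<alpha> (\<lambda>x. snd x $ \<alpha> * K \<mu> x) p)"
      by (intro sum.cong refl derivation_diff[OF derivation_D(3)] dsl smooth_on_mult open_S_slice
          smooth_slice[OF smooth_flux_z] smooth_slice[OF smooth_Gam1] sK smooth_on_v_coordinate)
    finally show ?thesis by (simp add: 1 2)
  qed
  have "(\<Sum>\<alpha>\<in>UNIV. D_v \<alpha> (flux_v a \<beta> \<alpha>) p) = - (\<Sum>\<mu>\<in>UNIV. \<Sum>\<alpha>\<in>UNIV. D_v \<alpha> (flux_z \<beta> \<mu>) p * Gam1 g \<alpha> \<mu> p + flux_z \<beta> \<mu> p * Gam2 g \<alpha> \<alpha> \<mu> p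
       - (K \<mu> p + snd p $ \<alpha> * D_v \<alpha> (K \<mu>) p))"
    unfolding Dv sum_negf by (subst sum.swap) (rule refl)
  also have "\<dots> = - (\<Sum>\<mu>\<in>UNIV. (\<Sum>\<alpha>\<in>UNIV. Gam1 g \<alpha> \<mu> p * D_v \<alpha> (flux_z \<beta> \<mu>) p) + flux_z \<beta> \<mu> p * (\<Sum>\<alpha>\<in>UNIV. Gam2 g \<alpha> \<alpha> \<mu> p)
       - (of_nat CARD('n) * K \<mu> p + euler (K \<mu>) p))"
    by (simp add: sum.distrib sum_subtractf euler_def sum_distrib_left mult.commute)
  finally have Sv: "(\<Sum>\<alpha>\<in>UNIV. D_v \<alpha> (flux_v a \<beta> \<alpha>) p) = 
     - (\<Sum>\<mu>\<in>UNIV. (\<Sum>\<alpha>\<in>UNIV. Gam1 g \<alpha> \<mu> p * D_v \<alpha> (flux_z \<beta> \<mu>) p) + flux_z \<beta> \<mu> p * (\<Sum>\<alpha>\<in>UNIV. Gam2 g \<alpha> \<alpha> \<mu> p))"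
    by (simp add: eulerK)
  have delY: "del g \<mu> (flux_z \<beta> \<mu>) p = density p * (2 * (\<Sum>\<gamma>\<in>UNIV. Gam2 g \<gamma> \<gamma> \<mu> p) * N \<beta> \<mu> p - (\<Sum>\<sigma>\<in>UNIV. N \<beta> \<sigma> p * Gam2 g \<mu> \<sigma> \<mu> p))" for \<mu>
  proof -
    have "del g \<mu> (flux_z \<beta> \<mu>) p = del g \<mu> density p * N \<beta> \<mu> p + density p * del g \<mu> (N \<beta> \<mu>) p"
      unfolding flux_z_def[abs_def]
      by (rule derivation_mult[OF derivation_del]) (intro diffble[OF _ pS] smooth_density smooth_N)+
    moreover have "del g \<mu> (N \<beta> \<mu>) p = - (\<Sum>\<sigma>\<in>UNIV. N \<beta> \<sigma> p * Gam2 g \<mu> \<sigma> \<mu> p)"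
      unfolding derivation_N[OF derivation_del pS] Gam2_def by (simp add: sum_distrib_left mult_ac)
    ultimately show ?thesis by (simp add: del_density[OF pS] algebra_simps)
  qed
  have "(\<Sum>\<mu>\<in>UNIV. D_z \<mu> (flux_z \<beta> \<mu>) p) + (\<Sum>\<alpha>\<in>UNIV. D_v \<alpha> (flux_v a \<beta> \<alpha>) p)
     = (\<Sum>\<mu>\<in>UNIV. del g \<mu> (flux_z \<beta> \<mu>) p - flux_z \<beta> \<mu> p * (\<Sum>\<alpha>\<in>UNIV. Gam2 g \<alpha> \<alpha> \<mu> p))"
    unfolding Sv by (simp add: del_def sum.distrib sum_subtractf)
  also have "\<dots> = density p * ((\<Sum>\<mu>\<in>UNIV. N \<beta> \<mu> p * (\<Sum>\<gamma>\<in>UNIV. Gam2 g \<gamma> \<gamma> \<mu> p)) - (\<Sum>\<mu>\<in>UNIV. \<Sum>\<sigma>\<in>UNIV. N \<beta> \<sigma> p * Gam2 g \<mu> \<sigma> \<mu> p))"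
    unfolding delY flux_z_def sum_subtractf[symmetric] sum_distrib_left[of "density p"]
    by (intro sum.cong refl) (simp add: algebra_simps)
  also have "(\<Sum>\<mu>\<in>UNIV. \<Sum>\<sigma>\<in>UNIV. N \<beta> \<sigma> p * Gam2 g \<mu> \<sigma> \<mu> p) = (\<Sum>\<sigma>\<in>UNIV. N \<beta> \<sigma> p * (\<Sum>\<mu>\<in>UNIV. Gam2 g \<mu> \<sigma> \<mu> p))"
    unfolding sum_distrib_left by (rule sum.swap)
  finally show ?thesis
    by (simp add: torsion_trace_def sum_subtractf right_diff_distrib)
qed

text \<open>The product rule for \<open>f\<close> times the flux. The Euler correction in the flux annihilates the homogeneous
  function \<open>f\<close>, so the flux differentiates \<open>f\<close> exactly by \<open>\<delta>\<^sub>\<mu>\<close>.\<close>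

lemma integration_by_parts_pointwise:
  assumes p: "p \<in> S_slice a" and chi: "smooth_on S f" and hom: "euler f p = 0"
  shows "density p * (\<Sum>\<mu>\<in>UNIV. N \<beta> \<mu> p * del g \<mu> f p) + f p * (density p * (\<Sum>\<sigma>\<in>UNIV. N \<beta> \<sigma> p * torsion_trace \<sigma> p))
    = (\<Sum>\<mu>\<in>UNIV. D_z \<mu> (\<lambda>x. f x * flux_z \<beta> \<mu> x) p) + (\<Sum>\<alpha>\<in>UNIV-{a}. D_v \<alpha> (\<lambda>x. f x * flux_v a \<beta> \<alpha> x) p)"
proof -
  have pS: "p \<in> S" using p by (auto simp: S_slice_def)
  note dsl = smooth_on_differentiable[OF open_S_slice _ p]
  have 1: "D_z \<mu> (\<lambda>x. f x * flux_z \<beta> \<mu> x) p = D_z \<mu> f p * flux_z \<beta> \<mu> p + f p * D_z \<mu> (flux_z \<beta> \<mu>) p" for \<mu>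
    by (rule derivation_mult[OF derivation_D(1)]) (intro diffble[OF _ pS] chi smooth_flux_z)+
  have 2: "D_v \<alpha> (\<lambda>x. f x * flux_v a \<beta> \<alpha> x) p = D_v \<alpha> f p * flux_v a \<beta> \<alpha> p + f p * D_v \<alpha> (flux_v a \<beta> \<alpha>) p" for \<alpha>
    by (rule derivation_mult[OF derivation_D(3)]) (intro dsl smooth_slice[OF chi] smooth_flux_v)+
  have 3: "D_v a (flux_v a \<beta> a) p = 0"
    using derivation_cong[OF derivation_D(3) open_S_slice p dsl[OF smooth_flux_v] flux_v_a, of a \<beta>]
      derivation_const[OF derivation_D(3)] by simp
  have "(\<Sum>\<alpha>\<in>UNIV. D_v \<alpha> f p * flux_v a \<beta> \<alpha> p) = 
     - (\<Sum>\<alpha>\<in>UNIV. \<Sum>\<mu>\<in>UNIV. flux_z \<beta> \<mu> p * (Gam1 g \<alpha> \<mu> p * D_v \<alpha> f p) - flux_z \<beta> \<mu> p * (Gam1 g a \<mu> p * inverse (snd p $ a)) * (snd p $ \<alpha> * D_v \<alpha> f p))"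
    unfolding flux_v_def mult_minus_right sum_negf sum_distrib_left
    by (intro arg_cong[where f = uminus] sum.cong refl) (simp add: algebra_simps)
  also have "\<dots> = - (\<Sum>\<mu>\<in>UNIV. flux_z \<beta> \<mu> p * (\<Sum>\<alpha>\<in>UNIV. Gam1 g \<alpha> \<mu> p * D_v \<alpha> f p) - flux_z \<beta> \<mu> p * (Gam1 g a \<mu> p * inverse (snd p $ a)) * euler f p)"
    by (subst sum.swap) (simp add: sum_subtractf sum_distrib_left euler_def)
  finally have "(\<Sum>\<mu>\<in>UNIV. D_z \<mu> f p * flux_z \<beta> \<mu> p) + (\<Sum>\<alpha>\<in>UNIV. D_v \<alpha> f p * flux_v a \<beta> \<alpha> p)
     = (\<Sum>\<mu>\<in>UNIV. flux_z \<beta> \<mu> p * del g \<mu> f p)"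
    by (simp add: hom del_def right_diff_distrib sum_subtractf mult.commute)
  also have "\<dots> = density p * (\<Sum>\<mu>\<in>UNIV. N \<beta> \<mu> p * del g \<mu> f p)"
    by (simp add: flux_z_def sum_distrib_left mult.assoc)
  finally have 4: "(\<Sum>\<mu>\<in>UNIV. D_z \<mu> f p * flux_z \<beta> \<mu> p) + (\<Sum>\<alpha>\<in>UNIV. D_v \<alpha> f p * flux_v a \<beta> \<alpha> p)
     = density p * (\<Sum>\<mu>\<in>UNIV. N \<beta> \<mu> p * del g \<mu> f p)" .
  have "(\<Sum>\<alpha>\<in>UNIV-{a}. D_v \<alpha> (\<lambda>x. f x * flux_v a \<beta> \<alpha> x) p) = (\<Sum>\<alpha>\<in>UNIV. D_v \<alpha> (\<lambda>x. f x * flux_v a \<beta> \<alpha> x) p)"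
    by (subst sum.remove[of UNIV a]) (simp_all add: 2 3 flux_v_a[OF p])
  then show ?thesis
    unfolding 4[symmetric] divergence_flux[OF p, of \<beta>, symmetric] 1 2
    by (simp add: sum.distrib sum_distrib_left algebra_simps)
qed

lemma logG_mat_eq:
  assumes p: "p \<in> S"
  shows "logG_mat g p $ \<alpha> $ \<beta> = M \<alpha> \<beta> p / G p - D_v \<alpha> G p * D_vbar \<beta> G p / (G p)\<^sup>2"
proof -
  have dlog: "D_vbar \<beta> (\<lambda>q. complex_of_real (ln (g q))) x = D_vbar \<beta> G x * inverse (G x ^ 1)" if x: "x \<in> S" for x
  proof -
    have dg: "(g has_derivative frechet_derivative g (at x)) (at x)"
      by (rule smooth_on_has_derivative[OF open_S smooth_g x])
    have "((\<lambda>q. complex_of_real (ln (g q))) has_derivative (\<lambda>h. complex_of_real (frechet_derivative g (at x) h / g x))) (at x)"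
      using g_pos[OF x]
      by (auto intro!: bounded_linear.has_derivative[OF bounded_linear_of_real] derivative_eq_intros dg simp: field_simps)
    moreover have "(G has_derivative (\<lambda>h. complex_of_real (frechet_derivative g (at x) h))) (at x)"
      by (rule bounded_linear.has_derivative[OF bounded_linear_of_real dg])
    ultimately have F: "frechet_derivative (\<lambda>q. complex_of_real (ln (g q))) (at x) = (\<lambda>h. complex_of_real (frechet_derivative g (at x) h / g x))"
      "frechet_derivative G (at x) = (\<lambda>h. complex_of_real (frechet_derivative g (at x) h))"
      using frechet_derivative_at by metis+
    show ?thesis
      unfolding D_vbar_def F using G_nonzero[OF x] by (simp add: field_simps)
  qed
  have sm: "smooth_on S (\<lambda>x. D_vbar \<beta> G x * inverse (G x ^ 1))"
    by (intro smooth_on_mult open_S smooth_D smooth_G smooth_G_power)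
  have inv: "D_v \<alpha> (\<lambda>x. inverse (G x ^ 1)) p = - D_v \<alpha> G p / (G p)\<^sup>2"
    using derivation_inverse_power[OF derivation_D(3) open_S p smooth_G G_nonzero, of \<alpha> "D_v \<alpha> G p / G p" 1] G_nonzero[OF p]
    by (simp add: field_simps power2_eq_square)
  have "logG_mat g p $ \<alpha> $ \<beta> = D_v \<alpha> (D_vbar \<beta> (\<lambda>q. complex_of_real (ln (g q)))) p"
    by (simp add: logG_mat_def)
  also have "\<dots> = D_v \<alpha> (\<lambda>x. D_vbar \<beta> G x * inverse (G x ^ 1)) p"
    by (rule derivation_cong[OF derivation_D(3) open_S p diffble[OF sm p], symmetric]) (simp only: dlog)
  also have "\<dots> = M \<alpha> \<beta> p * inverse (G p ^ 1) + D_vbar \<beta> G p * D_v \<alpha> (\<lambda>x. inverse (G x ^ 1)) p"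
    unfolding M_at by (rule derivation_mult[OF derivation_D(3)]) (intro diffble[OF _ p] smooth_D smooth_G smooth_G_power)+
  finally show ?thesis unfolding inv by (simp add: field_simps)
qed

text \<open>The Levi form of \<open>log G\<close> is a rank one perturbation of \<open>G\<^sub>\<alpha>\<^sub>\<beta>/G\<close>, and by homogeneity the perturbing vector
  is \<open>G\<^sub>\<alpha>\<^sub>\<beta>\<close> contracted with \<open>v\<close>.\<close>

lemma det_logG_minor:
  assumes p: "p \<in> S" and va: "snd p $ a = 1"
  shows "det (\<chi> \<alpha> \<beta>. if \<alpha> = a \<or> \<beta> = a then of_bool (\<alpha> = \<beta>) else logG_mat g p $ \<alpha> $ \<beta>)
    = det (G_mat g p) / G p ^ CARD('n)"
  unfolding logG_mat_eq[OF p]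
proof (rule det_log_minor[OF va])
  show "D_v \<alpha> G p = (\<Sum>\<beta>\<in>UNIV. M \<alpha> \<beta> p * cnj (snd p $ \<beta>))" for \<alpha> by (rule M_vbar[OF p, symmetric])
  show "D_vbar \<beta> G p = (\<Sum>\<alpha>\<in>UNIV. snd p $ \<alpha> * M \<alpha> \<beta> p)" for \<beta> by (rule M_v[OF p, symmetric])
  show "G p = (\<Sum>\<alpha>\<in>UNIV. snd p $ \<alpha> * D_v \<alpha> G p)" using euler_G[OF p] by (simp add: euler_def)
qed (rule G_nonzero[OF p])

lemma det_M_real: assumes "p \<in> S" shows "det (G_mat g p) \<in> \<real>" "det (G_mat g p) \<noteq> 0"
proof -
  have "cnj (det (G_mat g p)) = det (\<chi> i j. cnj (M i j p))"
    by (simp add: det_def)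
  also have "(\<chi> i j. cnj (M i j p)) = transpose (G_mat g p)"
    using M_hermitian[OF assms] by (simp add: vec_eq_iff transpose_def M_hermitian[OF assms, symmetric])
  finally show "det (G_mat g p) \<in> \<real>" by (simp add: Reals_cnj_iff)
  show "det (G_mat g p) \<noteq> 0" using invertible_M[OF assms] invertible_det_nz by blast
qed

end


lemma has_derivative_vec:
  fixes f :: "'n::finite \<Rightarrow> 'a::real_normed_vector \<Rightarrow> 'b::euclidean_space"
  assumes "\<And>i. (f i has_derivative f' i) (at x)"
  shows "((\<lambda>x. \<chi> i. f i x) has_derivative (\<lambda>h. \<chi> i. f' i h)) (at x)"
  unfolding has_derivative_componentwise_within[of "\<lambda>x. \<chi> i. f i x"]
  using assms by (auto simp: Basis_vec_def inner_axis intro!: has_derivative_inner_left)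

lemma cnj_of_bool [simp]: "cnj (of_bool b) = of_bool b"
  by (cases b) simp_all

section \<open>Covariance under holomorphic bundle maps\<close>

text \<open>Both a change of coordinates on the base and the fibrewise multiplication by a complex number are
  covered by fibrewise linear holomorphic maps.\<close>

locale finsler_bundle_map = src: finsler_chart S g + tgt: finsler_chart S' g'
  for S :: "'n::finite cpair set" and g and S' :: "'n cpair set" and g' +
  fixes W :: "'n cpair set" and t :: "complex^'n \<Rightarrow> complex^'n" and J B :: "complex^'n \<Rightarrow> complex^'n^'n"
    and dB :: "complex^'n \<Rightarrow> 'n \<Rightarrow> 'n \<Rightarrow> 'n \<Rightarrow> complex" and \<kappa> :: real
  assumes open_W: "open W" and W_subset: "W \<subseteq> S"
    and \<Phi>_in: "p \<in> W \<Longrightarrow> (t (fst p), B (fst p) *v snd p) \<in> S'"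
    and t_derivative: "p \<in> W \<Longrightarrow> (t has_derivative (\<lambda>h. J (fst p) *v h)) (at (fst p))"
    and B_derivative: "p \<in> W \<Longrightarrow> ((\<lambda>z. B z $ \<sigma> $ \<tau>) has_derivative (\<lambda>h. \<Sum>\<mu>\<in>UNIV. dB (fst p) \<sigma> \<tau> \<mu> * h $ \<mu>)) (at (fst p))"
    and B_invertible: "p \<in> W \<Longrightarrow> invertible (B (fst p))"
    and \<kappa>: "\<kappa> \<noteq> 0"
    and g_eq: "p \<in> W \<Longrightarrow> g p = \<kappa> * g' (t (fst p), B (fst p) *v snd p)"
begin

definition \<Phi> :: "'n cpair \<Rightarrow> 'n cpair" where
  "\<Phi> p = (t (fst p), B (fst p) *v snd p)"

definition \<eta> :: "'n cpair \<Rightarrow> 'n \<Rightarrow> 'n \<Rightarrow> complex" where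
  "\<eta> p \<mu> k = (\<Sum>\<tau>\<in>UNIV. dB (fst p) k \<tau> \<mu> * snd p $ \<tau>)"

lemma \<Phi>_in': "p \<in> W \<Longrightarrow> \<Phi> p \<in> S'"
  using \<Phi>_in by (simp add: \<Phi>_def)

lemma B_fst_derivative:
  assumes "p \<in> W"
  shows "((\<lambda>p. B (fst p) $ \<sigma> $ \<tau>) has_derivative (\<lambda>h. \<Sum>\<mu>\<in>UNIV. dB (fst p) \<sigma> \<tau> \<mu> * fst h $ \<mu>)) (at p)"
  by (rule has_derivative_compose[OF has_derivative_fst[OF has_derivative_ident] B_derivative[OF assms]])

lemma \<Phi>_derivative:
  assumes p: "p \<in> W"
  shows "(\<Phi> has_derivative (\<lambda>h. (J (fst p) *v fst h,
     \<chi> k. \<Sum>\<tau>\<in>UNIV. B (fst p) $ k $ \<tau> * snd h $ \<tau> + (\<Sum>\<mu>\<in>UNIV. dB (fst p) k \<tau> \<mu> * fst h $ \<mu>) * snd p $ \<tau>))) (at p)"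
proof -
  have v: "((\<lambda>p. snd p $ \<tau>) has_derivative (\<lambda>h. snd h $ \<tau>)) (at p)" for \<tau> and p :: "'n cpair"
    by (intro bounded_linear_imp_has_derivative bounded_linear_compose[OF bounded_linear_vec_nth] bounded_linear_snd)
  have "((\<lambda>p. t (fst p)) has_derivative (\<lambda>h. J (fst p) *v fst h)) (at p)"
    by (rule has_derivative_compose[OF has_derivative_fst[OF has_derivative_ident] t_derivative[OF p]])
  moreover have "((\<lambda>p. \<chi> k. \<Sum>\<tau>\<in>UNIV. B (fst p) $ k $ \<tau> * snd p $ \<tau>) has_derivative
     (\<lambda>h. \<chi> k. \<Sum>\<tau>\<in>UNIV. B (fst p) $ k $ \<tau> * snd h $ \<tau> + (\<Sum>\<mu>\<in>UNIV. dB (fst p) k \<tau> \<mu> * fst h $ \<mu>) * snd p $ \<tau>)) (at p)"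
    by (intro has_derivative_vec has_derivative_sum has_derivative_mult B_fst_derivative[OF p] v)
  ultimately show ?thesis
    unfolding \<Phi>_def[abs_def] matrix_vector_mult_def by (intro has_derivative_Pair)
qed

lemma
  assumes p: "p \<in> W" and f: "f differentiable (at (\<Phi> p))"
  shows D_v_\<Phi>: "D_v \<alpha> (\<lambda>x. f (\<Phi> x)) p = (\<Sum>k\<in>UNIV. D_v k f (\<Phi> p) * B (fst p) $ k $ \<alpha>)"
    and D_vbar_\<Phi>: "D_vbar \<alpha> (\<lambda>x. f (\<Phi> x)) p = (\<Sum>k\<in>UNIV. D_vbar k f (\<Phi> p) * cnj (B (fst p) $ k $ \<alpha>))"
    and D_z_\<Phi>: "D_z \<mu> (\<lambda>x. f (\<Phi> x)) p = (\<Sum>k\<in>UNIV. D_z k f (\<Phi> p) * J (fst p) $ k $ \<mu>) + (\<Sum>k\<in>UNIV. D_v k f (\<Phi> p) * \<eta> p \<mu> k)"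
proof -
  let ?L = "\<lambda>h. (J (fst p) *v fst h,
     \<chi> k. \<Sum>\<tau>\<in>UNIV. B (fst p) $ k $ \<tau> * snd h $ \<tau> + (\<Sum>\<mu>\<in>UNIV. dB (fst p) k \<tau> \<mu> * fst h $ \<mu>) * snd p $ \<tau>)"
  have ax: "axis i x $ k = of_bool (k = i) * x" for i k and x :: complex by (simp add: axis_def)
  have v1: "?L (0, axis \<alpha> x) = (0, x *s (\<chi> k. B (fst p) $ k $ \<alpha>))" for x
    by (simp add: vec_eq_iff ax mult.left_commute[of _ "of_bool _"])
  have z1: "?L (axis \<mu> x, 0) = (x *s (\<chi> k. J (fst p) $ k $ \<mu>), x *s (\<chi> k. \<eta> p \<mu> k))" for x
    by (simp add: vec_eq_iff matrix_vector_mult_def ax \<eta>_def sum_distrib_left mult.left_commute[of _ "of_bool _"])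
      (simp add: mult_ac)
  have v: "?L (0, axis \<alpha> 1) = (0, \<chi> k. B (fst p) $ k $ \<alpha>)" "?L (0, axis \<alpha> \<i>) = (\<i> *s 0, \<i> *s (\<chi> k. B (fst p) $ k $ \<alpha>))"
    unfolding v1 by (simp_all add: vec_eq_iff)
  have z: "?L (axis \<mu> 1, 0) = (\<chi> k. J (fst p) $ k $ \<mu>, \<chi> k. \<eta> p \<mu> k)"
    "?L (axis \<mu> \<i>, 0) = (\<i> *s (\<chi> k. J (fst p) $ k $ \<mu>), \<i> *s (\<chi> k. \<eta> p \<mu> k))"
    unfolding z1 by (simp_all add: vec_eq_iff)
  note ch = wirtinger_chain[OF f \<Phi>_derivative[OF p]]
  show "D_v \<alpha> (\<lambda>x. f (\<Phi> x)) p = (\<Sum>k\<in>UNIV. D_v k f (\<Phi> p) * B (fst p) $ k $ \<alpha>)"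
    unfolding D_v_wirtinger[of \<alpha>] using ch(1)[OF v] by simp
  show "D_vbar \<alpha> (\<lambda>x. f (\<Phi> x)) p = (\<Sum>k\<in>UNIV. D_vbar k f (\<Phi> p) * cnj (B (fst p) $ k $ \<alpha>))"
    unfolding D_vbar_wirtinger[of \<alpha>] using ch(2)[OF v] by simp
  show "D_z \<mu> (\<lambda>x. f (\<Phi> x)) p = (\<Sum>k\<in>UNIV. D_z k f (\<Phi> p) * J (fst p) $ k $ \<mu>) + (\<Sum>k\<in>UNIV. D_v k f (\<Phi> p) * \<eta> p \<mu> k)"
    unfolding D_z_wirtinger[of \<mu>] using ch(1)[OF z] by simp
qed

lemma D_B:
  assumes p: "p \<in> W"
  shows "D_v \<alpha> (\<lambda>x. cnj (B (fst x) $ \<sigma> $ \<tau>)) p = 0" "D_z \<alpha> (\<lambda>x. cnj (B (fst x) $ \<sigma> $ \<tau>)) p = 0"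
proof -
  have fd: "frechet_derivative (\<lambda>x. B (fst x) $ \<sigma> $ \<tau>) (at p) = (\<lambda>h. \<Sum>\<mu>\<in>UNIV. dB (fst p) \<sigma> \<tau> \<mu> * fst h $ \<mu>)"
    using frechet_derivative_at[OF B_fst_derivative[OF p]] by metis
  have df: "(\<lambda>x. B (fst x) $ \<sigma> $ \<tau>) differentiable (at p)"
    using B_fst_derivative[OF p] differentiable_def by blast
  have ax: "axis i x $ k = of_bool (k = i) * x" for i k :: 'n and x :: complex by (simp add: axis_def)
  have "D_vbar \<alpha> (\<lambda>x. B (fst x) $ \<sigma> $ \<tau>) p = 0" "D_zbar \<alpha> (\<lambda>x. B (fst x) $ \<sigma> $ \<tau>) p = 0"
    unfolding D_vbar_def D_zbar_def fd by (simp_all add: ax mult.left_commute[of _ "of_bool _"])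
      (simp add: mult.commute[of _ \<i>])
  then show "D_v \<alpha> (\<lambda>x. cnj (B (fst x) $ \<sigma> $ \<tau>)) p = 0" "D_z \<alpha> (\<lambda>x. cnj (B (fst x) $ \<sigma> $ \<tau>)) p = 0"
    by (simp_all add: D_cnj[OF df])
qed

lemma in_S: "p \<in> W \<Longrightarrow> p \<in> S" using W_subset by auto

lemma differentiable_comp_\<Phi>: "p \<in> W \<Longrightarrow> f differentiable (at (\<Phi> p)) \<Longrightarrow> (\<lambda>x. f (\<Phi> x)) differentiable (at p)"
  using has_derivative_compose[OF \<Phi>_derivative] unfolding differentiable_def by blast

lemma D_vbar_G:
  assumes p: "p \<in> W"
  shows "D_vbar \<beta> src.G p = (\<Sum>\<tau>\<in>UNIV. of_real \<kappa> * (cnj (B (fst p) $ \<tau> $ \<beta>) * D_vbar \<tau> tgt.G (\<Phi> p)))"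
proof -
  have d: "tgt.G differentiable (at (\<Phi> p))" by (rule tgt.diffble[OF tgt.smooth_G \<Phi>_in'[OF p]])
  have "D_vbar \<beta> src.G p = D_vbar \<beta> (\<lambda>x. of_real \<kappa> * tgt.G (\<Phi> x)) p"
    by (rule derivation_cong[OF derivation_D(4) open_W p src.diffble[OF src.smooth_G in_S[OF p]]])
      (simp add: g_eq \<Phi>_def)
  also have "\<dots> = of_real \<kappa> * D_vbar \<beta> (\<lambda>x. tgt.G (\<Phi> x)) p"
    by (rule derivation_cmult[OF derivation_D(4) differentiable_comp_\<Phi>[OF p d]])
  finally show ?thesis by (simp add: D_vbar_\<Phi>[OF p d] sum_distrib_left mult_ac)
qed

lemma
  assumes p: "p \<in> W"
  shows M_\<Phi>: "src.M \<alpha> \<beta> p = of_real \<kappa> * (\<Sum>\<tau>\<in>UNIV. \<Sum>\<sigma>\<in>UNIV. cnj (B (fst p) $ \<tau> $ \<beta>) * B (fst p) $ \<sigma> $ \<alpha> * tgt.M \<sigma> \<tau> (\<Phi> p))"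
    and D_z_D_vbar_\<Phi>: "D_z \<mu> (D_vbar \<beta> src.G) p = of_real \<kappa> * (\<Sum>\<tau>\<in>UNIV. cnj (B (fst p) $ \<tau> $ \<beta>) *
        ((\<Sum>k\<in>UNIV. D_z k (D_vbar \<tau> tgt.G) (\<Phi> p) * J (fst p) $ k $ \<mu>) + (\<Sum>k\<in>UNIV. tgt.M k \<tau> (\<Phi> p) * \<eta> p \<mu> k)))"
proof -
  have d: "D_vbar \<tau> tgt.G differentiable (at (\<Phi> p))" for \<tau>
    by (rule tgt.diffble[OF tgt.smooth_D(4)[OF tgt.smooth_G] \<Phi>_in'[OF p]])
  have dB: "(\<lambda>x. cnj (B (fst x) $ \<tau> $ \<beta>)) differentiable (at p)" for \<tau>
    using bounded_linear.has_derivative[OF bounded_linear_cnj B_fst_derivative[OF p]] differentiable_def by blast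
  have ds: "D_vbar \<beta> src.G differentiable (at p)"
    by (rule src.diffble[OF src.smooth_D(4)[OF src.smooth_G] in_S[OF p]])
  have *: "P (D_vbar \<beta> src.G) p = of_real \<kappa> * (\<Sum>\<tau>\<in>UNIV. cnj (B (fst p) $ \<tau> $ \<beta>) * P (\<lambda>x. D_vbar \<tau> tgt.G (\<Phi> x)) p)"
    if P: "\<And>p. derivation_at p (\<lambda>f. P f p)" and PB: "\<And>\<tau>. P (\<lambda>x. cnj (B (fst x) $ \<tau> $ \<beta>)) p = 0"
    for P :: "('n cpair \<Rightarrow> complex) \<Rightarrow> 'n cpair \<Rightarrow> complex"
  proof -
    have "P (D_vbar \<beta> src.G) p = P (\<lambda>x. \<Sum>\<tau>\<in>UNIV. of_real \<kappa> * (cnj (B (fst x) $ \<tau> $ \<beta>) * D_vbar \<tau> tgt.G (\<Phi> x))) p"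
      by (rule derivation_cong[OF P open_W p ds D_vbar_G])
    also have "\<dots> = (\<Sum>\<tau>\<in>UNIV. P (\<lambda>x. of_real \<kappa> * (cnj (B (fst x) $ \<tau> $ \<beta>) * D_vbar \<tau> tgt.G (\<Phi> x))) p)"
      by (rule derivation_sum[OF P]) (simp, intro differentiable_mult differentiable_const dB differentiable_comp_\<Phi>[OF p d])
    also have "\<dots> = (\<Sum>\<tau>\<in>UNIV. of_real \<kappa> * P (\<lambda>x. cnj (B (fst x) $ \<tau> $ \<beta>) * D_vbar \<tau> tgt.G (\<Phi> x)) p)"
      by (intro sum.cong refl derivation_cmult[OF P] differentiable_mult dB differentiable_comp_\<Phi>[OF p d])
    also have "\<dots> = (\<Sum>\<tau>\<in>UNIV. of_real \<kappa> * (P (\<lambda>x. cnj (B (fst x) $ \<tau> $ \<beta>)) p * D_vbar \<tau> tgt.G (\<Phi> p) + cnj (B (fst p) $ \<tau> $ \<beta>) * P (\<lambda>x. D_vbar \<tau> tgt.G (\<Phi> x)) p))"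
      by (intro sum.cong refl arg_cong2[where f = "(*)"] derivation_mult[OF P] dB differentiable_comp_\<Phi>[OF p d])
    finally show ?thesis by (simp add: PB sum_distrib_left)
  qed
  show "src.M \<alpha> \<beta> p = of_real \<kappa> * (\<Sum>\<tau>\<in>UNIV. \<Sum>\<sigma>\<in>UNIV. cnj (B (fst p) $ \<tau> $ \<beta>) * B (fst p) $ \<sigma> $ \<alpha> * tgt.M \<sigma> \<tau> (\<Phi> p))"
    unfolding src.M_at tgt.M_at *[of "D_v \<alpha>", OF derivation_D(3) D_B(1)[OF p]] D_v_\<Phi>[OF p d]
    by (simp add: sum_distrib_left mult_ac)
  show "D_z \<mu> (D_vbar \<beta> src.G) p = of_real \<kappa> * (\<Sum>\<tau>\<in>UNIV. cnj (B (fst p) $ \<tau> $ \<beta>) *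
        ((\<Sum>k\<in>UNIV. D_z k (D_vbar \<tau> tgt.G) (\<Phi> p) * J (fst p) $ k $ \<mu>) + (\<Sum>k\<in>UNIV. tgt.M k \<tau> (\<Phi> p) * \<eta> p \<mu> k)))"
    unfolding tgt.M_at *[of "D_z \<mu>", OF derivation_D(1) D_B(2)[OF p]] D_z_\<Phi>[OF p d] ..
qed

lemma cnj_B_injective:
  assumes p: "p \<in> W" and z: "\<And>\<beta>. (\<Sum>\<tau>\<in>UNIV. cnj (B (fst p) $ \<tau> $ \<beta>) * f \<tau>) = 0" shows "f m = 0"
proof -
  define C where "C = matrix_inv (B (fst p))"
  have CB: "(\<Sum>\<beta>\<in>UNIV. B (fst p) $ \<tau> $ \<beta> * C $ \<beta> $ m) = of_bool (\<tau> = m)" for \<tau>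
    using arg_cong[OF matrix_inv_mult(1)[OF B_invertible[OF p]], of "\<lambda>X. X $ \<tau> $ m"]
    by (simp add: C_def matrix_matrix_mult_def mat_def)
  have "0 = (\<Sum>\<beta>\<in>UNIV. (\<Sum>\<tau>\<in>UNIV. cnj (B (fst p) $ \<tau> $ \<beta>) * f \<tau>) * cnj (C $ \<beta> $ m))" by (simp add: z)
  also have "\<dots> = (\<Sum>\<tau>\<in>UNIV. f \<tau> * cnj (\<Sum>\<beta>\<in>UNIV. B (fst p) $ \<tau> $ \<beta> * C $ \<beta> $ m))"
    unfolding sum_distrib_left sum_distrib_right cnj_sum by (subst sum.swap) (simp add: mult_ac)
  finally show ?thesis by (simp only: CB) simp
qed

text \<open>The connection coefficients are determined by \<open>G\<^sub>\<alpha>\<^sub>\<lambda> \<Gamma>\<^sup>\<alpha>\<^sub>;\<^sub>\<mu> = \<partial>\<^sub>\<lambda>\<partial>\<^sub>\<mu>G\<close> (with \<open>\<lambda>\<close> barred),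
  which makes their transformation law a comparison of coefficients.\<close>

lemma (in finsler_chart) M_Gam1:
  assumes p: "p \<in> S" shows "(\<Sum>\<alpha>\<in>UNIV. M \<alpha> l p * Gam1 g \<alpha> \<mu> p) = D_z \<mu> (D_vbar l G) p"
proof -
  have "(\<Sum>\<alpha>\<in>UNIV. M \<alpha> l p * Gam1 g \<alpha> \<mu> p) = (\<Sum>\<alpha>\<in>UNIV. \<Sum>k\<in>UNIV. D_vbar k (D_z \<mu> G) p * (N k \<alpha> p * M \<alpha> l p))"
    by (simp add: Gam1_def sum_distrib_left mult_ac)
  also have "\<dots> = (\<Sum>k\<in>UNIV. D_vbar k (D_z \<mu> G) p * (\<Sum>\<alpha>\<in>UNIV. N k \<alpha> p * M \<alpha> l p))"
    unfolding sum_distrib_left by (rule sum.swap)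
  also have "\<dots> = D_vbar l (D_z \<mu> G) p" by (simp add: NM_sum[OF p])
  also have "\<dots> = D_z \<mu> (D_vbar l G) p" by (rule D_commute) (auto intro: smooth_G p)
  finally show ?thesis .
qed

lemma (in finsler_chart) M_injective:
  assumes p: "p \<in> S" and z: "\<And>\<beta>. (\<Sum>k\<in>UNIV. M k \<beta> p * f k) = 0" shows "f m = 0"
proof -
  have "0 = (\<Sum>\<beta>\<in>UNIV. (\<Sum>k\<in>UNIV. M k \<beta> p * f k) * N \<beta> m p)" by (simp add: z)
  also have "\<dots> = (\<Sum>k\<in>UNIV. (\<Sum>\<beta>\<in>UNIV. M k \<beta> p * N \<beta> m p) * f k)"
    unfolding sum_distrib_left sum_distrib_right by (subst sum.swap) (simp add: mult_ac)
  finally show ?thesis by (simp add: MN_sum[OF p])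
qed

lemma Gam1_\<Phi>:
  assumes p: "p \<in> W"
  shows "(\<Sum>\<alpha>\<in>UNIV. B (fst p) $ k $ \<alpha> * Gam1 g \<alpha> \<mu> p) = (\<Sum>\<nu>\<in>UNIV. Gam1 g' k \<nu> (\<Phi> p) * J (fst p) $ \<nu> $ \<mu>) + \<eta> p \<mu> k"
proof -
  define y where "y k = (\<Sum>\<alpha>\<in>UNIV. B (fst p) $ k $ \<alpha> * Gam1 g \<alpha> \<mu> p)" for k
  define r where "r k = (\<Sum>\<nu>\<in>UNIV. Gam1 g' k \<nu> (\<Phi> p) * J (fst p) $ \<nu> $ \<mu>) + \<eta> p \<mu> k" for k
  have 1: "D_z \<mu> (D_vbar \<beta> src.G) p = of_real \<kappa> * (\<Sum>\<tau>\<in>UNIV. cnj (B (fst p) $ \<tau> $ \<beta>) * (\<Sum>\<sigma>\<in>UNIV. tgt.M \<sigma> \<tau> (\<Phi> p) * y \<sigma>))" for \<beta>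
  proof -
    have "D_z \<mu> (D_vbar \<beta> src.G) p = (\<Sum>\<alpha>\<in>UNIV. \<Sum>\<tau>\<in>UNIV. \<Sum>\<sigma>\<in>UNIV. of_real \<kappa> * (cnj (B (fst p) $ \<tau> $ \<beta>) * (tgt.M \<sigma> \<tau> (\<Phi> p) * (B (fst p) $ \<sigma> $ \<alpha> * Gam1 g \<alpha> \<mu> p))))"
      unfolding src.M_Gam1[OF in_S[OF p], symmetric] M_\<Phi>[OF p] by (simp add: sum_distrib_left sum_distrib_right mult_ac)
    also have "\<dots> = (\<Sum>\<tau>\<in>UNIV. \<Sum>\<sigma>\<in>UNIV. \<Sum>\<alpha>\<in>UNIV. of_real \<kappa> * (cnj (B (fst p) $ \<tau> $ \<beta>) * (tgt.M \<sigma> \<tau> (\<Phi> p) * (B (fst p) $ \<sigma> $ \<alpha> * Gam1 g \<alpha> \<mu> p))))"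
      by (subst sum.swap, rule sum.cong[OF refl], rule sum.swap)
    finally show ?thesis by (simp add: y_def sum_distrib_left)
  qed
  have 2: "(\<Sum>k\<in>UNIV. D_z k (D_vbar \<tau> tgt.G) (\<Phi> p) * J (fst p) $ k $ \<mu>) + (\<Sum>k\<in>UNIV. tgt.M k \<tau> (\<Phi> p) * \<eta> p \<mu> k) = (\<Sum>\<sigma>\<in>UNIV. tgt.M \<sigma> \<tau> (\<Phi> p) * r \<sigma>)" for \<tau>
  proof -
    have "(\<Sum>k\<in>UNIV. D_z k (D_vbar \<tau> tgt.G) (\<Phi> p) * J (fst p) $ k $ \<mu>)
       = (\<Sum>k\<in>UNIV. \<Sum>\<sigma>\<in>UNIV. tgt.M \<sigma> \<tau> (\<Phi> p) * (Gam1 g' \<sigma> k (\<Phi> p) * J (fst p) $ k $ \<mu>))"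
      unfolding tgt.M_Gam1[OF \<Phi>_in'[OF p], symmetric] by (simp add: sum_distrib_right mult.assoc)
    also have "\<dots> = (\<Sum>\<sigma>\<in>UNIV. \<Sum>k\<in>UNIV. tgt.M \<sigma> \<tau> (\<Phi> p) * (Gam1 g' \<sigma> k (\<Phi> p) * J (fst p) $ k $ \<mu>))"
      by (rule sum.swap)
    finally show ?thesis by (simp add: r_def distrib_left sum.distrib sum_distrib_left)
  qed
  have "(\<Sum>\<tau>\<in>UNIV. cnj (B (fst p) $ \<tau> $ \<beta>) * (\<Sum>\<sigma>\<in>UNIV. tgt.M \<sigma> \<tau> (\<Phi> p) * (y \<sigma> - r \<sigma>))) = 0" for \<beta>
    using 1[of \<beta>] D_z_D_vbar_\<Phi>[OF p, of \<mu> \<beta>] \<kappa> unfolding 2 by (simp add: right_diff_distrib sum_subtractf)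
  then have "(\<Sum>\<sigma>\<in>UNIV. tgt.M \<sigma> \<tau> (\<Phi> p) * (y \<sigma> - r \<sigma>)) = 0" for \<tau>
    by (rule cnj_B_injective[OF p, of "\<lambda>\<tau>. \<Sum>\<sigma>\<in>UNIV. tgt.M \<sigma> \<tau> (\<Phi> p) * (y \<sigma> - r \<sigma>)"])
  then have "y k - r k = 0"
    by (rule tgt.M_injective[OF \<Phi>_in'[OF p], of "\<lambda>k. y k - r k"])
  then show ?thesis by (simp add: y_def r_def)
qed

lemma del_\<Phi>:
  assumes p: "p \<in> W" and f: "f differentiable (at (\<Phi> p))"
  shows "del g \<mu> (\<lambda>x. f (\<Phi> x)) p = (\<Sum>\<nu>\<in>UNIV. J (fst p) $ \<nu> $ \<mu> * del g' \<nu> f (\<Phi> p))"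
proof -
  have "(\<Sum>\<alpha>\<in>UNIV. Gam1 g \<alpha> \<mu> p * D_v \<alpha> (\<lambda>x. f (\<Phi> x)) p)
     = (\<Sum>k\<in>UNIV. D_v k f (\<Phi> p) * (\<Sum>\<alpha>\<in>UNIV. B (fst p) $ k $ \<alpha> * Gam1 g \<alpha> \<mu> p))"
    unfolding D_v_\<Phi>[OF p f] sum_distrib_left by (subst sum.swap) (simp add: mult_ac)
  also have "\<dots> = (\<Sum>k\<in>UNIV. \<Sum>\<nu>\<in>UNIV. D_v k f (\<Phi> p) * (Gam1 g' k \<nu> (\<Phi> p) * J (fst p) $ \<nu> $ \<mu>))
      + (\<Sum>k\<in>UNIV. D_v k f (\<Phi> p) * \<eta> p \<mu> k)"
    unfolding Gam1_\<Phi>[OF p] by (simp add: distrib_left sum.distrib sum_distrib_left)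
  also have "(\<Sum>k\<in>UNIV. \<Sum>\<nu>\<in>UNIV. D_v k f (\<Phi> p) * (Gam1 g' k \<nu> (\<Phi> p) * J (fst p) $ \<nu> $ \<mu>))
     = (\<Sum>\<nu>\<in>UNIV. J (fst p) $ \<nu> $ \<mu> * (\<Sum>k\<in>UNIV. Gam1 g' k \<nu> (\<Phi> p) * D_v k f (\<Phi> p)))"
    by (subst sum.swap) (simp add: sum_distrib_left mult_ac)
  finally show ?thesis
    unfolding del_def D_z_\<Phi>[OF p f] by (simp add: right_diff_distrib sum_subtractf mult.commute)
qed

text \<open>By the transformation law of the metric, the left-hand side is an inverse of the matrix of which the
  right-hand side is the inverse.\<close>

lemma N_\<Phi>:
  assumes p: "p \<in> W"
  shows "(\<Sum>\<beta>\<in>UNIV. \<Sum>\<alpha>\<in>UNIV. of_real \<kappa> * (cnj (B (fst p) $ k $ \<beta>) * B (fst p) $ m $ \<alpha> * src.N \<beta> \<alpha> p)) = tgt.N k m (\<Phi> p)"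
proof -
  define Bm where "Bm = B (fst p)"
  define Bt where "Bt = (\<chi> \<alpha> \<sigma>. Bm $ \<sigma> $ \<alpha>)"
  define Bc where "Bc = (\<chi> \<tau> \<beta>. cnj (Bm $ \<tau> $ \<beta>))"
  define X where "X = (\<chi> k m. \<Sum>\<beta>\<in>UNIV. \<Sum>\<alpha>\<in>UNIV. of_real \<kappa> * (cnj (Bm $ k $ \<beta>) * Bm $ m $ \<alpha> * src.N \<beta> \<alpha> p))"
  define N' where "N' = (\<chi> i j. of_real \<kappa> * G_inv g p $ i $ j)"
  have Meq: "G_mat g p = (\<chi> i j. of_real \<kappa> * (Bt ** G_mat g' (\<Phi> p) ** Bc) $ i $ j)"
    by (simp add: vec_eq_iff M_\<Phi>[OF p] matrix_matrix_mult_def Bt_def Bc_def Bm_def sum_distrib_left sum_distrib_right mult_ac)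
  have Xeq: "X = Bc ** N' ** Bt"
    by (simp add: vec_eq_iff X_def N'_def matrix_matrix_mult_def Bt_def Bc_def sum_distrib_left sum_distrib_right mult_ac)
      (intro allI sum.swap)
  have BtI: "invertible Bt"
  proof -
    have "Bt = transpose Bm" by (simp add: Bt_def transpose_def)
    then show ?thesis using B_invertible[OF p] by (simp add: invertible_det_nz Bm_def)
  qed
  have BcI: "invertible Bc"
  proof -
    have "det Bc = cnj (det Bm)" by (simp add: Bc_def det_def)
    then show ?thesis using B_invertible[OF p] by (simp add: invertible_det_nz Bm_def)
  qed
  have 1: "(Bt ** G_mat g' (\<Phi> p) ** Bc) ** N' = mat 1"
  proof -
    have "(Bt ** G_mat g' (\<Phi> p) ** Bc) ** N' = G_mat g p ** G_inv g p"
      unfolding N'_def by (subst Meq) (simp add: vec_eq_iff matrix_matrix_mult_def[where m' = "G_inv g p"] matrix_matrix_mult_def[of "Bt ** G_mat g' (\<Phi> p) ** Bc"] matrix_matrix_mult_def[of "\<chi> i j. _ i j"] mult_ac)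
    then show ?thesis using src.MN[OF in_S[OF p]] by simp
  qed
  have "matrix_inv Bt ** ((Bt ** G_mat g' (\<Phi> p) ** Bc) ** N') ** Bt = mat 1"
    unfolding 1 by (simp add: matrix_inv_mult[OF BtI])
  then have "G_mat g' (\<Phi> p) ** (Bc ** N' ** Bt) = mat 1"
    by (simp add: matrix_mul_assoc matrix_inv_mult[OF BtI])
  then have "G_mat g' (\<Phi> p) ** X = mat 1" by (simp add: Xeq)
  then have "X ** G_mat g' (\<Phi> p) = mat 1" using matrix_left_right_inverse by blast
  then have "G_inv g' (\<Phi> p) = X" unfolding G_inv_def by (rule matrix_inv_eqI)
  then show ?thesis by (simp add: X_def Bm_def)
qed

end


section \<open>Products of (1,1)-forms\<close>

definition alternating_sum :: "nat \<Rightarrow> ((nat \<Rightarrow> nat) \<Rightarrow> complex) \<Rightarrow> complex" where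
  "alternating_sum n F = (\<Sum>\<sigma> | \<sigma> permutes {..<n}. of_int (sign \<sigma>) * F \<sigma>)"

lemma alternating_sum_cong:
  "(\<And>\<sigma>. \<sigma> permutes {..<n} \<Longrightarrow> F \<sigma> = F' \<sigma>) \<Longrightarrow> alternating_sum n F = alternating_sum n F'"
  unfolding alternating_sum_def by (rule sum.cong) auto

lemma alternating_sum_cmult: "alternating_sum n (\<lambda>\<sigma>. c * F \<sigma>) = c * alternating_sum n F"
  unfolding alternating_sum_def sum_distrib_left by (simp add: mult_ac)

lemma alternating_sum_mult_right: "alternating_sum n F * c = alternating_sum n (\<lambda>\<sigma>. F \<sigma> * c)"
  unfolding alternating_sum_def sum_distrib_right by (simp add: mult_ac)

lemma alternating_sum_swap:
  "alternating_sum n (\<lambda>\<sigma>. alternating_sum k (\<lambda>\<rho>. F \<sigma> \<rho>)) = alternating_sum k (\<lambda>\<rho>. alternating_sum n (\<lambda>\<sigma>. F \<sigma> \<rho>))"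
  unfolding alternating_sum_def sum_distrib_left by (subst sum.swap) (simp add: mult_ac)

text \<open>The two signs cancel, so that every permutation contributes the same term.\<close>

lemma alternating_sum_sign: "alternating_sum k (\<lambda>\<rho>. of_int (sign \<rho>) * c) = fact k * c"
proof -
  have "alternating_sum k (\<lambda>\<rho>. of_int (sign \<rho>) * c) = (\<Sum>\<rho> | \<rho> permutes {..<k}. of_int (sign \<rho> * sign \<rho>) * c)"
    unfolding alternating_sum_def of_int_mult by (simp add: mult.assoc)
  then show ?thesis by (simp add: card_permutations[OF card_lessThan])
qed

lemma alternating_sum_compose:
  assumes "\<rho> permutes {..<n}"
  shows "alternating_sum n (\<lambda>\<sigma>. F (\<sigma> \<circ> \<rho>)) = of_int (sign \<rho>) * alternating_sum n F"
proof -
  have "alternating_sum n F = (\<Sum>\<sigma> | \<sigma> permutes {..<n}. of_int (sign (\<sigma> \<circ> \<rho>)) * F (\<sigma> \<circ> \<rho>))"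
    unfolding alternating_sum_def by (rule sum_permutations_compose_right[OF assms])
  also have "\<dots> = (\<Sum>\<sigma> | \<sigma> permutes {..<n}. of_int (sign \<rho>) * (of_int (sign \<sigma>) * F (\<sigma> \<circ> \<rho>)))"
  proof (intro sum.cong refl)
    fix \<sigma> assume "\<sigma> \<in> {\<sigma>. \<sigma> permutes {..<n}}"
    then have "permutation \<sigma>" "permutation \<rho>" using assms by (auto simp: permutation_permutes)
    then show "of_int (sign (\<sigma> \<circ> \<rho>)) * F (\<sigma> \<circ> \<rho>) = of_int (sign \<rho>) * (of_int (sign \<sigma>) * F (\<sigma> \<circ> \<rho>))"
      by (simp add: sign_compose)
  qed
  also have "\<dots> = of_int (sign \<rho>) * alternating_sum n (\<lambda>\<sigma>. F (\<sigma> \<circ> \<rho>))"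
    by (simp add: alternating_sum_def sum_distrib_left)
  finally have "of_int (sign \<rho>) * alternating_sum n F = of_int (sign \<rho> * sign \<rho>) * alternating_sum n (\<lambda>\<sigma>. F (\<sigma> \<circ> \<rho>))"
    by (simp only: of_int_mult mult.assoc)
  then show ?thesis by simp
qed

text \<open>Antisymmetrizing over a subgroup before antisymmetrizing over the whole group only contributes the
  order of the subgroup. The map \<open>e\<close> embeds the subgroup.\<close>

lemma alternating_sum_absorb:
  assumes e: "\<And>\<rho>. \<rho> permutes {..<k} \<Longrightarrow> e \<rho> permutes {..<n} \<and> sign (e \<rho>) = sign \<rho>"
    and B: "\<And>\<sigma> \<tau> \<rho> \<rho>'. \<rho> permutes {..<k} \<Longrightarrow> \<rho>' permutes {..<k} \<Longrightarrow> B (\<sigma> \<circ> e \<rho>) (\<tau> \<circ> e \<rho>') = B \<sigma> \<tau>"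
  shows "alternating_sum n (\<lambda>\<sigma>. alternating_sum n (\<lambda>\<tau>.
      alternating_sum k (\<lambda>\<rho>. alternating_sum k (\<lambda>\<rho>'. h (\<sigma> \<circ> e \<rho>) (\<tau> \<circ> e \<rho>'))) * B \<sigma> \<tau>))
    = (fact k)\<^sup>2 * alternating_sum n (\<lambda>\<sigma>. alternating_sum n (\<lambda>\<tau>. h \<sigma> \<tau> * B \<sigma> \<tau>))"
proof -
  define C where "C = alternating_sum n (\<lambda>\<sigma>. alternating_sum n (\<lambda>\<tau>. h \<sigma> \<tau> * B \<sigma> \<tau>))"
  have "alternating_sum n (\<lambda>\<sigma>. alternating_sum n (\<lambda>\<tau>.
      alternating_sum k (\<lambda>\<rho>. alternating_sum k (\<lambda>\<rho>'. h (\<sigma> \<circ> e \<rho>) (\<tau> \<circ> e \<rho>'))) * B \<sigma> \<tau>))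
    = alternating_sum n (\<lambda>\<sigma>. alternating_sum n (\<lambda>\<tau>.
      alternating_sum k (\<lambda>\<rho>. alternating_sum k (\<lambda>\<rho>'. h (\<sigma> \<circ> e \<rho>) (\<tau> \<circ> e \<rho>') * B (\<sigma> \<circ> e \<rho>) (\<tau> \<circ> e \<rho>')))))"
    unfolding alternating_sum_mult_right by (intro alternating_sum_cong) (simp add: B)
  also have "\<dots> = alternating_sum k (\<lambda>\<rho>. alternating_sum k (\<lambda>\<rho>'. alternating_sum n (\<lambda>\<sigma>. alternating_sum n (\<lambda>\<tau>.
       h (\<sigma> \<circ> e \<rho>) (\<tau> \<circ> e \<rho>') * B (\<sigma> \<circ> e \<rho>) (\<tau> \<circ> e \<rho>')))))"
    by (simp only: alternating_sum_swap[of n k])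
  also have "\<dots> = alternating_sum k (\<lambda>\<rho>. alternating_sum k (\<lambda>\<rho>'. of_int (sign \<rho>') * (of_int (sign \<rho>) * C)))"
  proof (intro alternating_sum_cong)
    fix \<rho> \<rho>' assume r: "\<rho> permutes {..<k}" "\<rho>' permutes {..<k}"
    note 1 = alternating_sum_compose[OF conjunct1[OF e[OF r(2)]], of "\<lambda>\<tau>. h (\<sigma> \<circ> e \<rho>) \<tau> * B (\<sigma> \<circ> e \<rho>) \<tau>" for \<sigma>]
    note 2 = alternating_sum_compose[OF conjunct1[OF e[OF r(1)]], of "\<lambda>\<sigma>. alternating_sum n (\<lambda>\<tau>. h \<sigma> \<tau> * B \<sigma> \<tau>)"]
    show "alternating_sum n (\<lambda>\<sigma>. alternating_sum n (\<lambda>\<tau>. h (\<sigma> \<circ> e \<rho>) (\<tau> \<circ> e \<rho>') * B (\<sigma> \<circ> e \<rho>) (\<tau> \<circ> e \<rho>')))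
       = of_int (sign \<rho>') * (of_int (sign \<rho>) * C)"
      unfolding 1 alternating_sum_cmult 2 C_def using e r by simp
  qed
  also have "\<dots> = fact k * (fact k * C)"
    by (simp only: alternating_sum_sign alternating_sum_cmult)
  finally show ?thesis by (simp add: C_def power2_eq_square)
qed

text \<open>The coefficients of the product of the (1,1)-forms \<open>\<Sum> K\<^sub>i\<^sub>j e\<^sup>i \<and> cnj e\<^sup>j\<close>, one for each \<open>K\<close> in the
  list, up to the sign that results from separating barred and unbarred covectors.\<close>

definition product_form :: "('i \<Rightarrow> 'i \<Rightarrow> complex) list \<Rightarrow> 'i cform" where
  "product_form Ks I J = (if length I = length Ks \<and> length J = length Ks
     then alternating_sum (length Ks) (\<lambda>\<sigma>. alternating_sum (length Ks) (\<lambda>\<tau>.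
       \<Prod>k<length Ks. (Ks ! k) (I ! \<sigma> k) (J ! \<tau> k))) else 0)"

lemma wedge_scale_right: "wedge \<phi> (\<lambda>I J. c * \<psi> I J) I J = c * wedge \<phi> \<psi> I J"
  unfolding wedge_def sum_distrib_left by (simp add: mult_ac)

lemma wedge_scale_left: "wedge (\<lambda>I J. c * \<phi> I J) \<psi> I J = c * wedge \<phi> \<psi> I J"
  unfolding wedge_def sum_distrib_left by (simp add: mult_ac)

text \<open>The factorials in the wedge product compensate for antisymmetrizing within each factor; the sign comes from
  moving the barred covectors of the first product past the unbarred covectors of the second.\<close>

lemma wedge_product_form:
  "wedge (product_form Ks) (product_form Ls) I J = (-1) ^ (length Ks * length Ls) * product_form (Ks @ Ls) I J"
proof -
  define m where "m = length Ks"
  define r where "r = length Ls"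
  define T where "T p q = (-1) ^ (q * (length I - p)) /
          (fact p * fact (length I - p) * fact q * fact (length J - q)) *
        (\<Sum>\<sigma> | \<sigma> permutes {..<length I}. \<Sum>\<tau> | \<tau> permutes {..<length J}.
           of_int (sign \<sigma>) * of_int (sign \<tau>) *
           product_form Ks (take p (permute_list \<sigma> I)) (take q (permute_list \<tau> J)) *
           product_form Ls (drop p (permute_list \<sigma> I)) (drop q (permute_list \<tau> J)))" for p q
  have T0: "T p q = 0" if "p \<le> length I" "q \<le> length J" "\<not> (p = m \<and> q = m \<and> length I = m + r \<and> length J = m + r)" for p q
  proof -
    have "product_form Ks (take p (permute_list \<sigma> I)) (take q (permute_list \<tau> J)) *
           product_form Ls (drop p (permute_list \<sigma> I)) (drop q (permute_list \<tau> J)) = 0" for \<sigma> \<tau>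
      using that by (auto simp: product_form_def m_def r_def)
    then show ?thesis unfolding T_def by (simp only: mult.assoc mult_zero_right sum.neutral_const)
  qed
  have w: "wedge (product_form Ks) (product_form Ls) I J = (\<Sum>p\<le>length I. \<Sum>q\<le>length J. T p q)"
    by (simp add: wedge_def T_def)
  show ?thesis
  proof (cases "length I = m + r \<and> length J = m + r")
    case False
    have "(\<Sum>p\<le>length I. \<Sum>q\<le>length J. T p q) = 0"
      using False by (intro sum.neutral ballI T0) auto
    then show ?thesis using False w by (auto simp: product_form_def m_def r_def)
  next
    case True
    then have len: "length I = m + r" "length J = m + r" by auto
    have "(\<Sum>p\<le>length I. \<Sum>q\<le>length J. T p q) = (\<Sum>p\<in>{m}. \<Sum>q\<le>length J. T p q)"
      using len by (intro sum.mono_neutral_right ballI sum.neutral T0) auto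
    also have "\<dots> = (\<Sum>p\<in>{m}. \<Sum>q\<in>{m}. T p q)"
      using len by (intro sum.cong refl sum.mono_neutral_right ballI T0) auto
    finally have wT: "wedge (product_form Ks) (product_form Ls) I J = T m m" using w by simp
    define n where "n = m + r"
    define h1 where "h1 \<sigma> \<tau> = (\<Prod>k<m. (Ks ! k) (I ! \<sigma> k) (J ! \<tau> k))" for \<sigma> \<tau> :: "nat \<Rightarrow> nat"
    define h2 where "h2 \<sigma> \<tau> = (\<Prod>k<r. (Ls ! k) (I ! \<sigma> (m + k)) (J ! \<tau> (m + k)))" for \<sigma> \<tau> :: "nat \<Rightarrow> nat"
    define e where "e = map_permutation {..<r} ((+) m)"
    have bij: "bij_betw ((+) m) {..<r} {m..<n}"
      by (rule bij_betwI[where g = "\<lambda>k. k - m"]) (auto simp: n_def)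
    have subset_lessThan: "{m..<n} \<subseteq> {..<n}" by auto
    have e: "e \<rho> permutes {m..<n}" "e \<rho> permutes {..<n} \<and> sign (e \<rho>) = sign \<rho>" "k < r \<Longrightarrow> e \<rho> (m + k) = m + \<rho> k"
      if "\<rho> permutes {..<r}" for \<rho> k
    proof -
      show 1: "e \<rho> permutes {m..<n}" unfolding e_def by (rule map_permutation_permutes[OF bij that])
      show "e \<rho> permutes {..<n} \<and> sign (e \<rho>) = sign \<rho>"
        using permutes_subset[OF 1 subset_lessThan] sign_map_permutation[of "(+) m" "{..<r}" \<rho>] that by (auto simp: e_def)
      show "k < r \<Longrightarrow> e \<rho> (m + k) = m + \<rho> k"
        using map_permutation_apply[of "(+) m" "{..<r}" k \<rho>] by (simp add: e_def)
    qed
    have nth1: "permute_list \<sigma> L ! k = L ! \<sigma> k" if "length L = n" "k < n" for \<sigma> and L :: "'a list" and k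
      using that by (simp add: permute_list_def)
    have A: "product_form Ks (take m (permute_list \<sigma> I)) (take m (permute_list \<tau> J))
        = alternating_sum m (\<lambda>\<sigma>1. alternating_sum m (\<lambda>\<tau>1. h1 (\<sigma> \<circ> \<sigma>1) (\<tau> \<circ> \<tau>1)))" for \<sigma> \<tau>
    proof -
      have "(\<Prod>k<m. (Ks ! k) (take m (permute_list \<sigma> I) ! \<sigma>1 k) (take m (permute_list \<tau> J) ! \<tau>1 k)) = h1 (\<sigma> \<circ> \<sigma>1) (\<tau> \<circ> \<tau>1)"
        if "\<sigma>1 permutes {..<m}" "\<tau>1 permutes {..<m}" for \<sigma>1 \<tau>1
        unfolding h1_def
      proof (rule prod.cong[OF refl])
        fix k assume "k \<in> {..<m}"
        then have "\<sigma>1 k < m" "\<tau>1 k < m" using permutes_in_image[OF that(1)] permutes_in_image[OF that(2)] by auto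
        then show "(Ks ! k) (take m (permute_list \<sigma> I) ! \<sigma>1 k) (take m (permute_list \<tau> J) ! \<tau>1 k)
          = (Ks ! k) (I ! (\<sigma> \<circ> \<sigma>1) k) (J ! (\<tau> \<circ> \<tau>1) k)"
          using len by (simp add: nth1 n_def)
      qed
      note prod_eq = this
      have "product_form Ks (take m (permute_list \<sigma> I)) (take m (permute_list \<tau> J)) = alternating_sum m (\<lambda>\<sigma>1. alternating_sum m (\<lambda>\<tau>1.
          \<Prod>k<m. (Ks ! k) (take m (permute_list \<sigma> I) ! \<sigma>1 k) (take m (permute_list \<tau> J) ! \<tau>1 k)))"
        using len by (simp add: product_form_def m_def)
      also have "\<dots> = alternating_sum m (\<lambda>\<sigma>1. alternating_sum m (\<lambda>\<tau>1. h1 (\<sigma> \<circ> \<sigma>1) (\<tau> \<circ> \<tau>1)))"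
        by (intro alternating_sum_cong prod_eq)
      finally show ?thesis .
    qed
    have B: "product_form Ls (drop m (permute_list \<sigma> I)) (drop m (permute_list \<tau> J))
        = alternating_sum r (\<lambda>\<sigma>2. alternating_sum r (\<lambda>\<tau>2. h2 (\<sigma> \<circ> e \<sigma>2) (\<tau> \<circ> e \<tau>2)))" for \<sigma> \<tau>
    proof -
      have "(\<Prod>k<r. (Ls ! k) (drop m (permute_list \<sigma> I) ! \<sigma>2 k) (drop m (permute_list \<tau> J) ! \<tau>2 k)) = h2 (\<sigma> \<circ> e \<sigma>2) (\<tau> \<circ> e \<tau>2)"
        if "\<sigma>2 permutes {..<r}" "\<tau>2 permutes {..<r}" for \<sigma>2 \<tau>2
        unfolding h2_def
      proof (rule prod.cong[OF refl])
        fix k assume k: "k \<in> {..<r}"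
        then have "\<sigma>2 k < r" "\<tau>2 k < r" using permutes_in_image[OF that(1)] permutes_in_image[OF that(2)] by auto
        then show "(Ls ! k) (drop m (permute_list \<sigma> I) ! \<sigma>2 k) (drop m (permute_list \<tau> J) ! \<tau>2 k)
          = (Ls ! k) (I ! (\<sigma> \<circ> e \<sigma>2) (m + k)) (J ! (\<tau> \<circ> e \<tau>2) (m + k))"
          using len k that by (simp add: nth1 n_def e)
      qed
      note prod_eq = this
      have "product_form Ls (drop m (permute_list \<sigma> I)) (drop m (permute_list \<tau> J)) = alternating_sum r (\<lambda>\<sigma>2. alternating_sum r (\<lambda>\<tau>2.
          \<Prod>k<r. (Ls ! k) (drop m (permute_list \<sigma> I) ! \<sigma>2 k) (drop m (permute_list \<tau> J) ! \<tau>2 k)))"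
        using len by (simp add: product_form_def r_def)
      also have "\<dots> = alternating_sum r (\<lambda>\<sigma>2. alternating_sum r (\<lambda>\<tau>2. h2 (\<sigma> \<circ> e \<sigma>2) (\<tau> \<circ> e \<tau>2)))"
        by (intro alternating_sum_cong prod_eq)
      finally show ?thesis .
    qed
    define B' where "B' \<sigma> \<tau> = alternating_sum r (\<lambda>\<sigma>2. alternating_sum r (\<lambda>\<tau>2. h2 (\<sigma> \<circ> e \<sigma>2) (\<tau> \<circ> e \<tau>2)))" for \<sigma> \<tau>
    have B'inv: "B' (\<sigma> \<circ> \<rho>) (\<tau> \<circ> \<rho>') = B' \<sigma> \<tau>" if "\<rho> permutes {..<m}" "\<rho>' permutes {..<m}" for \<sigma> \<tau> \<rho> \<rho>'
      unfolding B'_def h2_def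
    proof (intro alternating_sum_cong prod.cong refl)
      fix \<sigma>2 \<tau>2 k assume s: "\<sigma>2 permutes {..<r}" "\<tau>2 permutes {..<r}" and k: "k \<in> {..<r}"
      have "\<rho> (m + \<sigma>2 k) = m + \<sigma>2 k" "\<rho>' (m + \<tau>2 k) = m + \<tau>2 k"
        using permutes_not_in[OF that(1)] permutes_not_in[OF that(2)] by auto
      then show "(Ls ! k) (I ! (\<sigma> \<circ> \<rho> \<circ> e \<sigma>2) (m + k)) (J ! (\<tau> \<circ> \<rho>' \<circ> e \<tau>2) (m + k))
        = (Ls ! k) (I ! (\<sigma> \<circ> e \<sigma>2) (m + k)) (J ! (\<tau> \<circ> e \<tau>2) (m + k))"
        using k s by (simp add: e)
    qed
    have h1inv: "h1 (\<sigma> \<circ> e \<rho>) (\<tau> \<circ> e \<rho>') = h1 \<sigma> \<tau>" if "\<rho> permutes {..<r}" "\<rho>' permutes {..<r}" for \<sigma> \<tau> \<rho> \<rho>'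
      unfolding h1_def using permutes_not_in[OF e(1)[OF that(1)]] permutes_not_in[OF e(1)[OF that(2)]] by simp
    have sub: "\<rho> permutes {..<n} \<and> sign \<rho> = sign \<rho>" if "\<rho> permutes {..<m}" for \<rho>
      using permutes_subset[OF that, of "{..<n}"] by (simp add: n_def)
    have "alternating_sum n (\<lambda>\<sigma>. alternating_sum n (\<lambda>\<tau>.
          alternating_sum m (\<lambda>\<sigma>1. alternating_sum m (\<lambda>\<tau>1. h1 (\<sigma> \<circ> \<sigma>1) (\<tau> \<circ> \<tau>1))) * B' \<sigma> \<tau>))
        = (fact m)\<^sup>2 * alternating_sum n (\<lambda>\<sigma>. alternating_sum n (\<lambda>\<tau>. h1 \<sigma> \<tau> * B' \<sigma> \<tau>))"
      using alternating_sum_absorb[of m "\<lambda>\<rho>. \<rho>" n B' h1] sub B'inv by simp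
    also have "alternating_sum n (\<lambda>\<sigma>. alternating_sum n (\<lambda>\<tau>. h1 \<sigma> \<tau> * B' \<sigma> \<tau>))
        = (fact r)\<^sup>2 * alternating_sum n (\<lambda>\<sigma>. alternating_sum n (\<lambda>\<tau>. h2 \<sigma> \<tau> * h1 \<sigma> \<tau>))"
      using alternating_sum_absorb[of r e n h1 h2] e(2) h1inv by (simp add: B'_def mult.commute)
    also have "alternating_sum n (\<lambda>\<sigma>. alternating_sum n (\<lambda>\<tau>. h2 \<sigma> \<tau> * h1 \<sigma> \<tau>)) = product_form (Ks @ Ls) I J"
    proof -
      have "h2 \<sigma> \<tau> * h1 \<sigma> \<tau> = (\<Prod>k<n. ((Ks @ Ls) ! k) (I ! \<sigma> k) (J ! \<tau> k))" for \<sigma> \<tau>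
      proof -
        have "(\<Prod>k<n. ((Ks @ Ls) ! k) (I ! \<sigma> k) (J ! \<tau> k))
           = (\<Prod>k<m. ((Ks @ Ls) ! k) (I ! \<sigma> k) (J ! \<tau> k)) * (\<Prod>k\<in>{m..<n}. ((Ks @ Ls) ! k) (I ! \<sigma> k) (J ! \<tau> k))"
          by (subst prod.union_disjoint[symmetric]) (auto simp: n_def intro!: prod.cong)
        also have "(\<Prod>k\<in>{m..<n}. ((Ks @ Ls) ! k) (I ! \<sigma> k) (J ! \<tau> k)) = h2 \<sigma> \<tau>"
          unfolding h2_def prod.reindex_bij_betw[OF bij, symmetric] by (simp add: m_def nth_append)
        also have "(\<Prod>k<m. ((Ks @ Ls) ! k) (I ! \<sigma> k) (J ! \<tau> k)) = h1 \<sigma> \<tau>"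
          unfolding h1_def by (intro prod.cong) (auto simp: m_def nth_append)
        finally show ?thesis by (simp add: mult.commute)
      qed
      then show ?thesis using len by (simp add: product_form_def n_def m_def r_def)
    qed
    finally have X: "alternating_sum n (\<lambda>\<sigma>. alternating_sum n (\<lambda>\<tau>.
          alternating_sum m (\<lambda>\<sigma>1. alternating_sum m (\<lambda>\<tau>1. h1 (\<sigma> \<circ> \<sigma>1) (\<tau> \<circ> \<tau>1))) * B' \<sigma> \<tau>))
        = (fact m)\<^sup>2 * ((fact r)\<^sup>2 * product_form (Ks @ Ls) I J)" .
    have "T m m = (-1) ^ (m * r) / (fact m * fact r * fact m * fact r) *
      alternating_sum n (\<lambda>\<sigma>. alternating_sum n (\<lambda>\<tau>.
          alternating_sum m (\<lambda>\<sigma>1. alternating_sum m (\<lambda>\<tau>1. h1 (\<sigma> \<circ> \<sigma>1) (\<tau> \<circ> \<tau>1))) * B' \<sigma> \<tau>))"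
      unfolding T_def A B B'_def[symmetric] alternating_sum_def[of n] len n_def[symmetric]
      by (simp add: n_def sum_distrib_left mult_ac)
    then show ?thesis unfolding wT X by (simp add: m_def r_def power2_eq_square)
  qed
qed

lemma product_form_singleton: "product_form [K] I J = (if length I = 1 \<and> length J = 1 then K (I ! 0) (J ! 0) else 0)"
proof -
  have "{\<sigma>. \<sigma> permutes {..<Suc 0}} = {id}" by (auto simp: lessThan_Suc)
  then show ?thesis by (simp add: product_form_def alternating_sum_def)
qed

lemma product_form_Nil: "product_form [] I J = (if I = [] \<and> J = [] then 1 else 0)"
  by (simp add: product_form_def alternating_sum_def)

lemma form11_product_form:
  "form11 h \<theta> = product_form [\<lambda>i j. \<i> * (\<Sum>\<alpha>\<in>UNIV. \<Sum>\<beta>\<in>UNIV. h $ \<alpha> $ \<beta> * \<theta> \<alpha> i * cnj (\<theta> \<beta> j))]"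
  by (intro ext) (simp add: product_form_singleton form11_def)

lemma wedge_pow_product_form:
  "wedge_pow (product_form [K]) k = (\<lambda>I J. (-1) ^ (\<Sum>i<k. i) * product_form (replicate k K) I J)"
proof (induction k)
  case 0 then show ?case by (simp add: product_form_Nil fun_eq_iff)
next
  case (Suc k)
  show ?case
    unfolding wedge_pow.simps Suc by (intro ext) (simp add: wedge_scale_right wedge_product_form power_add)
qed

lemma product_form_scale:
  "product_form (map (\<lambda>K i j. c * K i j) Ks) I J = c ^ length Ks * product_form Ks I J"
proof -
  have "(\<Prod>k<length Ks. (map (\<lambda>K i j. c * K i j) Ks ! k) (I ! \<sigma> k) (J ! \<tau> k)) = c ^ length Ks * (\<Prod>k<length Ks. (Ks ! k) (I ! \<sigma> k) (J ! \<tau> k))" for \<sigma> \<tau>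
    by (simp add: prod.distrib)
  then show ?thesis by (simp add: product_form_def alternating_sum_cmult)
qed

lemma permutes_lessThan_2: "{\<sigma>. \<sigma> permutes {..<2::nat}} = {id, Transposition.transpose 0 1}"
proof -
  have "{\<sigma>. \<sigma> permutes {0, 1::nat}} = {id, Transposition.transpose 0 1}"
    by (subst permutes_insert) (auto simp: permutes_sing image_def)
  moreover have "{..<2::nat} = {0, 1}" by auto
  ultimately show ?thesis by simp
qed

lemma wedge_form11_square:
  fixes \<theta> :: "'n::finite \<Rightarrow> 'i \<Rightarrow> complex" and h :: "complex^'n^'n"
  defines "K \<equiv> \<lambda>i j. \<i> * (\<Sum>\<alpha>\<in>UNIV. \<Sum>\<beta>\<in>UNIV. h $ \<alpha> $ \<beta> * \<theta> \<alpha> i * cnj (\<theta> \<beta> j))"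
  shows "wedge (form11 h \<theta>) (form11 h \<theta>) [a, b] [c, d] = - 2 * (K a c * K b d - K a d * K b c)"
proof -
  have ne: "id \<noteq> Transposition.transpose 0 (1::nat)" by (metis id_apply transpose_apply_first zero_neq_one)
  have "wedge (form11 h \<theta>) (form11 h \<theta>) [a, b] [c, d] = - product_form [K, K] [a, b] [c, d]"
    unfolding form11_product_form K_def[symmetric] by (simp add: wedge_product_form)
  also have "product_form [K, K] [a, b] [c, d] = 2 * (K a c * K b d - K a d * K b c)"
    using ne ne[symmetric]
    by (simp add: product_form_def alternating_sum_def permutes_lessThan_2[unfolded numeral_2_eq_2] sign_swap_id numeral_2_eq_2 algebra_simps)
  finally show ?thesis by simp
qed


section \<open>The volume form in slice coordinates\<close>

text \<open>The Leibniz formula on a set of indices, since the minors and blocks below are indexed by subsets of a type.\<close>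

definition det_on :: "'i set \<Rightarrow> ('i \<Rightarrow> 'i \<Rightarrow> complex) \<Rightarrow> complex" where
  "det_on S B = (\<Sum>\<rho> | \<rho> permutes S. of_int (sign \<rho>) * (\<Prod>i\<in>S. B i (\<rho> i)))"

lemma det_on_cong: "(\<And>i j. i \<in> S \<Longrightarrow> j \<in> S \<Longrightarrow> B i j = B' i j) \<Longrightarrow> det_on S B = det_on S B'"
  unfolding det_on_def by (intro sum.cong refl arg_cong2[where f = "(*)"] prod.cong) (auto simp: permutes_in_image)

lemma det_on_UNIV: "det_on UNIV (\<lambda>i j. A $ i $ j) = det A"
  by (simp add: det_on_def det_def)

lemma det_on_reindex:
  assumes f: "bij_betw f A S" and fin: "finite A"
  shows "det_on S B = det_on A (\<lambda>i j. B (f i) (f j))"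
proof -
  have inj: "inj_on f A" using f by (simp add: bij_betw_def)
  have "bij_betw (map_permutation A f) {p. p permutes A} {p. p permutes S}"
  proof (rule bij_betwI)
    show "map_permutation A f \<in> {p. p permutes A} \<rightarrow> {p. p permutes S}"
      using map_permutation_permutes[OF f] by auto
    show "map_permutation S (inv_into A f) \<in> {p. p permutes S} \<rightarrow> {p. p permutes A}"
      using map_permutation_permutes[OF bij_betw_inv_into[OF f]] by auto
    show "map_permutation S (inv_into A f) (map_permutation A f p) = p" if "p \<in> {p. p permutes A}" for p
      using that inj by (intro map_permutation_compose_inv[OF f]) auto
    show "map_permutation A f (map_permutation S (inv_into A f) p) = p" if "p \<in> {p. p permutes S}" for p
      using that f by (intro map_permutation_compose_inv[OF bij_betw_inv_into[OF f]]) (auto simp: bij_betw_inv_into_right)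
  qed
  then have "det_on S B = (\<Sum>p | p permutes A. of_int (sign (map_permutation A f p)) * (\<Prod>i\<in>S. B i (map_permutation A f p i)))"
    unfolding det_on_def by (rule sum.reindex_bij_betw[symmetric])
  also have "\<dots> = (\<Sum>p | p permutes A. of_int (sign p) * (\<Prod>i\<in>A. B (f i) (f (p i))))"
    unfolding prod.reindex_bij_betw[OF f, symmetric]
    using inj fin by (intro sum.cong refl arg_cong2[where f = "(*)"] prod.cong) (auto simp: sign_map_permutation map_permutation_apply)
  finally show ?thesis by (simp add: det_on_def)
qed

text \<open>A permutation contributes only if it preserves \<open>S\<close>, and then it splits into permutations of \<open>S\<close> and \<open>T\<close>.\<close>

lemma det_on_block:
  assumes fin: "finite S" "finite T" and disj: "S \<inter> T = {}" and zero: "\<And>i j. i \<in> S \<Longrightarrow> j \<in> T \<Longrightarrow> B i j = 0"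
  shows "det_on (S \<union> T) B = det_on S B * det_on T B"
proof -
  define P where "P = {\<rho>. \<rho> permutes (S \<union> T) \<and> \<rho> ` S \<subseteq> S}"
  have finP: "finite {\<rho>. \<rho> permutes (S \<union> T)}" using fin by (simp add: finite_permutations)
  have "det_on (S \<union> T) B = (\<Sum>\<rho>\<in>P. of_int (sign \<rho>) * (\<Prod>i\<in>S \<union> T. B i (\<rho> i)))"
    unfolding det_on_def
  proof (rule sum.mono_neutral_right[OF finP])
    show "\<forall>\<rho>\<in>{\<rho>. \<rho> permutes S \<union> T} - P. of_int (sign \<rho>) * (\<Prod>i\<in>S \<union> T. B i (\<rho> i)) = 0"
    proof
      fix \<rho> assume "\<rho> \<in> {\<rho>. \<rho> permutes S \<union> T} - P"
      then obtain i where i: "i \<in> S" "\<rho> i \<notin> S" "\<rho> permutes S \<union> T" by (auto simp: P_def)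
      then have "\<rho> i \<in> T" using permutes_in_image[OF i(3), of i] by auto
      then have "B i (\<rho> i) = 0" using zero i by auto
      then have "(\<Prod>i\<in>S \<union> T. B i (\<rho> i)) = 0" using fin i by (intro prod_zero) auto
      then show "of_int (sign \<rho>) * (\<Prod>i\<in>S \<union> T. B i (\<rho> i)) = 0" by simp
    qed
  qed (auto simp: P_def)
  also have "\<dots> = (\<Sum>x\<in>{p. p permutes S} \<times> {q. q permutes T}. of_int (sign (fst x \<circ> snd x)) * (\<Prod>i\<in>S \<union> T. B i ((fst x \<circ> snd x) i)))"
  proof (rule sum.reindex_bij_betw[symmetric], rule bij_betwI)
    show "(\<lambda>x. fst x \<circ> snd x) \<in> {p. p permutes S} \<times> {q. q permutes T} \<rightarrow> P"
    proof
      fix x assume "x \<in> {p. p permutes S} \<times> {q. q permutes T}"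
      then have x: "fst x permutes S" "snd x permutes T" by auto
      have "fst x \<circ> snd x permutes S \<union> T"
        by (intro permutes_compose permutes_subset[OF x(1)] permutes_subset[OF x(2)]) auto
      moreover have "(fst x \<circ> snd x) i \<in> S" if "i \<in> S" for i
        using permutes_not_in[OF x(2), of i] permutes_in_image[OF x(1), of i] disj that by (auto simp: disjoint_iff)
      ultimately show "fst x \<circ> snd x \<in> P" by (auto simp: P_def)
    qed
    define r where "r \<rho> = (restrict_id \<rho> S, restrict_id \<rho> T)" for \<rho> :: "'a \<Rightarrow> 'a"
    have PS: "\<rho> ` S = S" "\<rho> ` T = T" "inj \<rho>" if "\<rho> \<in> P" for \<rho>
    proof -
      have p: "\<rho> permutes S \<union> T" "\<rho> ` S \<subseteq> S" using that by (auto simp: P_def)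
      show inj: "inj \<rho>" using permutes_inj[OF p(1)] .
      show S: "\<rho> ` S = S" by (rule endo_inj_surj[OF fin(1) p(2) inj_on_subset[OF inj subset_UNIV]])
      have T: "T = (S \<union> T) - S" using disj by auto
      have "\<rho> ` T = \<rho> ` (S \<union> T) - \<rho> ` S" by (subst T) (rule image_set_diff[OF inj])
      also have "\<dots> = T" using permutes_image[OF p(1)] S disj by auto
      finally show "\<rho> ` T = T" .
    qed
    have perm: "restrict_id \<rho> A permutes A" if "\<rho> ` A = A" "inj \<rho>" for \<rho> :: "'a \<Rightarrow> 'a" and A
      using that by (intro bij_imp_permutes bij_betw_restrict_id) (auto simp: bij_betw_def inj_on_def inj_def restrict_id_def)
    show "r \<in> P \<rightarrow> {p. p permutes S} \<times> {q. q permutes T}"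
      using PS perm by (auto simp: r_def)
    show "r (fst x \<circ> snd x) = x" if xin: "x \<in> {p. p permutes S} \<times> {q. q permutes T}" for x
    proof -
      obtain p q where x: "x = (p, q)" "p permutes S" "q permutes T" using xin by (cases x) auto
      have "restrict_id (p \<circ> q) S i = p i" for i
        using permutes_not_in[OF x(3), of i] permutes_not_in[OF x(2), of i] disj by (auto simp: restrict_id_def disjoint_iff)
      moreover have "restrict_id (p \<circ> q) T i = q i" for i
        using permutes_not_in[OF x(3), of i] permutes_not_in[OF x(2), of "q i"] permutes_in_image[OF x(3), of i] disj
        by (auto simp: restrict_id_def disjoint_iff)
      ultimately show ?thesis by (simp add: r_def x fun_eq_iff)
    qed
    show "fst (r \<rho>) \<circ> snd (r \<rho>) = \<rho>" if "\<rho> \<in> P" for \<rho>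
    proof
      fix i
      have p: "\<rho> permutes S \<union> T" using that by (auto simp: P_def)
      show "(fst (r \<rho>) \<circ> snd (r \<rho>)) i = \<rho> i"
        using PS[OF that] disj permutes_not_in[OF p, of i] by (auto simp: r_def restrict_id_def)
    qed
  qed
  also have "\<dots> = (\<Sum>x\<in>{p. p permutes S} \<times> {q. q permutes T}.
      (of_int (sign (fst x)) * (\<Prod>i\<in>S. B i (fst x i))) * (of_int (sign (snd x)) * (\<Prod>i\<in>T. B i (snd x i))))"
  proof (rule sum.cong[OF refl])
    fix x assume "x \<in> {p. p permutes S} \<times> {q. q permutes T}"
    then have x: "fst x permutes S" "snd x permutes T" by auto
    have s: "sign (fst x \<circ> snd x) = sign (fst x) * sign (snd x)"
      using x fin by (intro sign_compose) (auto simp: permutation_permutes)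
    have "(\<Prod>i\<in>S \<union> T. B i ((fst x \<circ> snd x) i)) = (\<Prod>i\<in>S. B i ((fst x \<circ> snd x) i)) * (\<Prod>i\<in>T. B i ((fst x \<circ> snd x) i))"
      by (rule prod.union_disjoint[OF fin disj])
    also have "(\<Prod>i\<in>S. B i ((fst x \<circ> snd x) i)) = (\<Prod>i\<in>S. B i (fst x i))"
      using permutes_not_in[OF x(2)] disj by (intro prod.cong refl) (auto simp: disjoint_iff)
    also have "(\<Prod>i\<in>T. B i ((fst x \<circ> snd x) i)) = (\<Prod>i\<in>T. B i (snd x i))"
    proof (rule prod.cong[OF refl])
      fix i assume "i \<in> T"
      then have "snd x i \<notin> S" using permutes_in_image[OF x(2), of i] disj by auto
      then show "B i ((fst x \<circ> snd x) i) = B i (snd x i)" using permutes_not_in[OF x(1)] by simp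
    qed
    finally show "of_int (sign (fst x \<circ> snd x)) * (\<Prod>i\<in>S \<union> T. B i ((fst x \<circ> snd x) i)) =
      (of_int (sign (fst x)) * (\<Prod>i\<in>S. B i (fst x i))) * (of_int (sign (snd x)) * (\<Prod>i\<in>T. B i (snd x i)))"
      unfolding s by simp
  qed
  also have "\<dots> = det_on S B * det_on T B"
    unfolding det_on_def sum_product sum.cartesian_product by (simp add: split_beta)
  finally show ?thesis .
qed

lemma det_on_minor: "det_on (UNIV - {a}) B = det (\<chi> \<alpha> \<beta>. if \<alpha> = a \<or> \<beta> = a then of_bool (\<alpha> = \<beta>) else B \<alpha> \<beta>)"
proof -
  define D where "D \<alpha> \<beta> = (if \<alpha> = a \<or> \<beta> = a then of_bool (\<alpha> = \<beta>) else B \<alpha> \<beta>)" for \<alpha> \<beta>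
  have "det (\<chi> \<alpha> \<beta>. D \<alpha> \<beta>) = det_on ({a} \<union> (UNIV - {a})) D"
    by (simp add: det_on_UNIV[symmetric] insert_absorb)
  also have "\<dots> = det_on {a} D * det_on (UNIV - {a}) D"
    by (rule det_on_block) (auto simp: D_def)
  also have "det_on {a} D = 1" by (simp add: det_on_def D_def)
  also have "det_on (UNIV - {a}) D = det_on (UNIV - {a}) B"
    by (rule det_on_cong) (auto simp: D_def)
  finally show ?thesis by (simp add: D_def)
qed


text \<open>The permutations that put the base covectors into the last \<open>CARD('n)\<close> positions, which belong to the factors
  \<open>\<omega>\<^sub>H\<close> of the volume form.\<close>

definition slice_perm :: "'n::finite \<Rightarrow> (nat \<Rightarrow> nat) \<Rightarrow> bool" where
  "slice_perm a \<sigma> \<longleftrightarrow> \<sigma> permutes {..<2 * CARD('n) - 1} \<and>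
     (\<forall>k. CARD('n) - 1 \<le> k \<and> k < 2 * CARD('n) - 1 \<longrightarrow> slice_indices a ! \<sigma> k \<in> range Inl)"

definition vol_const :: "'n::finite \<Rightarrow> real" where
  "vol_const a = 2 ^ (2 * CARD('n) - 1) * real (card {\<sigma>. slice_perm a \<sigma>}) / (fact (CARD('n) - 1) * fact CARD('n))"

lemma slice_indices:
  fixes a :: "'n::finite"
  shows "distinct (slice_indices a)" "set (slice_indices a) = UNIV - {Inr a}"
proof -
  have "\<exists>I. distinct I \<and> set I = UNIV - {Inr a :: 'n + 'n}"
    using finite_distinct_list[of "UNIV - {Inr a :: 'n + 'n}"] by auto
  then have "distinct (slice_indices a) \<and> set (slice_indices a) = UNIV - {Inr a}"
    unfolding slice_indices_def by (rule someI_ex)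
  then show "distinct (slice_indices a)" "set (slice_indices a) = UNIV - {Inr a}" by auto
qed

lemma length_slice_indices: "length (slice_indices (a::'n::finite)) = 2 * CARD('n) - 1"
proof -
  have "length (slice_indices a) = card (UNIV - {Inr a :: 'n + 'n})"
    using distinct_card[OF slice_indices(1)[of a]] slice_indices(2)[of a] by simp
  also have "\<dots> = 2 * CARD('n) - 1"
    by (simp add: card_Diff_singleton card_UNIV_sum mult_2)
  finally show ?thesis .
qed

lemma bij_slice_indices: "bij_betw (nth (slice_indices (a::'n::finite))) {..<2 * CARD('n) - 1} (UNIV - {Inr a})"
  using bij_betw_nth[OF slice_indices(1)[of a] refl refl] by (simp add: slice_indices(2) length_slice_indices)

lemma card_Inl_positions: "card {b. b < 2 * CARD('n) - 1 \<and> slice_indices (a::'n::finite) ! b \<in> range Inl} = CARD('n)"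
proof -
  have "bij_betw (nth (slice_indices a)) {b. b < 2 * CARD('n) - 1 \<and> slice_indices a ! b \<in> range Inl} (range Inl)"
    unfolding bij_betw_def
  proof
    show "inj_on (nth (slice_indices a)) {b. b < 2 * CARD('n) - 1 \<and> slice_indices a ! b \<in> range Inl}"
      using bij_slice_indices[of a] unfolding bij_betw_def by (auto simp: inj_on_def)
    have "x \<in> nth (slice_indices a) ` {b. b < 2 * CARD('n) - 1 \<and> slice_indices a ! b \<in> range Inl}" if "x \<in> range Inl" for x
    proof -
      have "x \<in> nth (slice_indices a) ` {..<2 * CARD('n) - 1}"
        using bij_slice_indices[of a] that unfolding bij_betw_def by auto
      then show ?thesis using that by auto
    qed
    then show "nth (slice_indices a) ` {b. b < 2 * CARD('n) - 1 \<and> slice_indices a ! b \<in> range Inl} = range Inl"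
      by blast
  qed
  then have "card {b. b < 2 * CARD('n) - 1 \<and> slice_indices a ! b \<in> range Inl} = card (range (Inl :: 'n \<Rightarrow> 'n + 'n))"
    by (rule bij_betw_same_card)
  then show ?thesis by (simp add: card_image)
qed

lemma vol_const_pos: "0 < vol_const (a::'n::finite)"
proof -
  define N where "N = 2 * CARD('n) - 1"
  define n where "n = CARD('n)"
  have n: "0 < n" "N = n + (n - 1)" by (auto simp: n_def N_def)
  define P where "P = {b. b < N \<and> slice_indices a ! b \<in> range Inl}"
  have cP: "card P = n" using card_Inl_positions[of a] by (simp add: P_def N_def n_def)
  have P: "P \<subseteq> {..<N}" by (auto simp: P_def)
  have "card {n - 1..<N} = card P" using n by (simp add: cP)
  then obtain f where f: "bij_betw f {n - 1..<N} P"
    using finite_same_card_bij[of "{n - 1..<N}" P] finite_subset[OF P] by auto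
  have "card {..<n - 1} = card ({..<N} - P)"
    using n P by (simp add: card_Diff_subset finite_subset[OF P] cP)
  then obtain g where g: "bij_betw g {..<n - 1} ({..<N} - P)"
    using finite_same_card_bij[of "{..<n - 1}" "{..<N} - P"] by auto
  define \<sigma> where "\<sigma> k = (if k < n - 1 then g k else if k < N then f k else k)" for k
  have "bij_betw \<sigma> {..<n - 1} ({..<N} - P)"
    using g by (rule iffD1[OF bij_betw_cong, rotated]) (simp add: \<sigma>_def)
  moreover have "bij_betw \<sigma> {n - 1..<N} P"
    using f by (rule iffD1[OF bij_betw_cong, rotated]) (simp add: \<sigma>_def)
  ultimately have "bij_betw \<sigma> ({..<n - 1} \<union> {n - 1..<N}) (({..<N} - P) \<union> P)"
    by (rule bij_betw_combine) auto
  moreover have "{..<n - 1} \<union> {n - 1..<N} = {..<N}" "({..<N} - P) \<union> P = {..<N}" using P n by auto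
  ultimately have bij: "bij_betw \<sigma> {..<N} {..<N}" by simp
  have "\<sigma> permutes {..<N}" by (rule bij_imp_permutes[OF bij]) (use n in \<open>auto simp: \<sigma>_def\<close>)
  moreover have "\<sigma> k \<in> P" if "n - 1 \<le> k" "k < N" for k
    using f that by (auto simp: \<sigma>_def bij_betw_def)
  ultimately have "slice_perm a \<sigma>" by (auto simp: slice_perm_def P_def N_def n_def)
  moreover have "finite {\<sigma>. slice_perm a \<sigma>}"
    by (rule finite_subset[OF _ finite_permutations[of "{..<2 * CARD('n) - 1}"]]) (auto simp: slice_perm_def)
  ultimately have "0 < card {\<sigma>. slice_perm a \<sigma>}" by (auto simp: card_gt_0_iff)
  then show ?thesis by (simp add: vol_const_def)
qed

lemma slice_perm_iff:
  assumes "slice_perm (a::'n::finite) \<sigma>" "k < 2 * CARD('n) - 1"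
  shows "slice_indices a ! \<sigma> k \<in> range Inl \<longleftrightarrow> CARD('n) - 1 \<le> k"
proof
  define N where "N = 2 * CARD('n) - 1"
  define n where "n = CARD('n)"
  have n: "0 < n" "N = n + (n - 1)" by (auto simp: n_def N_def)
  have \<sigma>: "\<sigma> permutes {..<N}" using assms by (simp add: slice_perm_def N_def)
  define P where "P = {b. b < N \<and> slice_indices a ! b \<in> range Inl}"
  have cP: "card P = n" using card_Inl_positions[of a] by (simp add: P_def N_def n_def)
  assume L: "slice_indices a ! \<sigma> k \<in> range Inl"
  have "\<sigma> ` {n - 1..<N} \<subseteq> P"
    using assms(1) permutes_in_image[OF \<sigma>] by (auto simp: slice_perm_def P_def N_def n_def)
  moreover have "card (\<sigma> ` {n - 1..<N}) = card P"
    using n by (simp add: cP card_image[OF permutes_inj_on[OF \<sigma>]])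
  moreover have "finite P" by (simp add: P_def)
  ultimately have "\<sigma> ` {n - 1..<N} = P" by (simp add: card_subset_eq)
  moreover have "\<sigma> k \<in> P" using L assms(2) permutes_in_image[OF \<sigma>, of k] by (simp add: P_def N_def)
  ultimately obtain k' where "k' \<in> {n - 1..<N}" "\<sigma> k = \<sigma> k'" by auto
  then have "k \<in> {n - 1..<N}" using permutes_inj[OF \<sigma>] by (auto simp: inj_def)
  then show "CARD('n) - 1 \<le> k" by (simp add: n_def)
qed (use assms in \<open>auto simp: slice_perm_def\<close>)

text \<open>Of the double antisymmetrization, a term survives only if the base covectors of \<open>\<omega>\<^sub>H\<close> fill exactly the
  base positions. Each surviving term is the determinant of a block triangular matrix.\<close>

lemma product_form_volume:
  fixes a :: "'n::finite" and V H :: "'n + 'n \<Rightarrow> 'n + 'n \<Rightarrow> complex" and A L :: "'n \<Rightarrow> 'n \<Rightarrow> complex"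
  assumes HR: "\<And>\<alpha> j. H (Inr \<alpha>) j = 0" and HLR: "\<And>\<alpha> \<beta>. H (Inl \<alpha>) (Inr \<beta>) = 0"
    and HLL: "\<And>\<alpha> \<beta>. H (Inl \<alpha>) (Inl \<beta>) = A \<alpha> \<beta>" and VRR: "\<And>\<alpha> \<beta>. V (Inr \<alpha>) (Inr \<beta>) = L \<alpha> \<beta>"
  shows "product_form (replicate (CARD('n) - 1) V @ replicate CARD('n) H) (slice_indices a) (slice_indices a)
    = of_nat (card {\<sigma>. slice_perm a \<sigma>}) * (det_on UNIV A * det_on (UNIV - {a}) L)"
proof -
  define N where "N = 2 * CARD('n) - 1"
  define n where "n = CARD('n)"
  have n: "0 < n" "N = n - 1 + n" by (auto simp: n_def N_def)
  define I where "I = slice_indices a"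
  have lenI: "length I = N" by (simp add: I_def length_slice_indices N_def)
  define Ls where "Ls = replicate (n - 1) V @ replicate n H"
  have lenL: "length Ls = N" using n by (simp add: Ls_def)
  have nthL: "Ls ! k = (if k < n - 1 then V else H)" if "k < N" for k
    using that n by (auto simp: Ls_def nth_append)
  define D where "D i j = (case i of Inl \<alpha> \<Rightarrow> H i j | Inr \<alpha> \<Rightarrow> V i j)" for i j
  define C where "C = det_on UNIV A * det_on (UNIV - {a}) L"
  have bij: "bij_betw (nth I) {..<N} (UNIV - {Inr a})" using bij_slice_indices[of a] by (simp add: I_def N_def)
  have detD: "det_on {..<N} (\<lambda>b c. D (I ! b) (I ! c)) = C"
  proof -
    have "det_on {..<N} (\<lambda>b c. D (I ! b) (I ! c)) = det_on (UNIV - {Inr a}) D"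
      by (rule det_on_reindex[OF bij, symmetric]) simp
    also have "UNIV - {Inr a} = range Inl \<union> Inr ` (UNIV - {a})"
    proof (rule set_eqI)
      fix x show "x \<in> UNIV - {Inr a} \<longleftrightarrow> x \<in> range Inl \<union> Inr ` (UNIV - {a})" by (cases x) auto
    qed
    also have "det_on (range Inl \<union> Inr ` (UNIV - {a})) D = det_on (range Inl) D * det_on (Inr ` (UNIV - {a})) D"
      by (rule det_on_block) (auto simp: D_def HLR)
    also have "det_on (range Inl) D = det_on UNIV (\<lambda>\<alpha> \<beta>. D (Inl \<alpha>) (Inl \<beta>))"
      by (rule det_on_reindex) (auto simp: bij_betw_def)
    also have "det_on (Inr ` (UNIV - {a})) D = det_on (UNIV - {a}) (\<lambda>\<alpha> \<beta>. D (Inr \<alpha>) (Inr \<beta>))"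
      by (rule det_on_reindex) (auto simp: bij_betw_def)
    finally show ?thesis by (simp add: C_def D_def HLL VRR)
  qed
  have summand: "of_int (sign \<sigma>) * alternating_sum N (\<lambda>\<tau>. \<Prod>k<N. (Ls ! k) (I ! \<sigma> k) (I ! \<tau> k)) = of_bool (slice_perm a \<sigma>) * C"
    if \<sigma>: "\<sigma> permutes {..<N}" for \<sigma>
  proof (cases "slice_perm a \<sigma>")
    case True
    have "of_int (sign \<sigma>) * alternating_sum N (\<lambda>\<tau>. \<Prod>k<N. (Ls ! k) (I ! \<sigma> k) (I ! \<tau> k))
       = alternating_sum N (\<lambda>\<rho>. \<Prod>k<N. (Ls ! k) (I ! \<sigma> k) (I ! (\<rho> \<circ> \<sigma>) k))"
      by (rule alternating_sum_compose[OF \<sigma>, symmetric])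
    also have "\<dots> = alternating_sum N (\<lambda>\<rho>. \<Prod>b<N. D (I ! b) (I ! \<rho> b))"
    proof (rule alternating_sum_cong)
      fix \<rho>
      have "(\<Prod>k<N. (Ls ! k) (I ! \<sigma> k) (I ! (\<rho> \<circ> \<sigma>) k)) = (\<Prod>k<N. D (I ! \<sigma> k) (I ! \<rho> (\<sigma> k)))"
      proof (rule prod.cong[OF refl])
        fix k assume "k \<in> {..<N}"
        then have k: "k < N" by simp
        have "I ! \<sigma> k \<in> range Inl \<longleftrightarrow> \<not> k < n - 1"
          using slice_perm_iff[OF True, of k] k by (auto simp: I_def n_def N_def)
        then show "(Ls ! k) (I ! \<sigma> k) (I ! (\<rho> \<circ> \<sigma>) k) = D (I ! \<sigma> k) (I ! \<rho> (\<sigma> k))"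
          using nthL[OF k] by (cases "I ! \<sigma> k") (auto simp: D_def)
      qed
      also have "\<dots> = (\<Prod>b<N. D (I ! b) (I ! \<rho> b))"
        by (rule prod.reindex_bij_betw[OF permutes_imp_bij[OF \<sigma>], of "\<lambda>b. D (I ! b) (I ! \<rho> b)"])
      finally show "(\<Prod>k<N. (Ls ! k) (I ! \<sigma> k) (I ! (\<rho> \<circ> \<sigma>) k)) = (\<Prod>b<N. D (I ! b) (I ! \<rho> b))" .
    qed
    also have "\<dots> = C" using detD by (simp add: det_on_def alternating_sum_def)
    finally show ?thesis using True by simp
  next
    case False
    then obtain k where k: "n - 1 \<le> k" "k < N" "I ! \<sigma> k \<notin> range Inl"
      using \<sigma> by (auto simp: slice_perm_def n_def N_def I_def)
    obtain \<alpha> where \<alpha>: "I ! \<sigma> k = Inr \<alpha>" using k(3) by (cases "I ! \<sigma> k") auto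
    have "(\<Prod>k<N. (Ls ! k) (I ! \<sigma> k) (I ! \<tau> k)) = 0" for \<tau>
      using k nthL[OF k(2)] by (intro prod_zero bexI[of _ k]) (auto simp: \<alpha> HR)
    then have "alternating_sum N (\<lambda>\<tau>. \<Prod>k<N. (Ls ! k) (I ! \<sigma> k) (I ! \<tau> k)) = 0"
      unfolding alternating_sum_def by (simp only: mult_zero_right sum.neutral_const)
    then show ?thesis using False by simp
  qed
  have "product_form Ls I I = (\<Sum>\<sigma> | \<sigma> permutes {..<N}. of_bool (slice_perm a \<sigma>) * C)"
    unfolding product_form_def lenL lenI by (simp add: alternating_sum_def[of _ "\<lambda>\<sigma>. alternating_sum N (F \<sigma>)" for F] summand)
  also have "\<dots> = (\<Sum>\<sigma> | slice_perm a \<sigma>. C)"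
    by (rule sum.mono_neutral_cong_right) (auto simp: finite_permutations slice_perm_def N_def)
  finally show ?thesis by (simp add: Ls_def I_def C_def n_def)
qed

lemma sum_lessThan_triangle: "2 * (\<Sum>i<m. i) + m = m * (m::nat)"
  by (induction m) auto

text \<open>The factor \<open>\<omega>\<^sub>H\<^sup>n\<close> contributes \<open>det G\<^sub>\<alpha>\<^sub>\<beta>\<close> and saturates the covectors \<open>dz\<^sup>\<alpha>\<close>, so that \<open>\<omega>\<^sub>V\<close> contributes only the
  minor of the Levi form of \<open>log G\<close>, which is \<open>det G\<^sub>\<alpha>\<^sub>\<beta> / G\<^sup>n\<close>. All signs and powers of \<open>\<i>\<close> cancel against
  those relating the complex coordinates of the slice to Lebesgue measure.\<close>

lemma (in finsler_chart) vol_density_eq: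
  assumes p: "slice a y \<in> S"
  shows "vol_density g a y = vol_const a * Re (density (slice a y))"
proof -
  define x where "x = slice a y"
  define N where "N = 2 * CARD('n) - 1"
  define n where "n = CARD('n)"
  have n: "0 < n" "N = n - 1 + n" by (auto simp: n_def N_def)
  have xS: "x \<in> S" and xa: "snd x $ a = 1" using p by (auto simp: x_def slice_def)
  define V where "V = (\<lambda>i j. \<Sum>\<alpha>\<in>UNIV. \<Sum>\<beta>\<in>UNIV. logG_mat g x $ \<alpha> $ \<beta> * dv_cov g x \<alpha> i * cnj (dv_cov g x \<beta> j))"
  define H where "H = (\<lambda>i j. \<Sum>\<alpha>\<in>UNIV. \<Sum>\<beta>\<in>UNIV. G_mat g x $ \<alpha> $ \<beta> * of_bool (i = (Inl \<alpha> :: 'n + 'n)) * cnj (of_bool (j = (Inl \<beta> :: 'n + 'n))))"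
  define I where "I = slice_indices a"
  have HRR: "H (Inr \<alpha>) j = 0" "H (Inl \<alpha>) (Inr \<beta>) = 0" "H (Inl \<alpha>) (Inl \<beta>) = M \<alpha> \<beta> x" "V (Inr \<alpha>) (Inr \<beta>) = logG_mat g x $ \<alpha> $ \<beta>" for \<alpha> \<beta> j
    by (simp_all add: H_def V_def dv_cov_def mult.assoc mult.left_commute[of _ "of_bool _"] flip: sum_distrib_left)
  define Ls where "Ls = replicate (n - 1) V @ replicate n H"
  have pf: "product_form Ls I I = of_nat (card {\<sigma>. slice_perm a \<sigma>}) * density x"
  proof -
    have "product_form Ls I I = of_nat (card {\<sigma>. slice_perm a \<sigma>}) * (det_on UNIV (\<lambda>\<alpha> \<beta>. M \<alpha> \<beta> x) * det_on (UNIV - {a}) (\<lambda>\<alpha> \<beta>. logG_mat g x $ \<alpha> $ \<beta>))"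
      unfolding Ls_def I_def n_def by (rule product_form_volume) (simp_all add: HRR)
    also have "det_on UNIV (\<lambda>\<alpha> \<beta>. M \<alpha> \<beta> x) * det_on (UNIV - {a}) (\<lambda>\<alpha> \<beta>. logG_mat g x $ \<alpha> $ \<beta>) = density x"
      unfolding det_on_UNIV det_on_minor det_logG_minor[OF xS xa] by (simp add: density_def power2_eq_square divide_inverse)
    finally show ?thesis .
  qed
  have Lsm: "replicate (n - 1) (\<lambda>i j. \<i> * V i j) @ replicate n (\<lambda>i j. \<i> * H i j) = map (\<lambda>K i j. \<i> * K i j) Ls"
    by (simp add: Ls_def)
  have wV: "wedge_pow (omega_V_full g x) k = (\<lambda>I J. (-1) ^ (\<Sum>i<k. i) * product_form (replicate k (\<lambda>i j. \<i> * V i j)) I J)" for k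
    unfolding omega_V_full_def form11_product_form V_def by (rule wedge_pow_product_form)
  have wH: "wedge_pow (omega_H_full g x) k = (\<lambda>I J. (-1) ^ (\<Sum>i<k. i) * product_form (replicate k (\<lambda>i j. \<i> * H i j)) I J)" for k
    unfolding omega_H_full_def form11_product_form H_def by (rule wedge_pow_product_form)
  define s where "s = (\<Sum>i<n - 1. i) + (\<Sum>i<n. i) + (n - 1) * n"
  have "vol_form g x I I = (-1) ^ s * (\<i> ^ N * product_form Ls I I) / (fact (n - 1) * fact n)"
    unfolding vol_form_def n_def[symmetric] wV wH wedge_scale_left wedge_scale_right wedge_product_form length_replicate Lsm product_form_scale
    using n by (simp add: Ls_def s_def power_add mult_ac)
  moreover have "s = N * (N - 1) div 2"
  proof -
    obtain m where m: "n = Suc m" using n(1) gr0_implies_Suc by blast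
    have "2 * s = N * (N - 1)"
      using sum_lessThan_triangle[of m] n(2) by (simp add: s_def m algebra_simps)
    then show ?thesis by simp
  qed
  moreover have "vol_density g a y = Re (vol_form g x I I * (-1) ^ (N * (N - 1) div 2) * (- 2 * \<i>) ^ N)"
    by (simp add: vol_density_def Let_def x_def I_def N_def)
  ultimately have "vol_density g a y = Re (((-1) ^ s * (-1) ^ s) * (\<i> ^ N * (- 2 * \<i>) ^ N) * (product_form Ls I I / (fact (n - 1) * fact n)))"
    by (simp add: mult_ac)
  also have "(-1) ^ s * (-1) ^ s = (1::complex)" by (simp flip: power_add)
  also have "\<i> ^ N * (- 2 * \<i>) ^ N = 2 ^ N"
  proof -
    have "\<i> * (- 2 * \<i>) = 2" by (simp add: complex_eq_iff)
    then show ?thesis unfolding power_mult_distrib[symmetric] by simp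
  qed
  also have "1 * 2 ^ N * (product_form Ls I I / (fact (n - 1) * fact n)) = of_real (vol_const a) * density x"
    unfolding pf vol_const_def by (simp add: N_def n_def)
  finally show ?thesis by (simp add: x_def)
qed


section \<open>Holomorphic functions of several variables are smooth\<close>

text \<open>Real differentiability with a complex linear derivative. Continuity of the derivative is not part of the
  definition; it follows from Cauchy's formula.\<close>

definition complex_differentiable_on :: "(complex^'n::finite) set \<Rightarrow> (complex^'n \<Rightarrow> complex) \<Rightarrow> bool" where
  "complex_differentiable_on S f \<longleftrightarrow>
     (\<forall>x\<in>S. \<exists>L. (f has_derivative L) (at x) \<and> (\<forall>c h. L (c *s h) = c * L h))"

lemma norm_vector_smult: "norm (c *s (x::complex^'n::finite)) = cmod c * norm x"
  by (simp add: norm_vec_def L2_set_right_distrib norm_mult)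

lemma bounded_linear_smult_left: "bounded_linear (\<lambda>c::complex. c *s (h::complex^'n::finite))"
  by (rule linear_conv_bounded_linear[THEN iffD1], rule linearI) (auto simp: vec_eq_iff algebra_simps)

lemma complex_differentiable_onD:
  assumes "complex_differentiable_on S f" "x \<in> S"
  shows "(f has_derivative frechet_derivative f (at x)) (at x)"
    and "frechet_derivative f (at x) (c *s h) = c * frechet_derivative f (at x) h"
proof -
  obtain L where L: "(f has_derivative L) (at x)" "\<And>c h. L (c *s h) = c * L h"
    using assms unfolding complex_differentiable_on_def by blast
  have "L = frechet_derivative f (at x)" by (rule frechet_derivative_at[OF L(1)])
  then show "(f has_derivative frechet_derivative f (at x)) (at x)"
    "frechet_derivative f (at x) (c *s h) = c * frechet_derivative f (at x) h" using L by auto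
qed

text \<open>Cauchy's formula on the complex line through \<open>x\<close> in the direction \<open>h\<close>, uniformly for all \<open>x\<close> in a
  ball. The weight \<open>k\<close> and the circle \<open>c\<close> do not depend on \<open>x\<close>, so the derivative inherits the
  regularity of \<open>f\<close>.\<close>

lemma directional_Cauchy_formula:
  assumes f: "complex_differentiable_on S f" and r: "0 < r" "ball x0 (2 * r) \<subseteq> S"
  shows "\<exists>c k :: real \<Rightarrow> complex. continuous_on {0..1} c \<and> continuous_on {0..1} k \<and>
    (\<forall>x\<in>ball x0 r. \<forall>t. x + c t *s h \<in> ball x0 (2 * r)) \<and>
    (\<forall>x\<in>ball x0 r. frechet_derivative f (at x) h = integral {0..1} (\<lambda>t. f (x + c t *s h) * k t))"
proof -
  define \<epsilon> where "\<epsilon> = r / (norm h + 1)"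
  have pos: "0 < norm h + 1" by (simp add: add_nonneg_pos)
  have \<epsilon>: "0 < \<epsilon>" using r pos by (simp add: \<epsilon>_def)
  have "\<epsilon> * norm h < \<epsilon> * (norm h + 1)" using \<epsilon> by simp
  also have "\<dots> = r" using pos by (simp add: \<epsilon>_def)
  finally have \<epsilon>h: "\<epsilon> * norm h < r" .
  have inb: "x + \<zeta> *s h \<in> ball x0 (2 * r)" if "x \<in> ball x0 r" "cmod \<zeta> \<le> \<epsilon>" for x \<zeta>
  proof -
    have "norm (x + \<zeta> *s h - x0) \<le> norm (x - x0) + norm (\<zeta> *s h)"
      using norm_triangle_ineq[of "x - x0" "\<zeta> *s h"] by (simp add: algebra_simps)
    also have "norm (\<zeta> *s h) \<le> \<epsilon> * norm h"
      unfolding norm_vector_smult using that by (intro mult_right_mono) auto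
    also have "norm (x - x0) < r" using that by (simp add: dist_norm norm_minus_commute)
    finally show ?thesis using \<epsilon>h by (simp add: dist_norm norm_minus_commute)
  qed
  define c where "c = circlepath 0 \<epsilon>"
  define k where "k t = 1 / (2 * of_real pi * \<i>) * (1 / (c t)\<^sup>2 * (2 * pi * \<i> * \<epsilon> * exp (2 * of_real pi * \<i> * t)))" for t
  have c: "c t = \<epsilon> * exp (2 * of_real pi * \<i> * t)" for t by (simp add: c_def circlepath)
  have cnz: "c t \<noteq> 0" for t using \<epsilon> by (simp add: c)
  have cn: "cmod (c t) = \<epsilon>" for t using \<epsilon> by (simp add: c norm_mult)
  show ?thesis
  proof (rule exI[of _ c], rule exI[of _ k], intro conjI ballI allI)
    show cc: "continuous_on {0..1} c" unfolding c[abs_def] by (intro continuous_intros)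
    show "continuous_on {0..1} k" unfolding k_def[abs_def] using cnz cc by (intro continuous_intros) auto
  next
    fix x t assume "x \<in> ball x0 r"
    then show "x + c t *s h \<in> ball x0 (2 * r)" using inb[of x "c t"] cn by simp
  next
    fix x assume x: "x \<in> ball x0 r"
    define u where "u \<zeta> = f (x + \<zeta> *s h)" for \<zeta>
    have du: "(u has_field_derivative frechet_derivative f (at (x + \<zeta> *s h)) h) (at \<zeta>)" if "cmod \<zeta> \<le> \<epsilon>" for \<zeta>
    proof -
      have xS: "x + \<zeta> *s h \<in> S" using inb[OF x that] r by auto
      have "((\<lambda>\<zeta>. x + \<zeta> *s h) has_derivative (\<lambda>w. w *s h)) (at \<zeta>)"
        by (intro has_derivative_add_const has_derivative_add[OF has_derivative_const, of _ _ _ x, simplified]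
            bounded_linear_imp_has_derivative bounded_linear_smult_left)
      then have "(u has_derivative (\<lambda>w. frechet_derivative f (at (x + \<zeta> *s h)) (w *s h))) (at \<zeta>)"
        unfolding u_def by (rule has_derivative_compose) (rule complex_differentiable_onD(1)[OF f xS])
      moreover have "(\<lambda>w. frechet_derivative f (at (x + \<zeta> *s h)) (w *s h)) = (*) (frechet_derivative f (at (x + \<zeta> *s h)) h)"
        by (simp add: fun_eq_iff complex_differentiable_onD(2)[OF f xS])
      ultimately show ?thesis by (simp add: has_field_derivative_def)
    qed
    have hol: "u holomorphic_on ball 0 \<epsilon>"
      using du by (subst holomorphic_on_open) (auto intro!: exI du)
    have cont: "continuous_on (cball 0 \<epsilon>) u"
      using du by (intro continuous_at_imp_continuous_on ballI DERIV_isCont) auto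
    have "(u has_field_derivative 1 / (2 * of_real pi * \<i>) * contour_integral (circlepath 0 \<epsilon>) (\<lambda>w. u w / (w - 0)\<^sup>2)) (at 0)"
      by (rule Cauchy_derivative_integral_circlepath(2)[OF cont hol]) (use \<epsilon> in simp)
    from DERIV_unique[OF this du[of 0]]
    have "frechet_derivative f (at x) h = 1 / (2 * of_real pi * \<i>) * contour_integral (circlepath 0 \<epsilon>) (\<lambda>w. u w / (w - 0)\<^sup>2)"
      using \<epsilon> by simp
    also have "contour_integral (circlepath 0 \<epsilon>) (\<lambda>w. u w / (w - 0)\<^sup>2)
      = integral {0..1} (\<lambda>t. u (c t) / (c t)\<^sup>2 * (2 * pi * \<i> * \<epsilon> * exp (2 * of_real pi * \<i> * t)))"
      unfolding contour_integral_integral c_def[symmetric] by (simp add: c_def vector_derivative_circlepath)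
    also have "1 / (2 * of_real pi * \<i>) * \<dots> = integral {0..1} (\<lambda>t. 1 / (2 * of_real pi * \<i>) * (u (c t) / (c t)\<^sup>2 * (2 * pi * \<i> * \<epsilon> * exp (2 * of_real pi * \<i> * t))))"
      by (rule integral_mult_right[symmetric])
    also have "\<dots> = integral {0..1} (\<lambda>t. f (x + c t *s h) * k t)"
      unfolding u_def k_def by (rule integral_cong) (simp only: divide_inverse mult_1_left mult_ac)
    finally show "frechet_derivative f (at x) h = integral {0..1} (\<lambda>t. f (x + c t *s h) * k t)" .
  qed
qed

lemma complex_differentiable_continuous:
  assumes "complex_differentiable_on S f" shows "continuous_on S f"
  using complex_differentiable_onD(1)[OF assms]
  by (meson continuous_at_imp_continuous_on has_derivative_continuous)

lemma continuous_on_shifted_line: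
  assumes g: "continuous_on (ball x0 (2 * r)) g" and c: "continuous_on {0..1} c"
    and inb: "\<And>x t. x \<in> ball x0 r \<Longrightarrow> x + c t *s h \<in> ball x0 (2 * r)"
  shows "continuous_on (ball x0 r \<times> cbox 0 1) (\<lambda>(x, t::real). g (x + c t *s (h::complex^'n::finite)))"
  unfolding split_beta
proof (rule continuous_on_compose2[OF g])
  have "continuous_on (ball x0 r \<times> cbox 0 1) (\<lambda>p. c (snd p))"
    by (rule continuous_on_compose2[OF c]) (auto intro: continuous_intros)
  then have "continuous_on (ball x0 r \<times> cbox 0 1) (\<lambda>p. c (snd p) *s h)"
    by (rule bounded_linear.continuous_on[OF bounded_linear_smult_left])
  then show "continuous_on (ball x0 r \<times> cbox 0 1) (\<lambda>p. fst p + c (snd p) *s h)"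
    by (intro continuous_intros)
qed (use inb in auto)

lemma continuous_on_frechet_derivative_complex:
  assumes S: "open S" and f: "complex_differentiable_on S f"
  shows "continuous_on S (\<lambda>x. frechet_derivative f (at x) h)"
proof -
  have "continuous (at x0) (\<lambda>x. frechet_derivative f (at x) h)" if x0: "x0 \<in> S" for x0
  proof -
    obtain r' where r': "0 < r'" "ball x0 r' \<subseteq> S" using S x0 openE by blast
    define r where "r = r' / 2"
    have r: "0 < r" "ball x0 (2 * r) \<subseteq> S" using r' by (auto simp: r_def)
    obtain c k :: "real \<Rightarrow> complex" where P: "continuous_on {0..1} c \<and> continuous_on {0..1} k \<and>
        (\<forall>x\<in>ball x0 r. \<forall>t. x + c t *s h \<in> ball x0 (2 * r)) \<and>
        (\<forall>x\<in>ball x0 r. frechet_derivative f (at x) h = integral {0..1} (\<lambda>t. f (x + c t *s h) * k t))"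
      using directional_Cauchy_formula[OF f r, of h] by (elim exE)
    have ck: "continuous_on {0..1} c" "continuous_on {0..1} k"
      "\<And>x t. x \<in> ball x0 r \<Longrightarrow> x + c t *s h \<in> ball x0 (2 * r)"
      "\<And>x. x \<in> ball x0 r \<Longrightarrow> frechet_derivative f (at x) h = integral {0..1} (\<lambda>t. f (x + c t *s h) * k t)"
      using P by blast+
    have "continuous_on (ball x0 r \<times> cbox 0 1) (\<lambda>(x, t). f (x + c t *s h))"
      by (rule continuous_on_shifted_line[OF continuous_on_subset[OF complex_differentiable_continuous[OF f] r(2)] ck(1,3)])
    moreover have "continuous_on (ball x0 r \<times> cbox 0 1) (\<lambda>p. k (snd p))"
      by (rule continuous_on_compose2[OF ck(2)]) (auto intro: continuous_intros)
    ultimately have "continuous_on (ball x0 r \<times> cbox 0 1) (\<lambda>(x, t). f (x + c t *s h) * k t)"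
      unfolding split_beta by (intro continuous_intros)
    then have "continuous_on (ball x0 r) (\<lambda>x. integral (cbox 0 1) (\<lambda>t. f (x + c t *s h) * k t))"
      by (rule integral_continuous_on_param)
    then have "continuous_on (ball x0 r) (\<lambda>x. frechet_derivative f (at x) h)"
      by (rule continuous_on_eq) (simp add: ck(4))
    then show ?thesis using r(1) by (simp add: continuous_on_eq_continuous_at)
  qed
  then show ?thesis by (rule continuous_at_imp_continuous_on[OF ballI])
qed

text \<open>Differentiation under the integral sign in Cauchy's formula on lines. With this lemma, smoothness follows by
  induction on the order of differentiation.\<close>

lemma complex_differentiable_frechet_derivative:
  assumes S: "open S" and f: "complex_differentiable_on S f"
  shows "complex_differentiable_on S (\<lambda>x. frechet_derivative f (at x) h)"
  unfolding complex_differentiable_on_def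
proof
  fix x0 assume x0: "x0 \<in> S"
  obtain r' where r': "0 < r'" "ball x0 r' \<subseteq> S" using S x0 openE by blast
  define r where "r = r' / 2"
  have r: "0 < r" "ball x0 (2 * r) \<subseteq> S" using r' by (auto simp: r_def)
  obtain c k :: "real \<Rightarrow> complex" where P: "continuous_on {0..1} c \<and> continuous_on {0..1} k \<and>
      (\<forall>x\<in>ball x0 r. \<forall>t. x + c t *s h \<in> ball x0 (2 * r)) \<and>
      (\<forall>x\<in>ball x0 r. frechet_derivative f (at x) h = integral {0..1} (\<lambda>t. f (x + c t *s h) * k t))"
    using directional_Cauchy_formula[OF f r, of h] by (elim exE)
  have ck: "continuous_on {0..1} c" "continuous_on {0..1} k"
    "\<And>x t. x \<in> ball x0 r \<Longrightarrow> x + c t *s h \<in> ball x0 (2 * r)"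
    "\<And>x. x \<in> ball x0 r \<Longrightarrow> frechet_derivative f (at x) h = integral {0..1} (\<lambda>t. f (x + c t *s h) * k t)"
    using P by blast+
  define Df where "Df x = Blinfun (frechet_derivative f (at x))" for x
  have Df: "blinfun_apply (Df x) = frechet_derivative f (at x)" if "x \<in> S" for x
    unfolding Df_def using has_derivative_bounded_linear[OF complex_differentiable_onD(1)[OF f that]]
    by (rule bounded_linear_Blinfun_apply)
  have cDf: "continuous_on S Df"
  proof (rule continuous_on_blinfun_componentwise)
    fix i show "continuous_on S (\<lambda>x. blinfun_apply (Df x) i)"
      using continuous_on_frechet_derivative_complex[OF S f, of i] by (rule continuous_on_eq) (simp add: Df)
  qed
  define fx where "fx x t = blinfun_mult_left (k t) o\<^sub>L Df (x + c t *s h)" for x t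
  have in2: "x + c t *s h \<in> S" if "x \<in> ball x0 r" for x t using ck(3)[OF that] r by auto
  have kc: "continuous_on (ball x0 r \<times> cbox 0 1) (\<lambda>p. k (snd p))"
    by (rule continuous_on_compose2[OF ck(2)]) (auto intro: continuous_intros)
  have contfx: "continuous_on (ball x0 r \<times> cbox 0 1) (\<lambda>(x, t). fx x t)"
    unfolding fx_def split_beta
    by (intro continuous_intros bounded_linear.continuous_on[OF bounded_linear_blinfun_mult_left] kc
       continuous_on_shifted_line[OF continuous_on_subset[OF cDf r(2)] ck(1,3), unfolded split_beta])
  have section_cont: "continuous_on (cbox 0 1) (\<lambda>t::real. (x, t))" for x :: "complex^'n"
    by (intro continuous_intros)
  have section_sub: "(\<lambda>t. (x, t)) ` cbox 0 (1::real) \<subseteq> ball x0 r \<times> cbox 0 1" if "x \<in> ball x0 r" for x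
    using that by auto
  have integrable: "(\<lambda>t. f (x + c t *s h) * k t) integrable_on cbox 0 1" if x: "x \<in> ball x0 r" for x
  proof (rule integrable_continuous)
    have "continuous_on (ball x0 r \<times> cbox 0 1) (\<lambda>(x, t). f (x + c t *s h))"
      by (rule continuous_on_shifted_line[OF continuous_on_subset[OF complex_differentiable_continuous[OF f] r(2)] ck(1,3)])
    from continuous_on_compose2[OF this[unfolded split_beta] section_cont section_sub[OF x]]
    have "continuous_on (cbox 0 1) (\<lambda>t. f (x + c t *s h))" by simp
    then show "continuous_on (cbox 0 1) (\<lambda>t. f (x + c t *s h) * k t)"
      using ck(2) by (intro continuous_intros) auto
  qed
  have "((\<lambda>x. integral (cbox 0 1) (\<lambda>t. f (x + c t *s h) * k t)) has_derivative integral (cbox 0 1) (fx x0)) (at x0 within ball x0 r)"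
  proof (rule leibniz_rule[OF _ integrable contfx])
    fix x and t :: real assume x: "x \<in> ball x0 r"
    have "((\<lambda>x. f (x + c t *s h)) has_derivative (\<lambda>u. frechet_derivative f (at (x + c t *s h)) u)) (at x within ball x0 r)"
      by (rule has_derivative_compose[where f = "\<lambda>x. x + c t *s h" and f' = "\<lambda>u. u", OF _ complex_differentiable_onD(1)[OF f in2[OF x]]])
        (auto intro!: derivative_eq_intros)
    then have "((\<lambda>x. f (x + c t *s h) * k t) has_derivative (\<lambda>u. frechet_derivative f (at (x + c t *s h)) u * k t)) (at x within ball x0 r)"
      by (rule has_derivative_mult_left)
    moreover have "blinfun_apply (fx x t) = (\<lambda>u. frechet_derivative f (at (x + c t *s h)) u * k t)"
      by (rule ext) (simp add: fx_def Df[OF in2[OF x]])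
    ultimately show "((\<lambda>x. f (x + c t *s h) * k t) has_derivative blinfun_apply (fx x t)) (at x within ball x0 r)"
      by simp
  qed (use r in auto)
  then have "((\<lambda>x. integral (cbox 0 1) (\<lambda>t. f (x + c t *s h) * k t)) has_derivative integral (cbox 0 1) (fx x0)) (at x0)"
    using r(1) by (simp add: at_within_open[of x0 "ball x0 r"])
  then have D: "((\<lambda>x. frechet_derivative f (at x) h) has_derivative integral (cbox 0 1) (fx x0)) (at x0)"
    by (rule has_derivative_transform_within_open[of _ _ _ _ "ball x0 r"]) (use r ck(4) in auto)
  have fxi: "fx x0 integrable_on cbox 0 1"
  proof (rule integrable_continuous)
    show "continuous_on (cbox 0 1) (fx x0)"
      using continuous_on_compose2[OF contfx[unfolded split_beta] section_cont section_sub[of x0]] r by simp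
  qed
  have app: "blinfun_apply (integral (cbox 0 1) (fx x0)) u = integral (cbox 0 1) (\<lambda>t. blinfun_apply (fx x0 t) u)" for u
    using integral_linear[OF fxi blinfun.bounded_linear_left[of u]] by (simp add: o_def)
  have "blinfun_apply (integral (cbox 0 1) (fx x0)) (a *s u) = a * blinfun_apply (integral (cbox 0 1) (fx x0)) u" for a u
  proof -
    have x0r: "x0 \<in> ball x0 r" using r by simp
    have "blinfun_apply (fx x0 t) (a *s u) = a * blinfun_apply (fx x0 t) u" for t
      by (simp add: fx_def Df[OF in2[OF x0r]] complex_differentiable_onD(2)[OF f in2[OF x0r]])
    then show ?thesis unfolding app by simp
  qed
  with D show "\<exists>L. ((\<lambda>x. frechet_derivative f (at x) h) has_derivative L) (at x0) \<and> (\<forall>c h. L (c *s h) = c * L h)"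
    by blast
qed

theorem complex_differentiable_smooth:
  assumes "open S" "complex_differentiable_on S f"
  shows "smooth_on S f"
  unfolding smooth_on_def
proof
  fix k show "Ck_on k S f"
    using assms(2)
  proof (induction k arbitrary: f)
    case 0
    then show ?case by (simp add: complex_differentiable_continuous)
  next
    case (Suc k)
    have "f differentiable_on S"
      using complex_differentiable_onD(1)[OF Suc.prems] assms(1)
      by (auto simp: differentiable_on_eq_differentiable_at differentiable_def)
    then show ?case
      using Suc.IH[OF complex_differentiable_frechet_derivative[OF assms(1) Suc.prems]] by simp
  qed
qed

lemma holo_map_on_component:
  assumes "holo_map_on S t"
  shows "complex_differentiable_on S (\<lambda>z. t z $ k)"
  unfolding complex_differentiable_on_def
proof
  fix z assume "z \<in> S"
  then obtain A where "(t has_derivative (\<lambda>h. A *v h)) (at z)"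
    using assms unfolding holo_map_on_def by blast
  then have "((\<lambda>z. t z $ k) has_derivative (\<lambda>h. (A *v h) $ k)) (at z)"
    by (rule bounded_linear.has_derivative[OF bounded_linear_vec_nth])
  moreover have "(A *v (c *s h)) $ k = c * (A *v h) $ k" for c h
    by (simp add: matrix_vector_mult_def sum_distrib_left mult_ac)
  ultimately show "\<exists>L. ((\<lambda>z. t z $ k) has_derivative L) (at z) \<and> (\<forall>c h. L (c *s h) = c * L h)"
    by blast
qed

lemma holo_map_on_matrix:
  assumes "holo_map_on S t" "z \<in> S"
  shows "(t has_derivative (\<lambda>h. matrix (frechet_derivative t (at z)) *v h)) (at z)"
proof -
  obtain A where A: "(t has_derivative (\<lambda>h. A *v h)) (at z)"
    using assms unfolding holo_map_on_def by blast
  then have "frechet_derivative t (at z) = (\<lambda>h. A *v h)" by (rule frechet_derivative_at[symmetric])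
  then show ?thesis using A by (simp add: matrix_of_matrix_vector_mul)
qed

lemma holo_map_on_matrix_entry:
  assumes S: "open S" and t: "holo_map_on S t"
  shows "complex_differentiable_on S (\<lambda>z. matrix (frechet_derivative t (at z)) $ i $ j)"
proof -
  have eq: "frechet_derivative (\<lambda>z. t z $ i) (at z) (axis j 1) = matrix (frechet_derivative t (at z)) $ i $ j" if "z \<in> S" for z
  proof -
    have "((\<lambda>z. t z $ i) has_derivative (\<lambda>h. (matrix (frechet_derivative t (at z)) *v h) $ i)) (at z)"
      by (rule bounded_linear.has_derivative[OF bounded_linear_vec_nth holo_map_on_matrix[OF t that]])
    from frechet_derivative_at[OF this, symmetric] show ?thesis
      by (simp add: matrix_vector_mult_def axis_def if_distrib cong: if_cong)
  qed
  have *: "complex_differentiable_on S (\<lambda>z. frechet_derivative (\<lambda>z. t z $ i) (at z) (axis j 1))"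
    by (rule complex_differentiable_frechet_derivative[OF S holo_map_on_component[OF t]])
  show ?thesis
    unfolding complex_differentiable_on_def
  proof
    fix z assume z: "z \<in> S"
    obtain L where L: "((\<lambda>z. frechet_derivative (\<lambda>z. t z $ i) (at z) (axis j 1)) has_derivative L) (at z)" "\<forall>c h. L (c *s h) = c * L h"
      using * z unfolding complex_differentiable_on_def by blast
    have "((\<lambda>z. matrix (frechet_derivative t (at z)) $ i $ j) has_derivative L) (at z)"
      by (rule has_derivative_transform_within_open[OF L(1) S z eq])
    with L(2) show "\<exists>L. ((\<lambda>z. matrix (frechet_derivative t (at z)) $ i $ j) has_derivative L) (at z) \<and> (\<forall>c h. L (c *s h) = c * L h)"
      by blast
  qed
qed


section \<open>The tangent bundle in charts\<close>

lemma complex_linear_expansion: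
  fixes L :: "complex^'n::finite \<Rightarrow> complex"
  assumes "linear L" "\<And>c h. L (c *s h) = c * L h"
  shows "L h = (\<Sum>\<mu>\<in>UNIV. L (axis \<mu> 1) * h $ \<mu>)"
proof -
  have "h = (\<Sum>\<mu>\<in>UNIV. (h $ \<mu>) *s axis \<mu> 1)"
    by (simp add: vec_eq_iff axis_def if_distrib cong: if_cong)
  then have "L h = L (\<Sum>\<mu>\<in>UNIV. (h $ \<mu>) *s axis \<mu> 1)" by simp
  then show ?thesis by (simp add: linear_sum[OF assms(1)] assms(2) mult.commute)
qed

locale finsler_manifold =
  fixes A :: "('m::{t2_space, second_countable_topology}, 'n::finite) chart set"
    and F :: "('m, 'n) tvec \<Rightarrow> real"
  assumes manifold: "complex_manifold A" and finsler: "complex_finsler A F" and spc: "strongly_pseudoconvex A F"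
begin

definition overlap :: "('m, 'n) chart \<Rightarrow> ('m, 'n) chart \<Rightarrow> (complex^'n) set" where
  "overlap c d = cmap c ` (cdom c \<inter> cdom d)"

lemma chart_open: "c \<in> A \<Longrightarrow> open (cdom c)" "c \<in> A \<Longrightarrow> open (cmap c ` cdom c)"
  using manifold by (auto simp: complex_manifold_def)

lemma charts_cover: obtains c where "c \<in> A" "x \<in> cdom c"
  using manifold unfolding complex_manifold_def by blast

lemma chart_homeomorphism: "c \<in> A \<Longrightarrow> homeomorphism (cdom c) (cmap c ` cdom c) (cmap c) (cinv c)"
  using manifold by (auto simp: complex_manifold_def)

lemma cinv_cmap: "c \<in> A \<Longrightarrow> x \<in> cdom c \<Longrightarrow> cinv c (cmap c x) = x"
  using chart_homeomorphism homeomorphism_apply1 by blast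

lemma cmap_cinv: "c \<in> A \<Longrightarrow> z \<in> cmap c ` cdom c \<Longrightarrow> cmap c (cinv c z) = z"
  using chart_homeomorphism homeomorphism_apply2 by blast

lemma cinv_in: "c \<in> A \<Longrightarrow> z \<in> cmap c ` cdom c \<Longrightarrow> cinv c z \<in> cdom c"
  by (auto simp: cinv_cmap)

lemma overlap_eq: "c \<in> A \<Longrightarrow> overlap c d = cmap c ` cdom c \<inter> cinv c -` cdom d"
  unfolding overlap_def by (auto simp: cinv_cmap)

lemma open_overlap: "c \<in> A \<Longrightarrow> d \<in> A \<Longrightarrow> open (overlap c d)"
  unfolding overlap_eq
  using chart_open homeomorphism_cont2[OF chart_homeomorphism] continuous_open_preimage by metis

lemma holo_transition: "c \<in> A \<Longrightarrow> d \<in> A \<Longrightarrow> holo_map_on (overlap c d) (transition c d)"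
  using manifold by (auto simp: complex_manifold_def overlap_def)

lemma transition_cmap: "c \<in> A \<Longrightarrow> x \<in> cdom c \<Longrightarrow> transition c d (cmap c x) = cmap d x"
  by (simp add: transition_def cinv_cmap)

lemma transition_derivative:
  "c \<in> A \<Longrightarrow> d \<in> A \<Longrightarrow> z \<in> overlap c d \<Longrightarrow> (transition c d has_derivative (\<lambda>h. jac c d z *v h)) (at z)"
  unfolding jac_def by (rule holo_map_on_matrix[OF holo_transition])

lemma jac_complex_differentiable:
  "c \<in> A \<Longrightarrow> d \<in> A \<Longrightarrow> complex_differentiable_on (overlap c d) (\<lambda>z. jac c d z $ i $ j)"
  unfolding jac_def by (rule holo_map_on_matrix_entry[OF open_overlap holo_transition])

lemma jac_unique:
  assumes "(transition c d has_derivative (\<lambda>h. B *v h)) (at z)" shows "jac c d z = B"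
proof -
  have "frechet_derivative (transition c d) (at z) = (\<lambda>h. B *v h)"
    by (rule frechet_derivative_at[symmetric, OF assms])
  then show ?thesis by (simp add: jac_def matrix_of_matrix_vector_mul)
qed

lemma jac_self:
  assumes c: "c \<in> A" and z: "z \<in> cmap c ` cdom c" shows "jac c c z = mat 1"
proof (rule jac_unique)
  have "((\<lambda>h. h) has_derivative (\<lambda>h. h)) (at z)" by (rule has_derivative_ident)
  then show "(transition c c has_derivative (\<lambda>h. mat 1 *v h)) (at z)"
    unfolding matrix_vector_mul_lid
    by (rule has_derivative_transform_within_open[OF _ chart_open(2)[OF c] z])
      (simp add: transition_def cmap_cinv[OF c])
qed

lemma jac_cocycle:
  assumes A: "c \<in> A" "d \<in> A" "e \<in> A" and x: "x \<in> cdom c" "x \<in> cdom d" "x \<in> cdom e"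
  shows "jac c e (cmap c x) = jac d e (cmap d x) ** jac c d (cmap c x)"
proof (rule jac_unique)
  have zo: "cmap c x \<in> overlap c d" "cmap c x \<in> overlap c e" "cmap d x \<in> overlap d e" using x by (auto simp: overlap_def)
  have t: "transition c d (cmap c x) = cmap d x" by (rule transition_cmap[OF A(1) x(1)])
  have "((\<lambda>z. transition d e (transition c d z)) has_derivative (\<lambda>h. jac d e (cmap d x) *v (jac c d (cmap c x) *v h))) (at (cmap c x))"
    by (rule has_derivative_compose[OF transition_derivative[OF A(1,2) zo(1)]])
      (use transition_derivative[OF A(2,3) zo(3)] t in simp)
  then show "(transition c e has_derivative (\<lambda>h. (jac d e (cmap d x) ** jac c d (cmap c x)) *v h)) (at (cmap c x))"
    unfolding matrix_vector_mul_assoc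
  proof (rule has_derivative_transform_within_open[OF _ open_Int[OF open_overlap[OF A(1,2)] open_overlap[OF A(1,3)]]])
    show "cmap c x \<in> overlap c d \<inter> overlap c e" using zo by auto
    show "transition d e (transition c d z) = transition c e z" if "z \<in> overlap c d \<inter> overlap c e" for z
    proof -
      have "z \<in> overlap c d" using that by simp
      then obtain x' where x': "z = cmap c x'" "x' \<in> cdom c" "x' \<in> cdom d" unfolding overlap_def by blast
      then show ?thesis using A by (simp add: transition_cmap)
    qed
  qed
qed

lemma jac_inverse:
  assumes A: "c \<in> A" "d \<in> A" and x: "x \<in> cdom c" "x \<in> cdom d"
  shows "jac d c (cmap d x) ** jac c d (cmap c x) = mat 1"
  using jac_cocycle[OF A(1,2,1) x(1,2,1)] jac_self[OF A(1), of "cmap c x"] x by simp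

lemma tcoord_in_tdom: "fst u \<in> cdom c \<Longrightarrow> tcoord c u \<in> tdom c"
  by (simp add: tcoord_def tdom_def)

lemma TM_iff: "u \<in> TM A \<longleftrightarrow> (\<forall>c. c \<notin> A \<or> fst u \<notin> cdom c \<longrightarrow> snd u c = 0) \<and>
    (\<forall>c\<in>A. \<forall>d\<in>A. fst u \<in> cdom c \<inter> cdom d \<longrightarrow> snd u d = jac c d (cmap c (fst u)) *v snd u c)"
  by (cases u) (simp only: TM_def mem_Collect_eq prod.case fst_conv snd_conv)

lemma TM_snd_zero: "u \<in> TM A \<Longrightarrow> c \<notin> A \<or> fst u \<notin> cdom c \<Longrightarrow> snd u c = 0"
  unfolding TM_iff by blast

lemma TM_snd:
  "u \<in> TM A \<Longrightarrow> c \<in> A \<Longrightarrow> d \<in> A \<Longrightarrow> fst u \<in> cdom c \<Longrightarrow> fst u \<in> cdom d \<Longrightarrow>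
    snd u d = jac c d (cmap c (fst u)) *v snd u c"
  unfolding TM_iff by blast

lemma tcoord_inj:
  assumes "c \<in> A" "u \<in> TM A" "w \<in> TM A" "fst u \<in> cdom c" "fst w \<in> cdom c" "tcoord c u = tcoord c w"
  shows "u = w"
proof -
  have f: "fst u = fst w" using assms cinv_cmap unfolding tcoord_def by (metis fst_conv)
  have "snd u d = snd w d" for d
  proof (cases "d \<in> A \<and> fst u \<in> cdom d")
    case True
    then show ?thesis using assms TM_snd[of u c d] TM_snd[of w c d] f by (simp add: tcoord_def)
  next
    case False
    then show ?thesis using TM_snd_zero[OF assms(2), of d] TM_snd_zero[OF assms(3), of d] f by auto
  qed
  then show ?thesis using f by (simp add: prod_eq_iff fun_eq_iff)
qed

text \<open>The components in one chart determine those in all others through the Jacobians, and the cocycle identity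
  makes the resulting family compatible.\<close>

lemma TM_point_exists:
  assumes c: "c \<in> A" and p: "p \<in> tdom c"
  shows "\<exists>u\<in>TM A. fst u \<in> cdom c \<and> tcoord c u = p"
proof -
  obtain x v where xv: "p = (cmap c x, v)" "x \<in> cdom c" using p by (auto simp: tdom_def)
  define X where "X d = (if d \<in> A \<and> x \<in> cdom d then jac c d (cmap c x) *v v else 0)" for d
  have "(x, X) \<in> TM A"
    unfolding TM_iff fst_conv snd_conv
  proof (intro conjI allI ballI impI)
    fix d assume "d \<notin> A \<or> x \<notin> cdom d"
    then show "X d = 0" by (auto simp: X_def)
  next
    fix d e assume "d \<in> A" "e \<in> A" "x \<in> cdom d \<inter> cdom e"
    then show "X e = jac d e (cmap d x) *v X d"
      using jac_cocycle[OF c, of d e x] xv(2) by (simp add: X_def matrix_vector_mul_assoc)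
  qed
  moreover have "X c = v" using c xv jac_self[OF c, of "cmap c x"] by (simp add: X_def)
  ultimately show ?thesis using xv by (intro bexI[of _ "(x, X)"]) (auto simp: tcoord_def)
qed

lemma tpoint:
  assumes "c \<in> A" "p \<in> tdom c"
  shows "tpoint A c p \<in> TM A" "fst (tpoint A c p) \<in> cdom c" "tcoord c (tpoint A c p) = p"
proof -
  have p: "p \<in> tcoord c ` {u \<in> TM A. fst u \<in> cdom c}" using TM_point_exists[OF assms] by auto
  show "tpoint A c p \<in> TM A" "fst (tpoint A c p) \<in> cdom c"
    using inv_into_into[OF p] by (auto simp: tpoint_def)
  show "tcoord c (tpoint A c p) = p" unfolding tpoint_def by (rule f_inv_into_f[OF p])
qed

lemma tpoint_tcoord: "c \<in> A \<Longrightarrow> u \<in> TM A \<Longrightarrow> fst u \<in> cdom c \<Longrightarrow> tpoint A c (tcoord c u) = u"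
  using tcoord_inj tpoint tcoord_in_tdom by metis

lemma tscale_TM: "u \<in> TM A \<Longrightarrow> tscale \<zeta> u \<in> TM A"
  unfolding TM_iff tscale_def fst_conv snd_conv
proof (elim conjE, intro conjI allI ballI impI)
  assume z: "\<forall>c. c \<notin> A \<or> fst u \<notin> cdom c \<longrightarrow> snd u c = 0"
  show "\<zeta> *s snd u c = 0" if "c \<notin> A \<or> fst u \<notin> cdom c" for c
  proof -
    have "snd u c = 0" using z that by blast
    then show ?thesis by simp
  qed
next
  fix c d assume t: "\<forall>c\<in>A. \<forall>d\<in>A. fst u \<in> cdom c \<inter> cdom d \<longrightarrow> snd u d = jac c d (cmap c (fst u)) *v snd u c"
    and cd: "c \<in> A" "d \<in> A" "fst u \<in> cdom c \<inter> cdom d"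
  have "snd u d = jac c d (cmap c (fst u)) *v snd u c" using t cd by blast
  then show "\<zeta> *s snd u d = jac c d (cmap c (fst u)) *v (\<zeta> *s snd u c)"
    by (simp add: vec_eq_iff matrix_vector_mult_def sum_distrib_left mult_ac)
qed

lemma tcoord_tscale: "tcoord c (tscale \<zeta> u) = (fst (tcoord c u), \<zeta> *s snd (tcoord c u))"
  by (simp add: tcoord_def tscale_def)

lemma TM0_iff:
  assumes "u \<in> TM A" "c \<in> A" "fst u \<in> cdom c" shows "u \<in> TM0 A \<longleftrightarrow> tcoord c u \<in> tdom0 c"
proof
  assume "u \<in> TM0 A"
  then obtain d where d: "snd u d \<noteq> 0" by (auto simp: TM0_def fun_eq_iff)
  then have "d \<in> A" "fst u \<in> cdom d" using TM_snd_zero[OF assms(1), of d] by auto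
  then have "snd u d = jac c d (cmap c (fst u)) *v snd u c" using TM_snd[OF assms(1,2)] assms(3) by auto
  then have "snd u c \<noteq> 0" using d by auto
  then show "tcoord c u \<in> tdom0 c" using assms(3) by (simp add: tcoord_def tdom0_def)
next
  assume "tcoord c u \<in> tdom0 c"
  then have "snd u c \<noteq> 0" by (auto simp: tcoord_def tdom0_def)
  then have "snd u \<noteq> (\<lambda>c. 0)" by metis
  then show "u \<in> TM0 A" using assms(1) by (simp add: TM0_def)
qed

lemma tdom0_tdom: "p \<in> tdom0 c \<Longrightarrow> p \<in> tdom c" by (auto simp: tdom0_def tdom_def)

lemma tpoint_TM0: "c \<in> A \<Longrightarrow> p \<in> tdom0 c \<Longrightarrow> tpoint A c p \<in> TM0 A"
  using TM0_iff[of "tpoint A c p" c] tpoint[of c p] tdom0_tdom[of p c] by auto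

lemma tpoint_tscale: 
  assumes "c \<in> A" "(z, v) \<in> tdom c" shows "tpoint A c (z, \<zeta> *s v) = tscale \<zeta> (tpoint A c (z, v))"
proof -
  have p: "(z, \<zeta> *s v) \<in> tdom c" using assms by (auto simp: tdom_def)
  show ?thesis
    by (rule tcoord_inj[OF assms(1)])
      (use tpoint[OF assms] tpoint[OF assms(1) p] tscale_TM in \<open>auto simp: tcoord_tscale\<close>, simp add: tscale_def)
qed

lemma open_tdom0: "c \<in> A \<Longrightarrow> open (tdom0 c)"
  unfolding tdom0_def by (intro open_Times chart_open) auto

lemma finsler_chart: assumes c: "c \<in> A" shows "finsler_chart (tdom0 c) (Gloc A F c)"
proof
  show "open (tdom0 c)" by (rule open_tdom0[OF c])
  show "smooth_on (tdom0 c) (Gloc A F c)"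
    using finsler c unfolding complex_finsler_def Gloc_def[abs_def] by blast
  show "0 < Gloc A F c p" if "p \<in> tdom0 c" for p
  proof -
    have "0 < F (tpoint A c p)" using finsler tpoint_TM0[OF c that] unfolding complex_finsler_def by blast
    then show ?thesis by (simp add: Gloc_def)
  qed
  show "(z, \<zeta> *s v) \<in> tdom0 c" if "(z, v) \<in> tdom0 c" "\<zeta> \<noteq> 0" for z v \<zeta>
    using that by (auto simp: tdom0_def)
  show "Gloc A F c (z, \<zeta> *s v) = (cmod \<zeta>)\<^sup>2 * Gloc A F c (z, v)" if "(z, v) \<in> tdom0 c" "\<zeta> \<noteq> 0" for z v \<zeta>
  proof -
    have p: "(z, v) \<in> tdom c" by (rule tdom0_tdom[OF that(1)])
    have "F (tscale \<zeta> (tpoint A c (z, v))) = cmod \<zeta> * F (tpoint A c (z, v))"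
      using finsler tpoint(1)[OF c p] unfolding complex_finsler_def by blast
    then show ?thesis by (simp add: Gloc_def tpoint_tscale[OF c p] power_mult_distrib)
  qed
  show "pos_def (G_mat (Gloc A F c) p)" if "p \<in> tdom0 c" for p
    using spc c that unfolding strongly_pseudoconvex_def by blast
qed

lemma Gloc_tcoord: "c \<in> A \<Longrightarrow> u \<in> TM A \<Longrightarrow> fst u \<in> cdom c \<Longrightarrow> Gloc A F c (tcoord c u) = (F u)\<^sup>2"
  by (simp add: Gloc_def tpoint_tcoord)

definition change :: "('m, 'n) chart \<Rightarrow> ('m, 'n) chart \<Rightarrow> 'n cpair \<Rightarrow> 'n cpair" where
  "change c d p = (transition c d (fst p), jac c d (fst p) *v snd p)"

lemma tcoord_change:
  "u \<in> TM A \<Longrightarrow> c \<in> A \<Longrightarrow> d \<in> A \<Longrightarrow> fst u \<in> cdom c \<Longrightarrow> fst u \<in> cdom d \<Longrightarrow> tcoord d u = change c d (tcoord c u)"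
  using TM_snd[of u c d] by (simp add: tcoord_def change_def transition_cmap)

definition tdom_overlap :: "('m, 'n) chart \<Rightarrow> ('m, 'n) chart \<Rightarrow> 'n cpair set" where
  "tdom_overlap c d = overlap c d \<times> (UNIV - {0})"

lemma overlap_subset: "overlap c d \<subseteq> cmap c ` cdom c" by (auto simp: overlap_def)

lemma tdom_overlap_point:
  assumes "c \<in> A" "d \<in> A" "p \<in> tdom_overlap c d"
  obtains u where "u \<in> TM0 A" "fst u \<in> cdom c" "fst u \<in> cdom d" "tcoord c u = p" "tcoord d u = change c d p"
proof -
  have p: "p \<in> tdom0 c" using assms(3) overlap_subset[of c d] by (auto simp: tdom_overlap_def tdom0_def)
  then have p': "p \<in> tdom c" by (rule tdom0_tdom)
  define u where "u = tpoint A c p"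
  have u: "u \<in> TM A" "fst u \<in> cdom c" "tcoord c u = p" "u \<in> TM0 A"
    using tpoint[OF assms(1) p'] tpoint_TM0[OF assms(1) p] by (auto simp: u_def)
  have "cmap c (fst u) \<in> overlap c d" using u(3) assms(3) by (auto simp: tcoord_def tdom_overlap_def)
  then have "fst u \<in> cdom d" using u(2) assms(1) by (auto simp: overlap_eq cinv_cmap)
  then show thesis using that u tcoord_change[OF u(1) assms(1,2) u(2)] by simp
qed

lemma tcoord_in_tdom_overlap:
  "u \<in> TM0 A \<Longrightarrow> c \<in> A \<Longrightarrow> fst u \<in> cdom c \<Longrightarrow> fst u \<in> cdom d \<Longrightarrow> tcoord c u \<in> tdom_overlap c d"
  using TM0_iff[of u c] by (auto simp: TM0_def tcoord_def tdom_overlap_def overlap_def tdom0_def)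

lemma change_bundle_map:
  assumes c: "c \<in> A" and d: "d \<in> A"
  shows "finsler_bundle_map (tdom0 c) (Gloc A F c) (tdom0 d) (Gloc A F d) (tdom_overlap c d) (transition c d) (jac c d) (jac c d)
    (\<lambda>z \<sigma> \<tau> \<mu>. frechet_derivative (\<lambda>z. jac c d z $ \<sigma> $ \<tau>) (at z) (axis \<mu> 1)) 1"
proof -
  interpret c: finsler_chart "tdom0 c" "Gloc A F c" by (rule finsler_chart[OF c])
  interpret d: finsler_chart "tdom0 d" "Gloc A F d" by (rule finsler_chart[OF d])
  show ?thesis
  proof
    show "open (tdom_overlap c d)" unfolding tdom_overlap_def by (intro open_Times open_overlap c d) auto
    show "tdom_overlap c d \<subseteq> tdom0 c" using overlap_subset[of c d] by (auto simp: tdom_overlap_def tdom0_def)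
    fix p assume p: "p \<in> tdom_overlap c d"
    obtain u where u: "u \<in> TM0 A" "fst u \<in> cdom c" "fst u \<in> cdom d" "tcoord c u = p" "tcoord d u = change c d p"
      by (rule tdom_overlap_point[OF c d p])
    have uT: "u \<in> TM A" using u(1) by (simp add: TM0_def)
    show "(transition c d (fst p), jac c d (fst p) *v snd p) \<in> tdom0 d"
      using TM0_iff[OF uT d u(3)] u by (simp add: change_def)
    have z: "fst p \<in> overlap c d" using p by (auto simp: tdom_overlap_def)
    show "(transition c d has_derivative (*v) (jac c d (fst p))) (at (fst p))"
      using transition_derivative[OF c d z] .
    show "((\<lambda>z. jac c d z $ \<sigma> $ \<tau>) has_derivative (\<lambda>h. \<Sum>\<mu>\<in>UNIV. frechet_derivative (\<lambda>z. jac c d z $ \<sigma> $ \<tau>) (at (fst p)) (axis \<mu> 1) * h $ \<mu>)) (at (fst p))" for \<sigma> \<tau>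
    proof -
      note D = complex_differentiable_onD[OF jac_complex_differentiable[OF c d, of \<sigma> \<tau>] z]
      have "frechet_derivative (\<lambda>z. jac c d z $ \<sigma> $ \<tau>) (at (fst p)) h =
        (\<Sum>\<mu>\<in>UNIV. frechet_derivative (\<lambda>z. jac c d z $ \<sigma> $ \<tau>) (at (fst p)) (axis \<mu> 1) * h $ \<mu>)" for h
        by (rule complex_linear_expansion[OF has_derivative_linear[OF D(1)] D(2)])
      then have "frechet_derivative (\<lambda>z. jac c d z $ \<sigma> $ \<tau>) (at (fst p)) =
        (\<lambda>h. \<Sum>\<mu>\<in>UNIV. frechet_derivative (\<lambda>z. jac c d z $ \<sigma> $ \<tau>) (at (fst p)) (axis \<mu> 1) * h $ \<mu>)" by (rule ext)
      then show ?thesis using D(1) by simp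
    qed
    have "cmap c (fst u) = fst p" using u(4) by (auto simp: tcoord_def)
    then show "invertible (jac c d (fst p))"
      using jac_inverse[OF c d u(2,3)] jac_inverse[OF d c u(3,2)] by (auto simp: invertible_def)
    show "Gloc A F c p = 1 * Gloc A F d (transition c d (fst p), jac c d (fst p) *v snd p)"
      using Gloc_tcoord[OF c uT u(2)] Gloc_tcoord[OF d uT u(3)] u by (simp add: change_def)
  qed simp
qed

end

lemma (in finsler_chart) scaling_bundle_map:
  assumes \<zeta>: "\<zeta> \<noteq> 0"
  shows "finsler_bundle_map S g S g S (\<lambda>z. z) (\<lambda>z. mat 1) (\<lambda>z. mat \<zeta>) (\<lambda>z \<sigma> \<tau> \<mu>. 0) (inverse ((cmod \<zeta>)\<^sup>2))"
proof
  have mv: "mat \<zeta> *v v = \<zeta> *s v" for v :: "complex^'n"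
    by (simp add: vec_eq_iff matrix_vector_mult_def mat_def if_distrib if_distribR cong: if_cong)
  show "open S" by (rule open_S)
  fix p assume p: "p \<in> S"
  show "(fst p, mat \<zeta> *v snd p) \<in> S" using cone[of "fst p" "snd p"] p \<zeta> by (simp add: mv)
  show "((\<lambda>z. z) has_derivative (*v) (mat 1)) (at (fst p))"
    unfolding matrix_vector_mul_lid[abs_def] by (rule has_derivative_ident)
  show "((\<lambda>z. mat \<zeta> $ \<sigma> $ \<tau>) has_derivative (\<lambda>h. \<Sum>\<mu>\<in>UNIV. 0 * h $ \<mu>)) (at (fst p))" for \<sigma> \<tau> :: 'n by simp
  show "invertible (mat \<zeta> :: complex^'n^'n)"
  proof -
    have "mat (inverse \<zeta>) ** mat \<zeta> = (mat 1 :: complex^'n^'n)" "mat \<zeta> ** mat (inverse \<zeta>) = (mat 1 :: complex^'n^'n)"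
    proof -
      have m: "(mat b ** X) $ i $ j = b * X $ i $ j" for b and X :: "complex^'n^'n" and i j
        by (simp add: matrix_matrix_mult_def mat_def if_distrib[of "\<lambda>x. x * _"] cong: if_cong)
      show "mat (inverse \<zeta>) ** mat \<zeta> = (mat 1 :: complex^'n^'n)" "mat \<zeta> ** mat (inverse \<zeta>) = (mat 1 :: complex^'n^'n)"
        unfolding vec_eq_iff m using \<zeta> by (auto simp: mat_def)
    qed
    then show ?thesis unfolding invertible_def by blast
  qed
  show "g p = inverse ((cmod \<zeta>)\<^sup>2) * g (fst p, mat \<zeta> *v snd p)"
    using g_homogeneous[of "fst p" "snd p" \<zeta>] p \<zeta> by (simp add: mv)
qed (use \<zeta> in auto)

context finsler_manifold
begin

subsection \<open>Functions on the projectivized bundle\<close>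

text \<open>Families of functions in charts that define a function on the projectivized bundle.\<close>

definition invariant_fun :: "(('m, 'n) chart \<Rightarrow> 'n cpair \<Rightarrow> complex) \<Rightarrow> bool" where
  "invariant_fun h \<longleftrightarrow> (\<forall>c\<in>A. \<forall>(z, v)\<in>tdom0 c. \<forall>\<zeta>. \<zeta> \<noteq> 0 \<longrightarrow> h c (z, \<zeta> *s v) = h c (z, v)) \<and>
     (\<forall>c\<in>A. \<forall>d\<in>A. \<forall>p\<in>tdom_overlap c d. h d (change c d p) = h c p)"

lemma proj_class:
  assumes "u \<in> TM0 A" "w \<in> proj_rel A `` {u}" shows "\<exists>\<zeta>. \<zeta> \<noteq> 0 \<and> w = tscale \<zeta> u" "w \<in> TM0 A"
  using assms by (auto simp: proj_rel_def)

lemma self_in_proj_class: "u \<in> TM0 A \<Longrightarrow> u \<in> proj_rel A `` {u}"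
  by (auto simp: proj_rel_def tscale_def intro!: exI[of _ 1] simp: prod_eq_iff)

lemma on_PTM_eq:
  assumes h: "invariant_fun h" and u: "u \<in> TM0 A" and c: "c \<in> A" "fst u \<in> cdom c"
  shows "on_PTM A h (proj_rel A `` {u}) = h c (tcoord c u)"
  unfolding on_PTM_def
proof (rule the_equality)
  show "\<forall>d\<in>A. \<forall>w\<in>proj_rel A `` {u}. fst w \<in> cdom d \<longrightarrow> h d (tcoord d w) = h c (tcoord c u)"
  proof (intro ballI impI)
    fix d w assume d: "d \<in> A" "fst w \<in> cdom d" and w: "w \<in> proj_rel A `` {u}"
    obtain \<zeta> where \<zeta>: "\<zeta> \<noteq> 0" "w = tscale \<zeta> u" using proj_class[OF u w] by blast
    have uT: "u \<in> TM A" using u by (simp add: TM0_def)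
    have ud: "fst u \<in> cdom d" using \<zeta> d by (simp add: tscale_def)
    have "tcoord d u \<in> tdom0 d" using TM0_iff[OF uT d(1) ud] u by simp
    then have "h d (fst (tcoord d u), \<zeta> *s snd (tcoord d u)) = h d (fst (tcoord d u), snd (tcoord d u))"
      using h d(1) \<zeta>(1) unfolding invariant_fun_def by fastforce
    then have "h d (tcoord d w) = h d (tcoord d u)" by (simp add: \<zeta>(2) tcoord_tscale)
    also have "\<dots> = h c (tcoord c u)"
      using h c d(1) tcoord_change[OF uT c(1) d(1) c(2) ud] tcoord_in_tdom_overlap[OF u c ud]
      unfolding invariant_fun_def by simp
    finally show "h d (tcoord d w) = h c (tcoord c u)" .
  qed
  then show "y = h c (tcoord c u)" if "\<forall>d\<in>A. \<forall>w\<in>proj_rel A `` {u}. fst w \<in> cdom d \<longrightarrow> h d (tcoord d w) = y" for y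
    using that c self_in_proj_class[OF u] by auto
qed

lemma PTM_cases:
  assumes "l \<in> PTM A" obtains u where "u \<in> TM0 A" "l = proj_rel A `` {u}"
  using assms unfolding PTM_def by (auto elim: quotientE)

lemma slice_tdom0: "y \<in> pdom c a \<Longrightarrow> slice a y \<in> tdom0 c"
  by (auto simp: pdom_def slice_def tdom0_def vec_eq_iff)

lemma ppoint_on_PTM:
  assumes h: "invariant_fun h" and c: "c \<in> A" and y: "y \<in> pdom c a"
  shows "on_PTM A h (ppoint A c a y) = h c (slice a y)"
proof -
  have p: "slice a y \<in> tdom0 c" by (rule slice_tdom0[OF y])
  then have p': "slice a y \<in> tdom c" by (rule tdom0_tdom)
  show ?thesis
    unfolding ppoint_def using on_PTM_eq[OF h tpoint_TM0[OF c p] c] tpoint[OF c p'] by simp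
qed

text \<open>A direction with nonvanishing \<open>a\<close>-th component has a unique representative in the slice \<open>v\<^sup>a = 1\<close>.\<close>

lemma in_ppoint_image:
  assumes c: "c \<in> A" and u: "u \<in> TM0 A" "fst u \<in> cdom c" and a: "snd u c $ a \<noteq> 0"
  shows "proj_rel A `` {u} \<in> ppoint A c a ` pdom c a"
proof -
  define s where "s = inverse (snd u c $ a)"
  define y where "y = (cmap c (fst u), \<lambda>i\<in>UNIV - {a}. s * snd u c $ i)"
  have y: "y \<in> pdom c a" using u by (auto simp: y_def pdom_def)
  have sl: "slice a y = (cmap c (fst u), s *s snd u c)"
    using a by (auto simp: slice_def y_def s_def vec_eq_iff)
  have uT: "u \<in> TM A" using u by (simp add: TM0_def)
  have "tpoint A c (slice a y) = tscale s u"
    using tpoint_tscale[OF c, of "cmap c (fst u)" "snd u c" s] tpoint_tcoord[OF c uT u(2)] tcoord_in_tdom[OF u(2)]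
    by (simp add: sl tcoord_def)
  moreover have "proj_rel A `` {tscale s u} = proj_rel A `` {u}"
  proof -
    have s0: "s \<noteq> 0" using a by (simp add: s_def)
    have t0: "tscale s u \<in> TM0 A"
      using TM0_iff[OF tscale_TM[OF uT] c, of s] TM0_iff[OF uT c u(2)] u s0 by (auto simp: tcoord_tscale tscale_def tcoord_def tdom0_def)
    have sc: "tscale \<zeta> (tscale \<xi> w) = tscale (\<zeta> * \<xi>) w" for \<zeta> \<xi> and w :: "('m, 'n) tvec"
      by (simp add: tscale_def vector_smult_assoc)
    have "\<exists>\<zeta>'. \<zeta>' \<noteq> 0 \<and> tscale \<zeta> u = tscale \<zeta>' (tscale s u)" if "\<zeta> \<noteq> 0" for \<zeta>
      using that s0 by (intro exI[of _ "\<zeta> * inverse s"]) (simp add: sc mult.assoc)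
    moreover have "\<exists>\<zeta>'. \<zeta>' \<noteq> 0 \<and> tscale \<zeta> (tscale s u) = tscale \<zeta>' u" if "\<zeta> \<noteq> 0" for \<zeta>
      using that s0 by (intro exI[of _ "\<zeta> * s"]) (simp add: sc)
    ultimately show ?thesis using u t0 by (auto simp: proj_rel_def)
  qed
  ultimately have "proj_rel A `` {u} = ppoint A c a y" by (simp add: ppoint_def)
  then show ?thesis using y by blast
qed

lemma ppoint_PTM: "c \<in> A \<Longrightarrow> y \<in> pdom c a \<Longrightarrow> ppoint A c a y \<in> PTM A"
  unfolding ppoint_def PTM_def by (intro quotientI tpoint_TM0 slice_tdom0)

end


section \<open>Bump functions\<close>

definition flat_exp :: "nat \<Rightarrow> real \<Rightarrow> real" where
  "flat_exp n x = (if x > 0 then exp (- 1 / x) / x ^ n else 0)"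

text \<open>From \<open>y \<le> exp y\<close> for \<open>y = 1/((n+2) x)\<close>, raised to the power \<open>n + 2\<close>. The quadratic bound gives the derivative
  zero at the origin, and the family of all \<open>flat_exp n\<close> is closed under differentiation up to linear
  combinations.\<close>

lemma flat_exp_bound: "\<bar>flat_exp n x\<bar> \<le> real (n + 2) ^ (n + 2) * x\<^sup>2"
proof (cases "x > 0")
  case True
  define m where "m = n + 2"
  have "(1 / (real m * x)) ^ m \<le> exp (1 / (real m * x)) ^ m"
    using True order_trans[OF _ exp_ge_add_one_self, of "1 / (real m * x)" "1 / (real m * x)"] by (intro power_mono) auto
  also have "\<dots> = exp (real m * (1 / (real m * x)))" by (rule exp_of_nat_mult[symmetric])
  also have "real m * (1 / (real m * x)) = 1 / x" by (simp add: m_def)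
  finally have "1 / (real m * x) ^ m \<le> exp (1 / x)" by (simp add: power_divide)
  moreover have "0 < (real m * x) ^ m" using True by (simp add: m_def)
  ultimately have "1 \<le> exp (1 / x) * (real m * x) ^ m" by (simp add: pos_divide_le_eq)
  then have "exp (- (1 / x)) \<le> (real m * x) ^ m" by (simp add: exp_minus field_simps)
  then have "exp (- 1 / x) / x ^ n \<le> (real m * x) ^ m / x ^ n"
    using True by (intro divide_right_mono) auto
  also have "\<dots> = real m ^ m * x\<^sup>2" using True by (simp add: m_def power_mult_distrib power_add power2_eq_square)
  finally show ?thesis using True by (simp add: flat_exp_def m_def)
qed (simp add: flat_exp_def)

lemma flat_exp_derivative: "(flat_exp n has_real_derivative (flat_exp (n + 2) x - real n * flat_exp (n + 1) x)) (at x)"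
proof -
  consider "x > 0" | "x < 0" | "x = 0" by linarith
  then show ?thesis
  proof cases
    case 1
    have "((\<lambda>x. exp (- 1 / x) / x ^ n) has_real_derivative (flat_exp (n + 2) x - real n * flat_exp (n + 1) x)) (at x)"
    proof -
      have "((\<lambda>x. exp (- 1 / x) / x ^ n) has_real_derivative
        (exp (- 1 / x) * (1 / x\<^sup>2) * x ^ n - exp (- 1 / x) * (real n * x ^ (n - Suc 0))) / (x ^ n * x ^ n)) (at x)"
        using 1 by (auto intro!: derivative_eq_intros simp: power2_eq_square)
      moreover have n: "real n * x ^ (n - Suc 0) = real n * x ^ n / x"
        using 1 by (cases n) auto
      moreover have alg: "(E * (1 / x\<^sup>2) * P - E * (real n * P / x)) / (P * P) = E / (P * x\<^sup>2) - real n * (E / (P * x))"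
        if "P > 0" for E P :: real
        using that 1 by (simp add: field_simps power2_eq_square)
      have "flat_exp (n + 2) x = exp (- 1 / x) / (x ^ n * x\<^sup>2)" "flat_exp (n + 1) x = exp (- 1 / x) / (x ^ n * x)"
        using 1 unfolding flat_exp_def power_add by simp_all
      then have "flat_exp (n + 2) x - real n * flat_exp (n + 1) x =
         (exp (- 1 / x) * (1 / x\<^sup>2) * x ^ n - exp (- 1 / x) * (real n * x ^ n / x)) / (x ^ n * x ^ n)"
        using alg[of "x ^ n" "exp (- 1 / x)"] 1 by (simp only: zero_less_power)
      ultimately show ?thesis by (simp only:)
    qed
    then show ?thesis
      by (rule has_field_derivative_transform_within_open[of _ _ _ "{0<..}"]) (use 1 in \<open>auto simp: flat_exp_def\<close>)
  next
    case 2
    have "((\<lambda>x. 0) has_real_derivative (flat_exp (n + 2) x - real n * flat_exp (n + 1) x)) (at x)"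
      using 2 by (simp add: flat_exp_def)
    then show ?thesis
      by (rule has_field_derivative_transform_within_open[of _ _ _ "{..<0}"]) (use 2 in \<open>auto simp: flat_exp_def\<close>)
  next
    case 3
    define C where "C = real (n + 2) ^ (n + 2)"
    have "((\<lambda>h. (flat_exp n (0 + h) - flat_exp n 0) / h) \<longlongrightarrow> 0) (at 0)"
    proof (rule Lim_null_comparison)
      have "norm (flat_exp n h / h) \<le> C * \<bar>h\<bar>" if "h \<noteq> 0" for h
        using flat_exp_bound[of n h] that by (simp add: C_def field_simps power2_eq_square)
      then show "\<forall>\<^sub>F h in at 0. norm ((flat_exp n (0 + h) - flat_exp n 0) / h) \<le> C * \<bar>h\<bar>"
        by (auto simp: eventually_at_filter flat_exp_def[of n 0])
      show "((\<lambda>h. C * \<bar>h\<bar>) \<longlongrightarrow> 0) (at 0)" by (auto intro!: tendsto_eq_intros)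
    qed
    then have "(flat_exp n has_real_derivative 0) (at 0)" by (simp add: DERIV_def)
    then show ?thesis using 3 by (simp add: flat_exp_def)
  qed
qed

lemma Ck_on_flat_exp: "Ck_on k UNIV (flat_exp n)"
proof (induction k arbitrary: n)
  case 0
  show ?case using DERIV_isCont[OF flat_exp_derivative] by (simp add: continuous_at_imp_continuous_on)
next
  case (Suc k)
  show ?case
  proof (rule Ck_on_SucI)
    show "(flat_exp n has_derivative (\<lambda>h. (flat_exp (n + 2) x + (- real n) * flat_exp (n + 1) x) * h)) (at x)" for x
    proof -
      have "(*) (flat_exp (n + 2) x - real n * flat_exp (n + 1) x) = (\<lambda>h. (flat_exp (n + 2) x + (- real n) * flat_exp (n + 1) x) * h)"
        by (auto simp: fun_eq_iff)
      then show ?thesis using flat_exp_derivative[of n x] by (simp only: has_field_derivative_def)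
    qed
    show "Ck_on k UNIV (\<lambda>x. (flat_exp (n + 2) x + (- real n) * flat_exp (n + 1) x) * h)" for h
      by (intro Ck_on_bilinear[OF bounded_bilinear_mult] Ck_on_add Suc Ck_on_const) auto
  qed simp
qed

lemma smooth_on_flat_exp: "smooth_on UNIV (flat_exp n)"
  by (simp add: smooth_on_def Ck_on_flat_exp)

text \<open>A function of bidegree \<open>(0, 0)\<close> in \<open>v\<close>. On the slice \<open>v\<^sup>a = 1\<close> it is positive exactly in the
  ball of radius \<open>r\<close> around \<open>(z0, w0)\<close>.\<close>

definition bump_arg :: "'n::finite \<Rightarrow> complex^'n \<Rightarrow> complex^'n \<Rightarrow> real \<Rightarrow> 'n cpair \<Rightarrow> real" where
  "bump_arg a z0 w0 r p = ((cmod (snd p $ a))\<^sup>2 * (r\<^sup>2 - (norm (fst p - z0))\<^sup>2)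
     - (norm (snd p - (snd p $ a) *s w0))\<^sup>2) / (norm (snd p))\<^sup>2"

definition bump :: "'n::finite \<Rightarrow> complex^'n \<Rightarrow> complex^'n \<Rightarrow> real \<Rightarrow> 'n cpair \<Rightarrow> complex" where
  "bump a z0 w0 r p = complex_of_real (flat_exp 0 (bump_arg a z0 w0 r p))"

lemma smooth_on_norm_square: "open S \<Longrightarrow> smooth_on S f \<Longrightarrow> smooth_on S (\<lambda>x. (norm (f x :: 'b::real_inner))\<^sup>2)"
  unfolding power2_norm_eq_inner by (rule smooth_on_bilinear[OF bounded_bilinear_inner])

lemma smooth_on_bump_arg:
  fixes a :: "'n::finite"
  shows "smooth_on (UNIV \<times> (UNIV - {0})) (bump_arg a z0 w0 r)"
proof -
  have S: "open (UNIV \<times> (UNIV - {0}) :: 'n cpair set)" by (intro open_Times) auto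
  have s1: "smooth_on (UNIV \<times> (UNIV - {0})) (\<lambda>p::'n cpair. fst p)"
    by (rule smooth_on_bounded_linear[OF bounded_linear_fst S])
  have s2: "smooth_on (UNIV \<times> (UNIV - {0})) (\<lambda>p::'n cpair. snd p)"
    by (rule smooth_on_bounded_linear[OF bounded_linear_snd S])
  have s3: "smooth_on (UNIV \<times> (UNIV - {0})) (\<lambda>p::'n cpair. snd p $ a)"
    by (rule smooth_on_v_coordinate[OF S])
  have s4: "smooth_on (UNIV \<times> (UNIV - {0})) (\<lambda>p::'n cpair. (snd p $ a) *s w0)"
    by (rule smooth_on_bounded_linear_comp[OF bounded_linear_smult_left S s3])
  have "smooth_on (UNIV \<times> (UNIV - {0})) (\<lambda>p::'n cpair. ((cmod (snd p $ a))\<^sup>2 * (r\<^sup>2 - (norm (fst p - z0))\<^sup>2)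
     - (norm (snd p - (snd p $ a) *s w0))\<^sup>2) * inverse ((norm (snd p))\<^sup>2))"
    by (intro smooth_on_mult smooth_on_diff smooth_on_inverse smooth_on_norm_square smooth_on_const S s1 s2 s3 s4) auto
  then show ?thesis by (simp add: bump_arg_def[abs_def] divide_inverse)
qed

lemma smooth_on_bump:
  fixes a :: "'n::finite"
  shows "smooth_on (UNIV \<times> (UNIV - {0})) (bump a z0 w0 r)"
proof -
  have S: "open (UNIV \<times> (UNIV - {0}) :: 'n cpair set)" by (intro open_Times) auto
  have "smooth_on (UNIV \<times> (UNIV - {0})) (\<lambda>p. flat_exp 0 (bump_arg a z0 w0 r p))"
    by (rule smooth_on_compose[OF S open_UNIV smooth_on_bump_arg smooth_on_flat_exp]) auto
  then show ?thesis unfolding bump_def[abs_def]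
    by (rule smooth_on_bounded_linear_comp[OF bounded_linear_of_real S])
qed

lemma bump_homogeneous: "\<zeta> \<noteq> 0 \<Longrightarrow> bump a z0 w0 r (z, \<zeta> *s v) = bump a z0 w0 r (z, v)"
proof -
  assume \<zeta>: "\<zeta> \<noteq> 0"
  have 1: "\<zeta> *s v - (\<zeta> *s v) $ a *s w0 = \<zeta> *s (v - v $ a *s w0)" by (simp add: vec_eq_iff algebra_simps)
  have "bump_arg a z0 w0 r (z, \<zeta> *s v) = ((cmod \<zeta>)\<^sup>2 * ((cmod (v $ a))\<^sup>2 * (r\<^sup>2 - (norm (z - z0))\<^sup>2)
     - (norm (v - v $ a *s w0))\<^sup>2)) / ((cmod \<zeta>)\<^sup>2 * (norm v)\<^sup>2)"
    unfolding bump_arg_def fst_conv snd_conv 1 norm_vector_smult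
    by (simp add: norm_mult power_mult_distrib algebra_simps)
  then show ?thesis using \<zeta> by (simp add: bump_def bump_arg_def)
qed

lemma bump_support:
  assumes "bump a z0 w0 r p \<noteq> 0"
  shows "snd p $ a \<noteq> 0" "norm (fst p - z0) < \<bar>r\<bar>"
proof -
  have "0 < bump_arg a z0 w0 r p" using assms by (auto simp: bump_def flat_exp_def split: if_splits)
  then have *: "0 < (cmod (snd p $ a))\<^sup>2 * (r\<^sup>2 - (norm (fst p - z0))\<^sup>2)"
    unfolding bump_arg_def zero_less_divide_iff using zero_le_power2[of "norm (snd p - (snd p $ a) *s w0)"]
      zero_le_power2[of "norm (snd p)"] by linarith
  then show "snd p $ a \<noteq> 0" by auto
  have "0 < r\<^sup>2 - (norm (fst p - z0))\<^sup>2" using * by (simp add: zero_less_mult_iff)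
  then have "(norm (fst p - z0))\<^sup>2 < \<bar>r\<bar>\<^sup>2" by simp
  then show "norm (fst p - z0) < \<bar>r\<bar>" by (rule power_less_imp_less_base) simp
qed

lemma bump_slice:
  assumes "snd p $ a = 1" "snd p \<noteq> 0"
  shows "bump a z0 w0 r p \<noteq> 0 \<longleftrightarrow> (norm (fst p - z0))\<^sup>2 + (norm (snd p - w0))\<^sup>2 < r\<^sup>2"
  using assms by (auto simp: bump_def flat_exp_def bump_arg_def zero_less_divide_iff)


section \<open>Integration on a slice\<close>

definition slice_shift :: "'n::finite \<Rightarrow> 'n cpair \<Rightarrow> (complex^'n) \<times> ('n \<Rightarrow> complex) \<Rightarrow> (complex^'n) \<times> ('n \<Rightarrow> complex)" where
  "slice_shift a d y = (fst d + fst y, \<lambda>i\<in>UNIV - {a}. snd d $ i + snd y i)"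

lemma slice_slice_shift: "snd d $ a = 0 \<Longrightarrow> slice a (slice_shift a d y) = slice a y + d"
  by (auto simp: slice_def slice_shift_def vec_eq_iff prod_eq_iff)

lemma lborel_emeasure_shift:
  fixes b :: complex
  assumes "X \<in> sets lborel"
  shows "{x. b + x \<in> X} \<in> sets lborel" "emeasure lborel {x. b + x \<in> X} = emeasure lborel X"
proof -
  have m: "(+) b \<in> measurable lborel borel" by simp
  have pre: "{x. b + x \<in> X} = (+) b -` X \<inter> space lborel" by auto
  show "{x. b + x \<in> X} \<in> sets lborel"
    using measurable_sets[OF m, of X] assms unfolding pre by simp
  have "emeasure lborel X = emeasure (distr lborel borel ((+) b)) X" by (simp add: lborel_distr_plus)
  also have "\<dots> = emeasure lborel {x. b + x \<in> X}"
    unfolding pre using assms by (intro emeasure_distr m) simp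
  finally show "emeasure lborel {x. b + x \<in> X} = emeasure lborel X" by simp
qed

lemma PiM_lborel_shift:
  fixes k :: "'i \<Rightarrow> complex"
  assumes fin: "finite I"
  shows "distr (\<Pi>\<^sub>M i\<in>I. lborel) (\<Pi>\<^sub>M i\<in>I. lborel) (\<lambda>w. \<lambda>i\<in>I. k i + w i) = (\<Pi>\<^sub>M i\<in>I. (lborel::complex measure))"
proof -
  interpret product_sigma_finite "\<lambda>i::'i. lborel :: complex measure" by unfold_locales
  have m: "(\<lambda>w. \<lambda>i\<in>I. k i + w i) \<in> measurable (\<Pi>\<^sub>M i\<in>I. lborel) (\<Pi>\<^sub>M i\<in>I. (lborel::complex measure))"
    by (rule measurable_restrict) (simp, measurable)
  show ?thesis
  proof (rule PiM_eqI[OF fin])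
    show "sets (distr (\<Pi>\<^sub>M i\<in>I. lborel) (\<Pi>\<^sub>M i\<in>I. lborel) (\<lambda>w. \<lambda>i\<in>I. k i + w i)) = sets (\<Pi>\<^sub>M i\<in>I. (lborel::complex measure))" by simp
    fix X :: "'i \<Rightarrow> complex set" assume X: "\<And>i. i \<in> I \<Longrightarrow> X i \<in> sets lborel"
    have XP: "Pi\<^sub>E I X \<in> sets (\<Pi>\<^sub>M i\<in>I. (lborel::complex measure))"
      using fin X by (intro sets_PiM_I_finite) auto
    have "(\<lambda>w. \<lambda>i\<in>I. k i + w i) -` Pi\<^sub>E I X \<inter> space (\<Pi>\<^sub>M i\<in>I. (lborel::complex measure)) = Pi\<^sub>E I (\<lambda>i. {x. k i + x \<in> X i})"
      by (auto simp: space_PiM PiE_iff)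
    then have "emeasure (distr (\<Pi>\<^sub>M i\<in>I. lborel) (\<Pi>\<^sub>M i\<in>I. lborel) (\<lambda>w. \<lambda>i\<in>I. k i + w i)) (Pi\<^sub>E I X)
       = emeasure (\<Pi>\<^sub>M i\<in>I. lborel) (Pi\<^sub>E I (\<lambda>i. {x. k i + x \<in> X i}))"
      by (subst emeasure_distr[OF m XP]) simp
    also have "\<dots> = (\<Prod>i\<in>I. emeasure lborel {x. k i + x \<in> X i})"
      by (rule emeasure_PiM[OF fin]) (use lborel_emeasure_shift X in auto)
    also have "\<dots> = (\<Prod>i\<in>I. emeasure lborel (X i))"
      by (intro prod.cong refl lborel_emeasure_shift X)
    finally show "emeasure (distr (\<Pi>\<^sub>M i\<in>I. lborel) (\<Pi>\<^sub>M i\<in>I. lborel) (\<lambda>w. \<lambda>i\<in>I. k i + w i)) (Pi\<^sub>E I X) = (\<Prod>i\<in>I. emeasure lborel (X i))" .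
  qed
qed

lemma sigma_finite_PiM_lborel: "finite I \<Longrightarrow> sigma_finite_measure (\<Pi>\<^sub>M i\<in>I. (lborel::complex measure))"
proof -
  interpret product_sigma_finite "\<lambda>i. lborel :: complex measure" by unfold_locales
  show "finite I \<Longrightarrow> sigma_finite_measure (\<Pi>\<^sub>M i\<in>I. (lborel::complex measure))" by (rule sigma_finite)
qed

text \<open>Translations tangent to the slice preserve the product of Lebesgue measures.\<close>

lemma leb_slice_shift: "distr (leb_slice a) (leb_slice a) (slice_shift a d) = leb_slice a"
proof -
  let ?P = "\<Pi>\<^sub>M i\<in>UNIV - {a}. (lborel::complex measure)"
  let ?T = "\<lambda>w. \<lambda>i\<in>UNIV - {a}. snd d $ i + w i"
  have m: "?T \<in> measurable ?P ?P" by (rule measurable_restrict) (simp, measurable)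
  have sf: "sigma_finite_measure (distr ?P ?P ?T)"
    unfolding PiM_lborel_shift[OF finite] by (rule sigma_finite_PiM_lborel) simp
  have "distr lborel lborel ((+) (fst d)) \<Otimes>\<^sub>M distr ?P ?P ?T = distr (lborel \<Otimes>\<^sub>M ?P) (lborel \<Otimes>\<^sub>M ?P) (\<lambda>(x, y). (fst d + x, ?T y))"
    by (rule pair_measure_distr[OF _ m sf]) simp
  moreover have "distr lborel lborel ((+) (fst d)) = lborel"
    using lborel_distr_plus[of "fst d"] by (simp cong: distr_cong)
  moreover have "(\<lambda>(x, y). (fst d + x, ?T y)) = slice_shift a d"
    by (auto simp: slice_shift_def fun_eq_iff)
  ultimately show ?thesis unfolding leb_slice_def PiM_lborel_shift[OF finite] by simp
qed

lemma measurable_slice_shift: "slice_shift a d \<in> measurable (leb_slice a) (leb_slice a)"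
  unfolding leb_slice_def slice_shift_def[abs_def]
proof (rule measurable_Pair)
  show "(\<lambda>y. fst d + fst y) \<in> lborel \<Otimes>\<^sub>M Pi\<^sub>M (UNIV - {a}) (\<lambda>_. lborel) \<rightarrow>\<^sub>M lborel" by simp
  show "(\<lambda>y. \<lambda>i\<in>UNIV - {a}. snd d $ i + snd y i) \<in> lborel \<Otimes>\<^sub>M Pi\<^sub>M (UNIV - {a}) (\<lambda>_. lborel) \<rightarrow>\<^sub>M Pi\<^sub>M (UNIV - {a}) (\<lambda>_. lborel)"
    by (rule measurable_restrict) (simp, measurable)
qed

lemma borel_measurable_vecI:
  fixes f :: "'a \<Rightarrow> complex^'n::finite"
  assumes "\<And>i. (\<lambda>x. f x $ i) \<in> borel_measurable M"
  shows "f \<in> borel_measurable M"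
  unfolding borel_measurable_euclidean_space[of f]
  using assms by (auto simp: Basis_vec_def inner_axis)

lemma measurable_slice [measurable]: "slice a \<in> borel_measurable (leb_slice a)"
  unfolding slice_def[abs_def]
proof (rule borel_measurable_Pair)
  show "fst \<in> borel_measurable (leb_slice a)" by (simp add: leb_slice_def)
  show "(\<lambda>y. \<chi> i. if i = a then 1 else snd y i) \<in> borel_measurable (leb_slice a)"
  proof (rule borel_measurable_vecI)
    fix i
    show "(\<lambda>y. (\<chi> i. if i = a then 1 else snd y i) $ i) \<in> borel_measurable (leb_slice a)"
    proof (cases "i = a")
      case False
      have "(\<lambda>y. snd y i) \<in> leb_slice a \<rightarrow>\<^sub>M lborel"
        unfolding leb_slice_def using False
        by (intro measurable_compose[OF measurable_snd measurable_component_singleton]) auto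
      then show ?thesis using False by simp
    qed simp
  qed
qed

lemma emeasure_bounded_slice: "emeasure (leb_slice a) {y \<in> space (leb_slice a). norm (slice a y) \<le> R} < \<infinity>"
proof -
  interpret product_sigma_finite "\<lambda>i. lborel :: complex measure" by unfold_locales
  interpret P: sigma_finite_measure "\<Pi>\<^sub>M i\<in>UNIV - {a}. (lborel::complex measure)" by (rule sigma_finite_PiM_lborel) simp
  let ?X = "cball (0::complex^'a) R \<times> (\<Pi>\<^sub>E i\<in>UNIV - {a}. cball (0::complex) R)"
  have Xs: "(\<Pi>\<^sub>E i\<in>UNIV - {a}. cball (0::complex) R) \<in> sets (\<Pi>\<^sub>M i\<in>UNIV - {a}. (lborel::complex measure))"
    by (intro sets_PiM_I_finite) auto
  have "{y \<in> space (leb_slice a). norm (slice a y) \<le> R} \<subseteq> ?X"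
  proof
    fix y assume y: "y \<in> {y \<in> space (leb_slice a). norm (slice a y) \<le> R}"
    then have n: "norm (fst (slice a y)) \<le> R" "norm (snd (slice a y)) \<le> R"
      using norm_fst_le[of "fst (slice a y)" "snd (slice a y)"] norm_snd_le[of "snd (slice a y)" "fst (slice a y)"] by auto
    have "norm (snd y i) \<le> R" if "i \<noteq> a" for i
      using Finite_Cartesian_Product.norm_nth_le[of "snd (slice a y)" i] n(2) that by (simp add: slice_def)
    moreover have "snd y \<in> extensional (UNIV - {a})"
    proof -
      have "y \<in> space (leb_slice a)" using y by simp
      then show ?thesis by (simp add: leb_slice_def space_pair_measure space_PiM PiE_iff mem_Times_iff)
    qed
    ultimately show "y \<in> ?X" using n(1) by (simp add: slice_def PiE_iff mem_Times_iff)
  qed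
  then have "emeasure (leb_slice a) {y \<in> space (leb_slice a). norm (slice a y) \<le> R} \<le> emeasure (leb_slice a) ?X"
    using Xs by (intro emeasure_mono) (auto simp: leb_slice_def)
  also have "\<dots> = emeasure lborel (cball (0::complex^'a) R) * (\<Prod>i\<in>UNIV - {a}. emeasure lborel (cball (0::complex) R))"
    unfolding leb_slice_def using Xs by (subst P.emeasure_pair_measure_Times) (auto simp: emeasure_PiM)
  also have "\<dots> < \<infinity>"
    using emeasure_lborel_cball_finite[of "0::complex^'a" R] emeasure_lborel_cball_finite[of "0::complex" R]
    by (simp add: ennreal_mult_less_top power_less_top_ennreal)
  finally show ?thesis .
qed


lemma measurable_comp_slice:
  fixes f :: "'n::finite cpair \<Rightarrow> complex"
  assumes U: "open U" "continuous_on U f" and slice_in: "\<And>y. slice a y \<in> U"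
  shows "(\<lambda>y. f (slice a y)) \<in> borel_measurable (leb_slice a)"
proof -
  have "(\<lambda>x. indicator U x *\<^sub>R f x) \<in> borel_measurable borel"
    using U by (intro borel_measurable_continuous_on_indicator) auto
  then have "(\<lambda>y. indicator U (slice a y) *\<^sub>R f (slice a y)) \<in> borel_measurable (leb_slice a)"
    by (rule measurable_compose[OF measurable_slice])
  then show ?thesis using slice_in by simp
qed

lemma integrable_comp_slice:
  fixes f :: "'n::finite cpair \<Rightarrow> complex"
  assumes U: "open U" "continuous_on U f" and slice_in: "\<And>y. slice a y \<in> U"
    and K: "compact K" "K \<subseteq> U" and zero: "\<And>y. slice a y \<notin> K \<Longrightarrow> f (slice a y) = 0"
  shows "integrable (leb_slice a) (\<lambda>y. f (slice a y))"
proof -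
  obtain R where R: "\<And>p. p \<in> K \<Longrightarrow> norm p \<le> R" using compact_imp_bounded[OF K(1)] bounded_iff by blast
  have "compact (f ` K)" using continuous_on_subset[OF U(2) K(2)] K(1) by (rule compact_continuous_image)
  then obtain C where C: "\<And>p. p \<in> K \<Longrightarrow> norm (f p) \<le> C" using compact_imp_bounded bounded_iff by (metis imageI)
  show ?thesis
  proof (rule integrableI_bounded_set)
    show "{y \<in> space (leb_slice a). norm (slice a y) \<le> R} \<in> sets (leb_slice a)" by measurable
    show "(\<lambda>y. f (slice a y)) \<in> borel_measurable (leb_slice a)" by (rule measurable_comp_slice[OF U slice_in])
    show "emeasure (leb_slice a) {y \<in> space (leb_slice a). norm (slice a y) \<le> R} < \<infinity>" by (rule emeasure_bounded_slice)
    have "norm (f (slice a y)) \<le> max 0 C" for y using C[of "slice a y"] zero[of y] by (cases "slice a y \<in> K") auto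
    then show "AE y\<in>{y \<in> space (leb_slice a). norm (slice a y) \<le> R} in leb_slice a. norm (f (slice a y)) \<le> max 0 C" by auto
    show "AE y in leb_slice a. y \<notin> {y \<in> space (leb_slice a). norm (slice a y) \<le> R} \<longrightarrow> f (slice a y) = 0"
    proof (intro AE_I2 impI)
      fix y assume "y \<in> space (leb_slice a)" "y \<notin> {y \<in> space (leb_slice a). norm (slice a y) \<le> R}"
      then have "slice a y \<notin> K" using R[of "slice a y"] by auto
      then show "f (slice a y) = 0" by (rule zero)
    qed
  qed
qed

text \<open>The integral of a directional derivative of a compactly supported function vanishes: the difference
  quotients have integral zero by translation invariance, and they converge boundedly.\<close>

lemma integral_slice_derivative:
  fixes f :: "'n::finite cpair \<Rightarrow> complex"
  assumes U: "open U" "smooth_on U f" and slice_in: "\<And>y. slice a y \<in> U"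
    and K: "compact K" "K \<subseteq> U" and zero: "\<And>y. slice a y \<notin> K \<Longrightarrow> f (slice a y) = 0"
    and d: "snd d $ a = 0"
  shows "integrable (leb_slice a) (\<lambda>y. frechet_derivative f (at (slice a y)) d)"
    and "(\<integral>y. frechet_derivative f (at (slice a y)) d \<partial>leb_slice a) = 0"
proof -
  define D where "D p = frechet_derivative f (at p) d" for p
  have cD: "continuous_on U D"
    unfolding D_def by (rule smooth_on_continuous[OF smooth_on_frechet_derivative[OF U(2)]])
  have shift: "slice a y + t *\<^sub>R d = slice a (slice_shift a (t *\<^sub>R d) y)" for y t
    using d by (subst slice_slice_shift) auto
  have deriv: "((\<lambda>s. f (p + s *\<^sub>R d)) has_derivative (\<lambda>h. h *\<^sub>R D (p + t *\<^sub>R d))) (at t)" if "p = slice a y" for p y t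
  proof -
    have pU: "p + t *\<^sub>R d \<in> U" using slice_in shift that by metis
    have df: "(f has_derivative frechet_derivative f (at (p + t *\<^sub>R d))) (at (p + t *\<^sub>R d))"
      by (rule smooth_on_has_derivative[OF U pU])
    have "((\<lambda>s. f (p + s *\<^sub>R d)) has_derivative (\<lambda>h. frechet_derivative f (at (p + t *\<^sub>R d)) (h *\<^sub>R d))) (at t)"
      by (rule has_derivative_compose[where f = "\<lambda>s. p + s *\<^sub>R d", OF _ df]) (auto intro!: derivative_eq_intros)
    then show ?thesis by (simp add: D_def linear_cmul[OF has_derivative_linear[OF df]])
  qed
  have D0: "D (slice a y) = 0" if "slice a y \<notin> K" for y
  proof -
    have "open (- K)" using compact_imp_closed[OF K(1)] by (rule open_Compl)
    then have "open ((\<lambda>t. slice a y + t *\<^sub>R d) -` (- K))" by (rule open_vimage) (intro continuous_intros)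
    moreover have "0 \<in> (\<lambda>t. slice a y + t *\<^sub>R d) -` (- K)" using that by simp
    moreover have "f (slice a y + t *\<^sub>R d) = 0" if "t \<in> (\<lambda>t. slice a y + t *\<^sub>R d) -` (- K)" for t
      using that zero shift by auto
    ultimately have "((\<lambda>t. 0) has_derivative (\<lambda>h. h *\<^sub>R D (slice a y + 0 *\<^sub>R d))) (at (0::real))"
      using has_derivative_transform_within_open[OF deriv[OF refl, of y 0], of _ "\<lambda>t. 0"] by blast
    then have "(\<lambda>h. h *\<^sub>R D (slice a y + 0 *\<^sub>R d)) = (\<lambda>h::real. 0)"
      using has_derivative_unique[OF _ has_derivative_const] by blast
    from fun_cong[OF this, of 1] show ?thesis by simp
  qed
  show int: "integrable (leb_slice a) (\<lambda>y. frechet_derivative f (at (slice a y)) d)"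
    using integrable_comp_slice[OF U(1) cD slice_in K D0] by (simp add: D_def)
  have fint: "integrable (leb_slice a) (\<lambda>y. f (slice a y))"
    by (rule integrable_comp_slice[OF U(1) smooth_on_continuous[OF U(2)] slice_in K zero])
  obtain R where R: "\<And>p. p \<in> K \<Longrightarrow> norm p \<le> R" using compact_imp_bounded[OF K(1)] bounded_iff by blast
  have "compact (D ` K)" using continuous_on_subset[OF cD K(2)] K(1) by (rule compact_continuous_image)
  then obtain C' where C': "\<And>p. p \<in> K \<Longrightarrow> norm (D p) \<le> C'" using compact_imp_bounded bounded_iff by (metis imageI)
  define C where "C = max 0 C'"
  have C: "norm (D (slice a y)) \<le> C" for y
    using C'[of "slice a y"] D0[of y] by (cases "slice a y \<in> K") (auto simp: C_def)
  define t where "t n = 1 / real (Suc n)" for n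
  have t: "0 < t n" "t n \<le> 1" for n by (auto simp: t_def)
  define q where "q n y = (f (slice a y + t n *\<^sub>R d) - f (slice a y)) /\<^sub>R t n" for n y
  have fshift: "integrable (leb_slice a) (\<lambda>y. f (slice a y + t n *\<^sub>R d))"
    "(\<integral>y. f (slice a y + t n *\<^sub>R d) \<partial>leb_slice a) = (\<integral>y. f (slice a y) \<partial>leb_slice a)" for n
  proof -
    have m: "(\<lambda>y. f (slice a y)) \<in> borel_measurable (leb_slice a)" using fint by simp
    have "integrable (distr (leb_slice a) (leb_slice a) (slice_shift a (t n *\<^sub>R d))) (\<lambda>y. f (slice a y))"
      unfolding leb_slice_shift by (rule fint)
    then show "integrable (leb_slice a) (\<lambda>y. f (slice a y + t n *\<^sub>R d))"
      unfolding shift by (rule integrable_distr[OF measurable_slice_shift])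
    have "(\<integral>y. f (slice a y) \<partial>leb_slice a) = (\<integral>y. f (slice a y) \<partial>distr (leb_slice a) (leb_slice a) (slice_shift a (t n *\<^sub>R d)))"
      unfolding leb_slice_shift ..
    also have "\<dots> = (\<integral>y. f (slice a (slice_shift a (t n *\<^sub>R d) y)) \<partial>leb_slice a)"
      by (rule integral_distr[OF measurable_slice_shift m])
    finally show "(\<integral>y. f (slice a y + t n *\<^sub>R d) \<partial>leb_slice a) = (\<integral>y. f (slice a y) \<partial>leb_slice a)"
      unfolding shift ..
  qed
  have q0: "(\<integral>y. q n y \<partial>leb_slice a) = 0" for n
    unfolding q_def using fint fshift by simp
  have qbound: "norm (q n y) \<le> C" for n y
  proof -
    have "norm (f (slice a y + t n *\<^sub>R d) - f (slice a y + 0 *\<^sub>R d)) \<le> C * norm (t n - 0)"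
    proof (rule differentiable_bound[of "{0..t n}" "\<lambda>s. f (slice a y + s *\<^sub>R d)" "\<lambda>s h. h *\<^sub>R D (slice a y + s *\<^sub>R d)"])
      show "((\<lambda>s. f (slice a y + s *\<^sub>R d)) has_derivative (\<lambda>h. h *\<^sub>R D (slice a y + s *\<^sub>R d))) (at s within {0..t n})" for s
        using deriv[OF refl] by (rule has_derivative_at_withinI)
      show "onorm (\<lambda>h. h *\<^sub>R D (slice a y + s *\<^sub>R d)) \<le> C" for s
      proof (rule onorm_le)
        fix h :: real
        have "norm (D (slice a y + s *\<^sub>R d)) \<le> C" unfolding shift by (rule C)
        then show "norm (h *\<^sub>R D (slice a y + s *\<^sub>R d)) \<le> C * norm h"
          by (simp add: mult.commute[of "\<bar>h\<bar>"] mult_right_mono)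
      qed
    qed (use t[of n] in auto)
    then have "norm (f (slice a y + t n *\<^sub>R d) - f (slice a y)) \<le> C * t n" using t[of n] by simp
    then show ?thesis using t[of n] by (simp add: q_def divide_simps mult.commute)
  qed
  have qlim: "(\<lambda>n. q n y) \<longlonglongrightarrow> D (slice a y)" for y
  proof -
    have "t \<longlonglongrightarrow> 0" unfolding t_def using LIMSEQ_inverse_real_of_nat by (simp add: inverse_eq_divide)
    then have "filterlim t (at 0) sequentially"
      using t by (auto simp: filterlim_at intro!: always_eventually) (metis less_irrefl)
    moreover have "((\<lambda>h. norm (f (slice a y + (0 + h) *\<^sub>R d) - f (slice a y + 0 *\<^sub>R d) - h *\<^sub>R D (slice a y + 0 *\<^sub>R d)) / norm h) \<longlongrightarrow> 0) (at 0)"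
      using deriv[OF refl, of y 0] unfolding has_derivative_at by blast
    ultimately have "(\<lambda>n. norm (f (slice a y + (0 + t n) *\<^sub>R d) - f (slice a y + 0 *\<^sub>R d) - t n *\<^sub>R D (slice a y + 0 *\<^sub>R d)) / norm (t n)) \<longlonglongrightarrow> 0"
      by (rule filterlim_compose[rotated])
    moreover have "norm (f (slice a y + (0 + t n) *\<^sub>R d) - f (slice a y + 0 *\<^sub>R d) - t n *\<^sub>R D (slice a y + 0 *\<^sub>R d)) / norm (t n)
       = norm (q n y - D (slice a y))" for n
    proof -
      have "q n y - D (slice a y) = (f (slice a y + t n *\<^sub>R d) - f (slice a y) - t n *\<^sub>R D (slice a y)) /\<^sub>R t n"
        using t[of n] by (simp add: q_def scaleR_diff_right)
      then show ?thesis using t[of n] by (simp add: divide_inverse mult.commute)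
    qed
    ultimately show ?thesis by (simp add: tendsto_norm_zero_iff LIM_zero_iff)
  qed
  define B where "B = {y \<in> space (leb_slice a). norm (slice a y) \<le> R + norm d}"
  have Bs: "B \<in> sets (leb_slice a)" unfolding B_def by measurable
  have "(\<lambda>n. \<integral>y. q n y \<partial>leb_slice a) \<longlonglongrightarrow> (\<integral>y. D (slice a y) \<partial>leb_slice a)"
  proof (rule integral_dominated_convergence[where w = "\<lambda>y. C * indicator B y"])
    show "(\<lambda>y. D (slice a y)) \<in> borel_measurable (leb_slice a)" using int by (simp add: D_def)
    show "q n \<in> borel_measurable (leb_slice a)" for n
      unfolding q_def using fint fshift(1)[of n] by (intro borel_measurable_scaleR borel_measurable_diff) auto
    show "integrable (leb_slice a) (\<lambda>y. C * indicator B y)"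
      using Bs emeasure_bounded_slice[of a "R + norm d"] by (intro integrable_mult_right integrable_real_indicator) (auto simp: B_def)
    show "AE y in leb_slice a. (\<lambda>n. q n y) \<longlonglongrightarrow> D (slice a y)" using qlim by simp
    show "AE y in leb_slice a. norm (q n y) \<le> C * indicator B y" for n
    proof (rule AE_I2)
      fix y assume y: "y \<in> space (leb_slice a)"
      show "norm (q n y) \<le> C * indicator B y"
      proof (cases "y \<in> B")
        case False
        then have big: "R + norm d < norm (slice a y)" using y by (simp add: B_def)
        have td: "norm (t n *\<^sub>R d) \<le> norm d" using t[of n] by (simp add: mult_left_le_one_le)
        have "R < norm (slice a y + t n *\<^sub>R d)"
          using norm_triangle_ineq2[of "slice a y" "- (t n *\<^sub>R d)"] big td by simp
        then have "slice a y + t n *\<^sub>R d \<notin> K" using R[of "slice a y + t n *\<^sub>R d"] by auto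
        moreover have "slice a y \<notin> K" using R[of "slice a y"] big norm_ge_zero[of d] by force
        ultimately have "q n y = 0" unfolding q_def shift using zero by simp
        then show ?thesis using False by simp
      qed (use qbound in simp)
    qed
  qed
  then have "(\<integral>y. D (slice a y) \<partial>leb_slice a) = 0" unfolding q0 by (simp add: LIMSEQ_const_iff)
  then show "(\<integral>y. frechet_derivative f (at (slice a y)) d \<partial>leb_slice a) = 0" by (simp add: D_def)
qed

lemma integral_slice_D:
  fixes f :: "'n::finite cpair \<Rightarrow> complex"
  assumes "open U" "smooth_on U f" "\<And>y. slice a y \<in> U"
    "compact K" "K \<subseteq> U" "\<And>y. slice a y \<notin> K \<Longrightarrow> f (slice a y) = 0"
  shows "has_bochner_integral (leb_slice a) (\<lambda>y. D_z \<mu> f (slice a y)) 0"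
    and "\<alpha> \<noteq> a \<Longrightarrow> has_bochner_integral (leb_slice a) (\<lambda>y. D_v \<alpha> f (slice a y)) 0"
proof -
  note I = integral_slice_derivative[OF assms(1-5) _, of d for d]
  have *: "has_bochner_integral (leb_slice a) (\<lambda>y. frechet_derivative f (at (slice a y)) d) 0" if "snd d $ a = 0" for d
    using I[of d] assms(6) that by (simp add: has_bochner_integral_iff)
  have **: "has_bochner_integral (leb_slice a) (\<lambda>y. (frechet_derivative f (at (slice a y)) d - \<i> * frechet_derivative f (at (slice a y)) e) / 2) 0"
    if "snd d $ a = 0" "snd e $ a = 0" for d e
  proof -
    have "has_bochner_integral (leb_slice a) (\<lambda>y. (frechet_derivative f (at (slice a y)) d - \<i> * frechet_derivative f (at (slice a y)) e) / 2) ((0 - \<i> * 0) / 2)"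
      by (intro has_bochner_integral_divide_zero has_bochner_integral_diff has_bochner_integral_mult_right * that)
    then show ?thesis by simp
  qed
  show "has_bochner_integral (leb_slice a) (\<lambda>y. D_z \<mu> f (slice a y)) 0"
    unfolding D_z_def by (rule **) auto
  show "has_bochner_integral (leb_slice a) (\<lambda>y. D_v \<alpha> f (slice a y)) 0" if "\<alpha> \<noteq> a"
    unfolding D_v_def by (rule **) (use that in \<open>auto simp: axis_def\<close>)
qed

context finsler_manifold
begin

section \<open>The volume measure on the projectivized bundle\<close>

lemma continuous_on_change:
  assumes c: "c \<in> A" and d: "d \<in> A" shows "continuous_on (tdom_overlap c d) (change c d)"
proof -
  interpret b: finsler_bundle_map "tdom0 c" "Gloc A F c" "tdom0 d" "Gloc A F d" "tdom_overlap c d" "transition c d" "jac c d" "jac c d"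
    "\<lambda>z \<sigma> \<tau> \<mu>. frechet_derivative (\<lambda>z. jac c d z $ \<sigma> $ \<tau>) (at z) (axis \<mu> 1)" 1
    by (rule change_bundle_map[OF c d])
  have "b.\<Phi> = change c d" by (simp add: fun_eq_iff b.\<Phi>_def change_def)
  moreover have "continuous_on (tdom_overlap c d) b.\<Phi>"
    by (rule continuous_at_imp_continuous_on) (rule ballI, rule has_derivative_continuous, rule b.\<Phi>_derivative)
  ultimately show ?thesis by simp
qed

lemma pdom_sets: "c \<in> A \<Longrightarrow> pdom c a \<in> sets (leb_slice a)"
  unfolding pdom_def leb_slice_def using chart_open(2)[of c]
  by (intro pair_measureI sets_PiM_I_finite) auto

lemma pdom_subset_space: "y \<in> pdom c a \<Longrightarrow> y \<in> space (leb_slice a)"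
  by (auto simp: pdom_def leb_slice_def space_pair_measure space_PiM)

lemma pdom_subset: "pdom c a \<subseteq> space (leb_slice a)"
  using pdom_subset_space by blast

lemma pdom_Collect_sets:
  assumes c: "c \<in> A" and V: "V \<in> sets borel" shows "{y \<in> pdom c a. slice a y \<in> V} \<in> sets (leb_slice a)"
proof -
  have "{y \<in> pdom c a. slice a y \<in> V} = pdom c a \<inter> (slice a -` V \<inter> space (leb_slice a))"
    using pdom_subset[of c a] by auto
  then show ?thesis using pdom_sets[OF c] measurable_sets[OF measurable_slice V] by auto
qed

text \<open>The \<open>a\<close>-th component of a tangent vector is nonzero for all or for no representatives of a direction.\<close>

lemma class_in_patch_iff:
  assumes c: "c \<in> A" and u: "u \<in> TM0 A"
  shows "proj_rel A `` {u} \<in> ppoint A c a ` pdom c a \<longleftrightarrow> fst u \<in> cdom c \<and> snd u c $ a \<noteq> 0"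
proof
  assume "proj_rel A `` {u} \<in> ppoint A c a ` pdom c a"
  then obtain y where y: "y \<in> pdom c a" "proj_rel A `` {u} = proj_rel A `` {tpoint A c (slice a y)}" by (auto simp: ppoint_def)
  define w where "w = tpoint A c (slice a y)"
  have p: "slice a y \<in> tdom0 c" by (rule slice_tdom0[OF y(1)])
  have w: "w \<in> TM0 A" "fst w \<in> cdom c" "tcoord c w = slice a y"
    using tpoint_TM0[OF c p] tpoint[OF c tdom0_tdom[OF p]] by (auto simp: w_def)
  obtain \<zeta> where \<zeta>: "\<zeta> \<noteq> 0" "u = tscale \<zeta> w"
    using proj_class[OF w(1), of u] self_in_proj_class[OF u] y(2) by (auto simp: w_def)
  have "snd w c = snd (slice a y)" using arg_cong[OF w(3), of snd] by (simp add: tcoord_def)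
  then show "fst u \<in> cdom c \<and> snd u c $ a \<noteq> 0"
    using w(2) \<zeta> by (simp add: tscale_def slice_def)
qed (use in_ppoint_image[OF c u] in blast)

text \<open>In any other patch, the points of the given patch form the preimage of an open set, since the change of
  coordinates is continuous.\<close>

lemma patch_sets:
  assumes vm: "volume_measure A F \<nu>" and c: "c \<in> A"
  shows "ppoint A c a ` pdom c a \<in> sets \<nu>"
proof -
  have "{y \<in> pdom d b. ppoint A d b y \<in> ppoint A c a ` pdom c a} \<in> sets (leb_slice b)" if d: "d \<in> A" for d b
  proof -
    define V where "V = {p \<in> tdom_overlap d c. snd (change d c p) $ a \<noteq> 0}"
    have ov: "open (tdom_overlap d c)" unfolding tdom_overlap_def by (intro open_Times open_overlap c d) auto
    have "V = tdom_overlap d c \<inter> (\<lambda>p. snd (change d c p) $ a) -` (- {0})" by (auto simp: V_def)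
    moreover have "continuous_on (tdom_overlap d c) (\<lambda>p. snd (change d c p) $ a)"
      by (intro continuous_intros continuous_on_change d c)
    moreover have "open (- {0::complex})" by auto
    ultimately have "open V" using continuous_open_preimage[OF _ ov] by metis
    moreover have "{y \<in> pdom d b. ppoint A d b y \<in> ppoint A c a ` pdom c a} = {y \<in> pdom d b. slice b y \<in> V}"
    proof (intro Collect_cong conj_cong refl)
      fix y assume y: "y \<in> pdom d b"
      have p: "slice b y \<in> tdom0 d" by (rule slice_tdom0[OF y])
      define u where "u = tpoint A d (slice b y)"
      have u: "u \<in> TM0 A" "fst u \<in> cdom d" "tcoord d u = slice b y"
        using tpoint_TM0[OF d p] tpoint[OF d tdom0_tdom[OF p]] by (auto simp: u_def)
      have uT: "u \<in> TM A" using u(1) by (simp add: TM0_def)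
      have fi: "fst u \<in> cdom c \<longleftrightarrow> slice b y \<in> tdom_overlap d c"
      proof
        assume "fst u \<in> cdom c" then show "slice b y \<in> tdom_overlap d c"
          using tcoord_in_tdom_overlap[OF u(1) d u(2)] u(3) by simp
      next
        assume "slice b y \<in> tdom_overlap d c"
        then have "cmap d (fst u) \<in> overlap d c" using arg_cong[OF u(3), of fst] by (auto simp: tcoord_def tdom_overlap_def)
        then show "fst u \<in> cdom c" using u(2) d by (auto simp: overlap_eq cinv_cmap)
      qed
      have "snd u c = snd (change d c (slice b y))" if "fst u \<in> cdom c"
        using arg_cong[OF tcoord_change[OF uT d c u(2) that], of snd] u(3) by (simp add: tcoord_def)
      then show "ppoint A d b y \<in> ppoint A c a ` pdom c a \<longleftrightarrow> slice b y \<in> V"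
        using class_in_patch_iff[OF c u(1)] fi unfolding ppoint_def[of A d] u_def[symmetric] V_def by auto
    qed
    ultimately show ?thesis using pdom_Collect_sets[OF d, of V b] by simp
  qed
  moreover have "ppoint A c a ` pdom c a \<subseteq> PTM A" using ppoint_PTM[OF c] by auto
  ultimately show ?thesis using vm unfolding volume_measure_def by auto
qed

lemma on_PTM_measurable:
  assumes vm: "volume_measure A F \<nu>" and h: "invariant_fun h" and cont: "\<And>c. c \<in> A \<Longrightarrow> continuous_on (tdom0 c) (h c)"
  shows "on_PTM A h \<in> borel_measurable \<nu>"
proof (rule measurableI)
  fix B :: "complex set" assume B: "B \<in> sets borel"
  have "{y \<in> pdom d b. ppoint A d b y \<in> on_PTM A h -` B \<inter> space \<nu>} \<in> sets (leb_slice b)" if d: "d \<in> A" for d b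
  proof -
    have m: "(\<lambda>p. indicator (tdom0 d) p *\<^sub>R h d p) \<in> borel_measurable borel"
      using cont[OF d] open_tdom0[OF d] by (intro borel_measurable_continuous_on_indicator) auto
    have "{y \<in> pdom d b. ppoint A d b y \<in> on_PTM A h -` B \<inter> space \<nu>} = {y \<in> pdom d b. slice b y \<in> (\<lambda>p. indicator (tdom0 d) p *\<^sub>R h d p) -` B}"
      using vm ppoint_PTM[OF d] ppoint_on_PTM[OF h d] slice_tdom0[of _ d b] unfolding volume_measure_def by auto
    then show ?thesis using pdom_Collect_sets[OF d, of "(\<lambda>p. indicator (tdom0 d) p *\<^sub>R h d p) -` B" b] measurable_sets[OF m B] by simp
  qed
  then show "on_PTM A h -` B \<inter> space \<nu> \<in> sets \<nu>" using vm unfolding volume_measure_def by auto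
qed simp

lemma vol_density_measurable:
  assumes c: "c \<in> A"
  shows "vol_density (Gloc A F c) a \<in> borel_measurable (restrict_space (leb_slice a) (pdom c a))"
    and "y \<in> pdom c a \<Longrightarrow> 0 < vol_density (Gloc A F c) a y"
proof -
  interpret g: finsler_chart "tdom0 c" "Gloc A F c" by (rule finsler_chart[OF c])
  have eq: "vol_density (Gloc A F c) a y = vol_const a * Re (g.density (slice a y))" if "y \<in> pdom c a" for y
    by (rule g.vol_density_eq[OF slice_tdom0[OF that]])
  show "0 < vol_density (Gloc A F c) a y" if y: "y \<in> pdom c a" for y
  proof -
    have p: "slice a y \<in> tdom0 c" by (rule slice_tdom0[OF y])
    obtain \<delta> where \<delta>: "det (G_mat (Gloc A F c) (slice a y)) = complex_of_real \<delta>" "\<delta> \<noteq> 0"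
      using g.det_M_real[OF p] by (auto elim: Reals_cases)
    have "g.density (slice a y) = complex_of_real (\<delta>\<^sup>2 * inverse (Gloc A F c (slice a y) ^ CARD('n)))"
      by (simp add: g.density_def \<delta>)
    then have "Re (g.density (slice a y)) = \<delta>\<^sup>2 * inverse (Gloc A F c (slice a y) ^ CARD('n))"
      by (simp only: Re_complex_of_real)
    then show ?thesis using \<delta>(2) g.g_pos[OF p] vol_const_pos[of a] by (simp add: eq[OF y])
  qed
  have "(\<lambda>p. indicator (tdom0 c) p *\<^sub>R g.density p) \<in> borel_measurable borel"
    using smooth_on_continuous[OF g.smooth_density] g.open_S by (intro borel_measurable_continuous_on_indicator) auto
  then have "(\<lambda>y. indicator (tdom0 c) (slice a y) *\<^sub>R g.density (slice a y)) \<in> borel_measurable (leb_slice a)"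
    by (rule measurable_compose[OF measurable_slice])
  then have "(\<lambda>y. vol_const a * Re (indicator (tdom0 c) (slice a y) *\<^sub>R g.density (slice a y))) \<in> borel_measurable (restrict_space (leb_slice a) (pdom c a))"
    by (intro borel_measurable_times borel_measurable_const measurable_restrict_space1 measurable_compose[OF _ borel_measurable_Re])
  then show "vol_density (Gloc A F c) a \<in> borel_measurable (restrict_space (leb_slice a) (pdom c a))"
    by (rule measurable_cong[THEN iffD1, rotated]) (auto simp: space_restrict_space eq slice_tdom0)
qed

text \<open>The volume measure is described by densities only inside the patches \<open>v\<^sup>a \<noteq> 0\<close> of the charts. An integrand
  that vanishes outside one patch is integrated by pushing the measure with that density forward along the
  parametrization of the patch.\<close>

lemma integral_patch:
  assumes vm: "volume_measure A F \<nu>" and h: "invariant_fun h" and cont: "\<And>c. c \<in> A \<Longrightarrow> continuous_on (tdom0 c) (h c)"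
    and c: "c \<in> A" and supp: "\<And>u. u \<in> TM0 A \<Longrightarrow> \<not> (fst u \<in> cdom c \<and> snd u c $ a \<noteq> 0) \<Longrightarrow> on_PTM A h (proj_rel A `` {u}) = 0"
  shows "(\<integral>l. on_PTM A h l \<partial>\<nu>) = (\<integral>y. indicator (pdom c a) y *\<^sub>R (vol_density (Gloc A F c) a y *\<^sub>R h c (slice a y)) \<partial>leb_slice a)"
proof -
  define U where "U = ppoint A c a ` pdom c a"
  define L where "L = restrict_space (leb_slice a) (pdom c a)"
  let ?v = "vol_density (Gloc A F c) a"
  have Us: "U \<in> sets \<nu>" unfolding U_def by (rule patch_sets[OF vm c])
  have sp: "space \<nu> = PTM A" using vm by (simp add: volume_measure_def)
  have spL: "space L = pdom c a" using pdom_subset[of c a] by (auto simp: L_def space_restrict_space)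
  have UP: "U \<subseteq> space \<nu>" using sets.sets_into_space[OF Us] .
  have vL: "?v \<in> borel_measurable L" unfolding L_def by (rule vol_density_measurable[OF c])
  have setsU: "S \<in> sets \<nu> \<and> S \<subseteq> U" if "S \<in> sets (restrict_space \<nu> U)" for S
    using that Us by (simp add: sets_restrict_space_iff)
  have pre: "{y \<in> pdom c a. ppoint A c a y \<in> S} \<in> sets (leb_slice a)" if "S \<in> sets \<nu>" for S
    using that vm c unfolding volume_measure_def by blast
  have preL: "ppoint A c a -` S \<inter> space L \<in> sets L" if "S \<in> sets \<nu>" for S
  proof -
    have "ppoint A c a -` S \<inter> space L = {y \<in> pdom c a. ppoint A c a y \<in> S}" using spL by auto
    then show ?thesis using pre[OF that] pdom_sets[OF c] by (auto simp: L_def sets_restrict_space_iff)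
  qed
  have mp: "ppoint A c a \<in> measurable L (restrict_space \<nu> U)"
  proof (rule measurableI)
    show "ppoint A c a y \<in> space (restrict_space \<nu> U)" if "y \<in> space L" for y
      using that spL UP by (auto simp: space_restrict_space U_def)
    show "ppoint A c a -` S \<inter> space L \<in> sets L" if "S \<in> sets (restrict_space \<nu> U)" for S
      using preL setsU[OF that] by blast
  qed
  have mpd: "ppoint A c a \<in> measurable (density L (\<lambda>y. ennreal (?v y))) (restrict_space \<nu> U)"
    using mp by simp
  have meq: "restrict_space \<nu> U = distr (density L (\<lambda>y. ennreal (?v y))) (restrict_space \<nu> U) (ppoint A c a)"
  proof (rule measure_eqI)
    fix S assume S: "S \<in> sets (restrict_space \<nu> U)"
    have SU: "S \<in> sets \<nu>" "S \<subseteq> U" using setsU[OF S] by auto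
    define P where "P = {y \<in> pdom c a. ppoint A c a y \<in> S}"
    have P: "ppoint A c a -` S \<inter> space L = P" using spL by (auto simp: P_def)
    have "emeasure (restrict_space \<nu> U) S = emeasure \<nu> S"
      using Us SU UP by (intro emeasure_restrict_space) auto
    also have "\<dots> = (\<integral>\<^sup>+ y. ennreal (?v y) * indicator P y \<partial>leb_slice a)"
      using vm c SU unfolding volume_measure_def U_def P_def by blast
    also have "\<dots> = (\<integral>\<^sup>+ y. (ennreal (?v y) * indicator P y) * indicator (pdom c a) y \<partial>leb_slice a)"
      by (intro nn_integral_cong) (auto simp: P_def indicator_def)
    also have "\<dots> = (\<integral>\<^sup>+ y. ennreal (?v y) * indicator P y \<partial>L)"
      unfolding L_def using pdom_sets[OF c] by (intro nn_integral_restrict_space[symmetric]) auto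
    also have "\<dots> = emeasure (density L (\<lambda>y. ennreal (?v y))) P"
      using vL preL[OF SU(1)] P by (subst emeasure_density) auto
    also have "\<dots> = emeasure (distr (density L (\<lambda>y. ennreal (?v y))) (restrict_space \<nu> U) (ppoint A c a)) S"
      using P by (subst emeasure_distr[OF mpd S]) simp
    finally show "emeasure (restrict_space \<nu> U) S = emeasure (distr (density L (\<lambda>y. ennreal (?v y))) (restrict_space \<nu> U) (ppoint A c a)) S" .
  qed simp
  define f where "f = on_PTM A h"
  have fm: "f \<in> borel_measurable \<nu>" unfolding f_def by (rule on_PTM_measurable[OF vm h cont])
  have f0: "f l = indicator U l *\<^sub>R f l" if l: "l \<in> space \<nu>" for l
  proof (cases "l \<in> U")
    case False
    obtain u where u: "u \<in> TM0 A" "l = proj_rel A `` {u}" using l sp by (auto elim: PTM_cases)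
    then have "\<not> (fst u \<in> cdom c \<and> snd u c $ a \<noteq> 0)" using False class_in_patch_iff[OF c u(1)] by (auto simp: U_def)
    then show ?thesis using supp[OF u(1)] u(2) by (simp add: f_def)
  qed simp
  have "(\<integral>l. f l \<partial>\<nu>) = (\<integral>l. indicator U l *\<^sub>R f l \<partial>\<nu>)"
    by (rule Bochner_Integration.integral_cong[OF refl f0])
  also have "\<dots> = (\<integral>l. f l \<partial>restrict_space \<nu> U)"
    using Us UP by (intro integral_restrict_space[symmetric]) auto
  also have "\<dots> = (\<integral>l. f l \<partial>distr (density L (\<lambda>y. ennreal (?v y))) (restrict_space \<nu> U) (ppoint A c a))"
    using meq by simp
  also have "\<dots> = (\<integral>y. f (ppoint A c a y) \<partial>density L (\<lambda>y. ennreal (?v y)))"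
    by (rule integral_distr[OF mpd measurable_restrict_space1[OF fm]])
  also have "\<dots> = (\<integral>y. ?v y *\<^sub>R f (ppoint A c a y) \<partial>L)"
  proof (rule integral_density)
    show "(\<lambda>y. f (ppoint A c a y)) \<in> borel_measurable L"
      by (rule measurable_compose[OF mp measurable_restrict_space1[OF fm]])
    show "AE y in L. 0 \<le> ?v y"
      using vol_density_measurable(2)[OF c] spL by (intro AE_I2) (auto intro: less_imp_le)
  qed (rule vL)
  also have "\<dots> = (\<integral>y. indicator (pdom c a) y *\<^sub>R (?v y *\<^sub>R f (ppoint A c a y)) \<partial>leb_slice a)"
    unfolding L_def using pdom_sets[OF c] by (intro integral_restrict_space) auto
  also have "\<dots> = (\<integral>y. indicator (pdom c a) y *\<^sub>R (?v y *\<^sub>R h c (slice a y)) \<partial>leb_slice a)"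
    by (intro Bochner_Integration.integral_cong refl) (auto simp: f_def ppoint_on_PTM[OF h c] indicator_def)
  finally show ?thesis by (simp add: f_def)
qed

end


section \<open>Inner products of horizontal forms\<close>

lemma sum_lists_0: "(\<Sum>I | length I = 0. f I) = f []"
proof -
  have "{I. length I = 0} = {[] :: 'a list}" by auto
  then show ?thesis by simp
qed

lemma sum_lists_Suc:
  fixes f :: "'n::finite list \<Rightarrow> 'b::comm_monoid_add"
  shows "(\<Sum>I | length I = Suc k. f I) = (\<Sum>i\<in>UNIV. \<Sum>I | length I = k. f (i # I))"
proof -
  have "bij_betw (\<lambda>(i, I). i # I) (UNIV \<times> {I. length I = k}) {I :: 'n list. length I = Suc k}"
    by (rule bij_betwI[where g = "\<lambda>I. (hd I, tl I)"]) (auto simp: length_Suc_conv)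
  from sum.reindex_bij_betw[OF this, of f] show ?thesis
    by (simp add: sum.cartesian_product split_beta)
qed

lemma sum_lists_1:
  fixes f :: "'n::finite list \<Rightarrow> 'b::comm_monoid_add"
  shows "(\<Sum>I | length I = 1. f I) = (\<Sum>i\<in>UNIV. f [i])"
  using sum_lists_Suc[of f 0] by (simp add: sum_lists_0[unfolded length_0_conv])

lemma sum_lists_2:
  fixes f :: "'n::finite list \<Rightarrow> 'b::comm_monoid_add"
  shows "(\<Sum>I | length I = 2. f I) = (\<Sum>i\<in>UNIV. \<Sum>j\<in>UNIV. f [i, j])"
  using sum_lists_Suc[of f 1] sum_lists_1[of "\<lambda>I. f (_ # I)"] by (simp add: numeral_2_eq_2 sum_lists_1[unfolded One_nat_def])

lemma sum_quadruple_product: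
  fixes f h :: "'n::finite \<Rightarrow> 'n \<Rightarrow> complex"
  shows "(\<Sum>i\<in>UNIV. \<Sum>j\<in>UNIV. \<Sum>k\<in>UNIV. \<Sum>l\<in>UNIV. f i k * h j l) = (\<Sum>i\<in>UNIV. \<Sum>k\<in>UNIV. f i k) * (\<Sum>j\<in>UNIV. \<Sum>l\<in>UNIV. h j l)"
    and "(\<Sum>i\<in>UNIV. \<Sum>j\<in>UNIV. \<Sum>k\<in>UNIV. \<Sum>l\<in>UNIV. f i l * h j k) = (\<Sum>i\<in>UNIV. \<Sum>l\<in>UNIV. f i l) * (\<Sum>j\<in>UNIV. \<Sum>k\<in>UNIV. h j k)"
proof -
  have *: "(\<Sum>i\<in>UNIV. \<Sum>j\<in>UNIV. \<Sum>k\<in>UNIV. \<Sum>l\<in>UNIV. f i k * h j l) = (\<Sum>i\<in>UNIV. \<Sum>k\<in>UNIV. f i k) * (\<Sum>j\<in>UNIV. \<Sum>l\<in>UNIV. h j l)"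
  proof -
    have "(\<Sum>i\<in>UNIV. \<Sum>j\<in>UNIV. \<Sum>k\<in>UNIV. \<Sum>l\<in>UNIV. f i k * h j l) = (\<Sum>i\<in>UNIV. \<Sum>k\<in>UNIV. \<Sum>j\<in>UNIV. \<Sum>l\<in>UNIV. f i k * h j l)"
      by (intro sum.cong refl sum.swap)
    then show ?thesis by (simp only: sum_distrib_left[symmetric] sum_distrib_right[symmetric])
  qed
  then show "(\<Sum>i\<in>UNIV. \<Sum>j\<in>UNIV. \<Sum>k\<in>UNIV. \<Sum>l\<in>UNIV. f i k * h j l) = (\<Sum>i\<in>UNIV. \<Sum>k\<in>UNIV. f i k) * (\<Sum>j\<in>UNIV. \<Sum>l\<in>UNIV. h j l)" .
  have "(\<Sum>i\<in>UNIV. \<Sum>j\<in>UNIV. \<Sum>k\<in>UNIV. \<Sum>l\<in>UNIV. f i l * h j k) = (\<Sum>i\<in>UNIV. \<Sum>j\<in>UNIV. \<Sum>l\<in>UNIV. \<Sum>k\<in>UNIV. f i l * h j k)"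
    by (intro sum.cong refl sum.swap)
  then show "(\<Sum>i\<in>UNIV. \<Sum>j\<in>UNIV. \<Sum>k\<in>UNIV. \<Sum>l\<in>UNIV. f i l * h j k) = (\<Sum>i\<in>UNIV. \<Sum>l\<in>UNIV. f i l) * (\<Sum>j\<in>UNIV. \<Sum>k\<in>UNIV. h j k)"
    by (simp only: *)
qed

lemma omega_H_eq:
  "omega_H A F c x I J = (if length I = 1 \<and> length J = 1 then \<i> * G_mat (Gloc A F c) x $ (I ! 0) $ (J ! 0) else 0)"
  by (simp add: omega_H_def form11_def mult.assoc mult.left_commute[of _ "of_bool _"] flip: sum_distrib_left)

context finsler_chart
begin

text \<open>Since \<open>M\<close> is Hermitian, the sum over \<open>l\<close> is a product of \<open>N\<close> with \<open>M\<close>.\<close>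

lemma contract_M_N:
  assumes p: "p \<in> S"
  shows "(\<Sum>\<kappa>\<in>UNIV. \<Sum>l\<in>UNIV. f \<kappa> * N \<beta> l p * cnj (M \<kappa> l p)) = f \<beta>"
proof -
  have "(\<Sum>\<kappa>\<in>UNIV. \<Sum>l\<in>UNIV. f \<kappa> * N \<beta> l p * cnj (M \<kappa> l p)) = (\<Sum>\<kappa>\<in>UNIV. f \<kappa> * (\<Sum>l\<in>UNIV. N \<beta> l p * M l \<kappa> p))"
    by (simp add: M_hermitian[OF p, symmetric] sum_distrib_left mult.assoc)
  then show ?thesis by (simp add: NM_sum[OF p])
qed

text \<open>Each factor \<open>\<omega>\<^sub>H\<close> of \<open>\<omega>\<^sub>H\<^sup>2\<close> cancels one of the inverse metrics in the inner product of (2,2)-forms, so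
  that two of the four remain.\<close>

lemma double_trace:
  assumes p: "p \<in> S"
  shows "(\<Sum>\<kappa>1\<in>UNIV. \<Sum>\<kappa>2\<in>UNIV. \<Sum>l1\<in>UNIV. \<Sum>l2\<in>UNIV. (N \<kappa>1 \<mu> p * N \<kappa>2 \<alpha> p) * (N \<nu> l1 p * N \<beta> l2 p) *
      cnj (2 * (M \<kappa>1 l1 p * M \<kappa>2 l2 p - M \<kappa>1 l2 p * M \<kappa>2 l1 p)))
    = 2 * (N \<nu> \<mu> p * N \<beta> \<alpha> p - N \<beta> \<mu> p * N \<nu> \<alpha> p)"
proof -
  note 1 = sum_quadruple_product(1)[of "\<lambda>\<kappa>1 l1. N \<kappa>1 \<mu> p * N \<nu> l1 p * cnj (M \<kappa>1 l1 p)" "\<lambda>\<kappa>2 l2. N \<kappa>2 \<alpha> p * N \<beta> l2 p * cnj (M \<kappa>2 l2 p)",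
      unfolded contract_M_N[OF p]]
  note 2 = sum_quadruple_product(2)[of "\<lambda>\<kappa>1 l2. N \<kappa>1 \<mu> p * N \<beta> l2 p * cnj (M \<kappa>1 l2 p)" "\<lambda>\<kappa>2 l1. N \<kappa>2 \<alpha> p * N \<nu> l1 p * cnj (M \<kappa>2 l1 p)",
      unfolded contract_M_N[OF p]]
  show ?thesis
    unfolding 1[symmetric] 2[symmetric] right_diff_distrib[of 2] sum_distrib_left sum_subtractf[symmetric]
    by (intro sum.cong refl) (simp add: algebra_simps)
qed

text \<open>The skew-symmetries in \<open>\<mu>, \<alpha>\<close> and in \<open>\<nu>, \<beta>\<close> make the four terms of the expanded product equal, and each
  of them is the trace \<open>trace_del_torsion_bar\<close>.\<close>

lemma trace_curvature:
  assumes tr: "\<And>x \<sigma>. x \<in> S \<Longrightarrow> torsion_trace \<sigma> x = 0" and p: "p \<in> S"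
  shows "(\<Sum>\<mu>\<in>UNIV. \<Sum>\<alpha>\<in>UNIV. \<Sum>\<nu>\<in>UNIV. \<Sum>\<beta>\<in>UNIV.
     - \<i> * (del g \<mu> (torsion_bar \<alpha> \<nu> \<beta>) p - del g \<alpha> (torsion_bar \<mu> \<nu> \<beta>) p) * (2 * (N \<nu> \<mu> p * N \<beta> \<alpha> p - N \<beta> \<mu> p * N \<nu> \<alpha> p)))
     = - 4 * \<i> * torsion_norm p"
proof -
  define X where "X \<mu> \<alpha> \<nu> \<beta> = del g \<mu> (torsion_bar \<alpha> \<nu> \<beta>) p" for \<mu> \<alpha> \<nu> \<beta>
  define T where "T f = (\<Sum>\<mu>\<in>UNIV. \<Sum>\<alpha>\<in>UNIV. \<Sum>\<nu>\<in>UNIV. \<Sum>\<beta>\<in>UNIV. (f \<mu> \<alpha> \<nu> \<beta> :: complex))" for f :: "'n \<Rightarrow> 'n \<Rightarrow> 'n \<Rightarrow> 'n \<Rightarrow> complex"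
  have anti: "X \<mu> \<alpha> \<beta> \<nu> = - X \<mu> \<alpha> \<nu> \<beta>" for \<mu> \<alpha> \<nu> \<beta>
  proof -
    have "torsion_bar \<alpha> \<beta> \<nu> = (\<lambda>x. - torsion_bar \<alpha> \<nu> \<beta> x)" by (simp add: torsion_bar_def fun_eq_iff)
    then show ?thesis unfolding X_def
      using derivation_minus[OF derivation_del diffble[OF smooth_torsion_bar p]] by simp
  qed
  have Tsw1: "T (\<lambda>\<mu> \<alpha> \<nu> \<beta>. f \<mu> \<alpha> \<beta> \<nu>) = T f" for f
    unfolding T_def by (intro sum.cong refl sum.swap)
  have Tsw2: "T (\<lambda>\<mu> \<alpha> \<nu> \<beta>. f \<alpha> \<mu> \<nu> \<beta>) = T f" for f
    unfolding T_def by (rule sum.swap)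
  have Tneg: "T (\<lambda>\<mu> \<alpha> \<nu> \<beta>. - f \<mu> \<alpha> \<nu> \<beta>) = - T f" for f unfolding T_def by (simp add: sum_negf)
  define Q where "Q = T (\<lambda>\<mu> \<alpha> \<nu> \<beta>. N \<nu> \<mu> p * N \<beta> \<alpha> p * X \<mu> \<alpha> \<nu> \<beta>)"
  have Qn: "Q = torsion_norm p / 2"
  proof -
    have "Q = (\<Sum>\<mu>\<in>UNIV. \<Sum>\<nu>\<in>UNIV. \<Sum>\<alpha>\<in>UNIV. \<Sum>\<beta>\<in>UNIV. N \<nu> \<mu> p * N \<beta> \<alpha> p * X \<mu> \<alpha> \<nu> \<beta>)"
      unfolding Q_def T_def by (intro sum.cong refl sum.swap)
    also have "\<dots> = (\<Sum>\<nu>\<in>UNIV. \<Sum>\<mu>\<in>UNIV. \<Sum>\<alpha>\<in>UNIV. \<Sum>\<beta>\<in>UNIV. N \<nu> \<mu> p * N \<beta> \<alpha> p * X \<mu> \<alpha> \<nu> \<beta>)"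
      by (rule sum.swap)
    also have "\<dots> = (\<Sum>\<nu>\<in>UNIV. \<Sum>\<mu>\<in>UNIV. N \<nu> \<mu> p * (\<Sum>\<beta>\<in>UNIV. \<Sum>\<alpha>\<in>UNIV. N \<beta> \<alpha> p * X \<mu> \<alpha> \<nu> \<beta>))"
    proof (intro sum.cong refl)
      fix \<nu> \<mu>
      have "(\<Sum>\<alpha>\<in>UNIV. \<Sum>\<beta>\<in>UNIV. N \<nu> \<mu> p * N \<beta> \<alpha> p * X \<mu> \<alpha> \<nu> \<beta>) = (\<Sum>\<beta>\<in>UNIV. \<Sum>\<alpha>\<in>UNIV. N \<nu> \<mu> p * N \<beta> \<alpha> p * X \<mu> \<alpha> \<nu> \<beta>)"
        by (rule sum.swap)
      then show "(\<Sum>\<alpha>\<in>UNIV. \<Sum>\<beta>\<in>UNIV. N \<nu> \<mu> p * N \<beta> \<alpha> p * X \<mu> \<alpha> \<nu> \<beta>) = N \<nu> \<mu> p * (\<Sum>\<beta>\<in>UNIV. \<Sum>\<alpha>\<in>UNIV. N \<beta> \<alpha> p * X \<mu> \<alpha> \<nu> \<beta>)"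
        by (simp add: sum_distrib_left mult.assoc)
    qed
    finally show ?thesis using trace_del_torsion_bar[OF tr p] by (simp add: X_def)
  qed
  have q1: "T (\<lambda>\<mu> \<alpha> \<nu> \<beta>. N \<beta> \<mu> p * N \<nu> \<alpha> p * X \<mu> \<alpha> \<nu> \<beta>) = - Q"
  proof -
    have "T (\<lambda>\<mu> \<alpha> \<nu> \<beta>. N \<beta> \<mu> p * N \<nu> \<alpha> p * X \<mu> \<alpha> \<nu> \<beta>) = T (\<lambda>\<mu> \<alpha> \<nu> \<beta>. N \<nu> \<mu> p * N \<beta> \<alpha> p * X \<mu> \<alpha> \<beta> \<nu>)"
      using Tsw1[of "\<lambda>\<mu> \<alpha> \<nu> \<beta>. N \<nu> \<mu> p * N \<beta> \<alpha> p * X \<mu> \<alpha> \<beta> \<nu>"] by simp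
    also have "\<dots> = T (\<lambda>\<mu> \<alpha> \<nu> \<beta>. - (N \<nu> \<mu> p * N \<beta> \<alpha> p * X \<mu> \<alpha> \<nu> \<beta>))"
      unfolding T_def by (intro sum.cong refl) (subst anti, simp)
    finally show ?thesis unfolding Tneg Q_def .
  qed
  have comm: "T (\<lambda>\<mu> \<alpha> \<nu> \<beta>. f \<mu> \<alpha> \<nu> \<beta> * h \<mu> \<alpha> \<nu> \<beta> * X \<mu> \<alpha> \<nu> \<beta>) = T (\<lambda>\<mu> \<alpha> \<nu> \<beta>. h \<mu> \<alpha> \<nu> \<beta> * f \<mu> \<alpha> \<nu> \<beta> * X \<mu> \<alpha> \<nu> \<beta>)" for f h
    unfolding T_def by (intro sum.cong refl) (simp add: mult.commute)
  have q2: "T (\<lambda>\<mu> \<alpha> \<nu> \<beta>. N \<nu> \<mu> p * N \<beta> \<alpha> p * X \<alpha> \<mu> \<nu> \<beta>) = - Q"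
    using Tsw2[of "\<lambda>\<mu> \<alpha> \<nu> \<beta>. N \<nu> \<alpha> p * N \<beta> \<mu> p * X \<mu> \<alpha> \<nu> \<beta>"] q1
      comm[of "\<lambda>\<mu> \<alpha> \<nu> \<beta>. N \<nu> \<alpha> p" "\<lambda>\<mu> \<alpha> \<nu> \<beta>. N \<beta> \<mu> p"] by (simp only:)
  have q3: "T (\<lambda>\<mu> \<alpha> \<nu> \<beta>. N \<beta> \<mu> p * N \<nu> \<alpha> p * X \<alpha> \<mu> \<nu> \<beta>) = Q"
    using Tsw2[of "\<lambda>\<mu> \<alpha> \<nu> \<beta>. N \<beta> \<alpha> p * N \<nu> \<mu> p * X \<mu> \<alpha> \<nu> \<beta>"]
      comm[of "\<lambda>\<mu> \<alpha> \<nu> \<beta>. N \<beta> \<alpha> p" "\<lambda>\<mu> \<alpha> \<nu> \<beta>. N \<nu> \<mu> p"] by (simp only: Q_def)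
  have "T (\<lambda>\<mu> \<alpha> \<nu> \<beta>. - \<i> * (X \<mu> \<alpha> \<nu> \<beta> - X \<alpha> \<mu> \<nu> \<beta>) * (2 * (N \<nu> \<mu> p * N \<beta> \<alpha> p - N \<beta> \<mu> p * N \<nu> \<alpha> p)))
    = - 2 * \<i> * (T (\<lambda>\<mu> \<alpha> \<nu> \<beta>. N \<nu> \<mu> p * N \<beta> \<alpha> p * X \<mu> \<alpha> \<nu> \<beta>) - T (\<lambda>\<mu> \<alpha> \<nu> \<beta>. N \<nu> \<mu> p * N \<beta> \<alpha> p * X \<alpha> \<mu> \<nu> \<beta>)
      - T (\<lambda>\<mu> \<alpha> \<nu> \<beta>. N \<beta> \<mu> p * N \<nu> \<alpha> p * X \<mu> \<alpha> \<nu> \<beta>) + T (\<lambda>\<mu> \<alpha> \<nu> \<beta>. N \<beta> \<mu> p * N \<nu> \<alpha> p * X \<alpha> \<mu> \<nu> \<beta>))"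
    unfolding T_def sum_distrib_left sum_subtractf[symmetric] sum.distrib[symmetric]
    by (intro sum.cong refl) (simp add: algebra_simps)
  also have "\<dots> = - 4 * \<i> * torsion_norm p"
    unfolding q1 q2 q3 Q_def[symmetric] by (simp add: Qn)
  finally show ?thesis by (simp add: T_def X_def)
qed

end

context finsler_manifold
begin

lemma dbar_omega:
  assumes c: "c \<in> A" and x: "x \<in> tdom0 c"
  shows "dbar_H A F (omega_H A F) c x [\<alpha>] [\<nu>, \<beta>] = - \<i> * finsler_chart.torsion_bar (Gloc A F c) \<alpha> \<nu> \<beta> x"
proof -
  interpret g: finsler_chart "tdom0 c" "Gloc A F c" by (rule finsler_chart[OF c])
  have "delbar (Gloc A F c) \<nu> (\<lambda>y. \<i> * g.M \<alpha> \<beta> y) x = \<i> * delbar (Gloc A F c) \<nu> (g.M \<alpha> \<beta>) x" for \<nu> \<beta>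
    by (rule derivation_cmult[OF g.derivation_delbar g.diffble[OF g.smooth_M x]])
  then show ?thesis
    by (simp add: dbar_H_def omit_def omega_H_eq g.torsion_bar_def lessThan_Suc numeral_2_eq_2 algebra_simps)
qed

lemma ddbar_omega:
  assumes c: "c \<in> A" and x: "x \<in> tdom0 c"
  shows "d_H A F (dbar_H A F (omega_H A F)) c x [\<mu>, \<alpha>] [\<nu>, \<beta>] =
     - \<i> * (del (Gloc A F c) \<mu> (finsler_chart.torsion_bar (Gloc A F c) \<alpha> \<nu> \<beta>) x - del (Gloc A F c) \<alpha> (finsler_chart.torsion_bar (Gloc A F c) \<mu> \<nu> \<beta>) x)"
proof -
  interpret g: finsler_chart "tdom0 c" "Gloc A F c" by (rule finsler_chart[OF c])
  have "del (Gloc A F c) \<mu> (\<lambda>y. dbar_H A F (omega_H A F) c y [\<alpha>] [\<nu>, \<beta>]) x = - \<i> * del (Gloc A F c) \<mu> (g.torsion_bar \<alpha> \<nu> \<beta>) x" for \<mu> \<alpha>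
  proof -
    have sm: "smooth_on (tdom0 c) (\<lambda>y. - \<i> * g.torsion_bar \<alpha> \<nu> \<beta> y)"
      by (intro smooth_on_mult smooth_on_const g.smooth_torsion_bar g.open_S)
    have "del (Gloc A F c) \<mu> (\<lambda>y. - \<i> * g.torsion_bar \<alpha> \<nu> \<beta> y) x = del (Gloc A F c) \<mu> (\<lambda>y. dbar_H A F (omega_H A F) c y [\<alpha>] [\<nu>, \<beta>]) x"
      by (rule derivation_cong[OF g.derivation_del g.open_S x g.diffble[OF sm x]]) (simp add: dbar_omega[OF c])
    moreover have "del (Gloc A F c) \<mu> (\<lambda>y. - \<i> * g.torsion_bar \<alpha> \<nu> \<beta> y) x = - \<i> * del (Gloc A F c) \<mu> (g.torsion_bar \<alpha> \<nu> \<beta>) x"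
      by (rule derivation_cmult[OF g.derivation_del g.diffble[OF g.smooth_torsion_bar x]])
    ultimately show ?thesis by simp
  qed
  then show ?thesis
    by (simp add: d_H_def omit_def lessThan_Suc numeral_2_eq_2 algebra_simps)
qed

lemma omega_square:
  "hwedge (omega_H A F) (omega_H A F) c x [k1, k2] [l1, l2] =
     2 * (G_mat (Gloc A F c) x $ k1 $ l1 * G_mat (Gloc A F c) x $ k2 $ l2 - G_mat (Gloc A F c) x $ k1 $ l2 * G_mat (Gloc A F c) x $ k2 $ l1)"
proof -
  have "(\<Sum>\<alpha>\<in>UNIV. \<Sum>\<beta>\<in>UNIV. G_mat (Gloc A F c) x $ \<alpha> $ \<beta> * of_bool (i = \<alpha>) * cnj (of_bool (j = \<beta>))) = G_mat (Gloc A F c) x $ i $ j" for i j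
    by (simp add: mult.assoc mult.left_commute[of _ "of_bool _"] flip: sum_distrib_left)
  then show ?thesis
    unfolding hwedge_def omega_H_def wedge_form11_square by (simp add: algebra_simps)
qed

text \<open>Up to the factor \<open>-\<i>\<close>, the coefficients of \<open>\<partial>\<^sub>H\<partial>\<^sub>H\<omega>\<^sub>H\<close>, the second operator being conjugate, are
  skew-symmetrized horizontal derivatives of the conjugate torsion. Their double trace is the one computed in
  \<open>trace_curvature\<close>.\<close>

lemma h_inner_ddbar_omega:
  assumes c: "c \<in> A" and x: "x \<in> tdom0 c"
    and tr: "\<And>x \<sigma>. x \<in> tdom0 c \<Longrightarrow> finsler_chart.torsion_trace (Gloc A F c) \<sigma> x = 0"
  shows "h_inner A F 2 2 (d_H A F (dbar_H A F (omega_H A F))) (hwedge (omega_H A F) (omega_H A F)) c x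
    = - \<i> * finsler_chart.torsion_norm (Gloc A F c) x"
proof -
  interpret g: finsler_chart "tdom0 c" "Gloc A F c" by (rule finsler_chart[OF c])
  let ?N = "\<lambda>\<beta> \<alpha>. G_inv (Gloc A F c) x $ \<beta> $ \<alpha>" and ?M = "\<lambda>\<alpha> \<beta>. G_mat (Gloc A F c) x $ \<alpha> $ \<beta>"
  let ?X = "\<lambda>\<mu> \<alpha> \<nu> \<beta>. - \<i> * (del (Gloc A F c) \<mu> (g.torsion_bar \<alpha> \<nu> \<beta>) x - del (Gloc A F c) \<alpha> (g.torsion_bar \<mu> \<nu> \<beta>) x)"
  have "h_inner A F 2 2 (d_H A F (dbar_H A F (omega_H A F))) (hwedge (omega_H A F) (omega_H A F)) c x
    = 1 / 4 * (\<Sum>\<mu>\<in>UNIV. \<Sum>\<alpha>\<in>UNIV. \<Sum>\<nu>\<in>UNIV. \<Sum>\<beta>\<in>UNIV. \<Sum>\<kappa>1\<in>UNIV. \<Sum>\<kappa>2\<in>UNIV. \<Sum>l1\<in>UNIV. \<Sum>l2\<in>UNIV.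
        ?X \<mu> \<alpha> \<nu> \<beta> * ((?N \<kappa>1 \<mu> * ?N \<kappa>2 \<alpha>) * (?N \<nu> l1 * ?N \<beta> l2) * cnj (2 * (?M \<kappa>1 l1 * ?M \<kappa>2 l2 - ?M \<kappa>1 l2 * ?M \<kappa>2 l1))))"
  proof -
    have P2: "(\<Prod>k<2. f k) = f 0 * f (1::nat)" for f :: "nat \<Rightarrow> complex"
      by (simp add: numeral_2_eq_2 lessThan_Suc mult.commute)
    have nth: "[a, b] ! 0 = a" "[a, b] ! 1 = b" for a b :: 'n by simp_all
    show ?thesis
      unfolding h_inner_def sum_lists_2 ddbar_omega[OF c x] omega_square P2 nth
      by (simp only: fact_2 mult.assoc) simp
  qed
  also have "\<dots> = 1 / 4 * (\<Sum>\<mu>\<in>UNIV. \<Sum>\<alpha>\<in>UNIV. \<Sum>\<nu>\<in>UNIV. \<Sum>\<beta>\<in>UNIV. ?X \<mu> \<alpha> \<nu> \<beta> * (2 * (?N \<nu> \<mu> * ?N \<beta> \<alpha> - ?N \<beta> \<mu> * ?N \<nu> \<alpha>)))"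
    by (simp only: sum_distrib_left[symmetric] g.double_trace[OF x])
  also have "\<dots> = 1 / 4 * (- 4 * \<i> * g.torsion_norm x)"
    by (simp only: g.trace_curvature[OF tr x])
  finally show ?thesis by simp
qed

text \<open>The form \<open>\<omega>\<^sub>H\<close> contracts the (1,1)-form \<open>\<partial>\<^sub>H\<phi>\<close> to its trace.\<close>

lemma h_inner_d_omega:
  assumes c: "c \<in> A" and x: "x \<in> tdom0 c"
  shows "h_inner A F 1 1 (d_H A F \<phi>) (omega_H A F) c x =
    - \<i> * (\<Sum>\<mu>\<in>UNIV. \<Sum>\<beta>\<in>UNIV. G_inv (Gloc A F c) x $ \<beta> $ \<mu> * del (Gloc A F c) \<mu> (\<lambda>y. \<phi> c y [] [\<beta>]) x)"
proof -
  interpret g: finsler_chart "tdom0 c" "Gloc A F c" by (rule finsler_chart[OF c])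
  have "h_inner A F 1 1 (d_H A F \<phi>) (omega_H A F) c x =
    (\<Sum>\<mu>\<in>UNIV. \<Sum>\<beta>\<in>UNIV. (- \<i> * del (Gloc A F c) \<mu> (\<lambda>y. \<phi> c y [] [\<beta>]) x) *
       (\<Sum>\<kappa>\<in>UNIV. \<Sum>l\<in>UNIV. g.N \<kappa> \<mu> x * g.N \<beta> l x * cnj (g.M \<kappa> l x)))"
    unfolding h_inner_def sum_lists_1
    by (simp add: d_H_def omit_def omega_H_eq sum_distrib_left mult_ac)
  also have "\<dots> = (\<Sum>\<mu>\<in>UNIV. \<Sum>\<beta>\<in>UNIV. (- \<i> * del (Gloc A F c) \<mu> (\<lambda>y. \<phi> c y [] [\<beta>]) x) * g.N \<beta> \<mu> x)"
    by (simp only: g.contract_M_N[OF x, of "\<lambda>\<kappa>. g.N \<kappa> _ x"])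
  finally show ?thesis by (simp add: sum_distrib_left mult_ac)
qed

text \<open>Multiplication by \<open>\<zeta>\<close> in the fibres maps the metric to a multiple of itself; the horizontal lift is unaffected.\<close>

lemma G_mat_scale:
  assumes c: "c \<in> A" and x: "(z, v) \<in> tdom0 c" and \<zeta>: "\<zeta> \<noteq> 0"
  shows "G_mat (Gloc A F c) (z, \<zeta> *s v) = G_mat (Gloc A F c) (z, v)"
    and "G_inv (Gloc A F c) (z, \<zeta> *s v) = G_inv (Gloc A F c) (z, v)"
    and "f differentiable (at (z, \<zeta> *s v)) \<Longrightarrow> (\<And>x. f (fst x, \<zeta> *s snd x) = h x) \<Longrightarrow>
      del (Gloc A F c) \<mu> f (z, \<zeta> *s v) = del (Gloc A F c) \<mu> h (z, v)"
proof -
  interpret g: finsler_chart "tdom0 c" "Gloc A F c" by (rule finsler_chart[OF c])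
  interpret b: finsler_bundle_map "tdom0 c" "Gloc A F c" "tdom0 c" "Gloc A F c" "tdom0 c" "\<lambda>z. z" "\<lambda>z. mat 1" "\<lambda>z. mat \<zeta>" "\<lambda>z \<sigma> \<tau> \<mu>. 0" "inverse ((cmod \<zeta>)\<^sup>2)"
    by (rule g.scaling_bundle_map[OF \<zeta>])
  have mv: "mat \<zeta> *v v = \<zeta> *s v" for v :: "complex^'n"
    by (simp add: vec_eq_iff matrix_vector_mult_def mat_def if_distrib[of "\<lambda>x. x * _"] cong: if_cong)
  have \<Phi>: "b.\<Phi> x = (fst x, \<zeta> *s snd x)" for x by (simp add: b.\<Phi>_def mv)
  have mat: "mat \<zeta> $ i $ j = of_bool (i = j) * \<zeta>" for i j :: 'n by (simp add: mat_def)
  show M: "G_mat (Gloc A F c) (z, \<zeta> *s v) = G_mat (Gloc A F c) (z, v)"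
  proof -
    have "g.M \<alpha> \<beta> (z, v) = g.M \<alpha> \<beta> (z, \<zeta> *s v)" for \<alpha> \<beta>
    proof -
      have s: "(\<Sum>\<tau>\<in>UNIV. \<Sum>\<sigma>\<in>UNIV. cnj (of_bool (\<tau> = \<beta>) * \<zeta>) * (of_bool (\<sigma> = \<alpha>) * \<zeta>) * f \<sigma> \<tau>) = \<zeta> * cnj \<zeta> * f \<alpha> \<beta>" for f :: "'n \<Rightarrow> 'n \<Rightarrow> complex"
      proof -
        have "(\<Sum>\<tau>\<in>UNIV. \<Sum>\<sigma>\<in>UNIV. cnj (of_bool (\<tau> = \<beta>) * \<zeta>) * (of_bool (\<sigma> = \<alpha>) * \<zeta>) * f \<sigma> \<tau>)
          = (\<Sum>\<tau>\<in>UNIV. of_bool (\<tau> = \<beta>) * (\<Sum>\<sigma>\<in>UNIV. of_bool (\<sigma> = \<alpha>) * (\<zeta> * cnj \<zeta> * f \<sigma> \<tau>)))"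
          unfolding sum_distrib_left by (intro sum.cong refl) simp
        then show ?thesis by simp
      qed
      have "complex_of_real (inverse ((cmod \<zeta>)\<^sup>2)) * (\<zeta> * cnj \<zeta>) = 1"
        unfolding complex_norm_square[symmetric] of_real_mult[symmetric] using \<zeta> by simp
      moreover have "g.M \<alpha> \<beta> (z, v) = complex_of_real (inverse ((cmod \<zeta>)\<^sup>2)) * (\<zeta> * cnj \<zeta>) * g.M \<alpha> \<beta> (z, \<zeta> *s v)"
        unfolding b.M_\<Phi>[OF x] \<Phi> mat s by (simp only: mult.assoc fst_conv snd_conv)
      ultimately show ?thesis by (simp only: mult_1_left)
    qed
    then show ?thesis by (simp add: vec_eq_iff)
  qed
  then show "G_inv (Gloc A F c) (z, \<zeta> *s v) = G_inv (Gloc A F c) (z, v)" by (simp add: G_inv_def)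
  show "del (Gloc A F c) \<mu> f (z, \<zeta> *s v) = del (Gloc A F c) \<mu> h (z, v)"
    if f: "f differentiable (at (z, \<zeta> *s v))" and h: "\<And>x. f (fst x, \<zeta> *s snd x) = h x"
  proof -
    have fh: "(\<lambda>x. f (b.\<Phi> x)) = h" using h by (simp only: \<Phi> fun_eq_iff simp_thms)
    have p: "b.\<Phi> (z, v) = (z, \<zeta> *s v)" by (simp only: \<Phi> fst_conv snd_conv)
    have m1: "mat 1 $ \<nu> $ \<mu> = of_bool (\<nu> = \<mu>)" for \<nu> :: 'n by (simp add: mat_def)
    have "del (Gloc A F c) \<mu> h (z, v) = (\<Sum>\<nu>\<in>UNIV. of_bool (\<nu> = \<mu>) * del (Gloc A F c) \<nu> f (z, \<zeta> *s v))"
      using b.del_\<Phi>[OF x, of f \<mu>] f unfolding fh p m1 by blast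
    then show ?thesis by simp
  qed
qed

lemma omega_H_hforms: "omega_H A F \<in> hforms A 1 1"
  unfolding hforms_def mem_Collect_eq
proof (intro conjI ballI allI impI)
  fix c x assume "c \<in> A" "x \<in> tdom0 c"
  have "permute_list \<sigma> I = I" if "\<sigma> permutes {..<1}" for \<sigma> and I :: "'n list"
  proof -
    have "\<sigma> = id" using that by (simp add: lessThan_Suc)
    then show ?thesis by simp
  qed
  moreover have "sign \<sigma> = 1" if "\<sigma> permutes {..<1::nat}" for \<sigma>
  proof -
    have "\<sigma> = id" using that by (simp add: lessThan_Suc)
    then show ?thesis by simp
  qed
  ultimately show "skew_pq 1 1 (omega_H A F c x)" unfolding skew_pq_def by (auto simp: omega_H_eq)
next
  fix c and I J :: "'n list" assume c: "c \<in> A"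
  interpret g: finsler_chart "tdom0 c" "Gloc A F c" by (rule finsler_chart[OF c])
  show "smooth_on (tdom0 c) (\<lambda>x. omega_H A F c x I J)"
  proof (cases "length I = 1 \<and> length J = 1")
    case True
    then show ?thesis unfolding omega_H_eq
      by (simp del: One_nat_def) (intro smooth_on_mult smooth_on_const g.smooth_M g.open_S)
  next
    case False
    then show ?thesis unfolding omega_H_eq by (simp only: if_False smooth_on_const)
  qed
next
  fix c x assume c: "c \<in> A" and x: "x \<in> tdom0 c"
  show "case x of (z, v) \<Rightarrow> \<forall>\<zeta>. \<zeta> \<noteq> 0 \<longrightarrow> omega_H A F c (z, \<zeta> *s v) = omega_H A F c (z, v)"
    using G_mat_scale(1)[OF c] x by (auto simp: omega_H_def split: prod.splits)
next
  fix c d u and I J :: "'n list"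
  assume c: "c \<in> A" and d: "d \<in> A" and u: "u \<in> TM0 A" "fst u \<in> cdom c \<inter> cdom d" and len: "length I = 1 \<and> length J = 1"
  interpret b: finsler_bundle_map "tdom0 c" "Gloc A F c" "tdom0 d" "Gloc A F d" "tdom_overlap c d" "transition c d" "jac c d" "jac c d"
    "\<lambda>z \<sigma> \<tau> \<mu>. frechet_derivative (\<lambda>z. jac c d z $ \<sigma> $ \<tau>) (at z) (axis \<mu> 1)" 1
    by (rule change_bundle_map[OF c d])
  have uT: "u \<in> TM A" using u by (simp add: TM0_def)
  have p: "tcoord c u \<in> tdom_overlap c d" using tcoord_in_tdom_overlap[OF u(1) c] u(2) by simp
  have \<Phi>: "b.\<Phi> (tcoord c u) = tcoord d u"
    using tcoord_change[OF uT c d] u(2) by (simp add: b.\<Phi>_def change_def)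
  obtain i j where ij: "I = [i]" "J = [j]" using len by (auto simp: length_Suc_conv)
  have fst_t: "fst (tcoord c u) = cmap c (fst u)" by (simp add: tcoord_def)
  have "omega_H A F c (tcoord c u) I J = \<i> * (\<Sum>\<tau>\<in>UNIV. \<Sum>\<sigma>\<in>UNIV. cnj (jac c d (cmap c (fst u)) $ \<tau> $ j) * jac c d (cmap c (fst u)) $ \<sigma> $ i * b.tgt.M \<sigma> \<tau> (tcoord d u))"
    using b.M_\<Phi>[OF p, of i j] by (simp add: omega_H_eq ij \<Phi> fst_t)
  also have "\<dots> = (\<Sum>\<tau>\<in>UNIV. \<Sum>\<sigma>\<in>UNIV. jac c d (cmap c (fst u)) $ \<sigma> $ i * cnj (jac c d (cmap c (fst u)) $ \<tau> $ j) * (\<i> * b.tgt.M \<sigma> \<tau> (tcoord d u)))"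
    by (simp add: sum_distrib_left mult_ac)
  also have "\<dots> = (\<Sum>\<sigma>\<in>UNIV. \<Sum>\<tau>\<in>UNIV. jac c d (cmap c (fst u)) $ \<sigma> $ i * cnj (jac c d (cmap c (fst u)) $ \<tau> $ j) * (\<i> * b.tgt.M \<sigma> \<tau> (tcoord d u)))"
    by (rule sum.swap)
  finally show "omega_H A F c (tcoord c u) I J = (\<Sum>K | length K = 1. \<Sum>L | length L = 1.
      (\<Prod>k<1. jac c d (cmap c (fst u)) $ (K ! k) $ (I ! k)) * (\<Prod>k<1. cnj (jac c d (cmap c (fst u)) $ (L ! k) $ (J ! k))) * omega_H A F d (tcoord d u) K L)"
    unfolding sum_lists_1 by (simp add: omega_H_eq ij)
qed

end


section \<open>Test forms\<close>

lemma smooth_on_vec: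
  fixes f :: "'n::finite \<Rightarrow> 'a::real_normed_vector \<Rightarrow> complex"
  assumes "open S" "\<And>i. smooth_on S (f i)"
  shows "smooth_on S (\<lambda>x. \<chi> i. f i x)"
proof -
  have "smooth_on S (\<lambda>x. \<Sum>i\<in>UNIV. f i x *s (axis i 1 :: complex^'n))"
    by (intro smooth_on_sum smooth_on_bounded_linear_comp[OF bounded_linear_smult_left] assms)
  moreover have "(\<lambda>x. \<Sum>i\<in>UNIV. f i x *s (axis i 1 :: complex^'n)) = (\<lambda>x. \<chi> i. f i x)"
    by (simp add: fun_eq_iff vec_eq_iff axis_def if_distrib cong: if_cong)
  ultimately show ?thesis by simp
qed

lemma smooth_on_Pair:
  assumes "open S" "smooth_on S f" "smooth_on S g" shows "smooth_on S (\<lambda>x. (f x, g x))"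
proof -
  have "smooth_on S (\<lambda>x. (f x, 0) + (0, g x))"
    by (intro smooth_on_add assms
        smooth_on_bounded_linear_comp[OF bounded_linear_Pair[OF bounded_linear_ident bounded_linear_zero]]
        smooth_on_bounded_linear_comp[OF bounded_linear_Pair[OF bounded_linear_zero bounded_linear_ident]])
  then show ?thesis by simp
qed

lemma smooth_on_fst_comp:
  fixes f :: "complex^'n::finite \<Rightarrow> complex"
  assumes "open S" "open T" "complex_differentiable_on T f" "fst ` S \<subseteq> T"
  shows "smooth_on S (\<lambda>p::'n cpair. f (fst p))"
  by (rule smooth_on_compose[OF assms(1,2) smooth_on_bounded_linear[OF bounded_linear_fst assms(1)]
      complex_differentiable_smooth[OF assms(2,3)] assms(4)])

text \<open>For a small ball around a point of the slice \<open>v\<^sup>a = 1\<close> in a chart \<open>c\<close>, the horizontal form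
  \<open>\<chi> d\<zbar>\<^sup>\<beta>\<close> extends by zero to the whole projectivized bundle, where \<open>\<chi>\<close> is a bump function.
  The adjoint of \<open>\<partial>\<^sub>\<H>\<close> is tested against these forms.\<close>

locale test_form = finsler_manifold A F
  for A :: "('m::{t2_space, second_countable_topology}, 'n::finite) chart set" and F +
  fixes c :: "('m, 'n) chart" and \<beta> a :: 'n and z0 w0 :: "complex^'n" and r :: real
  assumes c: "c \<in> A" and r: "0 < r" and ball_subset: "cball z0 r \<subseteq> cmap c ` cdom c"
begin

abbreviation cutoff :: "'n cpair \<Rightarrow> complex" where "cutoff \<equiv> bump a z0 w0 r"

definition coef :: "('m, 'n) chart \<Rightarrow> 'n \<Rightarrow> 'n cpair \<Rightarrow> complex" where
  "coef d j x = (if fst x \<in> overlap d c then cutoff (change d c x) * cnj (jac d c (fst x) $ \<beta> $ j) else 0)"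

definition form :: "('m, 'n) hform" where
  "form d x I J = (if I = [] \<and> length J = 1 then coef d (J ! 0) x else 0)"

definition outside :: "('m, 'n) chart \<Rightarrow> 'n cpair set" where
  "outside d = {z \<in> cmap d ` cdom d. cinv d z \<notin> cinv c ` cball z0 r} \<times> (UNIV - {0})"

lemma support_subset: "cinv c ` cball z0 r \<subseteq> cdom c"
  using ball_subset cinv_in[OF c] by blast

lemma open_outside:
  assumes d: "d \<in> A" shows "open (outside d)"
proof -
  have "compact (cinv c ` cball z0 r)"
    by (rule compact_continuous_image[OF continuous_on_subset[OF homeomorphism_cont2[OF chart_homeomorphism[OF c]] ball_subset] compact_cball])
  then have "open (- (cinv c ` cball z0 r))" by (intro open_Compl compact_imp_closed)
  then have "open (cmap d ` cdom d \<inter> cinv d -` (- (cinv c ` cball z0 r)))"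
    by (rule continuous_open_preimage[OF homeomorphism_cont2[OF chart_homeomorphism[OF d]] chart_open(2)[OF d]])
  moreover have "cmap d ` cdom d \<inter> cinv d -` (- (cinv c ` cball z0 r)) = {z \<in> cmap d ` cdom d. cinv d z \<notin> cinv c ` cball z0 r}"
    by blast
  ultimately show ?thesis unfolding outside_def by (intro open_Times) auto
qed

lemma coef_outside:
  assumes d: "d \<in> A" and x: "x \<in> outside d" shows "coef d j x = 0"
proof (rule ccontr)
  assume "coef d j x \<noteq> 0"
  then have o: "fst x \<in> overlap d c" and "cutoff (change d c x) \<noteq> 0" by (auto simp: coef_def split: if_splits)
  then have "norm (transition d c (fst x) - z0) < r" using bump_support(2)[of a z0 w0 r "change d c x"] r by (simp add: change_def)
  then have z: "transition d c (fst x) \<in> cball z0 r" by (simp add: dist_norm norm_minus_commute)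
  obtain m where m: "fst x = cmap d m" "m \<in> cdom d" "m \<in> cdom c" using o by (auto simp: overlap_def)
  have "cinv d (fst x) = cinv c (transition d c (fst x))"
    using m by (simp add: transition_cmap[OF d] cinv_cmap[OF d] cinv_cmap[OF c])
  then have "cinv d (fst x) \<in> cinv c ` cball z0 r" using z by blast
  then show False using x by (auto simp: outside_def)
qed

text \<open>The two open sets on which the coefficients of the test form are respectively given by the smooth formula and
  zero cover the chart, the support of the bump function being compact inside \<open>c\<close>.\<close>

lemma tdom0_cases:
  assumes d: "d \<in> A" and x: "x \<in> tdom0 d"
  obtains "x \<in> tdom_overlap d c" | "x \<in> outside d"
proof (cases "cinv d (fst x) \<in> cinv c ` cball z0 r")
  case True
  then have "fst x \<in> overlap d c"
    using x support_subset by (auto simp: overlap_eq[OF d] tdom0_def)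
  then show thesis using that(1) x by (simp add: tdom_overlap_def tdom0_def mem_Times_iff)
next
  case False
  then show thesis using that(2) x by (simp add: outside_def tdom0_def mem_Times_iff)
qed

lemma not_overlap_outside:
  assumes d: "d \<in> A" and x: "x \<in> tdom0 d" "fst x \<notin> overlap d c" shows "x \<in> outside d"
  by (rule tdom0_cases[OF d x(1)]) (use x(2) in \<open>auto simp: tdom_overlap_def\<close>)

lemma open_tdom_overlap: "d \<in> A \<Longrightarrow> open (tdom_overlap d c)"
  unfolding tdom_overlap_def by (intro open_Times open_overlap c) auto

lemma smooth_change:
  assumes d: "d \<in> A" shows "smooth_on (tdom_overlap d c) (change d c)"
proof -
  have S: "open (tdom_overlap d c)" by (rule open_tdom_overlap[OF d])
  have sub: "fst ` tdom_overlap d c \<subseteq> overlap d c" by (auto simp: tdom_overlap_def)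
  have 1: "smooth_on (tdom_overlap d c) (\<lambda>x. transition d c (fst x) $ i)" for i
    by (rule smooth_on_fst_comp[OF S open_overlap[OF d c] holo_map_on_component[OF holo_transition[OF d c]] sub])
  have 2: "smooth_on (tdom_overlap d c) (\<lambda>x. jac d c (fst x) $ i $ j)" for i j
    by (rule smooth_on_fst_comp[OF S open_overlap[OF d c] jac_complex_differentiable[OF d c] sub])
  have "smooth_on (tdom_overlap d c) (\<lambda>x. (\<chi> i. transition d c (fst x) $ i, \<chi> i. \<Sum>j\<in>UNIV. jac d c (fst x) $ i $ j * snd x $ j))"
    by (intro smooth_on_Pair smooth_on_vec smooth_on_sum smooth_on_mult smooth_on_v_coordinate S 1 2)
  then show ?thesis by (simp add: change_def[abs_def] matrix_vector_mult_def)
qed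

lemma change_in:
  assumes d: "d \<in> A" and x: "x \<in> tdom_overlap d c" shows "change d c x \<in> tdom0 c"
proof -
  obtain u where u: "u \<in> TM0 A" "fst u \<in> cdom d" "fst u \<in> cdom c" "tcoord d u = x" "tcoord c u = change d c x"
    by (rule tdom_overlap_point[OF d c x])
  have "u \<in> TM A" using u(1) by (simp add: TM0_def)
  then show ?thesis using TM0_iff[of u c] c u by simp
qed

lemma smooth_coef:
  assumes d: "d \<in> A" shows "smooth_on (tdom0 d) (coef d j)"
proof (rule smooth_on_locally[OF open_tdom0[OF d]])
  fix x assume x: "x \<in> tdom0 d"
  have S: "open (tdom_overlap d c)" by (rule open_tdom_overlap[OF d])
  have "smooth_on (tdom_overlap d c) (coef d j)"
  proof (rule smooth_on_cong[OF S])
    have "smooth_on (tdom_overlap d c) (\<lambda>x. jac d c (fst x) $ \<beta> $ j)"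
      by (rule smooth_on_fst_comp[OF S open_overlap[OF d c] jac_complex_differentiable[OF d c]]) (auto simp: tdom_overlap_def)
    moreover have "smooth_on (tdom_overlap d c) (\<lambda>x. cutoff (change d c x))"
    proof (rule smooth_on_compose[OF S _ smooth_change[OF d] smooth_on_bump])
      show "change d c ` tdom_overlap d c \<subseteq> UNIV \<times> (UNIV - {0})"
        by (rule image_subsetI) (use change_in[OF d] in \<open>simp add: tdom0_def mem_Times_iff\<close>)
    qed (auto intro!: open_Times)
    ultimately show "smooth_on (tdom_overlap d c) (\<lambda>x. cutoff (change d c x) * cnj (jac d c (fst x) $ \<beta> $ j))"
      by (intro smooth_on_mult smooth_on_cnj S)
  qed (auto simp: coef_def tdom_overlap_def)
  moreover have "smooth_on (outside d) (coef d j)"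
    by (rule smooth_on_cong[OF open_outside[OF d], of "\<lambda>x. 0"]) (simp_all add: coef_outside[OF d])
  ultimately show "\<exists>T. open T \<and> x \<in> T \<and> smooth_on T (coef d j)"
    using tdom0_cases[OF d x] S open_outside[OF d] by metis
qed

lemma coef_homogeneous: "\<zeta> \<noteq> 0 \<Longrightarrow> coef d j (fst x, \<zeta> *s snd x) = coef d j x"
proof -
  assume \<zeta>: "\<zeta> \<noteq> 0"
  have "change d c (fst x, \<zeta> *s snd x) = (fst (change d c x), \<zeta> *s snd (change d c x))"
    by (simp add: change_def vec_eq_iff matrix_vector_mult_def sum_distrib_left mult_ac)
  then show ?thesis using bump_homogeneous[OF \<zeta>, of a z0 w0 r "fst (change d c x)" "snd (change d c x)"]
    by (simp add: coef_def)
qed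

lemma fst_tcoord_overlap:
  assumes d: "d \<in> A" and u: "fst u \<in> cdom d"
  shows "fst (tcoord d u) \<in> overlap d c \<longleftrightarrow> fst u \<in> cdom c"
  using u by (auto simp: overlap_eq[OF d] tcoord_def cinv_cmap[OF d])

lemma form_hforms: "form \<in> hforms A 0 1"
  unfolding hforms_def mem_Collect_eq
proof (intro conjI ballI allI impI)
  fix d x assume "d \<in> A" "x \<in> tdom0 d"
  have id: "\<sigma> = id" if "\<sigma> permutes {..<1::nat}" for \<sigma> using that by (simp add: lessThan_Suc)
  have id0: "\<sigma> = id" if "\<sigma> permutes {..<0::nat}" for \<sigma> using that by simp
  show "skew_pq 0 1 (form d x)"
    unfolding skew_pq_def
  proof (intro conjI allI impI)
    fix I J :: "'n list" and \<sigma> \<tau> :: "nat \<Rightarrow> nat"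
    assume "length I = 0 \<and> length J = 1 \<and> \<sigma> permutes {..<0} \<and> \<tau> permutes {..<1}"
    then have "\<sigma> = id" "\<tau> = id" using id[of \<tau>] id0[of \<sigma>] by blast+
    then show "form d x (permute_list \<sigma> I) (permute_list \<tau> J) = of_int (sign \<sigma>) * of_int (sign \<tau>) * form d x I J"
      by simp
  qed (auto simp: form_def)
next
  fix d and I J :: "'n list" assume d: "d \<in> A"
  show "smooth_on (tdom0 d) (\<lambda>x. form d x I J)"
  proof (cases "I = [] \<and> length J = 1")
    case True
    then show ?thesis by (simp add: form_def smooth_coef[OF d] del: One_nat_def)
  next
    case False
    then show ?thesis by (simp only: form_def if_False smooth_on_const)
  qed
next
  fix d x assume "d \<in> A" "x \<in> tdom0 d"
  show "case x of (z, v) \<Rightarrow> \<forall>\<zeta>. \<zeta> \<noteq> 0 \<longrightarrow> form d (z, \<zeta> *s v) = form d (z, v)"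
    using coef_homogeneous[of _ d _ x] by (cases x) (simp add: form_def fun_eq_iff)
next
  fix d e u and I J :: "'n list"
  assume d: "d \<in> A" and e: "e \<in> A" and u: "u \<in> TM0 A" "fst u \<in> cdom d \<inter> cdom e" and len: "length I = 0 \<and> length J = 1"
  obtain j where ij: "I = []" "J = [j]" using len by (auto simp: length_Suc_conv)
  have uT: "u \<in> TM A" using u by (simp add: TM0_def)
  have "coef d j (tcoord d u) = (\<Sum>l\<in>UNIV. cnj (jac d e (cmap d (fst u)) $ l $ j) * coef e l (tcoord e u))"
  proof (cases "fst u \<in> cdom c")
    case True
    have "change d c (tcoord d u) = tcoord c u" "change e c (tcoord e u) = tcoord c u"
      using tcoord_change[OF uT d c _ True] tcoord_change[OF uT e c _ True] u(2) by simp_all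
    moreover have "jac d c (cmap d (fst u)) = jac e c (cmap e (fst u)) ** jac d e (cmap d (fst u))"
      using jac_cocycle[OF d e c] u(2) True by auto
    ultimately show ?thesis
      using fst_tcoord_overlap[OF d, of u] fst_tcoord_overlap[OF e, of u] u(2) True
      by (simp add: coef_def tcoord_def matrix_matrix_mult_def sum_distrib_left mult_ac)
  next
    case False
    then show ?thesis
      using fst_tcoord_overlap[OF d, of u] fst_tcoord_overlap[OF e, of u] u(2) by (simp add: coef_def)
  qed
  then show "form d (tcoord d u) I J = (\<Sum>K | length K = 0. \<Sum>L | length L = 1.
      (\<Prod>k<0. jac d e (cmap d (fst u)) $ (K ! k) $ (I ! k)) * (\<Prod>k<1. cnj (jac d e (cmap d (fst u)) $ (L ! k) $ (J ! k))) * form e (tcoord e u) K L)"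
    unfolding sum_lists_1 sum_lists_0 by (simp add: form_def ij)
qed

text \<open>The integrand of the \<open>L\<^sup>2\<close> product of \<open>\<partial>\<^sub>H\<close> of the test form with \<open>\<omega>\<^sub>H\<close>, and its expression in the
  chart \<open>c\<close>. In the other charts the conjugate Jacobian is not differentiated, being antiholomorphic, and is
  absorbed by the transformation law of the inverse metric.\<close>

definition pairing :: "('m, 'n) chart \<Rightarrow> 'n cpair \<Rightarrow> complex" where
  "pairing = h_inner A F 1 1 (d_H A F form) (omega_H A F)"

definition div_cutoff :: "'n cpair \<Rightarrow> complex" where
  "div_cutoff x = - \<i> * (\<Sum>\<nu>\<in>UNIV. G_inv (Gloc A F c) x $ \<beta> $ \<nu> * del (Gloc A F c) \<nu> cutoff x)"

lemma pairing_eq: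
  assumes d: "d \<in> A" and x: "x \<in> tdom0 d"
  shows "pairing d x = - \<i> * (\<Sum>\<mu>\<in>UNIV. \<Sum>j\<in>UNIV. G_inv (Gloc A F d) x $ j $ \<mu> * del (Gloc A F d) \<mu> (coef d j) x)"
  unfolding pairing_def h_inner_d_omega[OF d x] by (simp add: form_def)

lemma pairing_outside:
  assumes d: "d \<in> A" and x: "x \<in> tdom0 d" "x \<in> outside d" shows "pairing d x = 0"
proof -
  interpret d: finsler_chart "tdom0 d" "Gloc A F d" by (rule finsler_chart[OF d])
  have "del (Gloc A F d) \<mu> (coef d j) x = del (Gloc A F d) \<mu> (\<lambda>x. 0) x" for \<mu> j
    by (rule derivation_cong[OF d.derivation_del open_outside[OF d] x(2) d.diffble[OF smooth_coef[OF d] x(1)] coef_outside[OF d]])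
  then have "del (Gloc A F d) \<mu> (coef d j) x = 0" for \<mu> j by (simp add: derivation_const[OF d.derivation_del])
  then show ?thesis unfolding pairing_eq[OF d x(1)] by simp
qed

lemma cutoff_differentiable: "x \<in> tdom0 d \<Longrightarrow> cutoff differentiable (at x)"
  by (rule smooth_on_differentiable[OF _ smooth_on_bump]) (auto simp: tdom0_def intro!: open_Times)

lemma pairing_overlap:
  assumes d: "d \<in> A" and x: "x \<in> tdom_overlap d c" shows "pairing d x = div_cutoff (change d c x)"
proof -
  interpret b: finsler_bundle_map "tdom0 d" "Gloc A F d" "tdom0 c" "Gloc A F c" "tdom_overlap d c" "transition d c" "jac d c" "jac d c"
    "\<lambda>z \<sigma> \<tau> \<mu>. frechet_derivative (\<lambda>z. jac d c z $ \<sigma> $ \<tau>) (at z) (axis \<mu> 1)" 1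
    by (rule change_bundle_map[OF d c])
  have x0: "x \<in> tdom0 d" by (rule b.in_S[OF x])
  have \<Phi>: "b.\<Phi> = change d c" by (simp add: b.\<Phi>_def[abs_def] change_def[abs_def])
  have y: "change d c x \<in> tdom0 c" by (rule change_in[OF d x])
  have dc: "cutoff differentiable (at (b.\<Phi> x))" unfolding \<Phi> by (rule cutoff_differentiable[OF y])
  define B where "B = jac d c (fst x)"
  have "del (Gloc A F d) \<mu> (coef d j) x = (\<Sum>\<nu>\<in>UNIV. B $ \<nu> $ \<mu> * del (Gloc A F c) \<nu> cutoff (change d c x)) * cnj (B $ \<beta> $ j)" for \<mu> j
  proof -
    have cB: "(\<lambda>x. cnj (jac d c (fst x) $ \<beta> $ j)) differentiable (at x)"
    proof -
      have "(\<lambda>x. jac d c (fst x) $ \<beta> $ j) differentiable (at x)" using b.B_fst_derivative[OF x] differentiable_def by blast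
      then show ?thesis unfolding differentiable_def using has_derivative_cnj by blast
    qed
    have "del (Gloc A F d) \<mu> (coef d j) x = del (Gloc A F d) \<mu> (\<lambda>x. cutoff (b.\<Phi> x) * cnj (jac d c (fst x) $ \<beta> $ j)) x"
      by (rule derivation_cong[OF b.src.derivation_del b.open_W x b.src.diffble[OF smooth_coef[OF d] x0]])
        (simp add: coef_def tdom_overlap_def \<Phi> mem_Times_iff)
    also have "\<dots> = del (Gloc A F d) \<mu> (\<lambda>x. cutoff (b.\<Phi> x)) x * cnj (B $ \<beta> $ j)
       + cutoff (b.\<Phi> x) * del (Gloc A F d) \<mu> (\<lambda>x. cnj (jac d c (fst x) $ \<beta> $ j)) x"
      unfolding B_def by (rule derivation_mult[OF b.src.derivation_del b.differentiable_comp_\<Phi>[OF x dc] cB])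
    also have "del (Gloc A F d) \<mu> (\<lambda>x. cnj (jac d c (fst x) $ \<beta> $ j)) x = 0"
      by (simp add: del_def b.D_B[OF x])
    finally show ?thesis unfolding b.del_\<Phi>[OF x dc] by (simp add: \<Phi> B_def)
  qed
  then have "pairing d x = - \<i> * (\<Sum>\<mu>\<in>UNIV. \<Sum>j\<in>UNIV. \<Sum>\<nu>\<in>UNIV. cnj (B $ \<beta> $ j) * B $ \<nu> $ \<mu> * G_inv (Gloc A F d) x $ j $ \<mu> * del (Gloc A F c) \<nu> cutoff (change d c x))"
    unfolding pairing_eq[OF d x0] by (simp add: sum_distrib_left sum_distrib_right mult_ac)
  also have "(\<Sum>\<mu>\<in>UNIV. \<Sum>j\<in>UNIV. \<Sum>\<nu>\<in>UNIV. cnj (B $ \<beta> $ j) * B $ \<nu> $ \<mu> * G_inv (Gloc A F d) x $ j $ \<mu> * del (Gloc A F c) \<nu> cutoff (change d c x))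
    = (\<Sum>\<mu>\<in>UNIV. \<Sum>\<nu>\<in>UNIV. \<Sum>j\<in>UNIV. cnj (B $ \<beta> $ j) * B $ \<nu> $ \<mu> * G_inv (Gloc A F d) x $ j $ \<mu> * del (Gloc A F c) \<nu> cutoff (change d c x))"
    by (intro sum.cong refl sum.swap)
  also have "\<dots> = (\<Sum>\<nu>\<in>UNIV. \<Sum>\<mu>\<in>UNIV. \<Sum>j\<in>UNIV. cnj (B $ \<beta> $ j) * B $ \<nu> $ \<mu> * G_inv (Gloc A F d) x $ j $ \<mu> * del (Gloc A F c) \<nu> cutoff (change d c x))"
    by (rule sum.swap)
  also have "\<dots> = (\<Sum>\<nu>\<in>UNIV. G_inv (Gloc A F c) (change d c x) $ \<beta> $ \<nu> * del (Gloc A F c) \<nu> cutoff (change d c x))"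
  proof (intro sum.cong refl)
    fix \<nu>
    have "(\<Sum>j\<in>UNIV. \<Sum>\<mu>\<in>UNIV. cnj (B $ \<beta> $ j) * B $ \<nu> $ \<mu> * G_inv (Gloc A F d) x $ j $ \<mu>) = G_inv (Gloc A F c) (change d c x) $ \<beta> $ \<nu>"
      using b.N_\<Phi>[OF x, of \<beta> \<nu>] by (simp add: \<Phi> B_def)
    moreover have "(\<Sum>\<mu>\<in>UNIV. \<Sum>j\<in>UNIV. cnj (B $ \<beta> $ j) * B $ \<nu> $ \<mu> * G_inv (Gloc A F d) x $ j $ \<mu>) = (\<Sum>j\<in>UNIV. \<Sum>\<mu>\<in>UNIV. cnj (B $ \<beta> $ j) * B $ \<nu> $ \<mu> * G_inv (Gloc A F d) x $ j $ \<mu>)"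
      by (rule sum.swap)
    ultimately show "(\<Sum>\<mu>\<in>UNIV. \<Sum>j\<in>UNIV. cnj (B $ \<beta> $ j) * B $ \<nu> $ \<mu> * G_inv (Gloc A F d) x $ j $ \<mu> * del (Gloc A F c) \<nu> cutoff (change d c x))
      = G_inv (Gloc A F c) (change d c x) $ \<beta> $ \<nu> * del (Gloc A F c) \<nu> cutoff (change d c x)"
      by (simp only: sum_distrib_right[symmetric])
  qed
  finally show ?thesis by (simp only: div_cutoff_def)
qed

lemma pairing_tcoord:
  assumes d: "d \<in> A" and u: "u \<in> TM0 A" "fst u \<in> cdom d"
  shows "pairing d (tcoord d u) = (if fst u \<in> cdom c then div_cutoff (tcoord c u) else 0)"
proof -
  have uT: "u \<in> TM A" using u by (simp add: TM0_def)
  have x: "tcoord d u \<in> tdom0 d" using TM0_iff[OF uT d u(2)] u(1) by simp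
  show ?thesis
  proof (cases "fst u \<in> cdom c")
    case True
    then show ?thesis
      using pairing_overlap[OF d tcoord_in_tdom_overlap[OF u(1) d u(2) True]] tcoord_change[OF uT d c u(2) True] by simp
  next
    case False
    then have "fst (tcoord d u) \<notin> overlap d c" using fst_tcoord_overlap[OF d u(2)] by simp
    then show ?thesis using pairing_outside[OF d x not_overlap_outside[OF d x]] False by simp
  qed
qed

lemma pairing_chart:
  assumes x: "x \<in> tdom0 c" shows "pairing c x = div_cutoff x"
proof -
  note t = tpoint[OF c tdom0_tdom[OF x]]
  show ?thesis using pairing_tcoord[OF c tpoint_TM0[OF c x] t(2)] t by simp
qed

lemma pairing_invariant: "invariant_fun pairing"
  unfolding invariant_fun_def
proof (intro conjI ballI)
  fix d x assume d: "d \<in> A" and x: "x \<in> tdom0 d"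
  interpret d: finsler_chart "tdom0 d" "Gloc A F d" by (rule finsler_chart[OF d])
  obtain z v where zv: "x = (z, v)" by force
  have "pairing d (z, \<zeta> *s v) = pairing d (z, v)" if \<zeta>: "\<zeta> \<noteq> 0" for \<zeta>
  proof -
    have p: "(z, v) \<in> tdom0 d" "(z, \<zeta> *s v) \<in> tdom0 d" using x zv d.cone[OF _ \<zeta>] by auto
    have "del (Gloc A F d) \<mu> (coef d j) (z, \<zeta> *s v) = del (Gloc A F d) \<mu> (coef d j) (z, v)" for \<mu> j
      by (rule G_mat_scale(3)[OF d p(1) \<zeta> d.diffble[OF smooth_coef[OF d] p(2)] coef_homogeneous[OF \<zeta>]])
    then show ?thesis unfolding pairing_eq[OF d p(1)] pairing_eq[OF d p(2)] G_mat_scale(2)[OF d p(1) \<zeta>] by simp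
  qed
  then show "case x of (z, v) \<Rightarrow> \<forall>\<zeta>. \<zeta> \<noteq> 0 \<longrightarrow> pairing d (z, \<zeta> *s v) = pairing d (z, v)" by (simp add: zv)
next
  fix d e p assume d: "d \<in> A" and e: "e \<in> A" and p: "p \<in> tdom_overlap d e"
  obtain u where u: "u \<in> TM0 A" "fst u \<in> cdom d" "fst u \<in> cdom e" "tcoord d u = p" "tcoord e u = change d e p"
    by (rule tdom_overlap_point[OF d e p])
  show "pairing e (change d e p) = pairing d p"
    using pairing_tcoord[OF d u(1,2)] pairing_tcoord[OF e u(1,3)] u(4,5) by simp
qed

lemma pairing_continuous:
  assumes d: "d \<in> A" shows "continuous_on (tdom0 d) (pairing d)"
proof -
  interpret d: finsler_chart "tdom0 d" "Gloc A F d" by (rule finsler_chart[OF d])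
  have "smooth_on (tdom0 d) (\<lambda>x. - \<i> * (\<Sum>\<mu>\<in>UNIV. \<Sum>j\<in>UNIV. d.N j \<mu> x * del (Gloc A F d) \<mu> (coef d j) x))"
    by (intro smooth_on_mult smooth_on_const smooth_on_sum d.smooth_N d.smooth_del smooth_coef[OF d] d.open_S)
  from smooth_on_continuous[OF this] show ?thesis
    by (rule continuous_on_eq) (simp add: pairing_eq[OF d])
qed

text \<open>At directions with \<open>v\<^sup>a = 0\<close> the argument of the bump function is \<open>-1\<close>, so the function vanishes nearby.\<close>

lemma pairing_support:
  assumes u: "u \<in> TM0 A" and out: "\<not> (fst u \<in> cdom c \<and> snd u c $ a \<noteq> 0)"
  shows "on_PTM A pairing (proj_rel A `` {u}) = 0"
proof -
  obtain d where d: "d \<in> A" "fst u \<in> cdom d" by (rule charts_cover)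
  have "div_cutoff (tcoord c u) = 0" if uc: "fst u \<in> cdom c"
  proof -
    interpret g: finsler_chart "tdom0 c" "Gloc A F c" by (rule finsler_chart[OF c])
    have x: "tcoord c u \<in> tdom0 c" using TM0_iff[of u c] u c uc by (simp add: TM0_def)
    define X where "X = UNIV \<times> (UNIV - {0}) \<inter> bump_arg a z0 w0 r -` {..<0}"
    have X: "open X" unfolding X_def
      by (rule continuous_open_preimage[OF smooth_on_continuous[OF smooth_on_bump_arg]]) (auto intro!: open_Times)
    have v: "snd (tcoord c u) $ a = 0" "snd (tcoord c u) \<noteq> 0" using out uc x by (auto simp: tcoord_def tdom0_def)
    then have "bump_arg a z0 w0 r (tcoord c u) = - 1" by (simp add: bump_arg_def)
    then have xX: "tcoord c u \<in> X" using v(2) by (simp add: X_def mem_Times_iff)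
    have "del (Gloc A F c) \<nu> cutoff (tcoord c u) = del (Gloc A F c) \<nu> (\<lambda>x. 0) (tcoord c u)" for \<nu>
      by (rule derivation_cong[OF g.derivation_del X xX cutoff_differentiable[OF x]])
        (auto simp: X_def bump_def flat_exp_def)
    then have "del (Gloc A F c) \<nu> cutoff (tcoord c u) = 0" for \<nu> by (simp add: derivation_const[OF g.derivation_del])
    then show ?thesis by (simp add: div_cutoff_def)
  qed
  then show ?thesis
    unfolding on_PTM_eq[OF pairing_invariant u d] pairing_tcoord[OF d(1) u d(2)] by simp
qed

end


section \<open>The trace of the torsion of a balanced metric\<close>

context test_form
begin

sublocale g: finsler_chart "tdom0 c" "Gloc A F c" by (rule finsler_chart[OF c])

text \<open>The integral is the \<open>L\<^sup>2\<close> product of the test form with the adjoint of \<open>\<partial>\<^sub>H\<close> applied to \<open>\<omega>\<^sub>H\<close>.\<close>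

lemma pairing_integral_zero:
  assumes d_adj: "formal_adjoint A F \<nu> 1 0 (d_H A F) d_adj"
    and dbar_adj: "formal_adjoint A F \<nu> 0 1 (dbar_H A F) dbar_adj"
    and zero: "hzero A (hplus (d_adj (omega_H A F)) (dbar_adj (omega_H A F)))"
    and vm: "volume_measure A F \<nu>"
  shows "(\<integral>l. on_PTM A pairing l \<partial>\<nu>) = 0"
proof -
  define \<theta> where "\<theta> = d_adj (omega_H A F)"
  define \<theta>' where "\<theta>' = dbar_adj (omega_H A F)"
  have 1: "\<theta> \<in> hforms A 0 1 \<and> (\<forall>\<phi>\<in>hforms A 0 1. L2_inner A F \<nu> 1 1 (d_H A F \<phi>) (omega_H A F) = L2_inner A F \<nu> 0 1 \<phi> \<theta>)"
    using d_adj[unfolded formal_adjoint_def, THEN spec, THEN spec, of 0 1] omega_H_hforms unfolding \<theta>_def by simp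
  have 2: "\<theta>' \<in> hforms A 1 0"
    using dbar_adj[unfolded formal_adjoint_def, THEN spec, THEN spec, of 1 0] omega_H_hforms unfolding \<theta>'_def by simp
  \<comment> \<open>the two adjoints of \<open>\<omega>\<^sub>\<H>\<close> have different bidegrees, so each of them vanishes\<close>
  have \<theta>0: "\<theta> d x I J = 0" if d: "d \<in> A" and x: "x \<in> tdom0 d" for d x I J
  proof (cases "length I = 0 \<and> length J = 1")
    case True
    have "skew_pq 1 0 (\<theta>' d x)" using 2 d x unfolding hforms_def by blast
    then have "\<theta>' d x I J = 0" using True unfolding skew_pq_def by simp
    moreover have "\<theta> d x I J + \<theta>' d x I J = 0"
      using zero d x unfolding hzero_def hplus_def \<theta>_def \<theta>'_def by blast
    ultimately show ?thesis by simp
  next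
    case False
    have "skew_pq 0 1 (\<theta> d x)" using 1 d x unfolding hforms_def by blast
    then show ?thesis using False unfolding skew_pq_def by blast
  qed
  have h0: "h_inner A F 0 1 form \<theta> d x = 0" if "d \<in> A" "x \<in> tdom0 d" for d x
    unfolding h_inner_def by (simp add: \<theta>0[OF that])
  have inv: "invariant_fun (h_inner A F 0 1 form \<theta>)"
    unfolding invariant_fun_def
  proof (intro conjI ballI)
    fix d x assume d: "d \<in> A" and x: "x \<in> tdom0 d"
    interpret d: finsler_chart "tdom0 d" "Gloc A F d" by (rule finsler_chart[OF d])
    obtain z v where zv: "x = (z, v)" by force
    have "h_inner A F 0 1 form \<theta> d (z, \<zeta> *s v) = h_inner A F 0 1 form \<theta> d (z, v)" if \<zeta>: "\<zeta> \<noteq> 0" for \<zeta>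
      using h0[OF d] d.cone[OF _ \<zeta>, of z v] x zv by simp
    then show "case x of (z, v) \<Rightarrow> \<forall>\<zeta>. \<zeta> \<noteq> 0 \<longrightarrow> h_inner A F 0 1 form \<theta> d (z, \<zeta> *s v) = h_inner A F 0 1 form \<theta> d (z, v)" by (simp add: zv)
  next
    fix d e p assume d: "d \<in> A" and e: "e \<in> A" and p: "p \<in> tdom_overlap d e"
    obtain u where u: "u \<in> TM0 A" "fst u \<in> cdom d" "fst u \<in> cdom e" "tcoord d u = p" "tcoord e u = change d e p"
      by (rule tdom_overlap_point[OF d e p])
    have uT: "u \<in> TM A" using u(1) by (simp add: TM0_def)
    have "p \<in> tdom0 d" "change d e p \<in> tdom0 e"
      using TM0_iff[OF uT d u(2)] TM0_iff[OF uT e u(3)] u(1,4,5) by simp_all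
    then show "h_inner A F 0 1 form \<theta> e (change d e p) = h_inner A F 0 1 form \<theta> d p"
      by (simp only: h0[OF d] h0[OF e])
  qed
  have "on_PTM A (h_inner A F 0 1 form \<theta>) l = 0" if l: "l \<in> PTM A" for l
  proof -
    obtain u where u: "u \<in> TM0 A" "l = proj_rel A `` {u}" by (rule PTM_cases[OF l])
    obtain d where d: "d \<in> A" "fst u \<in> cdom d" by (rule charts_cover)
    have "tcoord d u \<in> tdom0 d" using TM0_iff[of u d] u(1) d by (simp add: TM0_def)
    then show ?thesis unfolding u(2) on_PTM_eq[OF inv u(1) d] by (rule h0[OF d(1)])
  qed
  then have "(\<integral>l. on_PTM A (h_inner A F 0 1 form \<theta>) l \<partial>\<nu>) = (\<integral>l. 0 \<partial>\<nu>)"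
    by (intro Bochner_Integration.integral_cong refl) (use vm in \<open>simp add: volume_measure_def\<close>)
  then have "L2_inner A F \<nu> 0 1 form \<theta> = 0" unfolding L2_inner_def by simp
  then show ?thesis using 1 form_hforms unfolding pairing_def L2_inner_def by simp
qed

text \<open>Extension by zero of \<open>\<chi> q\<close> beyond the chart, to a function that is smooth on a neighbourhood of the whole
  slice.\<close>

definition ext :: "('n cpair \<Rightarrow> complex) \<Rightarrow> 'n cpair \<Rightarrow> complex" where
  "ext q p = (if p \<in> g.S_slice a then cutoff p * q p else 0)"

definition far :: "'n cpair set" where
  "far = {p. r < norm (fst p - z0)}"

definition core :: "'n cpair set" where
  "core = {p. snd p $ a = 1 \<and> (norm (fst p - z0))\<^sup>2 + (norm (snd p - w0))\<^sup>2 \<le> r\<^sup>2}"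

lemma open_far: "open far"
  unfolding far_def by (intro open_Collect_less continuous_intros)

lemma open_dom: "open (g.S_slice a \<union> far)"
  by (intro open_Un g.open_S_slice open_far)

lemma smooth_cutoff: "smooth_on (tdom0 c) cutoff"
  by (rule smooth_on_subset[OF smooth_on_bump]) (auto simp: tdom0_def)

lemma ext_far: "p \<in> far \<Longrightarrow> ext q p = 0"
  using bump_support(2)[of a z0 w0 r p] r by (auto simp: ext_def far_def)

lemma smooth_ext:
  assumes "smooth_on (g.S_slice a) q" shows "smooth_on (g.S_slice a \<union> far) (ext q)"
proof (rule smooth_on_locally[OF open_dom])
  fix x assume x: "x \<in> g.S_slice a \<union> far"
  have "smooth_on (g.S_slice a) (ext q)"
  proof (rule smooth_on_cong[OF g.open_S_slice])
    show "smooth_on (g.S_slice a) (\<lambda>p. cutoff p * q p)"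
      by (intro smooth_on_mult g.open_S_slice assms smooth_on_subset[OF smooth_cutoff g.S_slice_subset])
  qed (simp add: ext_def)
  moreover have "smooth_on far (ext q)"
    by (rule smooth_on_cong[OF open_far, of "\<lambda>x. 0"]) (simp_all add: ext_far)
  ultimately show "\<exists>T. open T \<and> x \<in> T \<and> smooth_on T (ext q)"
    using x g.open_S_slice open_far by blast
qed

lemma slice_a: "snd (slice a y) $ a = 1" by (simp add: slice_def)

lemma slice_nonzero: "snd (slice a y) \<noteq> 0"
  using slice_a[of y] by (metis zero_index zero_neq_one)

lemma S_slice_iff: "p \<in> g.S_slice a \<longleftrightarrow> fst p \<in> cmap c ` cdom c \<and> snd p \<noteq> 0 \<and> snd p $ a \<noteq> 0"
  unfolding g.S_slice_def by (auto simp: tdom0_def mem_Times_iff)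

lemma slice_S_slice: "slice a y \<in> g.S_slice a \<longleftrightarrow> fst y \<in> cmap c ` cdom c"
  using slice_nonzero[of y] slice_a[of y] by (simp add: S_slice_iff slice_def)

lemma near_in_chart: "norm (z - z0) \<le> r \<Longrightarrow> z \<in> cmap c ` cdom c"
  using ball_subset by (auto simp: subset_iff dist_norm norm_minus_commute)

lemma slice_in: "slice a y \<in> g.S_slice a \<union> far"
  using slice_S_slice[of y] near_in_chart[of "fst y"] by (auto simp: far_def slice_def)

lemma slice_far: "fst y \<notin> cmap c ` cdom c \<Longrightarrow> slice a y \<in> far"
  using slice_S_slice[of y] slice_in[of y] by blast

lemma core_bounds:
  assumes "p \<in> core" shows "norm (fst p - z0) \<le> r" "norm (snd p - w0) \<le> r"
proof -
  have "(norm (fst p - z0))\<^sup>2 + (norm (snd p - w0))\<^sup>2 \<le> r\<^sup>2" using assms by (simp add: core_def)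
  then have "(norm (fst p - z0))\<^sup>2 \<le> r\<^sup>2" "(norm (snd p - w0))\<^sup>2 \<le> r\<^sup>2"
    using zero_le_power2[of "norm (fst p - z0)"] zero_le_power2[of "norm (snd p - w0)"] by linarith+
  then show "norm (fst p - z0) \<le> r" "norm (snd p - w0) \<le> r" using r by (auto intro: power2_le_imp_le)
qed

lemma core_subset: "core \<subseteq> g.S_slice a \<union> far"
proof
  fix p assume p: "p \<in> core"
  have "snd p $ a = 1" using p by (simp add: core_def)
  moreover from this have "snd p \<noteq> 0" by (metis zero_index zero_neq_one)
  ultimately show "p \<in> g.S_slice a \<union> far"
    using near_in_chart[OF core_bounds(1)[OF p]] by (simp add: S_slice_iff)
qed

lemma compact_core: "compact core"
proof -
  have "closed core" unfolding core_def by (intro closed_Collect_conj closed_Collect_eq closed_Collect_le continuous_intros)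
  moreover have "bounded core"
    unfolding bounded_iff
  proof (intro exI ballI)
    fix p assume p: "p \<in> core"
    have "norm (fst p) \<le> r + norm z0" "norm (snd p) \<le> r + norm w0"
      using core_bounds[OF p] norm_triangle_sub[of "fst p" z0] norm_triangle_sub[of "snd p" w0] by auto
    then show "norm p \<le> (r + norm z0) + (r + norm w0)"
      using norm_Pair_le[of "fst p" "snd p"] by simp
  qed
  ultimately show ?thesis by (simp add: compact_eq_bounded_closed)
qed

lemma ext_outside_core: "slice a y \<notin> core \<Longrightarrow> ext q (slice a y) = 0"
  using bump_slice[OF slice_a slice_nonzero, of z0 w0 r y] slice_a[of y] by (auto simp: ext_def core_def)

lemma integral_ext_D:
  assumes q: "smooth_on (g.S_slice a) q"
  shows "has_bochner_integral (leb_slice a) (\<lambda>y. D_z \<mu> (ext q) (slice a y)) 0"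
    and "\<alpha> \<noteq> a \<Longrightarrow> has_bochner_integral (leb_slice a) (\<lambda>y. D_v \<alpha> (ext q) (slice a y)) 0"
  using integral_slice_D[OF open_dom smooth_ext[OF q] slice_in compact_core core_subset ext_outside_core] by auto

lemma derivation_ext:
  assumes q: "smooth_on (g.S_slice a) q" and X: "derivation_at p X"
  shows "p \<in> g.S_slice a \<Longrightarrow> X (ext q) = X (\<lambda>x. cutoff x * q x)" and "p \<in> far \<Longrightarrow> X (ext q) = 0"
proof -
  have d: "ext q differentiable (at p)" if "p \<in> g.S_slice a \<union> far"
    by (rule smooth_on_differentiable[OF open_dom smooth_ext[OF q] that])
  show "X (ext q) = X (\<lambda>x. cutoff x * q x)" if p: "p \<in> g.S_slice a"
    by (rule derivation_cong[OF X g.open_S_slice p d]) (use p in \<open>simp_all add: ext_def\<close>)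
  show "X (ext q) = 0" if p: "p \<in> far"
  proof -
    have "X (ext q) = X (\<lambda>x. 0)" by (rule derivation_cong[OF X open_far p d]) (use p in \<open>simp_all add: ext_far\<close>)
    then show ?thesis by (simp add: derivation_const[OF X])
  qed
qed

lemma euler_cutoff: "p \<in> tdom0 c \<Longrightarrow> g.euler cutoff p = 0"
  using g.euler_homogeneous[of cutoff p 0 0] bump_homogeneous[of _ a z0 w0 r "fst p" "snd p"]
    cutoff_differentiable[of p c] by simp

definition trace_density :: "'n cpair \<Rightarrow> complex" where
  "trace_density p = g.density p * (\<Sum>\<sigma>\<in>UNIV. g.N \<beta> \<sigma> p * g.torsion_trace \<sigma> p)"

lemma smooth_trace_density: "smooth_on (tdom0 c) trace_density"
  unfolding trace_density_def[abs_def]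
  by (intro smooth_on_mult smooth_on_sum g.smooth_density g.smooth_N g.smooth_torsion_trace g.open_S)

lemma density_real:
  assumes "p \<in> tdom0 c" shows "g.density p = complex_of_real (Re (g.density p))"
proof -
  have "g.density p \<in> \<real>"
    unfolding g.density_def by (intro Reals_mult Reals_power Reals_inverse g.det_M_real[OF assms] Reals_of_real)
  then show ?thesis by (simp add: of_real_Re)
qed

lemma integrable_ext:
  assumes "smooth_on (g.S_slice a) q" shows "integrable (leb_slice a) (\<lambda>y. ext q (slice a y))"
  by (rule integrable_comp_slice[OF open_dom smooth_on_continuous[OF smooth_ext[OF assms]] slice_in compact_core core_subset ext_outside_core])

text \<open>On the slice the integrand is, up to a constant, the difference of a sum of derivatives of compactly supported
  functions, whose integrals vanish, and of the bump function times the trace of the torsion.\<close>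

lemma integral_trace_density:
  assumes zero: "(\<integral>y. indicator (pdom c a) y *\<^sub>R (vol_density (Gloc A F c) a y *\<^sub>R pairing c (slice a y)) \<partial>leb_slice a) = 0"
  shows "(\<integral>y. ext trace_density (slice a y) \<partial>leb_slice a) = 0"
proof -
  define R where "R y = (\<Sum>\<mu>\<in>UNIV. D_z \<mu> (ext (g.flux_z \<beta> \<mu>)) (slice a y)) + (\<Sum>\<alpha>\<in>UNIV-{a}. D_v \<alpha> (ext (g.flux_v a \<beta> \<alpha>)) (slice a y))" for y
  define P where "P y = indicator (pdom c a) y *\<^sub>R (g.density (slice a y) * (\<Sum>\<mu>\<in>UNIV. g.N \<beta> \<mu> (slice a y) * del (Gloc A F c) \<mu> cutoff (slice a y)))" for y
  have fz: "smooth_on (g.S_slice a) (g.flux_z \<beta> \<mu>)" for \<mu> by (rule smooth_on_subset[OF g.smooth_flux_z g.S_slice_subset])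
  note fv = g.smooth_flux_v
  have "has_bochner_integral (leb_slice a) R ((\<Sum>\<mu>\<in>(UNIV::'n set). 0) + (\<Sum>\<alpha>\<in>UNIV-{a}. 0))"
    unfolding R_def by (intro has_bochner_integral_add has_bochner_integral_sum integral_ext_D fz fv) auto
  then have R: "integrable (leb_slice a) R" "integral\<^sup>L (leb_slice a) R = 0" by (simp_all add: has_bochner_integral_iff)
  have sT: "smooth_on (g.S_slice a) trace_density" by (rule smooth_on_subset[OF smooth_trace_density g.S_slice_subset])
  have key: "P y = R y - ext trace_density (slice a y)" if y: "y \<in> space (leb_slice a)" for y
  proof (cases "fst y \<in> cmap c ` cdom c")
    case True
    have yp: "y \<in> pdom c a" using y True by (auto simp: pdom_def leb_slice_def space_pair_measure space_PiM)
    have p: "slice a y \<in> g.S_slice a" using slice_S_slice True by blast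
    have pS: "slice a y \<in> tdom0 c" using p g.S_slice_subset by blast
    have "R y = (\<Sum>\<mu>\<in>UNIV. D_z \<mu> (\<lambda>x. cutoff x * g.flux_z \<beta> \<mu> x) (slice a y)) + (\<Sum>\<alpha>\<in>UNIV-{a}. D_v \<alpha> (\<lambda>x. cutoff x * g.flux_v a \<beta> \<alpha> x) (slice a y))"
      unfolding R_def using derivation_ext(1)[OF fz derivation_D(1) p] derivation_ext(1)[OF fv derivation_D(3) p] by simp
    also have "\<dots> = g.density (slice a y) * (\<Sum>\<mu>\<in>UNIV. g.N \<beta> \<mu> (slice a y) * del (Gloc A F c) \<mu> cutoff (slice a y)) + cutoff (slice a y) * trace_density (slice a y)"
      unfolding trace_density_def by (rule g.integration_by_parts_pointwise[OF p smooth_cutoff euler_cutoff[OF pS], symmetric])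
    finally show ?thesis using yp p by (simp add: P_def ext_def)
  next
    case False
    have f: "slice a y \<in> far" by (rule slice_far[OF False])
    have "R y = 0" unfolding R_def using derivation_ext(2)[OF fz derivation_D(1) f] derivation_ext(2)[OF fv derivation_D(3) f] by simp
    moreover have "y \<notin> pdom c a" using False by (auto simp: pdom_def)
    ultimately show ?thesis by (simp add: P_def ext_far[OF f])
  qed
  have "integral\<^sup>L (leb_slice a) P = integral\<^sup>L (leb_slice a) (\<lambda>y. R y - ext trace_density (slice a y))"
    by (rule Bochner_Integration.integral_cong[OF refl key])
  also have "\<dots> = - (\<integral>y. ext trace_density (slice a y) \<partial>leb_slice a)"
    using R integrable_ext[OF sT] by simp
  finally have PE: "integral\<^sup>L (leb_slice a) P = - (\<integral>y. ext trace_density (slice a y) \<partial>leb_slice a)" .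
  have "indicator (pdom c a) y *\<^sub>R (vol_density (Gloc A F c) a y *\<^sub>R pairing c (slice a y)) = (- \<i> * complex_of_real (vol_const a)) * P y" for y
  proof (cases "y \<in> pdom c a")
    case True
    have pS: "slice a y \<in> tdom0 c" by (rule slice_tdom0[OF True])
    have "vol_density (Gloc A F c) a y *\<^sub>R pairing c (slice a y) = complex_of_real (vol_const a) * complex_of_real (Re (g.density (slice a y))) * div_cutoff (slice a y)"
      unfolding g.vol_density_eq[OF pS] pairing_chart[OF pS] by (simp add: scaleR_conv_of_real)
    then show ?thesis using True unfolding density_real[OF pS, symmetric] by (simp add: P_def div_cutoff_def)
  qed (simp add: P_def)
  then have "(- \<i> * complex_of_real (vol_const a)) * integral\<^sup>L (leb_slice a) P = 0"
    using zero by simp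
  then have "integral\<^sup>L (leb_slice a) P = 0" using vol_const_pos[of a] by simp
  then show ?thesis using PE by simp
qed

end

lemma emeasure_lborel_ball_nonzero: "0 < s \<Longrightarrow> emeasure lborel (ball (x::'a::euclidean_space) s) \<noteq> 0"
  using content_ball_pos[of s x] by (auto simp: measure_def)

lemma norm_vec_le_sum: "norm (x :: complex^'n::finite) \<le> (\<Sum>i\<in>UNIV. norm (x $ i))"
  unfolding norm_vec_def by (rule L2_set_le_sum) simp

lemma slice_box_not_null:
  assumes s: "0 < s"
  shows "ball (z0::complex^'n::finite) s \<times> (\<Pi>\<^sub>E i\<in>UNIV - {a}. ball (w0 $ i) s) \<in> sets (leb_slice a) - null_sets (leb_slice a)"
proof -
  interpret product_sigma_finite "\<lambda>i. lborel :: complex measure" by unfold_locales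
  interpret P: sigma_finite_measure "\<Pi>\<^sub>M i\<in>UNIV - {a}. (lborel::complex measure)" by (rule sigma_finite_PiM_lborel) simp
  have Xs: "(\<Pi>\<^sub>E i\<in>UNIV - {a}. ball (w0 $ i) s) \<in> sets (\<Pi>\<^sub>M i\<in>UNIV - {a}. (lborel::complex measure))"
    by (intro sets_PiM_I_finite) auto
  have "emeasure (leb_slice a) (ball z0 s \<times> (\<Pi>\<^sub>E i\<in>UNIV - {a}. ball (w0 $ i) s)) = emeasure lborel (ball z0 s) * (\<Prod>i\<in>UNIV - {a}. emeasure lborel (ball (w0 $ i) s))"
    unfolding leb_slice_def using Xs by (subst P.emeasure_pair_measure_Times) (auto simp: emeasure_PiM)
  also have "\<dots> \<noteq> 0" by (simp add: prod_zero_iff emeasure_lborel_ball_nonzero[OF s])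
  finally show ?thesis using Xs by (auto simp: leb_slice_def null_sets_def)
qed


locale balanced_manifold = finsler_manifold A F
  for A :: "('m::{t2_space, second_countable_topology}, 'n::finite) chart set" and F +
  fixes \<nu> d_adj dbar_adj
  assumes vm: "volume_measure A F \<nu>"
    and d_adj: "formal_adjoint A F \<nu> 1 0 (d_H A F) d_adj"
    and dbar_adj: "formal_adjoint A F \<nu> 0 1 (dbar_H A F) dbar_adj"
    and zero: "hzero A (hplus (d_adj (omega_H A F)) (dbar_adj (omega_H A F)))"
begin

text \<open>If the contraction \<open>G\<^sup>\<beta>\<^sup>\<sigma> \<tau>\<^sub>\<sigma>\<close> of the trace \<open>\<tau>\<close> were nonzero at a point, then in a small ball its product
  with the conjugate of its value there would have positive real part. Its integral against a bump function
  in that ball would then be positive, whereas it is zero.\<close>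

lemma torsion_trace_slice:
  assumes c: "c \<in> A" and p0: "p0 \<in> tdom0 c" and a: "snd p0 $ a = 1"
  shows "finsler_chart.torsion_trace (Gloc A F c) \<sigma> p0 = 0"
proof -
  interpret g: finsler_chart "tdom0 c" "Gloc A F c" by (rule finsler_chart[OF c])
  have "(\<Sum>\<sigma>\<in>UNIV. g.N \<beta> \<sigma> p0 * g.torsion_trace \<sigma> p0) = 0" for \<beta>
  proof (rule ccontr)
    assume nz: "(\<Sum>\<sigma>\<in>UNIV. g.N \<beta> \<sigma> p0 * g.torsion_trace \<sigma> p0) \<noteq> 0"
    define s where "s p = g.density p * (\<Sum>\<sigma>\<in>UNIV. g.N \<beta> \<sigma> p * g.torsion_trace \<sigma> p)" for p
    have "g.density p0 \<noteq> 0"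
      using g.det_M_real(2)[OF p0] g.g_pos[OF p0] by (simp add: g.density_def)
    then have s0: "s p0 \<noteq> 0" using nz by (simp add: s_def)
    define P where "P p = Re (cnj (s p0) * s p)" for p
    have "smooth_on (tdom0 c) s" unfolding s_def[abs_def]
      by (intro smooth_on_mult smooth_on_sum g.smooth_density g.smooth_N g.smooth_torsion_trace g.open_S)
    then have "continuous_on (tdom0 c) P"
      unfolding P_def[abs_def] by (intro continuous_intros smooth_on_continuous)
    then have "open (tdom0 c \<inter> P -` {0<..})" by (rule continuous_open_preimage[OF _ g.open_S]) simp
    moreover have "p0 \<in> tdom0 c \<inter> P -` {0<..}"
    proof -
      have "cnj (s p0) * s p0 = complex_of_real ((cmod (s p0))\<^sup>2)"
        unfolding complex_norm_square by (rule mult.commute)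
      then have "P p0 = (cmod (s p0))\<^sup>2" by (simp only: P_def Re_complex_of_real)
      then show ?thesis using p0 s0 by simp
    qed
    ultimately obtain \<delta> where \<delta>: "0 < \<delta>" "ball p0 \<delta> \<subseteq> tdom0 c \<inter> P -` {0<..}" by (rule openE)
    define r where "r = \<delta> / 2"
    have r: "0 < r" "r < \<delta>" using \<delta>(1) by (auto simp: r_def)
    have near: "p \<in> tdom0 c \<and> 0 < P p" if "(norm (fst p - fst p0))\<^sup>2 + (norm (snd p - snd p0))\<^sup>2 \<le> r\<^sup>2" for p
    proof -
      have "dist p0 p = sqrt ((norm (fst p - fst p0))\<^sup>2 + (norm (snd p - snd p0))\<^sup>2)"
        by (simp add: dist_prod_def dist_norm norm_minus_commute)
      also have "\<dots> \<le> sqrt (r\<^sup>2)" using that by (rule real_sqrt_le_mono)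
      finally have "dist p0 p < \<delta>" using r by simp
      then have "p \<in> ball p0 \<delta>" by simp
      then show ?thesis using \<delta>(2) by blast
    qed
    interpret t: test_form A F c \<beta> a "fst p0" "snd p0" r
    proof
      show "c \<in> A" by (rule c)
      show "0 < r" by (rule r(1))
      show "cball (fst p0) r \<subseteq> cmap c ` cdom c"
      proof
        fix z assume "z \<in> cball (fst p0) r"
        then have "norm (z - fst p0) \<le> r" by (simp add: dist_norm norm_minus_commute)
        then have "(norm (z - fst p0))\<^sup>2 \<le> r\<^sup>2" by (intro power_mono) auto
        then have "(z, snd p0) \<in> tdom0 c" using near[of "(z, snd p0)"] by simp
        then show "z \<in> cmap c ` cdom c" by (simp add: tdom0_def)
      qed
    qed
    have sT: "t.trace_density = s" by (simp add: fun_eq_iff t.trace_density_def s_def)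
    have "(\<integral>y. indicator (pdom c a) y *\<^sub>R (vol_density (Gloc A F c) a y *\<^sub>R t.pairing c (slice a y)) \<partial>leb_slice a) = 0"
      using integral_patch[OF vm t.pairing_invariant t.pairing_continuous c t.pairing_support]
        t.pairing_integral_zero[OF d_adj dbar_adj zero vm] by simp
    from t.integral_trace_density[OF this]
    have int0: "(\<integral>y. t.ext s (slice a y) \<partial>leb_slice a) = 0" unfolding sT .
    have int: "integrable (leb_slice a) (\<lambda>y. t.ext s (slice a y))"
      using t.integrable_ext[OF smooth_on_subset[OF t.smooth_trace_density g.S_slice_subset]] unfolding sT .
    define q where "q y = Re (cnj (s p0) * t.ext s (slice a y))" for y
    have q_int: "integrable (leb_slice a) q" unfolding q_def[abs_def] using int by (intro integrable_Re integrable_mult_right)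
    have "integral\<^sup>L (leb_slice a) q = Re (cnj (s p0) * (\<integral>y. t.ext s (slice a y) \<partial>leb_slice a))"
      unfolding q_def[abs_def] using int by simp
    then have q0: "integral\<^sup>L (leb_slice a) q = 0" by (simp add: int0)
    have q_eq: "q y = flat_exp 0 (bump_arg a (fst p0) (snd p0) r (slice a y)) * P (slice a y)" if "slice a y \<in> g.S_slice a" for y
      using that by (simp add: q_def t.ext_def P_def bump_def algebra_simps)
    have flat: "0 \<le> flat_exp 0 x" for x by (simp add: flat_exp_def)
    have q_nonneg: "0 \<le> q y" for y
    proof (cases "slice a y \<in> t.core \<and> slice a y \<in> g.S_slice a")
      case True
      then have "0 \<le> P (slice a y)" using near[of "slice a y"] by (simp add: t.core_def)
      then show ?thesis unfolding q_eq[OF conjunct2[OF True]] by (rule mult_nonneg_nonneg[OF flat])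
    next
      case False
      then have "t.ext s (slice a y) = 0" using t.ext_outside_core[of y s] by (auto simp: t.ext_def)
      then show ?thesis by (simp add: q_def)
    qed
    have AE: "AE y in leb_slice a. q y = 0"
      using integral_nonneg_eq_0_iff_AE[OF q_int AE_I2[OF q_nonneg]] q0 by blast
    \<comment> \<open>with this radius, the base displacement and the \<open>CARD('n)\<close> fibre displacements add up to less than \<open>r\<close>\<close>
    define \<rho> where "\<rho> = r / (real CARD('n) + 1)"
    have \<rho>: "0 < \<rho>" using r by (simp add: \<rho>_def add_pos_nonneg)
    define B where "B = ball (fst p0) \<rho> \<times> (\<Pi>\<^sub>E i\<in>UNIV - {a}. ball (snd p0 $ i) \<rho>)"
    have "q y \<noteq> 0" if y: "y \<in> B" for y
    proof -
      have yB: "fst y \<in> ball (fst p0) \<rho>" "snd y \<in> (\<Pi>\<^sub>E i\<in>UNIV - {a}. ball (snd p0 $ i) \<rho>)"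
        using y unfolding B_def mem_Times_iff by blast+
      have 1: "norm (fst y - fst p0) < \<rho>" using yB(1) by (simp add: dist_norm norm_minus_commute)
      have "norm ((snd (slice a y) - snd p0) $ i) \<le> \<rho>" for i
      proof (cases "i = a")
        case True
        then show ?thesis using a \<rho> by (simp add: slice_def)
      next
        case False
        then have "snd y i \<in> ball (snd p0 $ i) \<rho>" using PiE_mem[OF yB(2)] by blast
        then show ?thesis using False by (simp add: slice_def dist_norm norm_minus_commute)
      qed
      then have "norm (snd (slice a y) - snd p0) \<le> (\<Sum>i\<in>(UNIV::'n set). \<rho>)"
        by (intro order_trans[OF norm_vec_le_sum] sum_mono)
      then have 2: "norm (snd (slice a y) - snd p0) \<le> real CARD('n) * \<rho>" by simp
      define x1 x2 where "x1 = norm (fst (slice a y) - fst p0)" and "x2 = norm (snd (slice a y) - snd p0)"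
      have x: "0 \<le> x1" "0 \<le> x2" by (simp_all add: x1_def x2_def)
      have "x1 + x2 < \<rho> + real CARD('n) * \<rho>" using 1 2 by (simp add: x1_def x2_def slice_def)
      also have "\<dots> = (real CARD('n) + 1) * \<rho>" by (simp add: algebra_simps)
      also have "\<dots> = r" using \<rho> by (simp add: \<rho>_def)
      finally have "(x1 + x2)\<^sup>2 < r\<^sup>2" using x by (intro power_strict_mono) auto
      moreover have "x1\<^sup>2 + x2\<^sup>2 \<le> (x1 + x2)\<^sup>2" using x by (simp add: power2_sum)
      ultimately have lt: "x1\<^sup>2 + x2\<^sup>2 < r\<^sup>2" by linarith
      then have b: "bump a (fst p0) (snd p0) r (slice a y) \<noteq> 0"
        using bump_slice[OF t.slice_a t.slice_nonzero] by (simp add: x1_def x2_def)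
      have Pp: "slice a y \<in> tdom0 c" "0 < P (slice a y)" using near[of "slice a y"] lt by (simp_all add: x1_def x2_def)
      then have "slice a y \<in> g.S_slice a" using t.slice_a by (simp add: g.S_slice_def)
      then show ?thesis using q_eq b Pp(2) by (simp add: bump_def)
    qed
    then have "AE y in leb_slice a. y \<notin> B" using AE by (auto elim!: eventually_mono)
    moreover have B: "B \<in> sets (leb_slice a)" "B \<notin> null_sets (leb_slice a)"
      using slice_box_not_null[OF \<rho>, of "fst p0" a "snd p0"] by (auto simp: B_def)
    ultimately show False using AE_iff_null_sets[OF B(1)] by blast
  qed
  then show ?thesis by (rule g.N_injective'[OF p0])
qed

text \<open>The trace is invariant under scaling of \<open>v\<close>, and every vector can be scaled into one of the slices.\<close>

lemma torsion_trace_zero: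
  assumes c: "c \<in> A" and p: "p \<in> tdom0 c"
  shows "finsler_chart.torsion_trace (Gloc A F c) \<sigma> p = 0"
proof -
  interpret g: finsler_chart "tdom0 c" "Gloc A F c" by (rule finsler_chart[OF c])
  obtain z v where zv: "p = (z, v)" by force
  have "v \<noteq> 0" using p by (simp add: zv tdom0_def)
  then obtain a where a: "v $ a \<noteq> 0" by (auto simp: vec_eq_iff)
  define \<zeta> where "\<zeta> = inverse (v $ a)"
  have \<zeta>: "\<zeta> \<noteq> 0" using a by (simp add: \<zeta>_def)
  have q: "(z, v) \<in> tdom0 c" "(z, \<zeta> *s v) \<in> tdom0 c" using p g.cone[OF _ \<zeta>] by (simp_all add: zv)
  have Meq: "g.M \<alpha> \<beta> (fst x, \<zeta> *s snd x) = g.M \<alpha> \<beta> x" if "x \<in> tdom0 c" for x \<alpha> \<beta>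
    using G_mat_scale(1)[OF c _ \<zeta>, of "fst x" "snd x"] that by simp
  have "del (Gloc A F c) \<mu> (g.M \<alpha> \<beta>) (z, \<zeta> *s v) = del (Gloc A F c) \<mu> (g.M \<alpha> \<beta>) (z, v)" for \<mu> \<alpha> \<beta>
  proof -
    have "del (Gloc A F c) \<mu> (g.M \<alpha> \<beta>) (z, \<zeta> *s v) = del (Gloc A F c) \<mu> (\<lambda>x. g.M \<alpha> \<beta> (fst x, \<zeta> *s snd x)) (z, v)"
      by (rule G_mat_scale(3)[OF c q(1) \<zeta> g.diffble[OF g.smooth_M q(2)] refl])
    also have "\<dots> = del (Gloc A F c) \<mu> (g.M \<alpha> \<beta>) (z, v)"
      by (rule derivation_cong[OF g.derivation_del g.open_S q(1) g.diffble[OF g.smooth_M q(1)], symmetric])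
        (rule Meq[symmetric])
    finally show ?thesis .
  qed
  then have "g.torsion_trace \<sigma> (z, v) = g.torsion_trace \<sigma> (z, \<zeta> *s v)"
    by (simp add: g.torsion_trace_eq g.torsion_def G_mat_scale(2)[OF c q(1) \<zeta>])
  also have "\<dots> = 0"
    using a by (intro torsion_trace_slice[OF c q(2), of a]) (simp add: \<zeta>_def)
  finally show ?thesis by (simp add: zv)
qed

section \<open>The characterization of Kaehler-Finsler metrics\<close>

lemma kahler_finsler_iff:
  "kahler_finsler A F \<longleftrightarrow>
    (\<forall>c\<in>A. \<forall>x\<in>tdom0 c.
       h_inner A F 2 2 (d_H A F (dbar_H A F (omega_H A F)))
                       (hwedge (omega_H A F) (omega_H A F)) c x = 0)"
  (is "_ \<longleftrightarrow> (\<forall>c\<in>A. \<forall>x\<in>tdom0 c. ?h c x = 0)")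
proof
  assume K: "kahler_finsler A F"
  show "\<forall>c\<in>A. \<forall>x\<in>tdom0 c. ?h c x = 0"
  proof (intro ballI)
    fix c x assume c: "c \<in> A" and x: "x \<in> tdom0 c"
    interpret g: finsler_chart "tdom0 c" "Gloc A F c" by (rule finsler_chart[OF c])
    have "Gam2 (Gloc A F c) \<alpha> \<nu> \<mu> x = Gam2 (Gloc A F c) \<alpha> \<mu> \<nu> x" for \<alpha> \<mu> \<nu>
      by (rule g.kaehler_strong[OF _ x]) (use K c in \<open>simp add: kahler_finsler_def\<close>)
    then have "g.torsion \<mu> \<sigma> l x = 0" for \<mu> \<sigma> l using g.torsion_zero_iff[OF x] by blast
    then have "g.torsion_norm x = 0" by (simp add: g.torsion_norm_def)
    then show "?h c x = 0"
      by (simp add: h_inner_ddbar_omega[OF c x torsion_trace_zero[OF c]])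
  qed
next
  assume H: "\<forall>c\<in>A. \<forall>x\<in>tdom0 c. ?h c x = 0"
  show "kahler_finsler A F"
    unfolding kahler_finsler_def
  proof (intro ballI allI)
    fix c x \<alpha> \<mu> assume c: "c \<in> A" and x: "x \<in> tdom0 c"
    interpret g: finsler_chart "tdom0 c" "Gloc A F c" by (rule finsler_chart[OF c])
    have "?h c x = - \<i> * g.torsion_norm x"
      by (rule h_inner_ddbar_omega[OF c x torsion_trace_zero[OF c]])
    moreover have "?h c x = 0"
      using H c x by blast
    ultimately have "- \<i> * g.torsion_norm x = 0" by metis
    then have "g.torsion_norm x = 0" by simp
    then have "\<forall>\<mu> \<sigma> l. g.torsion \<mu> \<sigma> l x = 0" using g.torsion_norm_zero[OF x] by blast
    then have "Gam2 (Gloc A F c) \<alpha> \<beta> \<mu> x = Gam2 (Gloc A F c) \<alpha> \<mu> \<beta> x" for \<beta>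
      using g.torsion_zero_iff[OF x] by blast
    then show "(\<Sum>\<beta>\<in>UNIV. (Gam2 (Gloc A F c) \<alpha> \<beta> \<mu> x - Gam2 (Gloc A F c) \<alpha> \<mu> \<beta> x) * snd x $ \<beta>) = 0"
      by simp
  qed
qed

end

theorem theorem1p5:
  fixes A :: "('m::{t2_space, second_countable_topology}, 'n::finite) chart set"
    and F :: "('m, 'n) tvec \<Rightarrow> real"
  assumes "CARD('n) \<ge> 2"
    and "balanced_finsler A F"
  shows "kahler_finsler A F \<longleftrightarrow>
    (\<forall>c\<in>A. \<forall>x\<in>tdom0 c.
       h_inner A F 2 2 (d_H A F (dbar_H A F (omega_H A F)))
                       (hwedge (omega_H A F) (omega_H A F)) c x = 0)"
proof -
  obtain \<nu> d_adj dbar_adj where B: "complex_manifold A" "complex_finsler A F" "strongly_pseudoconvex A F"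
    "volume_measure A F \<nu>" "formal_adjoint A F \<nu> 1 0 (d_H A F) d_adj" "formal_adjoint A F \<nu> 0 1 (dbar_H A F) dbar_adj"
    "hzero A (hplus (d_adj (omega_H A F)) (dbar_adj (omega_H A F)))"
    using assms(2) unfolding balanced_finsler_def by blast
  interpret balanced_manifold A F \<nu> d_adj dbar_adj by unfold_locales (rule B)+
  show ?thesis by (rule kahler_finsler_iff)
qed


end
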